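(* Let $H$ be a Hopf algebra with invertible antipode over a field $\Bbbk$ and let $M,M',N,N',O$ be bicovariant bimodules over $H$. Then the maps $$\mathrm{ev}_{M,N}\colon\mathrm{HOM}(M,N)\otimes_HM\to N,\quad \phi\otimes_Hm\mapsto\phi(m),$$ $$\circ_{M,N,O}\colon\mathrm{HOM}(N,O)\otimes_H\mathrm{HOM}(M,N)\to\mathrm{HOM}(M,O),\quad (\phi\circ\psi)(m)=\phi(\psi(m)),$$ $$\hat\otimes\colon\mathrm{HOM}(M,M')\otimes\mathrm{HOM}(N,N')\to\mathrm{HOM}(M\otimes_HN,M'\otimes_HN'),\quad \phi\otimes\psi\mapsto\phi\,\hat\otimes\,\psi,$$ with $$(\phi\,\hat\otimes\,\psi)(m\otimes_Hn)=\phi(\psi_{-2}m_0S(\psi_{-1}m_1))\otimes_H\psi_0(m_2n),$$ are well defined; $\mathrm{ev}_{M,N}$ is a morphism in ${}^H_H\mathcal M^H$ (left $H$-linear, left and right $H$-colinear), while $\circ_{M,N,O}$ and $\hat\otimes$ are morphisms of bicovariant bimodules. Furthermore, the restriction of $\hat\otimes$ to right $H$-linear rational morphisms equals $\otimes_{\sigma^{\mathcal W}}$: for all $\phi\in\mathrm{HOM}_H(M,M')$, $\psi\in\mathrm{HOM}_H(N,N')$, $m\in M$, $n\in N$, $$(\phi\,\hat\otimes\,\psi)(m\otimes_Hn)=(\phi\otimes_{\sigma^{\mathcal W}}\psi)(m\otimes_Hn):=\phi(\psi_{-2}m_0S(m_1))\otimes_HS(\psi_{-1})\psi_0(m_2n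).$$
   Context: $\Bbbk$ is a field, $\otimes=\otimes_\Bbbk$, and $H$ is a Hopf algebra with coproduct $\Delta(h)=h_1\otimes h_2$, counit $\epsilon$ and invertible antipode $S$ with inverse $\overline S$. Right coactions are written $m\mapsto m_0\otimes m_1\in M\otimes H$, left coactions $m\mapsto m_{-1}\otimes m_0\in H\otimes M$; iterated coactions are $m_0\otimes m_1\otimes m_2$, $m_{-2}\otimes m_{-1}\otimes m_0$, etc. (Sweedler notation). A bicovariant bimodule is an $H$-bimodule $M$ with commuting right and left $H$-coactions $\delta_M,\lambda_M$ such that $\delta_M(amb)=\Delta(a)\delta_M(m)\Delta(b)$ and $\lambda_M(amb)=\Delta(a)\lambda_M(m)\Delta(b)$; morphisms are $H$-bilinear, left and right $H$-colinear maps. The category ${}^H_H\mathcal M^H$ is defined in the same way but with only a left $H$-action. Both $M\otimes N$ and $M\otimes_HN$ are bicovariant bimodules with actions $a(m\otimes n)b=am\otimes nb$ and diagonal coactions $m\otimes n\mapsto m_0\otimes n_0\otimes m_1n_1$, $m\otimes n\mapsto m_{-1}n_{-1}\otimes m_0\otimes n_0$. Rational morphisms: for $\phi\in\mathrm{Hom}_\Bbbk(M,N)$ put $\delta^{\mathrm{Ad}}(\phi)(m)=\phi(m_0)_0\otimes\phi(m_0)_1S(m_1)$ and $\lambda^{\mathrm{Ad}}(\phi)(m)=\phi(m_0)_{-1}\overline S(m_{-1})\otimes\phi(m_0)_0$. With $\mathrm{Hom}_\Bbbk(M,N)\otimes H\subseteq \mathrm{Hom}_\Bbbk(M,N\otimes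 H)$ and $H\otimes\mathrm{Hom}_\Bbbk(M,N)\subseteq\mathrm{Hom}_\Bbbk(M,H\otimes N)$, the space $\mathrm{HOM}(M,N)$ consists of all $\phi$ with $\delta^{\mathrm{Ad}}(\phi)\in\mathrm{Hom}_\Bbbk(M,N)\otimes H$ and $\lambda^{\mathrm{Ad}}(\phi)\in H\otimes\mathrm{Hom}_\Bbbk(M,N)$. One writes $\delta^{\mathrm{Ad}}(\phi)=\phi_0\otimes\phi_1$, $\lambda^{\mathrm{Ad}}(\phi)=\phi_{-1}\otimes\phi_0$, with iterations $\phi_{-2}\otimes\phi_{-1}\otimes\phi_0$. $\mathrm{HOM}(M,N)$ is a bicovariant bimodule with coactions $\delta^{\mathrm{Ad}},\lambda^{\mathrm{Ad}}$ and actions $(a\cdot\phi\cdot b)(m)=a\,\phi(bm)$. $\mathrm{HOM}_H(M,N)\subseteq\mathrm{HOM}(M,N)$ is the subspace of right $H$-linear rational morphisms. *)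

theory Defs
  imports Complex_Main "HOL-Library.Function_Algebras"
begin

section \<open>Vector spaces and tensor products\<close>

text \<open>
  A vector space is a subspace \<open>carr\<close> of an ambient space: the ambient space is a whole type of
  class \<^class>\<open>ab_group_add\<close> with scalar multiplication \<open>scl\<close>, the base field is a whole type of
  class \<^class>\<open>field\<close>. Functions carry the pointwise group structure of
  \<^theory>\<open>HOL-Library.Function_Algebras\<close>. Structure maps matter on \<open>carr\<close> only.
\<close>

record ('k, 'a) vspace =
  carr :: "'a set"
  scl :: "'k \<Rightarrow> 'a \<Rightarrow> 'a"

definition is_vspace :: "('k::field, 'a::ab_group_add, 'z) vspace_scheme \<Rightarrow> bool" where
  "is_vspace V \<longleftrightarrow> vector_space (scl V) \<and> module.subspace (scl V) (carr V)"

definition base :: "('k::field, 'k) vspace" where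
  "base = \<lparr>carr = UNIV, scl = (*)\<rparr>"

definition lin_map ::
  "('k::field, 'a::ab_group_add, 'y) vspace_scheme \<Rightarrow> ('k, 'b::ab_group_add, 'z) vspace_scheme
    \<Rightarrow> ('a \<Rightarrow> 'b) \<Rightarrow> bool" where
  "lin_map V W f \<longleftrightarrow>
     (\<forall>v\<in>carr V. f v \<in> carr W) \<and>
     (\<forall>v\<in>carr V. \<forall>v'\<in>carr V. f (v + v') = f v + f v') \<and>
     (\<forall>c. \<forall>v\<in>carr V. f (scl V c v) = scl W c (f v))"

text \<open>Linear maps are extended by zero, so that equality of maps on \<open>carr V\<close> is equality.\<close>

definition hom_space ::
  "('k::field, 'a::ab_group_add, 'y) vspace_scheme \<Rightarrow> ('k, 'b::ab_group_add, 'z) vspace_scheme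
    \<Rightarrow> ('k, 'a \<Rightarrow> 'b) vspace" where
  "hom_space V W =
     \<lparr>carr = {f. lin_map V W f \<and> (\<forall>x. x \<notin> carr V \<longrightarrow> f x = 0)},
      scl = (\<lambda>c f x. scl W c (f x))\<rparr>"

definition bilinear_maps ::
  "('k::field, 'a::ab_group_add, 'x) vspace_scheme \<Rightarrow> ('k, 'b::ab_group_add, 'y) vspace_scheme
    \<Rightarrow> ('k, 'c::ab_group_add, 'z) vspace_scheme \<Rightarrow> ('a \<Rightarrow> 'b \<Rightarrow> 'c) set" where
  "bilinear_maps V W U = {f.
     (\<forall>v\<in>carr V. lin_map W U (f v)) \<and> (\<forall>w\<in>carr W. lin_map V U (\<lambda>v. f v w))}"

text \<open>
  Over a field, an algebraic tensor product of \<open>V\<close> and \<open>W\<close> embeds into its double dual, that is,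
  into the functionals on a space \<open>B\<close> of forms on \<open>V \<times> W\<close>: \<open>v \<otimes> w\<close> becomes
  evaluation at \<open>(v, w)\<close>. So the tensor product is realised as the span of these evaluations.
  Taking for \<open>B\<close> all bilinear forms gives the tensor product over the base field; taking the
  \<open>H\<close>-balanced ones gives the tensor product over \<open>H\<close>. The universal properties are proved in
  \<open>tensor_universal\<close> and \<open>balanced_tensor_universal\<close> below.
\<close>

type_synonym ('a, 'b, 'k) tensor = "('a \<Rightarrow> 'b \<Rightarrow> 'k) \<Rightarrow> 'k"

definition pure :: "('a \<Rightarrow> 'b \<Rightarrow> 'k::field) set \<Rightarrow> 'a \<Rightarrow> 'b \<Rightarrow> ('a, 'b, 'k) tensor" where
  "pure B v w = (\<lambda>\<beta>. if \<beta> \<in> B then \<beta> v w else 0)"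

definition tensor_space ::
  "('a \<Rightarrow> 'b \<Rightarrow> 'k::field) set \<Rightarrow> ('k, 'a, 'y) vspace_scheme \<Rightarrow> ('k, 'b, 'z) vspace_scheme
    \<Rightarrow> ('k, ('a, 'b, 'k) tensor) vspace" where
  "tensor_space B V W =
     \<lparr>carr = module.span (\<lambda>c t \<beta>. c * t \<beta>) {pure B v w | v w. v \<in> carr V \<and> w \<in> carr W},
      scl = (\<lambda>c t \<beta>. c * t \<beta>)\<rparr>"

text \<open>
  \<open>lift B V W f t\<close> is \<open>\<Sum>\<^sub>i f v\<^sub>i w\<^sub>i\<close> where \<open>t = \<Sum>\<^sub>i v\<^sub>i \<otimes> w\<^sub>i\<close>. It is meaningful when this does not
  depend on the decomposition, as it is the case for bilinear \<open>f\<close> (balanced ones, over \<open>H\<close>).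
\<close>

definition lift ::
  "('a \<Rightarrow> 'b \<Rightarrow> 'k::field) set \<Rightarrow> ('k, 'a, 'y) vspace_scheme \<Rightarrow> ('k, 'b, 'z) vspace_scheme
    \<Rightarrow> ('a \<Rightarrow> 'b \<Rightarrow> 'c::ab_group_add) \<Rightarrow> ('a, 'b, 'k) tensor \<Rightarrow> 'c" where
  "lift B V W f t = (THE u. \<exists>xs. set xs \<subseteq> carr V \<times> carr W \<and>
     t = (\<Sum>(v, w)\<leftarrow>xs. pure B v w) \<and> u = (\<Sum>(v, w)\<leftarrow>xs. f v w))"

abbreviation bilinear_forms ::
  "('k::field, 'a::ab_group_add, 'y) vspace_scheme \<Rightarrow> ('k, 'b::ab_group_add, 'z) vspace_scheme
    \<Rightarrow> ('a \<Rightarrow> 'b \<Rightarrow> 'k) set" where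
  "bilinear_forms V W \<equiv> bilinear_maps V W base"

abbreviation tens ::
  "'a::ab_group_add \<Rightarrow> ('k::field, 'a, 'y) vspace_scheme \<Rightarrow> ('k, 'b::ab_group_add, 'z) vspace_scheme
    \<Rightarrow> 'b \<Rightarrow> ('a, 'b, 'k) tensor"  ("_ \<otimes>\<^bsub>_,_\<^esub> _" [71, 0, 0, 70] 70) where
  "v \<otimes>\<^bsub>V,W\<^esub> w \<equiv> pure (bilinear_forms V W) v w"

abbreviation tensor ::
  "('k::field, 'a::ab_group_add, 'y) vspace_scheme \<Rightarrow> ('k, 'b::ab_group_add, 'z) vspace_scheme
    \<Rightarrow> ('k, ('a, 'b, 'k) tensor) vspace" where
  "tensor V W \<equiv> tensor_space (bilinear_forms V W) V W"

text \<open>Sweedler notation: \<open>sw V W t (\<lambda>v w. f v w)\<close> is \<open>f v w\<close>, summed, for \<open>t = v \<otimes> w\<close>.\<close>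

abbreviation sw ::
  "('k::field, 'a::ab_group_add, 'y) vspace_scheme \<Rightarrow> ('k, 'b::ab_group_add, 'z) vspace_scheme
    \<Rightarrow> ('a, 'b, 'k) tensor \<Rightarrow> ('a \<Rightarrow> 'b \<Rightarrow> 'c::ab_group_add) \<Rightarrow> 'c" where
  "sw V W t f \<equiv> lift (bilinear_forms V W) V W f t"

subsection \<open>Universal properties\<close>

lemma sum_list_fun_apply: "(\<Sum>(v, w)\<leftarrow>xs. f v w) x = (\<Sum>(v, w)\<leftarrow>xs. f v w x)"
  for f :: "'a \<Rightarrow> 'b \<Rightarrow> 'c \<Rightarrow> 'd::ab_group_add"
  by (induction xs) auto

lemma vector_space_tensor: "vector_space (\<lambda>(c::'k::field) (t::('a, 'b, 'k) tensor) \<beta>. c * t \<beta>)"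
  by unfold_locales (auto simp: fun_eq_iff algebra_simps)

lemma exists_functional:
  fixes s :: "'k::field \<Rightarrow> 'c::ab_group_add \<Rightarrow> 'c"
  assumes "vector_space s" "u \<noteq> 0"
  shows "\<exists>g. Vector_Spaces.linear s (*) g \<and> g u \<noteq> 0"
proof -
  interpret vector_space s by fact
  interpret vector_space_pair s "(*) :: 'k \<Rightarrow> 'k \<Rightarrow> 'k"
    by unfold_locales (auto simp: algebra_simps)
  have "independent {u}" using \<open>u \<noteq> 0\<close> by simp
  from linear_independent_extend[OF this, of "\<lambda>_. 1"] show ?thesis by auto
qed

text \<open>
  The hypothesis on \<open>B\<close> and \<open>f\<close> holds for the bilinear forms and bilinear \<open>f\<close>, and for the balanced
  forms and balanced \<open>f\<close>.
\<close>

lemma lift_unique: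
  fixes f :: "'a \<Rightarrow> 'b \<Rightarrow> 'c::ab_group_add" and B :: "('a \<Rightarrow> 'b \<Rightarrow> 'k::field) set"
  assumes U: "vector_space s"
    and B: "\<And>g. Vector_Spaces.linear s (*) g \<Longrightarrow> (\<lambda>v w. g (f v w)) \<in> B"
    and eq: "(\<Sum>(v, w)\<leftarrow>xs. pure B v w) = (\<Sum>(v, w)\<leftarrow>ys. pure B v w)"
  shows "(\<Sum>(v, w)\<leftarrow>xs. f v w) = (\<Sum>(v, w)\<leftarrow>ys. f v w)"
proof (rule ccontr)
  assume "\<not> ?thesis"
  then have "(\<Sum>(v, w)\<leftarrow>xs. f v w) - (\<Sum>(v, w)\<leftarrow>ys. f v w) \<noteq> 0" by simp
  from exists_functional[OF U this] obtain g where g: "Vector_Spaces.linear s (*) g"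
    and ne: "g ((\<Sum>(v, w)\<leftarrow>xs. f v w) - (\<Sum>(v, w)\<leftarrow>ys. f v w)) \<noteq> 0" by blast
  interpret g: Vector_Spaces.linear s "(*)" g by fact
  have *: "g (\<Sum>(v, w)\<leftarrow>zs. f v w) = (\<Sum>(v, w)\<leftarrow>zs. pure B v w) (\<lambda>v w. g (f v w))" for zs
    unfolding sum_list_fun_apply using B[OF g]
    by (induction zs) (auto simp: pure_def g.zero g.add)
  show False using ne eq by (simp add: g.diff *)
qed

lemma lift_sum:
  fixes f :: "'a \<Rightarrow> 'b \<Rightarrow> 'c::ab_group_add" and B :: "('a \<Rightarrow> 'b \<Rightarrow> 'k::field) set"
  assumes U: "vector_space s"
    and B: "\<And>g. Vector_Spaces.linear s (*) g \<Longrightarrow> (\<lambda>v w. g (f v w)) \<in> B"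
    and xs: "set xs \<subseteq> carr V \<times> carr W"
  shows "lift B V W f (\<Sum>(v, w)\<leftarrow>xs. pure B v w) = (\<Sum>(v, w)\<leftarrow>xs. f v w)"
  unfolding lift_def
proof (rule the_equality)
  fix u
  assume "\<exists>ys. set ys \<subseteq> carr V \<times> carr W \<and>
     (\<Sum>(v, w)\<leftarrow>xs. pure B v w) = (\<Sum>(v, w)\<leftarrow>ys. pure B v w) \<and> u = (\<Sum>(v, w)\<leftarrow>ys. f v w)"
  then obtain ys where
    "(\<Sum>(v, w)\<leftarrow>ys. pure B v w) = (\<Sum>(v, w)\<leftarrow>xs. pure B v w)" "u = (\<Sum>(v, w)\<leftarrow>ys. f v w)"
    by (auto simp: eq_commute)
  then show "u = (\<Sum>(v, w)\<leftarrow>xs. f v w)" using lift_unique[of s f B ys xs, OF U B] by simp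
qed (use xs in blast)

lemma scale_closed:
  assumes "is_vspace V" "v \<in> carr V"
  shows "scl V c v \<in> carr V"
proof -
  interpret vector_space "scl V" using assms by (simp add: is_vspace_def)
  show ?thesis using assms subspace_scale by (simp add: is_vspace_def)
qed

lemma tensor_space_decomp:
  fixes V :: "('k::field, 'a::ab_group_add, 'y) vspace_scheme"
    and W :: "('k, 'b::ab_group_add, 'z) vspace_scheme"
  assumes V: "is_vspace V" and B: "B \<subseteq> bilinear_forms V W"
    and t: "t \<in> carr (tensor_space B V W)"
  obtains xs where "set xs \<subseteq> carr V \<times> carr W" "t = (\<Sum>(v, w)\<leftarrow>xs. pure B v w)"
proof -
  interpret T: vector_space "\<lambda>(c::'k) (t::('a, 'b, 'k) tensor) \<beta>. c * t \<beta>"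
    by (rule vector_space_tensor)
  have V': "scl V c v \<in> carr V" if "v \<in> carr V" for c v
    using V that scale_closed by blast
  have "t \<in> T.span {pure B v w | v w. v \<in> carr V \<and> w \<in> carr W}"
    using t by (simp add: tensor_space_def)
  then have "\<exists>xs. set xs \<subseteq> carr V \<times> carr W \<and> t = (\<Sum>(v, w)\<leftarrow>xs. pure B v w)"
  proof (induction rule: T.span_induct_alt)
    case base
    show ?case by (rule exI[of _ "[]"]) simp
  next
    case (step c x y)
    then obtain v w xs where h: "v \<in> carr V" "w \<in> carr W" "x = pure B v w"
      "set xs \<subseteq> carr V \<times> carr W" "y = (\<Sum>(v, w)\<leftarrow>xs. pure B v w)" by blast
    have "(\<lambda>\<beta>. c * x \<beta>) = pure B (scl V c v) w"
      using h B by (auto simp: fun_eq_iff pure_def bilinear_maps_def lin_map_def base_def)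
    then show ?case using h V'[OF h(1)] by (intro exI[of _ "(scl V c v, w) # xs"]) auto
  qed
  then show ?thesis using that by blast
qed

lemma tensor_space_universal:
  fixes V :: "('k::field, 'a::ab_group_add, 'x) vspace_scheme"
    and W :: "('k, 'b::ab_group_add, 'y) vspace_scheme"
    and U :: "('k, 'c::ab_group_add, 'z) vspace_scheme"
  assumes V: "is_vspace V" and U: "is_vspace U"
    and BV: "B \<subseteq> bilinear_forms V W" and f: "f \<in> bilinear_maps V W U"
    and B: "\<And>g. Vector_Spaces.linear (scl U) (*) g \<Longrightarrow> (\<lambda>v w. g (f v w)) \<in> B"
  shows "\<exists>!F. F \<in> carr (hom_space (tensor_space B V W) U) \<and>
           (\<forall>v\<in>carr V. \<forall>w\<in>carr W. F (pure B v w) = f v w)"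
proof -
  interpret T: vector_space "\<lambda>(c::'k) (t::('a, 'b, 'k) tensor) \<beta>. c * t \<beta>"
    by (rule vector_space_tensor)
  interpret U: vector_space "scl U" using U by (simp add: is_vspace_def)
  let ?T = "tensor_space B V W"
  have subU: "U.subspace (carr U)" using U by (simp add: is_vspace_def)
  have V': "scl V c v \<in> carr V" if "v \<in> carr V" for c v
    using V that scale_closed by blast
  have ls: "lift B V W f (\<Sum>(v, w)\<leftarrow>xs. pure B v w) = (\<Sum>(v, w)\<leftarrow>xs. f v w)"
    if "set xs \<subseteq> carr V \<times> carr W" for xs
    by (rule lift_sum[of "scl U" f, OF U.vector_space_axioms B that])
  have inU: "(\<Sum>(v, w)\<leftarrow>xs. f v w) \<in> carr U" if "set xs \<subseteq> carr V \<times> carr W" for xs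
    using that f by (induction xs)
      (auto intro!: U.subspace_add[OF subU] U.subspace_0[OF subU] simp: bilinear_maps_def lin_map_def)
  have add: "lift B V W f (s + t) = lift B V W f s + lift B V W f t"
    if st: "s \<in> carr ?T" "t \<in> carr ?T" for s t
  proof -
    obtain xs where xs: "set xs \<subseteq> carr V \<times> carr W" "s = (\<Sum>(v, w)\<leftarrow>xs. pure B v w)"
      using tensor_space_decomp[OF V BV st(1)] .
    obtain ys where ys: "set ys \<subseteq> carr V \<times> carr W" "t = (\<Sum>(v, w)\<leftarrow>ys. pure B v w)"
      using tensor_space_decomp[OF V BV st(2)] .
    show ?thesis using ls[of "xs @ ys"] ls[of xs] ls[of ys] xs ys by simp
  qed
  have scale: "lift B V W f (\<lambda>\<beta>. c * t \<beta>) = scl U c (lift B V W f t)"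
    if t: "t \<in> carr ?T" for c t
  proof -
    obtain xs where xs: "set xs \<subseteq> carr V \<times> carr W" "t = (\<Sum>(v, w)\<leftarrow>xs. pure B v w)"
      using tensor_space_decomp[OF V BV t] .
    let ?xs = "map (\<lambda>(v, w). (scl V c v, w)) xs"
    have xs': "set ?xs \<subseteq> carr V \<times> carr W" using xs V' by auto
    have p: "pure B (scl V c v) w = (\<lambda>\<beta>. c * pure B v w \<beta>)" if "v \<in> carr V" "w \<in> carr W" for v w
      using that BV by (auto simp: fun_eq_iff pure_def bilinear_maps_def lin_map_def base_def)
    have "(\<lambda>\<beta>. c * t \<beta>) = (\<Sum>(v, w)\<leftarrow>?xs. pure B v w)"
      using xs(1) unfolding xs(2)
      by (induction xs) (auto simp: p fun_eq_iff algebra_simps)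
    moreover have "(\<Sum>(v, w)\<leftarrow>?xs. f v w) = scl U c (\<Sum>(v, w)\<leftarrow>xs. f v w)"
      using xs(1) f
      by (induction xs) (auto simp: U.scale_right_distrib bilinear_maps_def lin_map_def)
    ultimately show ?thesis using ls[OF xs'] ls[OF xs(1)] xs(2) by simp
  qed
  have tin: "pure B v w \<in> carr ?T" if "v \<in> carr V" "w \<in> carr W" for v w
    using that by (auto simp: tensor_space_def intro!: T.span_base)
  have lp: "lift B V W f (pure B v w) = f v w" if "v \<in> carr V" "w \<in> carr W" for v w
    using ls[of "[(v, w)]"] that by simp
  show ?thesis
  proof (rule ex1I)
    let ?F = "\<lambda>t. if t \<in> carr ?T then lift B V W f t else 0"
    have "lift B V W f t \<in> carr U" if "t \<in> carr ?T" for t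
      using tensor_space_decomp[OF V BV that] ls inU by metis
    moreover have "s + t \<in> carr ?T" if "s \<in> carr ?T" "t \<in> carr ?T" for s t
      using that T.span_add by (simp add: tensor_space_def)
    moreover have "(\<lambda>\<beta>. c * t \<beta>) \<in> carr ?T" if "t \<in> carr ?T" for c t
      using that T.span_scale by (simp add: tensor_space_def)
    moreover have "scl ?T = (\<lambda>c t \<beta>. c * t \<beta>)" by (simp add: tensor_space_def)
    ultimately show "?F \<in> carr (hom_space ?T U) \<and> (\<forall>v\<in>carr V. \<forall>w\<in>carr W. ?F (pure B v w) = f v w)"
      using add scale tin lp by (simp add: hom_space_def lin_map_def)
  next
    fix F assume F: "F \<in> carr (hom_space ?T U) \<and> (\<forall>v\<in>carr V. \<forall>w\<in>carr W. F (pure B v w) = f v w)"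
    have zero_in: "0 \<in> carr ?T" using T.span_zero by (simp add: tensor_space_def)
    have F0: "F 0 = 0"
    proof -
      have "lin_map ?T U F" using F by (simp add: hom_space_def)
      then have "F (0 + 0) = F 0 + F 0" using zero_in unfolding lin_map_def by blast
      then show ?thesis by simp
    qed
    have sum_in: "(\<Sum>(v, w)\<leftarrow>xs. pure B v w) \<in> carr ?T" if "set xs \<subseteq> carr V \<times> carr W" for xs
      using that tin zero_in
      by (induction xs) (auto simp: tensor_space_def intro!: T.span_add)
    have "F (\<Sum>(v, w)\<leftarrow>xs. pure B v w) = (\<Sum>(v, w)\<leftarrow>xs. f v w)"
      if "set xs \<subseteq> carr V \<times> carr W" for xs
      using that
    proof (induction xs)
      case Nil
      then show ?case using F0 by (simp add: zero_fun_def)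
    next
      case (Cons x xs)
      then obtain v w where x: "x = (v, w)" "v \<in> carr V" "w \<in> carr W" by auto
      have "F (pure B v w + (\<Sum>(v, w)\<leftarrow>xs. pure B v w))
          = F (pure B v w) + F (\<Sum>(v, w)\<leftarrow>xs. pure B v w)"
        using F tin[OF x(2,3)] sum_in[of xs] Cons.prems
        by (simp add: hom_space_def lin_map_def)
      then show ?case using Cons x F by (simp add: plus_fun_def)
    qed
    then have "F t = lift B V W f t" if "t \<in> carr ?T" for t
      using tensor_space_decomp[OF V BV that] ls by metis
    then show "F = (\<lambda>t. if t \<in> carr ?T then lift B V W f t else 0)"
      using F by (auto simp: hom_space_def fun_eq_iff)
  qed
qed

lemma bilinear_compose:
  assumes "f \<in> bilinear_maps V W U" "Vector_Spaces.linear (scl U) (*) g"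
  shows "(\<lambda>v w. g (f v w)) \<in> bilinear_forms V W"
proof -
  interpret g: Vector_Spaces.linear "scl U" "(*)" g by fact
  show ?thesis
    using assms(1) by (auto simp: bilinear_maps_def lin_map_def base_def g.add g.scale)
qed

theorem tensor_universal:
  assumes "is_vspace V" "is_vspace U" "f \<in> bilinear_maps V W U"
  shows "\<exists>!F. F \<in> carr (hom_space (tensor V W) U) \<and>
           (\<forall>v\<in>carr V. \<forall>w\<in>carr W. F (v \<otimes>\<^bsub>V,W\<^esub> w) = f v w)"
  by (rule tensor_space_universal[OF assms(1,2) subset_refl assms(3) bilinear_compose[OF assms(3)]])


section \<open>Hopf algebras\<close>

text \<open>
  The ring structure of a Hopf algebra is that of its type; \<^class>\<open>ring_1\<close> assumes \<open>0 \<noteq> 1\<close>, which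
  holds in every Hopf algebra over a field because of the counit.
\<close>

record ('k, 'h) hopf = "('k, 'h) vspace" +
  comult :: "'h \<Rightarrow> ('h, 'h, 'k) tensor"
  counit :: "'h \<Rightarrow> 'k"
  antipode :: "'h \<Rightarrow> 'h"

text \<open>\<open>cop H h (\<lambda>a b. f a b)\<close> is \<open>f h\<^sub>1 h\<^sub>2\<close>.\<close>

abbreviation cop ::
  "('k::field, 'h::ring_1) hopf \<Rightarrow> 'h \<Rightarrow> ('h \<Rightarrow> 'h \<Rightarrow> 'c::ab_group_add) \<Rightarrow> 'c" where
  "cop H h f \<equiv> sw H H (comult H h) f"

definition hopf_algebra :: "('k::field, 'h::ring_1) hopf \<Rightarrow> bool" where
  "hopf_algebra H \<longleftrightarrow>
     is_vspace H \<and> carr H = UNIV \<and>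
     (\<forall>c a b. scl H c a * b = scl H c (a * b) \<and> a * scl H c b = scl H c (a * b)) \<and>
     lin_map H (tensor H H) (comult H) \<and>
     lin_map H base (counit H) \<and>
     (\<forall>h. cop H h (\<lambda>a b. cop H a (\<lambda>x y. x \<otimes>\<^bsub>H,tensor H H\<^esub> (y \<otimes>\<^bsub>H,H\<^esub> b)))
        = cop H h (\<lambda>a b. a \<otimes>\<^bsub>H,tensor H H\<^esub> comult H b)) \<and>
     (\<forall>h. cop H h (\<lambda>a b. scl H (counit H a) b) = h) \<and>
     (\<forall>h. cop H h (\<lambda>a b. scl H (counit H b) a) = h) \<and>
     comult H 1 = 1 \<otimes>\<^bsub>H,H\<^esub> 1 \<and>
     (\<forall>g h. comult H (g * h)
        = cop H g (\<lambda>g1 g2. cop H h (\<lambda>h1 h2. (g1 * h1) \<otimes>\<^bsub>H,H\<^esub> (g2 * h2)))) \<and>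
     counit H 1 = 1 \<and>
     (\<forall>g h. counit H (g * h) = counit H g * counit H h) \<and>
     lin_map H H (antipode H) \<and>
     (\<forall>h. cop H h (\<lambda>a b. antipode H a * b) = scl H (counit H h) 1) \<and>
     (\<forall>h. cop H h (\<lambda>a b. a * antipode H b) = scl H (counit H h) 1)"


section \<open>Bicovariant bimodules\<close>

record ('k, 'h, 'm) bicov = "('k, 'm) vspace" +
  lact :: "'h \<Rightarrow> 'm \<Rightarrow> 'm"
  ract :: "'m \<Rightarrow> 'h \<Rightarrow> 'm"
  rco :: "'m \<Rightarrow> ('m, 'h, 'k) tensor"
  lco :: "'m \<Rightarrow> ('h, 'm, 'k) tensor"

text \<open>
  \<open>rcs H M m (\<lambda>m0 m1. f m0 m1)\<close> is \<open>f m\<^sub>0 m\<^sub>1\<close> for the right coaction, and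
  \<open>lcs H M m (\<lambda>p m0. f p m0)\<close> is \<open>f m\<^sub>-\<^sub>1 m\<^sub>0\<close> for the left one; \<open>rcs2\<close>, \<open>lcs2\<close> are the iterated
  versions \<open>f m\<^sub>0 m\<^sub>1 m\<^sub>2\<close> and \<open>f m\<^sub>-\<^sub>2 m\<^sub>-\<^sub>1 m\<^sub>0\<close>.
\<close>

abbreviation rcs ::
  "('k::field, 'h::ring_1) hopf \<Rightarrow> ('k, 'h, 'm::ab_group_add) bicov \<Rightarrow> 'm
    \<Rightarrow> ('m \<Rightarrow> 'h \<Rightarrow> 'c::ab_group_add) \<Rightarrow> 'c" where
  "rcs H M m f \<equiv> sw M H (rco M m) f"

abbreviation lcs ::
  "('k::field, 'h::ring_1) hopf \<Rightarrow> ('k, 'h, 'm::ab_group_add) bicov \<Rightarrow> 'm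
    \<Rightarrow> ('h \<Rightarrow> 'm \<Rightarrow> 'c::ab_group_add) \<Rightarrow> 'c" where
  "lcs H M m f \<equiv> sw H M (lco M m) f"

abbreviation rcs2 ::
  "('k::field, 'h::ring_1) hopf \<Rightarrow> ('k, 'h, 'm::ab_group_add) bicov \<Rightarrow> 'm
    \<Rightarrow> ('m \<Rightarrow> 'h \<Rightarrow> 'h \<Rightarrow> 'c::ab_group_add) \<Rightarrow> 'c" where
  "rcs2 H M m f \<equiv> rcs H M m (\<lambda>m0 q. cop H q (\<lambda>m1 m2. f m0 m1 m2))"

abbreviation lcs2 ::
  "('k::field, 'h::ring_1) hopf \<Rightarrow> ('k, 'h, 'm::ab_group_add) bicov \<Rightarrow> 'm
    \<Rightarrow> ('h \<Rightarrow> 'h \<Rightarrow> 'm \<Rightarrow> 'c::ab_group_add) \<Rightarrow> 'c" where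
  "lcs2 H M m f \<equiv> lcs H M m (\<lambda>p m0. cop H p (\<lambda>p2 p1. f p2 p1 m0))"

definition left_module ::
  "('k::field, 'h::ring_1) hopf \<Rightarrow> ('k, 'h, 'm::ab_group_add) bicov \<Rightarrow> bool" where
  "left_module H M \<longleftrightarrow>
     is_vspace M \<and> lact M \<in> bilinear_maps H M M \<and>
     (\<forall>m\<in>carr M. lact M 1 m = m) \<and>
     (\<forall>a b. \<forall>m\<in>carr M. lact M (a * b) m = lact M a (lact M b m))"

definition right_module ::
  "('k::field, 'h::ring_1) hopf \<Rightarrow> ('k, 'h, 'm::ab_group_add) bicov \<Rightarrow> bool" where
  "right_module H M \<longleftrightarrow>
     is_vspace M \<and> ract M \<in> bilinear_maps M H M \<and>
     (\<forall>m\<in>carr M. ract M m 1 = m) \<and>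
     (\<forall>a b. \<forall>m\<in>carr M. ract M m (a * b) = ract M (ract M m a) b)"

definition bicomodule ::
  "('k::field, 'h::ring_1) hopf \<Rightarrow> ('k, 'h, 'm::ab_group_add) bicov \<Rightarrow> bool" where
  "bicomodule H M \<longleftrightarrow>
     is_vspace M \<and>
     lin_map M (tensor M H) (rco M) \<and>
     lin_map M (tensor H M) (lco M) \<and>
     (\<forall>m\<in>carr M. rcs H M m (\<lambda>m0 m1. rcs H M m0 (\<lambda>x y. x \<otimes>\<^bsub>M,tensor H H\<^esub> (y \<otimes>\<^bsub>H,H\<^esub> m1)))
        = rcs H M m (\<lambda>m0 m1. m0 \<otimes>\<^bsub>M,tensor H H\<^esub> comult H m1)) \<and>
     (\<forall>m\<in>carr M. rcs H M m (\<lambda>m0 m1. scl M (counit H m1) m0) = m) \<and>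
     (\<forall>m\<in>carr M. lcs H M m (\<lambda>p m0. cop H p (\<lambda>x y. x \<otimes>\<^bsub>H,tensor H M\<^esub> (y \<otimes>\<^bsub>H,M\<^esub> m0)))
        = lcs H M m (\<lambda>p m0. p \<otimes>\<^bsub>H,tensor H M\<^esub> lco M m0)) \<and>
     (\<forall>m\<in>carr M. lcs H M m (\<lambda>p m0. scl M (counit H p) m0) = m) \<and>
     (\<forall>m\<in>carr M. rcs H M m (\<lambda>m0 m1. lcs H M m0 (\<lambda>p x. p \<otimes>\<^bsub>H,tensor M H\<^esub> (x \<otimes>\<^bsub>M,H\<^esub> m1)))
        = lcs H M m (\<lambda>p m0. p \<otimes>\<^bsub>H,tensor M H\<^esub> rco M m0))"

text \<open>
  Objects of \<open>\<^sup>H\<^sub>H\<M>\<^sup>H\<close>. The field \<^const>\<open>ract\<close> plays no role here, so that every bicovariant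
  bimodule is such an object by forgetting its right action.
\<close>

definition left_bicov_module ::
  "('k::field, 'h::ring_1) hopf \<Rightarrow> ('k, 'h, 'm::ab_group_add) bicov \<Rightarrow> bool" where
  "left_bicov_module H M \<longleftrightarrow>
     left_module H M \<and> bicomodule H M \<and>
     (\<forall>a. \<forall>m\<in>carr M. rco M (lact M a m)
        = cop H a (\<lambda>a1 a2. rcs H M m (\<lambda>m0 m1. lact M a1 m0 \<otimes>\<^bsub>M,H\<^esub> (a2 * m1)))) \<and>
     (\<forall>a. \<forall>m\<in>carr M. lco M (lact M a m)
        = cop H a (\<lambda>a1 a2. lcs H M m (\<lambda>p m0. (a1 * p) \<otimes>\<^bsub>H,M\<^esub> lact M a2 m0)))"

definition bicov_bimodule ::
  "('k::field, 'h::ring_1) hopf \<Rightarrow> ('k, 'h, 'm::ab_group_add) bicov \<Rightarrow> bool" where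
  "bicov_bimodule H M \<longleftrightarrow>
     left_module H M \<and> right_module H M \<and>
     (\<forall>a b. \<forall>m\<in>carr M. ract M (lact M a m) b = lact M a (ract M m b)) \<and>
     bicomodule H M \<and>
     (\<forall>a b. \<forall>m\<in>carr M. rco M (ract M (lact M a m) b)
        = cop H a (\<lambda>a1 a2. rcs H M m (\<lambda>m0 m1. cop H b (\<lambda>b1 b2.
            ract M (lact M a1 m0) b1 \<otimes>\<^bsub>M,H\<^esub> (a2 * m1 * b2))))) \<and>
     (\<forall>a b. \<forall>m\<in>carr M. lco M (ract M (lact M a m) b)
        = cop H a (\<lambda>a1 a2. lcs H M m (\<lambda>p m0. cop H b (\<lambda>b1 b2.
            (a1 * p * b1) \<otimes>\<^bsub>H,M\<^esub> ract M (lact M a2 m0) b2))))"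

definition left_linear ::
  "('k, 'h, 'm) bicov \<Rightarrow> ('k, 'h, 'n) bicov \<Rightarrow> ('m \<Rightarrow> 'n) \<Rightarrow> bool" where
  "left_linear M N f \<longleftrightarrow> (\<forall>a. \<forall>m\<in>carr M. f (lact M a m) = lact N a (f m))"

definition right_linear ::
  "('k, 'h, 'm) bicov \<Rightarrow> ('k, 'h, 'n) bicov \<Rightarrow> ('m \<Rightarrow> 'n) \<Rightarrow> bool" where
  "right_linear M N f \<longleftrightarrow> (\<forall>b. \<forall>m\<in>carr M. f (ract M m b) = ract N (f m) b)"

definition right_colinear ::
  "('k::field, 'h::ring_1) hopf \<Rightarrow> ('k, 'h, 'm::ab_group_add) bicov
    \<Rightarrow> ('k, 'h, 'n::ab_group_add) bicov \<Rightarrow> ('m \<Rightarrow> 'n) \<Rightarrow> bool" where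
  "right_colinear H M N f \<longleftrightarrow>
     (\<forall>m\<in>carr M. rco N (f m) = rcs H M m (\<lambda>m0 m1. f m0 \<otimes>\<^bsub>N,H\<^esub> m1))"

definition left_colinear ::
  "('k::field, 'h::ring_1) hopf \<Rightarrow> ('k, 'h, 'm::ab_group_add) bicov
    \<Rightarrow> ('k, 'h, 'n::ab_group_add) bicov \<Rightarrow> ('m \<Rightarrow> 'n) \<Rightarrow> bool" where
  "left_colinear H M N f \<longleftrightarrow>
     (\<forall>m\<in>carr M. lco N (f m) = lcs H M m (\<lambda>p m0. p \<otimes>\<^bsub>H,N\<^esub> f m0))"

definition left_bicov_morphism ::
  "('k::field, 'h::ring_1) hopf \<Rightarrow> ('k, 'h, 'm::ab_group_add) bicov
    \<Rightarrow> ('k, 'h, 'n::ab_group_add) bicov \<Rightarrow> ('m \<Rightarrow> 'n) \<Rightarrow> bool" where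
  "left_bicov_morphism H M N f \<longleftrightarrow>
     left_bicov_module H M \<and> left_bicov_module H N \<and> lin_map M N f \<and>
     left_linear M N f \<and> left_colinear H M N f \<and> right_colinear H M N f"

definition bicov_morphism ::
  "('k::field, 'h::ring_1) hopf \<Rightarrow> ('k, 'h, 'm::ab_group_add) bicov
    \<Rightarrow> ('k, 'h, 'n::ab_group_add) bicov \<Rightarrow> ('m \<Rightarrow> 'n) \<Rightarrow> bool" where
  "bicov_morphism H M N f \<longleftrightarrow>
     bicov_bimodule H M \<and> bicov_bimodule H N \<and> lin_map M N f \<and>
     left_linear M N f \<and> right_linear M N f \<and> left_colinear H M N f \<and> right_colinear H M N f"


section \<open>Tensor products of bicovariant bimodules\<close>

definition balanced_maps ::
  "('k::field, 'h, 'm::ab_group_add) bicov \<Rightarrow> ('k, 'h, 'n::ab_group_add) bicov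
    \<Rightarrow> ('k, 'c::ab_group_add, 'z) vspace_scheme \<Rightarrow> ('m \<Rightarrow> 'n \<Rightarrow> 'c) set" where
  "balanced_maps M N U = {f \<in> bilinear_maps M N U.
     \<forall>m\<in>carr M. \<forall>h. \<forall>n\<in>carr N. f (ract M m h) n = f m (lact N h n)}"

abbreviation balanced_forms ::
  "('k::field, 'h, 'm::ab_group_add) bicov \<Rightarrow> ('k, 'h, 'n::ab_group_add) bicov
    \<Rightarrow> ('m \<Rightarrow> 'n \<Rightarrow> 'k) set" where
  "balanced_forms M N \<equiv> balanced_maps M N base"

definition bicov_tensor ::
  "('m \<Rightarrow> 'n \<Rightarrow> 'k::field) set \<Rightarrow> ('k, 'h::ring_1) hopf \<Rightarrow> ('k, 'h, 'm::ab_group_add) bicov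
    \<Rightarrow> ('k, 'h, 'n::ab_group_add) bicov \<Rightarrow> ('k, 'h, ('m, 'n, 'k) tensor) bicov" where
  "bicov_tensor B H M N = (let T = tensor_space B M N in
     \<lparr>carr = carr T, scl = scl T,
      lact = (\<lambda>a t. lift B M N (\<lambda>m n. pure B (lact M a m) n) t),
      ract = (\<lambda>t b. lift B M N (\<lambda>m n. pure B m (ract N n b)) t),
      rco = (\<lambda>t. lift B M N (\<lambda>m n. rcs H M m (\<lambda>m0 m1. rcs H N n (\<lambda>n0 n1.
               pure B m0 n0 \<otimes>\<^bsub>T,H\<^esub> (m1 * n1)))) t),
      lco = (\<lambda>t. lift B M N (\<lambda>m n. lcs H M m (\<lambda>p m0. lcs H N n (\<lambda>q n0.
               (p * q) \<otimes>\<^bsub>H,T\<^esub> pure B m0 n0))) t)\<rparr>)"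

text \<open>\<open>tensor_k H M N\<close> is the tensor product over the base field, \<open>tensor_H H M N\<close> that over \<open>H\<close>.\<close>

abbreviation tensor_k ::
  "('k::field, 'h::ring_1) hopf \<Rightarrow> ('k, 'h, 'm::ab_group_add) bicov
    \<Rightarrow> ('k, 'h, 'n::ab_group_add) bicov \<Rightarrow> ('k, 'h, ('m, 'n, 'k) tensor) bicov" where
  "tensor_k H M N \<equiv> bicov_tensor (bilinear_forms M N) H M N"

abbreviation tensor_H ::
  "('k::field, 'h::ring_1) hopf \<Rightarrow> ('k, 'h, 'm::ab_group_add) bicov
    \<Rightarrow> ('k, 'h, 'n::ab_group_add) bicov \<Rightarrow> ('k, 'h, ('m, 'n, 'k) tensor) bicov" where
  "tensor_H H M N \<equiv> bicov_tensor (balanced_forms M N) H M N"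

text \<open>\<open>m \<odot> n\<close> denotes the element \<open>m \<otimes>\<^sub>H n\<close>.\<close>

abbreviation tens_H ::
  "'m::ab_group_add \<Rightarrow> ('k::field, 'h, 'm) bicov \<Rightarrow> ('k, 'h, 'n::ab_group_add) bicov
    \<Rightarrow> 'n \<Rightarrow> ('m, 'n, 'k) tensor"  ("_ \<odot>\<^bsub>_,_\<^esub> _" [71, 0, 0, 70] 70) where
  "m \<odot>\<^bsub>M,N\<^esub> n \<equiv> pure (balanced_forms M N) m n"

abbreviation lift_H ::
  "('k::field, 'h, 'm::ab_group_add) bicov \<Rightarrow> ('k, 'h, 'n::ab_group_add) bicov
    \<Rightarrow> ('m \<Rightarrow> 'n \<Rightarrow> 'c::ab_group_add) \<Rightarrow> ('m, 'n, 'k) tensor \<Rightarrow> 'c" where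
  "lift_H M N f t \<equiv> lift (balanced_forms M N) M N f t"

theorem balanced_tensor_universal:
  assumes "is_vspace M" "is_vspace U" "f \<in> balanced_maps M N U"
  shows "\<exists>!F. F \<in> carr (hom_space (tensor_space (balanced_forms M N) M N) U) \<and>
           (\<forall>m\<in>carr M. \<forall>n\<in>carr N. F (m \<odot>\<^bsub>M,N\<^esub> n) = f m n)"
proof (rule tensor_space_universal[OF assms(1,2)])
  show "(\<lambda>v w. g (f v w)) \<in> balanced_forms M N" if "Vector_Spaces.linear (scl U) (*) g" for g
    using bilinear_compose[OF _ that] assms(3) by (auto simp: balanced_maps_def)
qed (use assms in \<open>auto simp: balanced_maps_def\<close>)

text \<open>The relation \<open>mh \<otimes>\<^sub>H n = m \<otimes>\<^sub>H hn\<close>:\<close>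

lemma tens_H_balanced:
  assumes "m \<in> carr M" "n \<in> carr N"
  shows "ract M m h \<odot>\<^bsub>M,N\<^esub> n = m \<odot>\<^bsub>M,N\<^esub> lact N h n"
  using assms by (auto simp: pure_def balanced_maps_def fun_eq_iff)


section \<open>Rational morphisms\<close>

definition delta_Ad ::
  "('k::field, 'h::ring_1) hopf \<Rightarrow> ('k, 'h, 'm::ab_group_add) bicov
    \<Rightarrow> ('k, 'h, 'n::ab_group_add) bicov \<Rightarrow> ('m \<Rightarrow> 'n) \<Rightarrow> 'm \<Rightarrow> ('n, 'h, 'k) tensor" where
  "delta_Ad H M N \<phi> m = rcs H M m (\<lambda>m0 m1. rcs H N (\<phi> m0) (\<lambda>n0 n1.
     n0 \<otimes>\<^bsub>N,H\<^esub> (n1 * antipode H m1)))"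

definition lambda_Ad ::
  "('k::field, 'h::ring_1) hopf \<Rightarrow> ('k, 'h, 'm::ab_group_add) bicov
    \<Rightarrow> ('k, 'h, 'n::ab_group_add) bicov \<Rightarrow> ('m \<Rightarrow> 'n) \<Rightarrow> 'm \<Rightarrow> ('h, 'n, 'k) tensor" where
  "lambda_Ad H M N \<phi> m = lcs H M m (\<lambda>p m0. lcs H N (\<phi> m0) (\<lambda>q n0.
     (q * inv (antipode H) p) \<otimes>\<^bsub>H,N\<^esub> n0))"

text \<open>
  For a space \<open>V\<close> of linear maps from \<open>M\<close> to \<open>N\<close>, the tensor \<open>t \<in> V \<otimes> H\<close> \<open>represents\<close> the map
  \<open>F\<close> from \<open>M\<close> to \<open>N \<otimes> H\<close> if \<open>F\<close> is its image under the canonical inclusion, and similarly on the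
  left.
\<close>

definition represents_right ::
  "('k::field, 'h::ring_1) hopf \<Rightarrow> ('k, 'm \<Rightarrow> 'n) vspace \<Rightarrow> ('k, 'h, 'm::ab_group_add) bicov
    \<Rightarrow> ('k, 'h, 'n::ab_group_add) bicov \<Rightarrow> ('m \<Rightarrow> 'n, 'h, 'k) tensor
    \<Rightarrow> ('m \<Rightarrow> ('n, 'h, 'k) tensor) \<Rightarrow> bool" where
  "represents_right H V M N t F \<longleftrightarrow> t \<in> carr (tensor V H) \<and>
     (\<forall>m\<in>carr M. F m = sw V H t (\<lambda>\<chi> h. \<chi> m \<otimes>\<^bsub>N,H\<^esub> h))"

definition represents_left ::
  "('k::field, 'h::ring_1) hopf \<Rightarrow> ('k, 'm \<Rightarrow> 'n) vspace \<Rightarrow> ('k, 'h, 'm::ab_group_add) bicov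
    \<Rightarrow> ('k, 'h, 'n::ab_group_add) bicov \<Rightarrow> ('h, 'm \<Rightarrow> 'n, 'k) tensor
    \<Rightarrow> ('m \<Rightarrow> ('h, 'n, 'k) tensor) \<Rightarrow> bool" where
  "represents_left H V M N t F \<longleftrightarrow> t \<in> carr (tensor H V) \<and>
     (\<forall>m\<in>carr M. F m = sw H V t (\<lambda>h \<chi>. h \<otimes>\<^bsub>H,N\<^esub> \<chi> m))"

definition HOM_space ::
  "('k::field, 'h::ring_1) hopf \<Rightarrow> ('k, 'h, 'm::ab_group_add) bicov
    \<Rightarrow> ('k, 'h, 'n::ab_group_add) bicov \<Rightarrow> ('k, 'm \<Rightarrow> 'n) vspace" where
  "HOM_space H M N =
     \<lparr>carr = {\<phi> \<in> carr (hom_space M N).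
        (\<exists>t. represents_right H (hom_space M N) M N t (delta_Ad H M N \<phi>)) \<and>
        (\<exists>t. represents_left H (hom_space M N) M N t (lambda_Ad H M N \<phi>))},
      scl = (\<lambda>c \<phi> m. scl N c (\<phi> m))\<rparr>"

definition HOM ::
  "('k::field, 'h::ring_1) hopf \<Rightarrow> ('k, 'h, 'm::ab_group_add) bicov
    \<Rightarrow> ('k, 'h, 'n::ab_group_add) bicov \<Rightarrow> ('k, 'h, 'm \<Rightarrow> 'n) bicov" where
  "HOM H M N = (let V = HOM_space H M N in
     \<lparr>carr = carr V, scl = scl V,
      lact = (\<lambda>a \<phi> m. lact N a (\<phi> m)),
      ract = (\<lambda>\<phi> b m. if m \<in> carr M then \<phi> (lact M b m) else 0),
      rco = (\<lambda>\<phi>. THE t. represents_right H V M N t (delta_Ad H M N \<phi>)),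
      lco = (\<lambda>\<phi>. THE t. represents_left H V M N t (lambda_Ad H M N \<phi>))\<rparr>)"

definition HOM_right_linear ::
  "('k::field, 'h::ring_1) hopf \<Rightarrow> ('k, 'h, 'm::ab_group_add) bicov
    \<Rightarrow> ('k, 'h, 'n::ab_group_add) bicov \<Rightarrow> ('m \<Rightarrow> 'n) set" where
  "HOM_right_linear H M N = {\<phi> \<in> carr (HOM H M N). right_linear M N \<phi>}"


section \<open>Evaluation, composition and tensor product of rational morphisms\<close>

definition ev ::
  "('k::field, 'h::ring_1) hopf \<Rightarrow> ('k, 'h, 'm::ab_group_add) bicov
    \<Rightarrow> ('k, 'h, 'n::ab_group_add) bicov \<Rightarrow> ('m \<Rightarrow> 'n, 'm, 'k) tensor \<Rightarrow> 'n" where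
  "ev H M N = lift_H (HOM H M N) M (\<lambda>\<phi> m. \<phi> m)"

definition comp_HOM ::
  "('k::field, 'h::ring_1) hopf \<Rightarrow> ('k, 'h, 'm::ab_group_add) bicov
    \<Rightarrow> ('k, 'h, 'n::ab_group_add) bicov \<Rightarrow> ('k, 'h, 'p::ab_group_add) bicov
    \<Rightarrow> ('n \<Rightarrow> 'p, 'm \<Rightarrow> 'n, 'k) tensor \<Rightarrow> ('m \<Rightarrow> 'p)" where
  "comp_HOM H M N P = lift_H (HOM H N P) (HOM H M N) (\<lambda>\<phi> \<psi>. \<phi> \<circ> \<psi>)"

text \<open>\<open>\<phi>(\<psi>\<^sub>-\<^sub>2 m\<^sub>0 S(\<psi>\<^sub>-\<^sub>1 m\<^sub>1)) \<otimes>\<^sub>H \<psi>\<^sub>0(m\<^sub>2 n)\<close>\<close>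

definition hat_formula ::
  "('k::field, 'h::ring_1) hopf \<Rightarrow> ('k, 'h, 'm::ab_group_add) bicov
    \<Rightarrow> ('k, 'h, 'm'::ab_group_add) bicov \<Rightarrow> ('k, 'h, 'n::ab_group_add) bicov
    \<Rightarrow> ('k, 'h, 'n'::ab_group_add) bicov \<Rightarrow> ('m \<Rightarrow> 'm') \<Rightarrow> ('n \<Rightarrow> 'n')
    \<Rightarrow> 'm \<Rightarrow> 'n \<Rightarrow> ('m', 'n', 'k) tensor" where
  "hat_formula H M M' N N' \<phi> \<psi> m n =
     lcs2 H (HOM H N N') \<psi> (\<lambda>p2 p1 \<psi>0. rcs2 H M m (\<lambda>m0 m1 m2.
       \<phi> (ract M (lact M p2 m0) (antipode H (p1 * m1))) \<odot>\<^bsub>M',N'\<^esub> \<psi>0 (lact N m2 n)))"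

definition hat_map ::
  "('k::field, 'h::ring_1) hopf \<Rightarrow> ('k, 'h, 'm::ab_group_add) bicov
    \<Rightarrow> ('k, 'h, 'm'::ab_group_add) bicov \<Rightarrow> ('k, 'h, 'n::ab_group_add) bicov
    \<Rightarrow> ('k, 'h, 'n'::ab_group_add) bicov \<Rightarrow> ('m \<Rightarrow> 'm') \<Rightarrow> ('n \<Rightarrow> 'n')
    \<Rightarrow> ('m, 'n, 'k) tensor \<Rightarrow> ('m', 'n', 'k) tensor" where
  "hat_map H M M' N N' \<phi> \<psi> =
     (\<lambda>t. if t \<in> carr (tensor_H H M N) then lift_H M N (hat_formula H M M' N N' \<phi> \<psi>) t else 0)"

definition hat_tensor ::
  "('k::field, 'h::ring_1) hopf \<Rightarrow> ('k, 'h, 'm::ab_group_add) bicov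
    \<Rightarrow> ('k, 'h, 'm'::ab_group_add) bicov \<Rightarrow> ('k, 'h, 'n::ab_group_add) bicov
    \<Rightarrow> ('k, 'h, 'n'::ab_group_add) bicov \<Rightarrow> ('m \<Rightarrow> 'm', 'n \<Rightarrow> 'n', 'k) tensor
    \<Rightarrow> (('m, 'n, 'k) tensor \<Rightarrow> ('m', 'n', 'k) tensor)" where
  "hat_tensor H M M' N N' t = sw (HOM H M M') (HOM H N N') t (hat_map H M M' N N')"

text \<open>\<open>\<phi>(\<psi>\<^sub>-\<^sub>2 m\<^sub>0 S(m\<^sub>1)) \<otimes>\<^sub>H S(\<psi>\<^sub>-\<^sub>1) \<psi>\<^sub>0(m\<^sub>2 n)\<close>\<close>

definition sigma_W_formula ::
  "('k::field, 'h::ring_1) hopf \<Rightarrow> ('k, 'h, 'm::ab_group_add) bicov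
    \<Rightarrow> ('k, 'h, 'm'::ab_group_add) bicov \<Rightarrow> ('k, 'h, 'n::ab_group_add) bicov
    \<Rightarrow> ('k, 'h, 'n'::ab_group_add) bicov \<Rightarrow> ('m \<Rightarrow> 'm') \<Rightarrow> ('n \<Rightarrow> 'n')
    \<Rightarrow> 'm \<Rightarrow> 'n \<Rightarrow> ('m', 'n', 'k) tensor" where
  "sigma_W_formula H M M' N N' \<phi> \<psi> m n =
     lcs2 H (HOM H N N') \<psi> (\<lambda>p2 p1 \<psi>0. rcs2 H M m (\<lambda>m0 m1 m2.
       \<phi> (ract M (lact M p2 m0) (antipode H m1))
         \<odot>\<^bsub>M',N'\<^esub> lact N' (antipode H p1) (\<psi>0 (lact N m2 n))))"

end

theory Submission
  imports Defs
begin

text \<open>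
  All identities are tested on multilinear forms, where Sweedler sums become honest finite sums of scalars.
  The coaction of \<open>HOM(M, N)\<close> is handled through
  \<open>\<phi>(m)\<^sub>0 \<otimes> \<phi>(m)\<^sub>1 = \<phi>\<^sub>0(m\<^sub>0) \<otimes> \<phi>\<^sub>1 m\<^sub>1\<close>, which determines \<open>\<delta>\<^sup>A\<^sup>d(\<phi>)\<close> and is free of the antipode:
  evaluation and composition are then colinear at a glance, and the comodule axioms follow from
  uniqueness. That \<open>\<delta>\<^sup>A\<^sup>d(\<phi>)\<close> lies in \<open>HOM(M, N) \<otimes> H\<close> holds because rational maps are closed under the
  contractions \<open>\<phi>\<^sub>0 g(\<phi>\<^sub>1)\<close>, and the left coaction is the right one of the mirror image \<open>H\<^sup>c\<^sup>o\<^sup>p\<close>.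

  With the right coinvariant \<open>\<pi>(m) = m\<^sub>0 S(m\<^sub>1)\<close> and the adjoint action \<open>x \<triangleright> u = x\<^sub>1 u S(x\<^sub>2)\<close> one has
  \<open>\<psi>\<^sub>-\<^sub>2 m\<^sub>0 S(\<psi>\<^sub>-\<^sub>1 m\<^sub>1) \<otimes> m\<^sub>2 = \<psi>\<^sub>-\<^sub>1 \<triangleright> \<pi>(m\<^sub>0) \<otimes> m\<^sub>1\<close>. Since \<open>\<pi>(mh) = \<epsilon>(h) \<pi>(m)\<close>, \<open>\<pi>(hm) = h \<triangleright> \<pi>(m)\<close> and
  \<open>x \<triangleright> \<pi>(m)\<close> is right coinvariant with left coaction \<open>x\<^sub>1 m\<^sub>-\<^sub>1 S(x\<^sub>3 m\<^sub>1) \<otimes> x\<^sub>2 \<triangleright> \<pi>(m\<^sub>0)\<close>, the statements on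
  \<open>\<phi> \<hat>\<otimes> \<psi>\<close> need only one cancellation \<open>S(x\<^sub>1 m\<^sub>1) x\<^sub>2 m\<^sub>2 = \<epsilon>(x) \<epsilon>(m)\<close>.
\<close>

section \<open>Linear algebra of tensors\<close>

text \<open>A tensor is a functional on a set of forms, and this set depends on the carriers. Hence
  including the rational maps into all linear maps does not make
  \<open>tensor (HOM_space H M N) H\<close> a subset of \<open>tensor (hom_space M N) H\<close>, and
  a coaction cannot be moved from one space to the other as it stands. Relations between a map and
  its coaction are therefore stated for a variable space \<open>V\<close> of maps, and the step to
  rational coefficients builds a new tensor from an expansion in a basis of \<open>H\<close>. This
  works because the coefficients of the expansion depend on \<open>\<phi>\<close> and a functional
  alone, not on the tensor that is expanded.

  The same device replaces the comparison of tensors with three factors: coassociativity on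
  \<open>HOM\<close> and the commutation of its two coactions are tested by applying a functional to
  the last factor, where both sides become the coaction of one contracted map.

  The inverse antipode in \<open>lambda_Ad\<close> is the antipode that belongs to the opposite
  coproduct; this is what makes the mirror image available.\<close>

lemma lin_mapI:
  assumes "\<And>v. v \<in> carr V \<Longrightarrow> f v \<in> carr W"
    "\<And>v v'. v \<in> carr V \<Longrightarrow> v' \<in> carr V \<Longrightarrow> f (v + v') = f v + f v'"
    "\<And>c v. v \<in> carr V \<Longrightarrow> f (scl V c v) = scl W c (f v)"
  shows "lin_map V W f"
  using assms by (auto simp: lin_map_def)

lemma lin_mapD:
  assumes "lin_map V W f"
  shows "v \<in> carr V \<Longrightarrow> f v \<in> carr W"
    "v \<in> carr V \<Longrightarrow> v' \<in> carr V \<Longrightarrow> f (v + v') = f v + f v'"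
    "v \<in> carr V \<Longrightarrow> f (scl V c v) = scl W c (f v)"
  using assms by (auto simp: lin_map_def)

text \<open>The conditions in \<open>lin_map\<close> also evaluate the maps at \<open>v + v'\<close>
  and \<open>scl V c v\<close>, so agreement on the carrier suffices once the carrier is a
  subspace.\<close>

lemma lin_map_cong:
  assumes "\<And>v. v \<in> carr V \<Longrightarrow> f v = g v" "is_vspace V"
  shows "lin_map V W f \<longleftrightarrow> lin_map V W g"
proof -
  interpret vector_space "scl V" using assms by (simp add: is_vspace_def)
  have "v + v' \<in> carr V" "scl V c v \<in> carr V" if "v \<in> carr V" "v' \<in> carr V" for v v' c
    using that assms subspace_add subspace_scale by (auto simp: is_vspace_def)
  then show ?thesis using assms by (simp add: lin_map_def)
qed

lemma is_vspace_base [simp]: "is_vspace (base :: ('k::field, 'k) vspace)"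
proof -
  interpret vector_space "(*) :: 'k \<Rightarrow> 'k \<Rightarrow> 'k" by unfold_locales (auto simp: algebra_simps)
  show ?thesis using vector_space_axioms subspace_UNIV by (simp add: is_vspace_def base_def)
qed

lemma carr_base [simp]: "carr base = UNIV" and scl_base [simp]: "scl base = (*)"
  by (simp_all add: base_def)

lemma is_vspace_tensor_space [simp]: "is_vspace (tensor_space B V W)"
  for B :: "('a \<Rightarrow> 'b \<Rightarrow> 'k::field) set"
proof -
  interpret vector_space "\<lambda>(c::'k) (t::('a, 'b, 'k) tensor) \<beta>. c * t \<beta>"
    by (rule vector_space_tensor)
  show ?thesis using vector_space_axioms by (simp add: is_vspace_def tensor_space_def)
qed

lemma scl_tensor_space [simp]: "scl (tensor_space B V W) = (\<lambda>c t \<beta>. c * t \<beta>)"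
  by (simp add: tensor_space_def)

context
  fixes V :: "('k::field, 'a::ab_group_add, 'y) vspace_scheme"
  assumes V: "is_vspace V"
begin

interpretation vector_space "scl V" using V by (simp add: is_vspace_def)

lemma zero_closed: "0 \<in> carr V"
  using V subspace_0 by (simp add: is_vspace_def)

lemma add_closed: "v \<in> carr V \<Longrightarrow> w \<in> carr V \<Longrightarrow> v + w \<in> carr V"
  using V subspace_add by (simp add: is_vspace_def)

lemma diff_closed: "v \<in> carr V \<Longrightarrow> w \<in> carr V \<Longrightarrow> v - w \<in> carr V"
  using V subspace_diff by (simp add: is_vspace_def)

lemma sum_list_closed: "(\<And>x. x \<in> set xs \<Longrightarrow> f x \<in> carr V) \<Longrightarrow> sum_list (map f xs) \<in> carr V"
  by (induction xs) (auto intro: zero_closed add_closed)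

lemma vspace_scale_simps:
  "scl V c (v + w) = scl V c v + scl V c w" "scl V (c + d) v = scl V c v + scl V d v"
  "scl V c (scl V d v) = scl V (c * d) v" "scl V 1 v = v" "scl V 0 v = 0" "scl V c 0 = 0"
  by (auto simp: algebra_simps)

lemma lin_map_zero: "lin_map V W f \<Longrightarrow> f 0 = 0"
proof -
  assume "lin_map V W f"
  from lin_mapD(2)[OF this zero_closed zero_closed] show ?thesis by simp
qed

lemma lin_map_diff: "lin_map V W f \<Longrightarrow> v \<in> carr V \<Longrightarrow> w \<in> carr V \<Longrightarrow> f (v - w) = f v - f w"
  using lin_mapD(2)[of V W f "v - w" w] diff_closed[of v w] by simp

lemma lin_map_sum_list:
  assumes "lin_map V W f" "\<And>x. x \<in> set xs \<Longrightarrow> g x \<in> carr V"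
  shows "f (\<Sum>x\<leftarrow>xs. g x) = (\<Sum>x\<leftarrow>xs. f (g x))"
  using assms(2)
  by (induction xs) (auto simp: lin_map_zero[OF assms(1)] lin_mapD(2)[OF assms(1)] sum_list_closed)

text \<open>Over a field, functionals separate points. Through this rule identities of vectors,
  among them those in a tensor product over \<open>H\<close>, turn into identities of
  scalars.\<close>

lemma vec_eqI:
  assumes "u \<in> carr V" "w \<in> carr V" "\<And>g. lin_map V base g \<Longrightarrow> g u = g w"
  shows "u = w"
proof (rule ccontr)
  assume "u \<noteq> w"
  then have "u - w \<noteq> 0" by simp
  from exists_functional[OF vector_space_axioms this]
  obtain g where g: "Vector_Spaces.linear (scl V) (*) g" "g (u - w) \<noteq> 0" by blast
  interpret g: Vector_Spaces.linear "scl V" "(*)" g by (rule g)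
  have "lin_map V base g" by (rule lin_mapI) (auto simp: g.add g.scale)
  then show False using assms(3) g by (simp add: g.diff)
qed

end

lemma bilinear_maps_iff:
  "f \<in> bilinear_maps V W U \<longleftrightarrow>
     (\<forall>v\<in>carr V. lin_map W U (\<lambda>w. f v w)) \<and> (\<forall>w\<in>carr W. lin_map V U (\<lambda>v. f v w))"
  by (simp add: bilinear_maps_def)

lemma bilinear_mapsI:
  assumes "\<And>v. v \<in> carr V \<Longrightarrow> lin_map W U (\<lambda>w. f v w)" "\<And>w. w \<in> carr W \<Longrightarrow> lin_map V U (\<lambda>v. f v w)"
  shows "f \<in> bilinear_maps V W U"
  using assms by (simp add: bilinear_maps_iff)

lemma pure_in [simp]: "v \<in> carr V \<Longrightarrow> w \<in> carr W \<Longrightarrow> pure B v w \<in> carr (tensor_space B V W)"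
  for B :: "('a \<Rightarrow> 'b \<Rightarrow> 'k::field) set"
proof -
  interpret T: vector_space "\<lambda>(c::'k) (t::('a, 'b, 'k) tensor) \<beta>. c * t \<beta>"
    by (rule vector_space_tensor)
  show "v \<in> carr V \<Longrightarrow> w \<in> carr W \<Longrightarrow> ?thesis"
    by (auto simp: tensor_space_def intro!: T.span_base)
qed

text \<open>
  \<open>sm B V W t f\<close> sums \<open>f\<close> over one fixed decomposition of \<open>t\<close>. For admissible \<open>f\<close> it is \<^const>\<open>lift\<close>,
  but sums can be interchanged and rewritten under the summation without any linearity conditions.
\<close>

definition dec ::
  "('a \<Rightarrow> 'b \<Rightarrow> 'k::field) set \<Rightarrow> ('k, 'a, 'y) vspace_scheme \<Rightarrow> ('k, 'b, 'z) vspace_scheme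
    \<Rightarrow> ('a, 'b, 'k) tensor \<Rightarrow> ('a \<times> 'b) list" where
  "dec B V W t = (SOME xs. set xs \<subseteq> carr V \<times> carr W \<and>
     ((\<exists>ys. set ys \<subseteq> carr V \<times> carr W \<and> t = (\<Sum>(v, w)\<leftarrow>ys. pure B v w)) \<longrightarrow>
       t = (\<Sum>(v, w)\<leftarrow>xs. pure B v w)))"

definition sm ::
  "('a \<Rightarrow> 'b \<Rightarrow> 'k::field) set \<Rightarrow> ('k, 'a, 'y) vspace_scheme \<Rightarrow> ('k, 'b, 'z) vspace_scheme
    \<Rightarrow> ('a, 'b, 'k) tensor \<Rightarrow> ('a \<Rightarrow> 'b \<Rightarrow> 'c::ab_group_add) \<Rightarrow> 'c" where
  "sm B V W t f = (\<Sum>(v, w)\<leftarrow>dec B V W t. f v w)"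

abbreviation ts ::
  "('k::field, 'a::ab_group_add, 'y) vspace_scheme \<Rightarrow> ('k, 'b::ab_group_add, 'z) vspace_scheme
    \<Rightarrow> ('a, 'b, 'k) tensor \<Rightarrow> ('a \<Rightarrow> 'b \<Rightarrow> 'c::ab_group_add) \<Rightarrow> 'c" where
  "ts V W \<equiv> sm (bilinear_forms V W) V W"

text \<open>The implication keeps the entries of \<open>dec\<close> in the carriers even when
  \<open>t\<close> is not a sum of pure tensors, with the empty list as witness. So
  \<open>dec_mem\<close> and \<open>sm_cong\<close> hold for arbitrary \<open>t\<close>.\<close>

lemma dec:
  "set (dec B V W t) \<subseteq> carr V \<times> carr W \<and>
     ((\<exists>ys. set ys \<subseteq> carr V \<times> carr W \<and> t = (\<Sum>(v, w)\<leftarrow>ys. pure B v w)) \<longrightarrow>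
       t = (\<Sum>(v, w)\<leftarrow>dec B V W t. pure B v w))"
  unfolding dec_def
proof (rule someI_ex)
  show "\<exists>xs. set xs \<subseteq> carr V \<times> carr W \<and>
     ((\<exists>ys. set ys \<subseteq> carr V \<times> carr W \<and> t = (\<Sum>(v, w)\<leftarrow>ys. pure B v w)) \<longrightarrow>
       t = (\<Sum>(v, w)\<leftarrow>xs. pure B v w))"
  proof (cases "\<exists>ys. set ys \<subseteq> carr V \<times> carr W \<and> t = (\<Sum>(v, w)\<leftarrow>ys. pure B v w)")
    case False
    then show ?thesis by (intro exI[of _ "[]"]) (simp only: list.set empty_subsetI simp_thms)
  qed blast
qed

lemma dec_mem: "(v, w) \<in> set (dec B V W t) \<Longrightarrow> v \<in> carr V \<and> w \<in> carr W"
  using dec[of B V W t] by auto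

lemma dec_sum:
  assumes "is_vspace V" "B \<subseteq> bilinear_forms V W" "t \<in> carr (tensor_space B V W)"
  shows "t = sm B V W t (\<lambda>v w. pure B v w)"
proof -
  obtain xs where "set xs \<subseteq> carr V \<times> carr W" "t = (\<Sum>(v, w)\<leftarrow>xs. pure B v w)"
    by (rule tensor_space_decomp[OF assms])
  then show ?thesis using dec[of B V W t] unfolding sm_def by blast
qed

text \<open>As a congruence rule this tells the simplifier, under the summation, that the summation
  variables lie in the carriers; the closure conditions of most rewrite rules are discharged in this
  way.\<close>

lemma sm_cong [cong]:
  assumes "B = B'" "V = V'" "W = W'" "t = t'"
    "\<And>v w. v \<in> carr V' \<Longrightarrow> w \<in> carr W' \<Longrightarrow> f v w = g v w"
  shows "sm B V W t f = sm B' V' W' t' g"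
  unfolding sm_def assms(1-4)
  by (rule arg_cong[of _ _ sum_list], rule map_cong) (auto dest: dec_mem assms(5))

lemma sm_swap:
  "sm B V W t (\<lambda>x y. sm B' V' W' s (\<lambda>v w. f x y v w))
    = sm B' V' W' s (\<lambda>v w. sm B V W t (\<lambda>x y. f x y v w))"
proof -
  have "(\<Sum>(x, y)\<leftarrow>xs. \<Sum>(v, w)\<leftarrow>ys. f x y v w) = (\<Sum>(v, w)\<leftarrow>ys. \<Sum>(x, y)\<leftarrow>xs. f x y v w)" for xs ys
    by (induction xs) (auto simp: split_def sum_list_addf)
  then show ?thesis by (simp add: sm_def)
qed

lemma sm_add: "sm B V W t (\<lambda>v w. f v w + g v w) = sm B V W t f + sm B V W t g"
  unfolding sm_def split_def by (rule sum_list_addf)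

lemma sm_mult_left: "sm B V W t (\<lambda>v w. c * f v w) = c * sm B V W t (f :: _ \<Rightarrow> _ \<Rightarrow> 'r::ring)"
  unfolding sm_def split_def by (rule sum_list_const_mult)

lemma sm_apply: "sm B V W t f x = sm B V W t (\<lambda>v w. f v w x)"
  unfolding sm_def by (rule sum_list_fun_apply)

lemma sm_closed: 
  "is_vspace U \<Longrightarrow> (\<And>v w. v \<in> carr V \<Longrightarrow> w \<in> carr W \<Longrightarrow> f v w \<in> carr U) \<Longrightarrow> sm B V W t f \<in> carr U"
  unfolding sm_def by (rule sum_list_closed) (auto dest: dec_mem)

lemma sm_hom:
  assumes "lin_map U X g" "is_vspace U" "\<And>v w. v \<in> carr V \<Longrightarrow> w \<in> carr W \<Longrightarrow> f v w \<in> carr U"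
  shows "g (sm B V W t f) = sm B V W t (\<lambda>v w. g (f v w))"
  unfolding sm_def using lin_map_sum_list[OF assms(2,1), of "dec B V W t" "\<lambda>(v, w). f v w"] assms(3)
  by (force simp: split_def dest: dec_mem)

text \<open>The maps which factor through the tensor product belonging to \<open>B\<close>.\<close>

definition adm ::
  "('a \<Rightarrow> 'b \<Rightarrow> 'k::field) set \<Rightarrow> ('k, 'a::ab_group_add, 'x) vspace_scheme
    \<Rightarrow> ('k, 'b::ab_group_add, 'y) vspace_scheme \<Rightarrow> ('k, 'c::ab_group_add, 'z) vspace_scheme
    \<Rightarrow> ('a \<Rightarrow> 'b \<Rightarrow> 'c) \<Rightarrow> bool" where
  "adm B V W U f \<longleftrightarrow> is_vspace V \<and> is_vspace U \<and> B \<subseteq> bilinear_forms V W \<and>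
     f \<in> bilinear_maps V W U \<and> (\<forall>g. Vector_Spaces.linear (scl U) (*) g \<longrightarrow> (\<lambda>v w. g (f v w)) \<in> B)"

lemma adm_bilinear:
  assumes "is_vspace V" "is_vspace U" "f \<in> bilinear_maps V W U"
  shows "adm (bilinear_forms V W) V W U f"
  using assms bilinear_compose[OF assms(3)] by (auto simp: adm_def)

lemma adm_balanced:
  assumes "is_vspace M" "is_vspace U" "f \<in> balanced_maps M N U"
  shows "adm (balanced_forms M N) M N U f"
  using assms bilinear_compose[of f M N U] by (auto simp: adm_def balanced_maps_def)

lemma adm_lift:
  assumes "adm B V W U f"
  shows "\<exists>F. lin_map (tensor_space B V W) U F \<and> (\<forall>v\<in>carr V. \<forall>w\<in>carr W. F (pure B v w) = f v w)"
    "set xs \<subseteq> carr V \<times> carr W \<Longrightarrow> lift B V W f (\<Sum>(v, w)\<leftarrow>xs. pure B v w) = (\<Sum>(v, w)\<leftarrow>xs. f v w)"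
proof -
  have a: "is_vspace V" "is_vspace U" "B \<subseteq> bilinear_forms V W" "f \<in> bilinear_maps V W U"
    "\<And>g. Vector_Spaces.linear (scl U) (*) g \<Longrightarrow> (\<lambda>v w. g (f v w)) \<in> B"
    using assms by (auto simp: adm_def)
  show "\<exists>F. lin_map (tensor_space B V W) U F \<and> (\<forall>v\<in>carr V. \<forall>w\<in>carr W. F (pure B v w) = f v w)"
    using tensor_space_universal[OF a] by (auto simp: hom_space_def)
  show "set xs \<subseteq> carr V \<times> carr W \<Longrightarrow> lift B V W f (\<Sum>(v, w)\<leftarrow>xs. pure B v w) = (\<Sum>(v, w)\<leftarrow>xs. f v w)"
    by (rule lift_sum[of "scl U"]) (use a in \<open>auto simp: is_vspace_def\<close>)
qed

lemma lift_eq_sm: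
  assumes "adm B V W U f" "t \<in> carr (tensor_space B V W)"
  shows "lift B V W f t = sm B V W t f"
proof -
  have "t = (\<Sum>(v, w)\<leftarrow>dec B V W t. pure B v w)"
    using dec_sum[OF _ _ assms(2)] assms(1) by (simp add: adm_def sm_def)
  then have "lift B V W f t = lift B V W f (\<Sum>(v, w)\<leftarrow>dec B V W t. pure B v w)" by simp
  also have "\<dots> = (\<Sum>(v, w)\<leftarrow>dec B V W t. f v w)"
    by (rule adm_lift(2)[OF assms(1)]) (auto dest: dec_mem)
  finally show ?thesis by (simp add: sm_def)
qed

text \<open>The decompositions \<open>dec\<close> of different tensors are unrelated, so additivity
  in \<open>t\<close> cannot be read off them. It comes from the universal property, whose linear
  map takes the same values.\<close>

lemma lin_sm_arg:
  assumes "adm B V W U f"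
  shows "lin_map (tensor_space B V W) U (\<lambda>t. sm B V W t f)"
proof -
  obtain F where F: "lin_map (tensor_space B V W) U F" "\<forall>v\<in>carr V. \<forall>w\<in>carr W. F (pure B v w) = f v w"
    using adm_lift(1)[OF assms] by auto
  have "F t = sm B V W t f" if "t \<in> carr (tensor_space B V W)" for t
  proof -
    have "F t = F (sm B V W t (\<lambda>v w. pure B v w))"
      using dec_sum[OF _ _ that] assms by (simp add: adm_def)
    also have "\<dots> = sm B V W t (\<lambda>v w. F (pure B v w))"
      by (rule sm_hom[OF F(1)]) auto
    also have "\<dots> = sm B V W t f" using F(2) by simp
    finally show ?thesis .
  qed
  then show ?thesis using F(1) by (subst lin_map_cong[where g = F]) auto
qed

lemma sm_pure:
  assumes "adm B V W U f" "v \<in> carr V" "w \<in> carr W"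
  shows "sm B V W (pure B v w) f = f v w"
  using adm_lift(2)[OF assms(1), of "[(v, w)]"] lift_eq_sm[OF assms(1), of "pure B v w"] assms(2,3)
  by simp

text \<open>Substitutes one Sweedler sum into another. It rests on linearity in the tensor argument,
  so \<open>f\<close> has to be admissible while \<open>F\<close> need only take values in the
  tensor product.\<close>

lemma sm_sm:
  assumes "adm B V W U f" "\<And>x y. x \<in> carr X \<Longrightarrow> y \<in> carr Y \<Longrightarrow> F x y \<in> carr (tensor_space B V W)"
  shows "sm B V W (sm B' X Y s F) f = sm B' X Y s (\<lambda>x y. sm B V W (F x y) f)"
  by (rule sm_hom[OF lin_sm_arg[OF assms(1)] is_vspace_tensor_space assms(2)])

lemma adm_base: "adm B V W base f \<Longrightarrow> f \<in> B"
proof -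
  assume f: "adm B V W base f"
  have "Vector_Spaces.linear (*) (*) (\<lambda>x::'c::field. x)"
    by unfold_locales (auto simp: algebra_simps)
  with f show ?thesis by (auto simp: adm_def)
qed

lemma tensor_apply:
  assumes "adm B V W base f" "t \<in> carr (tensor_space B V W)"
  shows "t f = sm B V W t f"
proof -
  have "t f = sm B V W t (\<lambda>v w. pure B v w) f"
    using dec_sum[OF _ _ assms(2)] assms(1) by (simp add: adm_def)
  also have "\<dots> = sm B V W t f"
    unfolding sm_apply using adm_base[OF assms(1)] by (simp add: pure_def)
  finally show ?thesis .
qed

lemma tensor_outside:
  assumes "is_vspace V" "B \<subseteq> bilinear_forms V W" "t \<in> carr (tensor_space B V W)" "f \<notin> B"
  shows "t f = 0"
proof -
  have "t f = sm B V W t (\<lambda>v w. pure B v w) f"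
    using dec_sum[OF assms(1-3)] by simp
  also have "\<dots> = 0" unfolding sm_apply using assms(4) by (simp add: pure_def sm_def split_def)
  finally show ?thesis .
qed

text \<open>A tensor vanishes off \<open>B\<close>, and at a form in \<open>B\<close> its value is
  the Sweedler sum of that form, so these sums determine it as a function.\<close>

lemma tensor_ext:
  assumes "is_vspace V" "B \<subseteq> bilinear_forms V W" "\<And>\<beta>. \<beta> \<in> B \<Longrightarrow> adm B V W base \<beta>"
    and "t \<in> carr (tensor_space B V W)" "t' \<in> carr (tensor_space B V W)"
    and "\<And>\<beta>. \<beta> \<in> B \<Longrightarrow> sm B V W t \<beta> = sm B V W t' \<beta>"
  shows "t = t'"
proof
  fix \<beta> show "t \<beta> = t' \<beta>"
  proof (cases "\<beta> \<in> B")
    case True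
    then show ?thesis using tensor_apply[OF assms(3,4)] tensor_apply[OF assms(3,5)] assms(6) by simp
  next
    case False
    then show ?thesis using tensor_outside[OF assms(1,2,4)] tensor_outside[OF assms(1,2,5)] by simp
  qed
qed

lemma tensor_eqI:
  assumes "is_vspace V" "t \<in> carr (tensor V W)" "t' \<in> carr (tensor V W)"
    and "\<And>\<beta>. (\<And>v. v \<in> carr V \<Longrightarrow> lin_map W base (\<lambda>w. \<beta> v w)) \<Longrightarrow>
      (\<And>w. w \<in> carr W \<Longrightarrow> lin_map V base (\<lambda>v. \<beta> v w)) \<Longrightarrow>
      ts V W t \<beta> = ts V W t' \<beta>"
  shows "t = t'"
  by (rule tensor_ext[OF assms(1) subset_refl adm_bilinear[OF assms(1)] assms(2,3)])
    (use assms(4) in \<open>auto simp: bilinear_maps_iff\<close>)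

lemma tensor_lin_ext:
  assumes "is_vspace V" "B \<subseteq> bilinear_forms V W"
    "lin_map (tensor_space B V W) U F" "lin_map (tensor_space B V W) U G"
    "\<And>v w. v \<in> carr V \<Longrightarrow> w \<in> carr W \<Longrightarrow> F (pure B v w) = G (pure B v w)"
    "t \<in> carr (tensor_space B V W)"
  shows "F t = G t"
proof -
  have "F t = F (sm B V W t (\<lambda>v w. pure B v w))" using dec_sum[OF assms(1,2,6)] by simp
  also have "\<dots> = sm B V W t (\<lambda>v w. F (pure B v w))" by (rule sm_hom[OF assms(3)]) auto
  also have "\<dots> = sm B V W t (\<lambda>v w. G (pure B v w))" using assms(5) by simp
  also have "\<dots> = G (sm B V W t (\<lambda>v w. pure B v w))" by (rule sm_hom[OF assms(4), symmetric]) auto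
  also have "\<dots> = G t" using dec_sum[OF assms(1,2,6)] by simp
  finally show ?thesis .
qed

lemma lin_compose: "lin_map W U g \<Longrightarrow> lin_map V W f \<Longrightarrow> lin_map V U (\<lambda>v. g (f v))"
  by (auto simp: lin_map_def)

section \<open>Linearity of Sweedler sums in their parameters\<close>

named_theorems lin

lemma lin_id [lin]: "lin_map V V (\<lambda>v. v)"
  by (simp add: lin_map_def)

lemma lin_mult_base [lin]:
  "lin_map V base f \<Longrightarrow> lin_map V base (\<lambda>v. f v * c)"
  "lin_map V base f \<Longrightarrow> lin_map V base (\<lambda>v. c * f v)"
  by (auto simp: lin_map_def algebra_simps)

lemma lin_scl [lin]:
  "is_vspace U \<Longrightarrow> lin_map V U f \<Longrightarrow> lin_map V U (\<lambda>v. scl U c (f v))"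
  "is_vspace U \<Longrightarrow> u \<in> carr U \<Longrightarrow> lin_map V base g \<Longrightarrow> lin_map V U (\<lambda>v. scl U (g v) u)"
  by (auto intro!: lin_mapI scale_closed simp: vspace_scale_simps lin_mapD mult.commute)

text \<open>Covers a variable in the summand, where no condition on the tensor arises. A variable in
  the tensor is the matter of \<open>lin_sm_tensor\<close>, which requires a bilinear
  summand.\<close>

lemma lin_sm_body [lin]:
  assumes "is_vspace U" "\<And>v w. v \<in> carr V \<Longrightarrow> w \<in> carr W \<Longrightarrow> lin_map X U (\<lambda>x. F x v w)"
  shows "lin_map X U (\<lambda>x. sm B V W t (F x))"
proof (rule lin_mapI)
  show "sm B V W t (F x) \<in> carr U" if "x \<in> carr X" for x
    by (rule sm_closed[OF assms(1)]) (use assms(2) that in \<open>auto dest: lin_mapD\<close>)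
  show "sm B V W t (F (x + y)) = sm B V W t (F x) + sm B V W t (F y)"
    if "x \<in> carr X" "y \<in> carr X" for x y
    unfolding sm_add[symmetric] by (rule sm_cong) (use lin_mapD(2)[OF assms(2)] that in auto)
  show "sm B V W t (F (scl X c x)) = scl U c (sm B V W t (F x))" if "x \<in> carr X" for c x
  proof -
    have "sm B V W t (F (scl X c x)) = sm B V W t (\<lambda>v w. scl U c (F x v w))"
      by (rule sm_cong) (use lin_mapD(3)[OF assms(2)] that in auto)
    also have "\<dots> = scl U c (sm B V W t (F x))"
      by (rule sm_hom[symmetric, OF lin_scl(1)[OF assms(1) lin_id]])
        (use assms lin_mapD(1)[OF assms(2)] that in auto)
    finally show ?thesis .
  qed
qed

lemma lin_pure [lin]:
  fixes B :: "('a::ab_group_add \<Rightarrow> 'b::ab_group_add \<Rightarrow> 'k::field) set"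
  shows
  "B \<subseteq> bilinear_forms V W \<Longrightarrow> lin_map X V f \<Longrightarrow> w \<in> carr W \<Longrightarrow>
    lin_map X (tensor_space B V W) (\<lambda>x. pure B (f x) w)"
  "B \<subseteq> bilinear_forms V W \<Longrightarrow> lin_map X W g \<Longrightarrow> v \<in> carr V \<Longrightarrow>
    lin_map X (tensor_space B V W) (\<lambda>x. pure B v (g x))"
proof -
  assume B: "B \<subseteq> bilinear_forms V W"
  have b: "\<beta> \<in> B \<Longrightarrow> v \<in> carr V \<Longrightarrow> lin_map W base (\<lambda>w. \<beta> v w)"
    "\<beta> \<in> B \<Longrightarrow> w \<in> carr W \<Longrightarrow> lin_map V base (\<lambda>v. \<beta> v w)" for \<beta> v w
    using B by (auto simp: bilinear_maps_iff)
  show "lin_map X V f \<Longrightarrow> w \<in> carr W \<Longrightarrow> lin_map X (tensor_space B V W) (\<lambda>x. pure B (f x) w)"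
    by (rule lin_mapI)
      (auto simp: pure_def fun_eq_iff lin_mapD(1) intro!: pure_in[unfolded pure_def],
        auto simp: lin_mapD lin_mapD(2,3)[OF b(2)])
  show "lin_map X W g \<Longrightarrow> v \<in> carr V \<Longrightarrow> lin_map X (tensor_space B V W) (\<lambda>x. pure B v (g x))"
    by (rule lin_mapI)
      (auto simp: pure_def fun_eq_iff lin_mapD(1) intro!: pure_in[unfolded pure_def],
        auto simp: lin_mapD lin_mapD(2,3)[OF b(1)])
qed

lemma lin_sm_tensor [lin]:
  assumes "is_vspace V" "is_vspace U" "lin_map X (tensor V W) T"
    "\<And>v. v \<in> carr V \<Longrightarrow> lin_map W U (\<lambda>w. f v w)" "\<And>w. w \<in> carr W \<Longrightarrow> lin_map V U (\<lambda>v. f v w)"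
  shows "lin_map X U (\<lambda>x. ts V W (T x) f)"
  by (rule lin_compose[OF lin_sm_arg[OF adm_bilinear] assms(3)])
    (use assms in \<open>auto simp: bilinear_maps_iff\<close>)

subsection \<open>Contractions\<close>

text \<open>Writing the right factors in a basis of \<open>W\<close> collects the left factors into
  contractions of \<open>t\<close> with the coordinate functionals. Since the coefficients are
  contractions, \<open>t\<close> can be rebuilt over any smaller space that contains them.\<close>

lemma tensor_expand:
  fixes V :: "('k::field, 'a::ab_group_add, 'y) vspace_scheme"
    and W :: "('k, 'b::ab_group_add, 'z) vspace_scheme"
  assumes V: "is_vspace V" and W: "is_vspace W" and t: "t \<in> carr (tensor V W)"
  obtains es g where "set es \<subseteq> carr W" "\<And>e. lin_map W base (g e)"
    "t = (\<Sum>e\<leftarrow>es. pure (bilinear_forms V W) (ts V W t (\<lambda>v w. scl V (g e w) v)) e)"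
proof -
  interpret W: vector_space "scl W" using W by (simp add: is_vspace_def)
  let ?B = "bilinear_forms V W"
  obtain Bs where Bs: "Bs \<subseteq> carr W" "W.independent Bs" "carr W \<subseteq> W.span Bs"
    using W.basis_exists[of "carr W"] by metis
  let ?R = "\<lambda>e w. W.representation Bs w e"
  have g: "lin_map W base (?R e)" for e
  proof (rule lin_mapI)
    fix v v' c assume v: "v \<in> carr W"
    then show "?R e (scl W c v) = scl base c (?R e v)"
      using Bs(3) W.representation_scale[OF Bs(2), of v c] by auto
    assume "v' \<in> carr W"
    with v have "v \<in> W.span Bs" "v' \<in> W.span Bs" using Bs(3) by auto
    from W.representation_add[OF Bs(2) this(2,1)]
    show "?R e (v + v') = ?R e v + ?R e v'" by (simp add: add.commute)
  qed simp
  \<comment> \<open>Finitely many right factors occur in the chosen decomposition of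
    \<open>t\<close>, and each has finite support in the basis, so their coordinates involve only a
    finite set of basis vectors.\<close>
  define E where "E = (\<Union>(v, w)\<in>set (dec ?B V W t). {e. ?R e w \<noteq> 0})"
  have E: "finite E" unfolding E_def
    by (auto simp: split_def W.finite_representation)
  have EB: "E \<subseteq> Bs" unfolding E_def using W.representation_ne_zero by (auto simp: split_def)
  obtain es where es: "set es = E" "distinct es" using finite_distinct_list[OF E] by blast
  have main: "sm ?B V W t \<beta> = sm ?B V W (\<Sum>e\<leftarrow>es. pure ?B (sm ?B V W t (\<lambda>v w. scl V (?R e w) v)) e) \<beta>"
    if \<beta>: "\<And>v. v \<in> carr V \<Longrightarrow> lin_map W base (\<lambda>w. \<beta> v w)" "\<And>w. w \<in> carr W \<Longrightarrow> lin_map V base (\<lambda>v. \<beta> v w)"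
    for \<beta>
  proof -
    have ad: "adm ?B V W base \<beta>" by (rule adm_bilinear) (use V \<beta> in \<open>auto simp: bilinear_maps_iff\<close>)
    have cl: "sm ?B V W t (\<lambda>v w. scl V (?R e w) v) \<in> carr V" for e
      by (rule sm_closed[OF V]) (simp add: scale_closed V)
    have esW: "e \<in> carr W" if "e \<in> set es" for e using that es EB Bs by auto
    have "sm ?B V W (\<Sum>e\<leftarrow>es. pure ?B (sm ?B V W t (\<lambda>v w. scl V (?R e w) v)) e) \<beta>
        = (\<Sum>e\<leftarrow>es. \<beta> (sm ?B V W t (\<lambda>v w. scl V (?R e w) v)) e)"
      by (subst lin_map_sum_list[OF _ lin_sm_arg[OF ad]])
        (auto simp: cl esW sm_pure[OF ad] intro!: arg_cong[of _ _ sum_list])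
    also have "\<dots> = (\<Sum>e\<leftarrow>es. sm ?B V W t (\<lambda>v w. ?R e w * \<beta> v e))"
    proof (rule arg_cong[of _ _ sum_list], rule map_cong[OF refl])
      fix e assume "e \<in> set es"
      then have e: "e \<in> carr W" by (rule esW)
      show "\<beta> (sm ?B V W t (\<lambda>v w. scl V (?R e w) v)) e = sm ?B V W t (\<lambda>v w. ?R e w * \<beta> v e)"
        by (subst sm_hom[OF \<beta>(2)[OF e] V])
          (auto simp: scale_closed V lin_mapD(3)[OF \<beta>(2)[OF e]] intro!: sm_cong)
    qed
    also have "\<dots> = (\<Sum>(v, w)\<leftarrow>dec ?B V W t. \<Sum>e\<leftarrow>es. ?R e w * \<beta> v e)"
    proof -
      have "(\<Sum>e\<leftarrow>es. \<Sum>(v, w)\<leftarrow>xs. ?R e w * \<beta> v e) = (\<Sum>(v, w)\<leftarrow>xs. \<Sum>e\<leftarrow>es. ?R e w * \<beta> v e)" for xs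
        by (induction xs) (auto simp: split_def sum_list_addf)
      then show ?thesis by (simp add: sm_def)
    qed
    also have "\<dots> = sm ?B V W t \<beta>" unfolding sm_def
    proof (rule arg_cong[of _ _ sum_list], rule map_cong[OF refl], clarify)
      fix v w assume vw: "(v, w) \<in> set (dec ?B V W t)"
      then have m: "v \<in> carr V" "w \<in> carr W" by (auto dest: dec_mem)
      have sub: "{e. ?R e w \<noteq> 0} \<subseteq> set es" using vw unfolding es(1) E_def by auto
      have mem: "scl W (?R e w) e \<in> carr W" if "e \<in> set es" for e
        by (rule scale_closed[OF W esW[OF that]])
      have "(\<Sum>e\<leftarrow>es. ?R e w * \<beta> v e) = (\<Sum>e\<leftarrow>es. \<beta> v (scl W (?R e w) e))"
        by (rule arg_cong[of _ _ sum_list], rule map_cong[OF refl])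
          (simp add: lin_mapD(3)[OF \<beta>(1)[OF m(1)]] esW)
      also have "\<dots> = \<beta> v (\<Sum>e\<leftarrow>es. scl W (?R e w) e)"
        by (rule lin_map_sum_list[OF W \<beta>(1)[OF m(1)], symmetric]) (rule mem)
      also have "(\<Sum>e\<leftarrow>es. scl W (?R e w) e) = (\<Sum>e\<in>set es. scl W (?R e w) e)"
        using es(2) by (rule sum_list_distinct_conv_sum_set)
      also have "\<dots> = (\<Sum>e\<in>{e. ?R e w \<noteq> 0}. scl W (?R e w) e)"
        by (rule sum.mono_neutral_right) (use sub in auto)
      also have "\<dots> = w" using W.sum_nonzero_representation_eq[OF Bs(2)] m(2) Bs(3) by auto
      finally show "(\<Sum>e\<leftarrow>es. ?R e w * \<beta> v e) = \<beta> v w" .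
    qed
    finally show ?thesis by simp
  qed
  have "(\<Sum>e\<leftarrow>es. pure ?B (sm ?B V W t (\<lambda>v w. scl V (?R e w) v)) e) \<in> carr (tensor V W)"
    by (rule sum_list_closed)
      (use es EB Bs V in \<open>auto intro!: pure_in sm_closed scale_closed\<close>)
  from tensor_eqI[OF V t this main]
  have "t = (\<Sum>e\<leftarrow>es. pure ?B (sm ?B V W t (\<lambda>v w. scl V (?R e w) v)) e)" .
  then show ?thesis using that[of es ?R] g es EB Bs by auto
qed

text \<open>If all contractions of \<open>t - t'\<close> vanish, so do the coefficients of its
  expansion. In contrast to \<open>tensor_eqI\<close> only functionals on the second factor are used
  and the results stay vectors of \<open>V\<close>, which suits a space of maps or a further tensor
  product in the place of \<open>V\<close>.\<close>

lemma tensor_eq_contract: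
  assumes V: "is_vspace V" and W: "is_vspace W"
    and t: "t \<in> carr (tensor V W)" "t' \<in> carr (tensor V W)"
    and eq: "\<And>g. lin_map W base g \<Longrightarrow> ts V W t (\<lambda>v w. scl V (g w) v)
      = ts V W t' (\<lambda>v w. scl V (g w) v)"
  shows "t = t'"
proof -
  let ?B = "bilinear_forms V W"
  have d: "t - t' \<in> carr (tensor V W)" using t by (simp add: diff_closed)
  have z: "sm ?B V W (t - t') (\<lambda>v w. scl V (g w) v) = 0" if "lin_map W base g" for g
  proof -
    have "adm ?B V W V (\<lambda>v w. scl V (g w) v)"
      by (rule adm_bilinear) (use V that in \<open>auto simp: bilinear_maps_iff intro!: lin\<close>)
    from lin_map_diff[OF is_vspace_tensor_space lin_sm_arg[OF this] t] show ?thesis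
      using eq[OF that] by simp
  qed
  obtain es g where "set es \<subseteq> carr W" "\<And>e. lin_map W base (g e)"
    and e: "t - t' = (\<Sum>e\<leftarrow>es. pure ?B (sm ?B V W (t - t') (\<lambda>v w. scl V (g e w) v)) e)"
    by (rule tensor_expand[OF V W d]) blast
  then have "t - t' = (\<Sum>e\<leftarrow>es. pure ?B 0 e)" using z by simp
  also have "\<dots> = 0"
    using \<open>set es \<subseteq> carr W\<close>
  proof (induction es)
    case (Cons a es)
    have "pure ?B 0 a = 0" using Cons.prems V
      by (auto simp: pure_def fun_eq_iff bilinear_maps_iff intro!: lin_map_zero)
    then show ?case using Cons by simp
  qed simp
  finally show ?thesis by simp
qed

subsection \<open>Exchanging the tensor factors\<close>

text \<open>As tensors are functionals on forms, exchanging the factors amounts to transposing the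
  form. In this form the exchange is an involution on the whole type, with no carriers
  involved.\<close>

definition flip :: "('a, 'b, 'k) tensor \<Rightarrow> ('b, 'a, 'k) tensor" where
  "flip t = (\<lambda>\<beta>. t (\<lambda>x y. \<beta> y x))"

lemma flip_flip [simp]: "flip (flip t) = t"
  by (simp add: flip_def)

lemma flip_add: "flip (t + t') = flip t + flip t'" and flip_zero: "flip 0 = 0"
  by (simp_all add: flip_def fun_eq_iff)

lemma flip_pure: "flip (pure (bilinear_forms V W) v w) = pure (bilinear_forms W V) w v"
  by (auto simp: flip_def pure_def fun_eq_iff bilinear_maps_iff)

lemma flip_sum:
  "flip (\<Sum>(v, w)\<leftarrow>xs. pure (bilinear_forms V W) v w)
    = (\<Sum>(w, v)\<leftarrow>map (\<lambda>(v, w). (w, v)) xs. pure (bilinear_forms W V) w v)"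
proof (induction xs)
  case Nil
  show ?case by (simp only: list.map sum_list.Nil flip_zero)
next
  case (Cons x xs)
  then show ?case
    by (cases x) (simp only: list.map sum_list.Cons prod.case flip_add flip_pure)
qed

lemma flip_in:
  assumes "is_vspace V" "t \<in> carr (tensor V W)"
  shows "flip t \<in> carr (tensor W V)"
proof -
  obtain xs where xs: "set xs \<subseteq> carr V \<times> carr W" "t = (\<Sum>(v, w)\<leftarrow>xs. pure (bilinear_forms V W) v w)"
    by (rule tensor_space_decomp[OF assms(1) subset_refl assms(2)])
  show ?thesis unfolding xs(2) flip_sum by (rule sum_list_closed) (use xs(1) in auto)
qed

lemma flip_lin [lin]:
  "is_vspace V \<Longrightarrow> lin_map X (tensor V W) T \<Longrightarrow> lin_map X (tensor W V) (\<lambda>x. flip (T x))"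
  by (rule lin_mapI) (simp_all add: flip_in lin_mapD flip_add, simp add: flip_def)

lemma sm_flip:
  assumes "is_vspace V" "is_vspace W" "is_vspace U" "t \<in> carr (tensor V W)"
    "\<And>v. v \<in> carr V \<Longrightarrow> lin_map W U (\<lambda>w. f w v)" "\<And>w. w \<in> carr W \<Longrightarrow> lin_map V U (\<lambda>v. f w v)"
  shows "ts W V (flip t) f = ts V W t (\<lambda>v w. f w v)"
proof (rule tensor_lin_ext[OF assms(1) subset_refl _ _ _ assms(4), where U = U])
  have a: "adm (bilinear_forms W V) W V U f"
    by (rule adm_bilinear) (use assms in \<open>auto simp: bilinear_maps_iff\<close>)
  have b: "adm (bilinear_forms V W) V W U (\<lambda>v w. f w v)"
    by (rule adm_bilinear) (use assms in \<open>auto simp: bilinear_maps_iff\<close>)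
  show "lin_map (tensor V W) U (\<lambda>t. ts W V (flip t) f)"
    by (rule lin_compose[OF lin_sm_arg[OF a]]) (intro lin assms)
  show "lin_map (tensor V W) U (\<lambda>t. ts V W t (\<lambda>v w. f w v))"
    by (rule lin_sm_arg[OF b])
  show "ts W V (flip (pure (bilinear_forms V W) v w)) f
      = ts V W (pure (bilinear_forms V W) v w) (\<lambda>v w. f w v)"
    if "v \<in> carr V" "w \<in> carr W" for v w
    unfolding flip_pure using that by (simp add: sm_pure[OF a] sm_pure[OF b])
qed

section \<open>Hopf algebras\<close>

lemma lift_cong [cong]:
  assumes "B = B'" "V = V'" "W = W'" "t = t'"
    "\<And>v w. v \<in> carr V' \<Longrightarrow> w \<in> carr W' \<Longrightarrow> f v w = g v w"
  shows "lift B V W f t = lift B' V' W' g t'"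
proof -
  have "(\<Sum>(v, w)\<leftarrow>xs. f v w) = (\<Sum>(v, w)\<leftarrow>xs. g v w)" if "set xs \<subseteq> carr V' \<times> carr W'" for xs
    by (rule arg_cong[of _ _ sum_list], rule map_cong) (use that assms(5) in auto)
  then show ?thesis unfolding lift_def assms(1-4) by (intro arg_cong[of _ _ The]) (auto simp: fun_eq_iff)
qed

text \<open>The bridge from the definitions, written with \<open>sw\<close>, to sums over a fixed
  decomposition. Well-definedness of a Sweedler expression is paid for here, once for every
  summation sign.\<close>

lemma sw_eq_sm:
  assumes "is_vspace V" "is_vspace U" "t \<in> carr (tensor V W)"
    "\<And>v. v \<in> carr V \<Longrightarrow> lin_map W U (\<lambda>w. f v w)" "\<And>w. w \<in> carr W \<Longrightarrow> lin_map V U (\<lambda>v. f v w)"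
  shows "sw V W t f = ts V W t f"
  by (rule lift_eq_sm[OF adm_bilinear]) (use assms in \<open>auto simp: bilinear_maps_iff\<close>)

lemma sm_tens:
  assumes "is_vspace V" "is_vspace U" "v \<in> carr V" "w \<in> carr W"
    "\<And>v. v \<in> carr V \<Longrightarrow> lin_map W U (\<lambda>w. f v w)" "\<And>w. w \<in> carr W \<Longrightarrow> lin_map V U (\<lambda>v. f v w)"
  shows "ts V W (v \<otimes>\<^bsub>V,W\<^esub> w) f = f v w"
  by (rule sm_pure[OF adm_bilinear]) (use assms in \<open>auto simp: bilinear_maps_iff\<close>)

lemma sm_sm_tensor:
  assumes "is_vspace V" "is_vspace U" 
    "\<And>x y. x \<in> carr X \<Longrightarrow> y \<in> carr Y \<Longrightarrow> F x y \<in> carr (tensor V W)"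
    "\<And>v. v \<in> carr V \<Longrightarrow> lin_map W U (\<lambda>w. f v w)" "\<And>w. w \<in> carr W \<Longrightarrow> lin_map V U (\<lambda>v. f v w)"
  shows "ts V W (sm B' X Y s F) f
    = sm B' X Y s (\<lambda>x y. ts V W (F x y) f)"
  by (rule sm_sm[OF adm_bilinear]) (use assms in \<open>auto simp: bilinear_maps_iff\<close>)

lemmas sw_sm_base = sm_tens[where U = base] sm_sm_tensor[where U = base]

section \<open>Multilinear forms as test functions\<close>

definition bilin ::
  "('k::field, 'a::ab_group_add, 'x) vspace_scheme \<Rightarrow> ('k, 'b::ab_group_add, 'y) vspace_scheme
    \<Rightarrow> ('a \<Rightarrow> 'b \<Rightarrow> 'k) \<Rightarrow> bool" where
  "bilin V W f \<longleftrightarrow> (\<forall>v\<in>carr V. lin_map W base (\<lambda>w. f v w)) \<and> (\<forall>w\<in>carr W. lin_map V base (\<lambda>v. f v w))"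

definition trilin ::
  "('k::field, 'a::ab_group_add, 'x) vspace_scheme \<Rightarrow> ('k, 'b::ab_group_add, 'y) vspace_scheme
    \<Rightarrow> ('k, 'c::ab_group_add, 'z) vspace_scheme \<Rightarrow> ('a \<Rightarrow> 'b \<Rightarrow> 'c \<Rightarrow> 'k) \<Rightarrow> bool" where
  "trilin V W X f \<longleftrightarrow> (\<forall>v\<in>carr V. \<forall>w\<in>carr W. lin_map X base (\<lambda>x. f v w x)) \<and>
     (\<forall>v\<in>carr V. \<forall>x\<in>carr X. lin_map W base (\<lambda>w. f v w x)) \<and>
     (\<forall>w\<in>carr W. \<forall>x\<in>carr X. lin_map V base (\<lambda>v. f v w x))"

text \<open>A linear map is built into the free argument so that the conclusions chain with the
  other \<open>lin\<close> rules.\<close>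

lemma bilinD:
  assumes "bilin V W f"
  shows "v \<in> carr V \<Longrightarrow> lin_map X W T \<Longrightarrow> lin_map X base (\<lambda>x. f v (T x))"
    "w \<in> carr W \<Longrightarrow> lin_map X V T' \<Longrightarrow> lin_map X base (\<lambda>x. f (T' x) w)"
  using assms by (auto simp: bilin_def intro: lin_compose[of W base "f v"] lin_compose[of V base "\<lambda>v. f v w"])

lemma trilinD:
  assumes "trilin V W X f"
  shows "v \<in> carr V \<Longrightarrow> w \<in> carr W \<Longrightarrow> lin_map Y X T \<Longrightarrow> lin_map Y base (\<lambda>y. f v w (T y))"
    "v \<in> carr V \<Longrightarrow> x \<in> carr X \<Longrightarrow> lin_map Y W T' \<Longrightarrow> lin_map Y base (\<lambda>y. f v (T' y) x)"
    "w \<in> carr W \<Longrightarrow> x \<in> carr X \<Longrightarrow> lin_map Y V T'' \<Longrightarrow> lin_map Y base (\<lambda>y. f (T'' y) w x)"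
  using assms
  by (auto simp: trilin_def intro: lin_compose[of X base "f v w"] lin_compose[of W base "\<lambda>w. f v w x"]
     lin_compose[of V base "\<lambda>v. f v w x"])

lemma tensor_functional:
  assumes V: "is_vspace V" "lin_map (tensor V W) base \<beta>" "t \<in> carr (tensor V W)"
  shows "\<beta> t = ts V W t (\<lambda>x y. \<beta> (x \<otimes>\<^bsub>V,W\<^esub> y))"
  by (subst dec_sum[where V = V and W = W and t = t])
    (use V in \<open>auto simp: sm_hom[OF V(2) is_vspace_tensor_space]\<close>)

lemma tensor_iff:
  assumes "is_vspace V" "t \<in> carr (tensor V W)" "t' \<in> carr (tensor V W)"
  shows "t = t' \<longleftrightarrow> (\<forall>f. bilin V W f \<longrightarrow> ts V W t f = ts V W t' f)"
  using tensor_eqI[OF assms] by (auto simp: bilin_def)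

text \<open>A functional on \<open>W \<otimes> X\<close> is determined by its values on pure
  tensors, so trilinear forms separate the elements of a triple tensor product. The coassociativity
  axioms thereby become scalar identities.\<close>

lemma triple_tensor_iff:
  assumes V [simp]: "is_vspace V" and W [simp]: "is_vspace W" and X [simp]: "is_vspace X"
    and t: "t \<in> carr (tensor V (tensor W X))" "t' \<in> carr (tensor V (tensor W X))"
  shows "t = t' \<longleftrightarrow> (\<forall>f. trilin V W X f \<longrightarrow>
     ts V (tensor W X) t (\<lambda>v u. ts W X u (\<lambda>w x. f v w x)) = ts V (tensor W X) t' (\<lambda>v u. ts W X u (\<lambda>w x. f v w x)))"
proof (intro iffI)
  assume eq: "\<forall>f. trilin V W X f \<longrightarrow> ts V (tensor W X) t (\<lambda>v u. ts W X u (\<lambda>w x. f v w x))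
     = ts V (tensor W X) t' (\<lambda>v u. ts W X u (\<lambda>w x. f v w x))"
  show "t = t'"
  proof (rule tensor_eqI[OF V t])
    fix \<beta> assume b: "\<And>v. v \<in> carr V \<Longrightarrow> lin_map (tensor W X) base (\<lambda>w. \<beta> v w)"
      "\<And>w. w \<in> carr (tensor W X) \<Longrightarrow> lin_map V base (\<lambda>v. \<beta> v w)"
    note [lin] = lin_compose[OF b(1)] lin_compose[OF b(2)]
    \<comment> \<open>The trilinear form belonging to \<open>\<beta>\<close>: its second argument is
      restricted to pure tensors.\<close>
    have "trilin V W X (\<lambda>v w x. \<beta> v (w \<otimes>\<^bsub>W,X\<^esub> x))" by (simp add: trilin_def lin)
    moreover have "ts V (tensor W X) s \<beta> = ts V (tensor W X) s (\<lambda>v u. ts W X u (\<lambda>w x. \<beta> v (w \<otimes>\<^bsub>W,X\<^esub> x)))" for s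
      by (rule sm_cong[OF refl refl refl refl], rule tensor_functional) (auto intro: b)
    ultimately show "ts V (tensor W X) t \<beta> = ts V (tensor W X) t' \<beta>" using eq by simp
  qed
qed simp

abbreviation cs ::
  "('k::field, 'h::ring_1) hopf \<Rightarrow> 'h \<Rightarrow> ('h \<Rightarrow> 'h \<Rightarrow> 'c::ab_group_add) \<Rightarrow> 'c" where
  "cs H h f \<equiv> ts H H (comult H h) f"

text \<open>The axioms may be verified on forms alone. This serves to recognise the opposite
  coproduct as a Hopf algebra structure.\<close>

lemma hopf_algebraI:
  fixes H :: "('k::field, 'h::ring_1) hopf"
  assumes "is_vspace H" "carr H = UNIV"
    "\<And>c a b. scl H c a * b = scl H c (a * b)" "\<And>c a b. a * scl H c b = scl H c (a * b)"
    "lin_map H (tensor H H) (comult H)" "lin_map H base (counit H)" "lin_map H H (antipode H)"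
    and coassoc: "\<And>h f. (\<And>a b. lin_map H base (\<lambda>x. f a b x)) \<Longrightarrow> (\<And>a b. lin_map H base (\<lambda>x. f a x b)) \<Longrightarrow>
      (\<And>a b. lin_map H base (\<lambda>x. f x a b)) \<Longrightarrow>
      cs H h (\<lambda>a b. cs H a (\<lambda>x y. f x y b)) = cs H h (\<lambda>a b. cs H b (\<lambda>x y. f a x y))"
    and counit: "\<And>h g. lin_map H base g \<Longrightarrow> cs H h (\<lambda>a b. counit H a * g b) = g h"
      "\<And>h g. lin_map H base g \<Longrightarrow> cs H h (\<lambda>a b. counit H b * g a) = g h"
    and one: "comult H 1 = 1 \<otimes>\<^bsub>H,H\<^esub> 1"
    and mult: "\<And>a b f. (\<And>a. lin_map H base (\<lambda>x. f a x)) \<Longrightarrow> (\<And>a. lin_map H base (\<lambda>x. f x a)) \<Longrightarrow>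
      cs H (a * b) f = cs H a (\<lambda>a1 a2. cs H b (\<lambda>b1 b2. f (a1 * b1) (a2 * b2)))"
    and "counit H 1 = 1" "\<And>g h. counit H (g * h) = counit H g * counit H h"
    and antipode: "\<And>h g. lin_map H base g \<Longrightarrow> cs H h (\<lambda>a b. g (antipode H a * b)) = counit H h * g 1"
      "\<And>h g. lin_map H base g \<Longrightarrow> cs H h (\<lambda>a b. g (a * antipode H b)) = counit H h * g 1"
  shows "hopf_algebra H"
proof -
  note [simp] = assms(1,2)
  have lm [lin]: "lin_map V H f \<Longrightarrow> lin_map V H (\<lambda>v. f v * b)"
     "lin_map V H f \<Longrightarrow> lin_map V H (\<lambda>v. b * f v)" for V :: "('k,'v::ab_group_add,'z) vspace_scheme" and f b
    using assms(3,4) by (auto simp: lin_map_def algebra_simps)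
  note [lin] = lin_compose[OF assms(5)] lin_compose[OF assms(6)] lin_compose[OF assms(7)]
  have [simp]: "comult H h \<in> carr (tensor H H)" for h using lin_mapD(1)[OF assms(5)] by simp
  have c3: "cop H h (\<lambda>a b. cop H a (\<lambda>x y. x \<otimes>\<^bsub>H,tensor H H\<^esub> (y \<otimes>\<^bsub>H,H\<^esub> b)))
        = cop H h (\<lambda>a b. a \<otimes>\<^bsub>H,tensor H H\<^esub> comult H b)" for h
  proof -
    have "cs H h (\<lambda>a b. cs H a (\<lambda>x y. x \<otimes>\<^bsub>H,tensor H H\<^esub> (y \<otimes>\<^bsub>H,H\<^esub> b)))
        = cs H h (\<lambda>a b. a \<otimes>\<^bsub>H,tensor H H\<^esub> comult H b)"
    proof (subst triple_tensor_iff; (intro allI impI)?)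
      fix f assume f: "trilin H H H f"
      note [lin] = trilinD[OF f]
      show "ts H (tensor H H) (cs H h (\<lambda>a b. cs H a (\<lambda>x y. x \<otimes>\<^bsub>H,tensor H H\<^esub> (y \<otimes>\<^bsub>H,H\<^esub> b)))) (\<lambda>v u. ts H H u (\<lambda>w x. f v w x))
        = ts H (tensor H H) (cs H h (\<lambda>a b. a \<otimes>\<^bsub>H,tensor H H\<^esub> comult H b)) (\<lambda>v u. ts H H u (\<lambda>w x. f v w x))"
        by (simp add: sw_sm_base lin sm_closed) (rule coassoc; simp add: lin)
    qed (auto intro!: sm_closed)
    then show ?thesis by (simp add: sw_eq_sm[where U = "tensor H (tensor H H)"] lin)
  qed
  have cu: "cop H h (\<lambda>a b. scl H (counit H a) b) = h" "cop H h (\<lambda>a b. scl H (counit H b) a) = h" for h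
    by (simp_all add: sw_eq_sm[where U = H] lin,
       (rule vec_eqI[OF assms(1)], simp, simp, simp add: sm_hom[OF _ assms(1)] lin_mapD counit)+)
  have an: "cop H h (\<lambda>a b. antipode H a * b) = scl H (counit H h) 1"
    "cop H h (\<lambda>a b. a * antipode H b) = scl H (counit H h) 1" for h
    by (simp_all add: sw_eq_sm[where U = H] lin,
       (rule vec_eqI[OF assms(1)], simp, simp, simp add: sm_hom[OF _ assms(1)] lin_mapD antipode)+)
  have mu: "comult H (g * h) = cop H g (\<lambda>g1 g2. cop H h (\<lambda>h1 h2. (g1 * h1) \<otimes>\<^bsub>H,H\<^esub> (g2 * h2)))" for g h
  proof -
    have "comult H (g * h) = cs H g (\<lambda>g1 g2. cs H h (\<lambda>h1 h2. (g1 * h1) \<otimes>\<^bsub>H,H\<^esub> (g2 * h2)))"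
    proof (rule tensor_eqI[OF assms(1)])
      fix \<beta> assume b: "\<And>v. v \<in> carr H \<Longrightarrow> lin_map H base (\<lambda>w. \<beta> v w)" 
       "\<And>w. w \<in> carr H \<Longrightarrow> lin_map H base (\<lambda>v. \<beta> v w)"
      then have [lin]: "lin_map H base (\<lambda>w. \<beta> v w)" "lin_map H base (\<lambda>v. \<beta> v w)" for v w by auto
      show "cs H (g * h) \<beta> = ts H H
        (cs H g (\<lambda>g1 g2. cs H h (\<lambda>h1 h2. (g1 * h1) \<otimes>\<^bsub>H,H\<^esub> (g2 * h2)))) \<beta>"
        by (simp add: sw_sm_base lin sm_closed mult)
    qed (auto intro!: sm_closed)
    then show ?thesis by (simp add: sw_eq_sm[where U = "tensor H H"] lin)
  qed
  show ?thesis unfolding hopf_algebra_def using assms(1-7) one assms(13,14) c3 cu an mu by blast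
qed

section \<open>Sweedler calculus and the antipode as an anti-homomorphism\<close>

locale hopf =
  fixes H :: "('k::field, 'h::ring_1) hopf"
  assumes hopf: "hopf_algebra H" and bij_antipode: "bij (antipode H)"
begin

lemma is_vspace_H [simp]: "is_vspace H" and carr_H [simp]: "carr H = UNIV"
  and comult_one: "comult H 1 = 1 \<otimes>\<^bsub>H,H\<^esub> 1"
  and counit_one [simp]: "counit H 1 = 1"
  and counit_mult: "counit H (a * b) = counit H a * counit H b"
  and scl_mult: "scl H c a * b = scl H c (a * b)" "a * scl H c b = scl H c (a * b)"
  using hopf by (auto simp: hopf_algebra_def)

lemma lin_comult: "lin_map H (tensor H H) (comult H)" and lin_counit: "lin_map H base (counit H)"
  and lin_antipode: "lin_map H H (antipode H)"
  using hopf by (auto simp: hopf_algebra_def)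

lemma lin_inv_antipode: "lin_map H H (inv (antipode H))"
proof (rule lin_mapI)
  note b = bij_is_inj[OF bij_antipode] surj_f_inv_f[OF bij_is_surj[OF bij_antipode]]
  let ?T = "inv (antipode H)"
  fix v v' c
  have "antipode H (?T (v + v')) = antipode H (?T v + ?T v')"
    using lin_mapD(2)[OF lin_antipode, of "?T v" "?T v'"] by (simp add: b(2))
  then show "?T (v + v') = ?T v + ?T v'" using b(1) by (simp add: inj_def)
  have "antipode H (?T (scl H c v)) = antipode H (scl H c (?T v))"
    using lin_mapD(3)[OF lin_antipode, of "?T v" c] by (simp add: b(2))
  then show "?T (scl H c v) = scl H c (?T v)" using b(1) by (simp add: inj_def)
qed simp

lemma comult_in [simp]: "comult H h \<in> carr (tensor H H)"
  using lin_mapD(1)[OF lin_comult] by simp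

lemmas lin_structure [lin] =
  lin_compose[OF lin_comult] lin_compose[OF lin_counit] lin_compose[OF lin_antipode]
  lin_compose[OF lin_inv_antipode]

lemma lin_mult [lin]:
  fixes V :: "('k,'v::ab_group_add,'z) vspace_scheme"
  shows "lin_map V H f \<Longrightarrow> lin_map V H (\<lambda>v. f v * b)" "lin_map V H f \<Longrightarrow> lin_map V H (\<lambda>v. b * f v)"
  by (auto simp: lin_map_def algebra_simps scl_mult)

lemma cs_coassoc:
  assumes f [lin]: "\<And>a b. lin_map H base (\<lambda>x. f a b x)" "\<And>a b. lin_map H base (\<lambda>x. f a x b)"
    "\<And>a b. lin_map H base (\<lambda>x. f x a b)"
  shows "cs H h (\<lambda>a b. cs H a (\<lambda>x y. f x y b)) = cs H h (\<lambda>a b. cs H b (\<lambda>x y. f a x y))"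
proof -
  have "cop H h (\<lambda>a b. cop H a (\<lambda>x y. x \<otimes>\<^bsub>H,tensor H H\<^esub> (y \<otimes>\<^bsub>H,H\<^esub> b)))
        = cop H h (\<lambda>a b. a \<otimes>\<^bsub>H,tensor H H\<^esub> comult H b)"
    using hopf by (auto simp: hopf_algebra_def)
  then have "cs H h (\<lambda>a b. cs H a (\<lambda>x y. x \<otimes>\<^bsub>H,tensor H H\<^esub> (y \<otimes>\<^bsub>H,H\<^esub> b)))
        = cs H h (\<lambda>a b. a \<otimes>\<^bsub>H,tensor H H\<^esub> comult H b)"
    by (simp add: sw_eq_sm[where U = "tensor H (tensor H H)"] lin)
  from arg_cong[OF this, of "\<lambda>t. ts H (tensor H H) t
    (\<lambda>x u. ts H H u (\<lambda>y z. f x y z))"]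
  show ?thesis by (simp add: sw_sm_base lin sm_closed)
qed

lemma cs_counit:
  assumes g: "lin_map H base g"
  shows "cs H h (\<lambda>a b. counit H a * g b) = g h" "cs H h (\<lambda>a b. counit H b * g a) = g h"
proof -
  have "cop H h (\<lambda>a b. scl H (counit H a) b) = h" "cop H h (\<lambda>a b. scl H (counit H b) a) = h"
    using hopf by (auto simp: hopf_algebra_def)
  then have *: "cs H h (\<lambda>a b. scl H (counit H a) b) = h" "cs H h (\<lambda>a b. scl H (counit H b) a) = h"
    by (simp_all add: sw_eq_sm[where U = H] lin)
  from arg_cong[OF *(1), of g] arg_cong[OF *(2), of g]
  show "cs H h (\<lambda>a b. counit H a * g b) = g h" "cs H h (\<lambda>a b. counit H b * g a) = g h"
    by (simp_all add: sm_hom[OF g] lin_mapD[OF g])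
qed

lemma cs_antipode:
  assumes g: "lin_map H base g"
  shows "cs H h (\<lambda>a b. g (antipode H a * b)) = counit H h * g 1"
    "cs H h (\<lambda>a b. g (a * antipode H b)) = counit H h * g 1"
proof -
  have "cop H h (\<lambda>a b. antipode H a * b) = scl H (counit H h) 1"
    "cop H h (\<lambda>a b. a * antipode H b) = scl H (counit H h) 1"
    using hopf by (auto simp: hopf_algebra_def)
  then have *: "cs H h (\<lambda>a b. antipode H a * b) = scl H (counit H h) 1"
     "cs H h (\<lambda>a b. a * antipode H b) = scl H (counit H h) 1"
    by (simp_all add: sw_eq_sm[where U = H] lin)
  from arg_cong[OF *(1), of g] arg_cong[OF *(2), of g]
  show "cs H h (\<lambda>a b. g (antipode H a * b)) = counit H h * g 1"
    "cs H h (\<lambda>a b. g (a * antipode H b)) = counit H h * g 1"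
    by (simp_all add: sm_hom[OF g] lin_mapD[OF g])
qed

lemma cs_one:
  assumes "\<And>a. lin_map H base (\<lambda>x. f a x)" "\<And>a. lin_map H base (\<lambda>x. f x a)"
  shows "cs H 1 f = f 1 1"
  by (simp add: comult_one sw_sm_base assms)

lemma cs_mult:
  assumes [lin]: "\<And>a. lin_map H base (\<lambda>x. f a x)" "\<And>a. lin_map H base (\<lambda>x. f x a)"
  shows "cs H (a * b) f = cs H a (\<lambda>a1 a2. cs H b (\<lambda>b1 b2. f (a1 * b1) (a2 * b2)))"
proof -
  have "comult H (a * b) = cop H a (\<lambda>g1 g2. cop H b (\<lambda>h1 h2. (g1 * h1) \<otimes>\<^bsub>H,H\<^esub> (g2 * h2)))"
    using hopf by (auto simp: hopf_algebra_def)
  then have "comult H (a * b) = cs H a (\<lambda>g1 g2. cs H b (\<lambda>h1 h2. (g1 * h1) \<otimes>\<^bsub>H,H\<^esub> (g2 * h2)))"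
    by (simp add: sw_eq_sm[where U = "tensor H H"] lin)
  then show ?thesis by (simp add: sw_sm_base lin sm_closed)
qed

lemma H_eqI: "(\<And>g. lin_map H base g \<Longrightarrow> g a = g b) \<Longrightarrow> a = b"
  by (rule vec_eqI[of H]) auto

lemma antipode_one: "antipode H 1 = 1"
proof (rule H_eqI)
  fix g assume g [lin]: "lin_map H base g"
  note [lin] = lin_compose[OF g]
  have "cs H 1 (\<lambda>a b. g (antipode H a * b)) = g (antipode H 1)"
    by (subst cs_one) (simp_all add: lin)
  then show "g (antipode H 1) = g 1" using cs_antipode(1)[OF g, of 1] by simp
qed

text \<open>Uniqueness of convolution inverses on \<open>H \<otimes> H\<close>: the maps
  \<open>S(ab)\<close> and \<open>S(b) S(a)\<close> are a left and a right inverse of the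
  multiplication. The sum \<open>?X\<close> of \<open>S(a1 b1) a2 b2 S(b3) S(a3)\<close> equals
  either of them, according to the pair that is cancelled.\<close>

lemma antipode_mult: "antipode H (a * b) = antipode H b * antipode H a"
proof (rule H_eqI)
  let ?S = "antipode H" and ?e = "counit H"
  fix g assume g [lin]: "lin_map H base g"
  note [lin] = lin_compose[OF g]
  let ?F = "\<lambda>a1 b1 a2 b2 a3 b3. g (?S (a1 * b1) * (a2 * b2) * (?S b3 * ?S a3))"
  let ?X = "cs H a (\<lambda>a1 a'. cs H b (\<lambda>b1 b'. cs H a' (\<lambda>a2 a3. cs H b' (\<lambda>b2 b3. ?F a1 b1 a2 b2 a3 b3))))"
  have 1: "cs H b' (\<lambda>b2 b3. ?F a1 b1 a2 b2 a3 b3) = ?e b' * g (?S (a1 * b1) * (a2 * ?S a3))"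
    for a1 b1 a2 a3 b'
    using cs_antipode(2)[of "\<lambda>x. g (?S (a1 * b1) * a2 * x * ?S a3)" b']
    by (simp add: lin mult.assoc)
  have 2: "cs H a' (\<lambda>a2 a3. g (?S (a1 * b1) * (a2 * ?S a3))) = ?e a' * g (?S (a1 * b1))" for a' a1 b1
    using cs_antipode(2)[of "\<lambda>x. g (?S (a1 * b1) * x)" a'] by (simp add: lin)
  have 3: "?X = g (?S (a * b))"
    by (simp add: 1 sm_mult_left 2 cs_counit lin mult.left_commute)
  \<comment> \<open>With the other bracketing \<open>a1 b1\<close> and \<open>a2 b2\<close> come
    from the coproduct of one product \<open>a' * b'\<close>, so that the antipode axiom applies to
    them.\<close>
  have "?X = cs H a (\<lambda>a' a3. cs H a' (\<lambda>a1 a2. cs H b (\<lambda>b1 b'. cs H b' (\<lambda>b2 b3. ?F a1 b1 a2 b2 a3 b3))))"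
    by (subst cs_coassoc) (simp_all add: lin sm_swap[of _ H H "comult H b"])
  also have "\<dots> = cs H a (\<lambda>a' a3. cs H a' (\<lambda>a1 a2. cs H b (\<lambda>b' b3. cs H b' (\<lambda>b1 b2. ?F a1 b1 a2 b2 a3 b3))))"
    by (simp add: cs_coassoc lin)
  also have "\<dots> = cs H a (\<lambda>a' a3. cs H b (\<lambda>b' b3. cs H (a' * b') (\<lambda>x y. g (?S x * y * (?S b3 * ?S a3)))))"
    by (simp add: cs_mult lin sm_swap[of _ H H "comult H b"])
  also have "\<dots> = cs H a (\<lambda>a' a3. cs H b (\<lambda>b' b3. ?e b' * (?e a' * g (?S b3 * ?S a3))))"
  proof -
    have "cs H c (\<lambda>x y. g (?S x * y * (?S b3 * ?S a3))) = ?e c * g (?S b3 * ?S a3)" for c b3 a3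
      using cs_antipode(1)[of "\<lambda>x. g (x * (?S b3 * ?S a3))" c] by (simp add: lin)
    then show ?thesis by (simp add: counit_mult ac_simps)
  qed
  also have "\<dots> = g (?S b * ?S a)" by (simp add: cs_counit lin)
  finally show "g (?S (a * b)) = g (?S b * ?S a)" using 3 by simp
qed

text \<open>The argument of \<open>antipode_mult\<close> with convolution of maps from
  \<open>H\<close> to \<open>H \<otimes> H\<close>: both sides are convolution inverse to the
  coproduct.\<close>

lemma cs_antipode_comult:
  assumes b: "\<And>a. lin_map H base (\<lambda>x. \<beta> a x)" "\<And>a. lin_map H base (\<lambda>x. \<beta> x a)"
  shows "cs H (antipode H h) \<beta> = cs H h (\<lambda>a b. \<beta> (antipode H b) (antipode H a))"
proof -
  let ?S = "antipode H" and ?e = "counit H"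
  note [lin] = b lin_compose[OF b(1)] lin_compose[OF b(2)]
  \<comment> \<open>The product of the coproduct of \<open>S(h1)\<close>, the coproduct of
    \<open>h2\<close> and \<open>S(h4) \<otimes> S(h3)\<close>, tested on \<open>\<beta>\<close>.
    Cancelling the last two leaves the coproduct of \<open>S(h)\<close>, cancelling the first two
    leaves the right side.\<close>
  let ?X = "cs H h (\<lambda>h1 h'. cs H (?S h1) (\<lambda>x y. cs H h' (\<lambda>h2 h''. cs H h2 (\<lambda>u v. cs H h'' (\<lambda>p q.
    \<beta> (x * u * ?S q) (y * v * ?S p))))))"
  have 1: "cs H w (\<lambda>v k. cs H k (\<lambda>p q. \<beta> (x * u * ?S q) (y * v * ?S p))) = \<beta> (x * u * ?S w) y" for w x u y
  proof -
    have 2: "cs H k (\<lambda>v p. \<beta> (x * u * ?S q) (y * v * ?S p)) = ?e k * \<beta> (x * u * ?S q) y" for k q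
      using cs_antipode(2)[of "\<lambda>z. \<beta> (x * u * ?S q) (y * z)" k] by (simp add: lin mult.assoc)
    have "cs H w (\<lambda>v k. cs H k (\<lambda>p q. \<beta> (x * u * ?S q) (y * v * ?S p)))
      = cs H w (\<lambda>k q. cs H k (\<lambda>v p. \<beta> (x * u * ?S q) (y * v * ?S p)))"
      by (simp add: cs_coassoc lin)
    then show ?thesis by (simp add: 2 cs_counit lin)
  qed
  have 3: "cs H h' (\<lambda>u w. \<beta> (x * u * ?S w) y) = ?e h' * \<beta> x y" for h' x y
    using cs_antipode(2)[of "\<lambda>z. \<beta> (x * z) y" h'] by (simp add: lin mult.assoc)
  have 4: "cs H h' (\<lambda>h2 h''. cs H h2 (\<lambda>u v. cs H h'' (\<lambda>p q. \<beta> (x * u * ?S q) (y * v * ?S p))))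
     = ?e h' * \<beta> x y" for h' x y
    by (subst cs_coassoc) (simp_all add: lin 1 3)
  have 5: "?X = cs H (?S h) \<beta>"
    by (simp add: 4 sm_mult_left cs_counit lin)
  have "?X = cs H h (\<lambda>w h''. cs H w (\<lambda>h1 h2. cs H (?S h1) (\<lambda>x y. cs H h2 (\<lambda>u v. cs H h'' (\<lambda>p q.
    \<beta> (x * u * ?S q) (y * v * ?S p))))))"
    by (simp add: sm_swap[of _ H H "comult H (?S _)"] cs_coassoc lin)
  also have "\<dots> = cs H h (\<lambda>w h''. cs H w (\<lambda>h1 h2. cs H (?S h1 * h2) (\<lambda>s t. cs H h'' (\<lambda>p q.
    \<beta> (s * ?S q) (t * ?S p)))))"
    by (simp add: cs_mult lin)
  also have "\<dots> = cs H h (\<lambda>w h''. ?e w * cs H 1 (\<lambda>s t. cs H h'' (\<lambda>p q. \<beta> (s * ?S q) (t * ?S p))))"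
    by (simp add: cs_antipode(1)[of "\<lambda>z. cs H z (\<lambda>s t. cs H _ (\<lambda>p q. \<beta> (s * ?S q) (t * ?S p)))"] lin)
  also have "\<dots> = cs H h (\<lambda>p q. \<beta> (?S q) (?S p))"
    by (simp add: cs_one cs_counit lin)
  finally show ?thesis using 5 by simp
qed

lemma inv_antipode [simp]: "antipode H (inv (antipode H) x) = x" "inv (antipode H) (antipode H x) = x"
  using bij_antipode by (auto simp: bij_is_surj surj_f_inv_f bij_is_inj)

lemma inv_antipode_one: "inv (antipode H) 1 = 1"
  using inv_antipode(2)[of 1] antipode_one by simp

lemma inv_antipode_mult: "inv (antipode H) (a * b) = inv (antipode H) b * inv (antipode H) a"
  using inv_antipode(2)[of "inv (antipode H) b * inv (antipode H) a"] by (simp add: antipode_mult)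

text \<open>Results from applying the inverse antipode, which reverses products, to the antipode
  axioms. These are the antipode axioms for the opposite coproduct.\<close>

lemma cs_inv_antipode:
  assumes g: "lin_map H base g"
  shows "cs H h (\<lambda>a b. g (inv (antipode H) b * a)) = counit H h * g 1"
    "cs H h (\<lambda>a b. g (b * inv (antipode H) a)) = counit H h * g 1"
proof -
  note [lin] = lin_compose[OF g]
  have e: "inv (antipode H) b * a = inv (antipode H) (antipode H a * b)"
     "b * inv (antipode H) a = inv (antipode H) (a * antipode H b)" for a b
    by (simp_all add: inv_antipode_mult)
  show "cs H h (\<lambda>a b. g (inv (antipode H) b * a)) = counit H h * g 1"
    "cs H h (\<lambda>a b. g (b * inv (antipode H) a)) = counit H h * g 1"
    unfolding e using cs_antipode[of "\<lambda>x. g (inv (antipode H) x)" h]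
    by (simp_all add: lin inv_antipode_one)
qed

end

section \<open>Bicovariant bimodules in terms of forms\<close>

abbreviation rs ::
  "('k::field, 'h::ring_1) hopf \<Rightarrow> ('k, 'h, 'm::ab_group_add) bicov \<Rightarrow> 'm
    \<Rightarrow> ('m \<Rightarrow> 'h \<Rightarrow> 'c::ab_group_add) \<Rightarrow> 'c" where
  "rs H M m f \<equiv> ts M H (rco M m) f"

abbreviation ls ::
  "('k::field, 'h::ring_1) hopf \<Rightarrow> ('k, 'h, 'm::ab_group_add) bicov \<Rightarrow> 'm
    \<Rightarrow> ('h \<Rightarrow> 'm \<Rightarrow> 'c::ab_group_add) \<Rightarrow> 'c" where
  "ls H M m f \<equiv> ts H M (lco M m) f"

definition bimod :: "('k::field, 'h::ring_1) hopf \<Rightarrow> ('k, 'h, 'm::ab_group_add) bicov \<Rightarrow> bool" where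
  "bimod H M \<longleftrightarrow> left_module H M \<and> right_module H M \<and>
     (\<forall>a b. \<forall>m\<in>carr M. ract M (lact M a m) b = lact M a (ract M m b))"

text \<open>The axioms on the right coaction alone, with compatibility split into left and right
  action. Keeping them apart from \<open>lside\<close> and from the mixed condition
  \<open>bico\<close> allows the left half to be deduced from the right half of the mirror
  image.\<close>

definition rside :: "('k::field, 'h::ring_1) hopf \<Rightarrow> ('k, 'h, 'm::ab_group_add) bicov \<Rightarrow> bool" where
  "rside H M \<longleftrightarrow>
     (\<forall>m\<in>carr M. \<forall>f. trilin M H H f \<longrightarrow>
        rs H M m (\<lambda>m0 m1. rs H M m0 (\<lambda>x y. f x y m1)) = rs H M m (\<lambda>m0 m1. cs H m1 (\<lambda>y z. f m0 y z))) \<and>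
     (\<forall>m\<in>carr M. \<forall>g. lin_map M base g \<longrightarrow> rs H M m (\<lambda>m0 m1. counit H m1 * g m0) = g m) \<and>
     (\<forall>a. \<forall>m\<in>carr M. \<forall>f. bilin M H f \<longrightarrow>
        rs H M (lact M a m) f = cs H a (\<lambda>a1 a2. rs H M m (\<lambda>m0 m1. f (lact M a1 m0) (a2 * m1)))) \<and>
     (\<forall>b. \<forall>m\<in>carr M. \<forall>f. bilin M H f \<longrightarrow>
        rs H M (ract M m b) f = rs H M m (\<lambda>m0 m1. cs H b (\<lambda>b1 b2. f (ract M m0 b1) (m1 * b2))))"

definition lside :: "('k::field, 'h::ring_1) hopf \<Rightarrow> ('k, 'h, 'm::ab_group_add) bicov \<Rightarrow> bool" where
  "lside H M \<longleftrightarrow>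
     (\<forall>m\<in>carr M. \<forall>f. trilin H H M f \<longrightarrow>
        ls H M m (\<lambda>p m0. ls H M m0 (\<lambda>y z. f p y z)) = ls H M m (\<lambda>p m0. cs H p (\<lambda>x y. f x y m0))) \<and>
     (\<forall>m\<in>carr M. \<forall>g. lin_map M base g \<longrightarrow> ls H M m (\<lambda>p m0. counit H p * g m0) = g m) \<and>
     (\<forall>a. \<forall>m\<in>carr M. \<forall>f. bilin H M f \<longrightarrow>
        ls H M (lact M a m) f = cs H a (\<lambda>a1 a2. ls H M m (\<lambda>p m0. f (a1 * p) (lact M a2 m0)))) \<and>
     (\<forall>b. \<forall>m\<in>carr M. \<forall>f. bilin H M f \<longrightarrow>
        ls H M (ract M m b) f = ls H M m (\<lambda>p m0. cs H b (\<lambda>b1 b2. f (p * b1) (ract M m0 b2))))"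

definition bico :: "('k::field, 'h::ring_1) hopf \<Rightarrow> ('k, 'h, 'm::ab_group_add) bicov \<Rightarrow> bool" where
  "bico H M \<longleftrightarrow> (\<forall>m\<in>carr M. \<forall>f. trilin H M H f \<longrightarrow>
     rs H M m (\<lambda>m0 m1. ls H M m0 (\<lambda>p x. f p x m1)) = ls H M m (\<lambda>p m0. rs H M m0 (\<lambda>x y. f p x y)))"

section \<open>Equivalence of the bicovariance axioms with their scalar form\<close>

context hopf
begin

lemma bimodD:
  assumes "bimod H M"
  shows "is_vspace M"
    "m \<in> carr M \<Longrightarrow> lact M a m \<in> carr M" "m \<in> carr M \<Longrightarrow> ract M m a \<in> carr M"
    "m \<in> carr M \<Longrightarrow> lact M 1 m = m" "m \<in> carr M \<Longrightarrow> ract M m 1 = m"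
    "m \<in> carr M \<Longrightarrow> lact M (a * b) m = lact M a (lact M b m)"
    "m \<in> carr M \<Longrightarrow> ract M m (a * b) = ract M (ract M m a) b"
    "m \<in> carr M \<Longrightarrow> ract M (lact M a m) b = lact M a (ract M m b)"
    "lin_map V M f \<Longrightarrow> lin_map V M (\<lambda>v. lact M a (f v))"
    "m \<in> carr M \<Longrightarrow> lin_map V H g \<Longrightarrow> lin_map V M (\<lambda>v. lact M (g v) m)"
    "lin_map V M f \<Longrightarrow> lin_map V M (\<lambda>v. ract M (f v) a)"
    "m \<in> carr M \<Longrightarrow> lin_map V H g \<Longrightarrow> lin_map V M (\<lambda>v. ract M m (g v))"
proof -
  have l: "lin_map M M (lact M a)" for a
    using assms by (auto simp: bimod_def left_module_def bilinear_maps_iff)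
  have r: "lin_map M M (\<lambda>m. ract M m a)" for a
    using assms by (auto simp: bimod_def right_module_def bilinear_maps_iff)
  show "m \<in> carr M \<Longrightarrow> lact M a m \<in> carr M" "m \<in> carr M \<Longrightarrow> ract M m a \<in> carr M"
    "lin_map V M f \<Longrightarrow> lin_map V M (\<lambda>v. lact M a (f v))"
    "lin_map V M f \<Longrightarrow> lin_map V M (\<lambda>v. ract M (f v) a)"
    using lin_mapD(1)[OF l] lin_mapD(1)[OF r] lin_compose[OF l] lin_compose[OF r] by auto
  have "m \<in> carr M \<Longrightarrow> lin_map H M (\<lambda>a. lact M a m)" "m \<in> carr M \<Longrightarrow> lin_map H M (\<lambda>a. ract M m a)"
    using assms by (auto simp: bimod_def left_module_def right_module_def bilinear_maps_iff)
  then show "m \<in> carr M \<Longrightarrow> lin_map V H g \<Longrightarrow> lin_map V M (\<lambda>v. lact M (g v) m)"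
    "m \<in> carr M \<Longrightarrow> lin_map V H g \<Longrightarrow> lin_map V M (\<lambda>v. ract M m (g v))"
    by (auto intro: lin_compose[of H M _ V g])
qed (use assms in \<open>auto simp: bimod_def left_module_def right_module_def\<close>)

context
  fixes M :: "('k, 'h, 'm::ab_group_add) bicov"
  assumes M: "bimod H M" "lin_map M (tensor M H) (rco M)" "lin_map M (tensor H M) (lco M)"
begin

private lemma loc:
  "is_vspace M" "m \<in> carr M \<Longrightarrow> rco M m \<in> carr (tensor M H)" "m \<in> carr M \<Longrightarrow> lco M m \<in> carr (tensor H M)"
  using bimodD[OF M(1)] lin_mapD(1)[OF M(2)] lin_mapD(1)[OF M(3)] by auto

private lemmas locl = lin bimodD(9-)[OF M(1)] lin_compose[OF M(2)] lin_compose[OF M(3)]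
private lemmas lics = loc bimodD[OF M(1)]

private lemma bicomodule_eqs:
  assumes m: "m \<in> carr M"
  shows
   "rcs H M m (\<lambda>m0 m1. rcs H M m0 (\<lambda>x y. x \<otimes>\<^bsub>M,tensor H H\<^esub> (y \<otimes>\<^bsub>H,H\<^esub> m1)))
        = rcs H M m (\<lambda>m0 m1. m0 \<otimes>\<^bsub>M,tensor H H\<^esub> comult H m1) \<longleftrightarrow>
    (\<forall>f. trilin M H H f \<longrightarrow> 
        rs H M m (\<lambda>m0 m1. rs H M m0 (\<lambda>x y. f x y m1)) = rs H M m (\<lambda>m0 m1. cs H m1 (\<lambda>y z. f m0 y z)))" (is ?A)
   "rcs H M m (\<lambda>m0 m1. scl M (counit H m1) m0) = m \<longleftrightarrow>
    (\<forall>g. lin_map M base g \<longrightarrow> rs H M m (\<lambda>m0 m1. counit H m1 * g m0) = g m)" (is ?B)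
   "lcs H M m (\<lambda>p m0. cop H p (\<lambda>x y. x \<otimes>\<^bsub>H,tensor H M\<^esub> (y \<otimes>\<^bsub>H,M\<^esub> m0)))
        = lcs H M m (\<lambda>p m0. p \<otimes>\<^bsub>H,tensor H M\<^esub> lco M m0) \<longleftrightarrow>
    (\<forall>f. trilin H H M f \<longrightarrow> 
        ls H M m (\<lambda>p m0. ls H M m0 (\<lambda>y z. f p y z)) = ls H M m (\<lambda>p m0. cs H p (\<lambda>x y. f x y m0)))" (is ?C)
   "lcs H M m (\<lambda>p m0. scl M (counit H p) m0) = m \<longleftrightarrow>
    (\<forall>g. lin_map M base g \<longrightarrow> ls H M m (\<lambda>p m0. counit H p * g m0) = g m)" (is ?D)
   "rcs H M m (\<lambda>m0 m1. lcs H M m0 (\<lambda>p x. p \<otimes>\<^bsub>H,tensor M H\<^esub> (x \<otimes>\<^bsub>M,H\<^esub> m1)))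
        = lcs H M m (\<lambda>p m0. p \<otimes>\<^bsub>H,tensor M H\<^esub> rco M m0) \<longleftrightarrow>
    (\<forall>f. trilin H M H f \<longrightarrow> 
       rs H M m (\<lambda>m0 m1. ls H M m0 (\<lambda>p x. f p x m1)) = ls H M m (\<lambda>p m0. rs H M m0 (\<lambda>x y. f p x y)))" (is ?E)
proof -
  note [simp] = loc m lics
  note [lin] = locl
  show ?A
  proof (simp add: sw_eq_sm[where U = "tensor M (tensor H H)"] lin, subst triple_tensor_iff; (intro all_cong1 imp_cong refl)?)
    fix f assume f: "trilin M H H f"
    note [lin] = trilinD[OF f]
    show "(ts M (tensor H H)
         (rs H M m (\<lambda>m0 m1. rs H M m0 (\<lambda>x y. x \<otimes>\<^bsub>M,tensor H H\<^esub> (y \<otimes>\<^bsub>H,H\<^esub> m1)))) (\<lambda>v u. ts H H u (\<lambda>w x. f v w x))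
      = ts M (tensor H H) (rs H M m (\<lambda>m0 m1. m0 \<otimes>\<^bsub>M,tensor H H\<^esub> comult H m1)) (\<lambda>v u. ts H H u (\<lambda>w x. f v w x)))
      \<longleftrightarrow> (rs H M m (\<lambda>m0 m1. rs H M m0 (\<lambda>x y. f x y m1)) = rs H M m (\<lambda>m0 m1. cs H m1 (\<lambda>y z. f m0 y z)))"
      by (simp add: sw_sm_base lin sm_closed)
  qed (auto intro!: sm_closed)
  show ?C
  proof (simp add: sw_eq_sm[where U = "tensor H (tensor H M)"] lin, subst triple_tensor_iff; (intro all_cong1 imp_cong refl)?)
    fix f assume f: "trilin H H M f"
    note [lin] = trilinD[OF f]
    show "(ts H (tensor H M)
         (ls H M m (\<lambda>p m0. cs H p (\<lambda>x y. x \<otimes>\<^bsub>H,tensor H M\<^esub> (y \<otimes>\<^bsub>H,M\<^esub> m0)))) (\<lambda>v u. ts H M u (\<lambda>w x. f v w x))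
      = ts H (tensor H M) (ls H M m (\<lambda>p m0. p \<otimes>\<^bsub>H,tensor H M\<^esub> lco M m0)) (\<lambda>v u. ts H M u (\<lambda>w x. f v w x)))
      \<longleftrightarrow> (ls H M m (\<lambda>p m0. ls H M m0 (\<lambda>y z. f p y z)) = ls H M m (\<lambda>p m0. cs H p (\<lambda>x y. f x y m0)))"
      by (simp add: sw_sm_base lin sm_closed eq_commute)
  qed (auto intro!: sm_closed)
  show ?E
  proof (simp add: sw_eq_sm[where U = "tensor H (tensor M H)"] lin, subst triple_tensor_iff; (intro all_cong1 imp_cong refl)?)
    fix f assume f: "trilin H M H f"
    note [lin] = trilinD[OF f]
    show "(ts H (tensor M H)
         (rs H M m (\<lambda>m0 m1. ls H M m0 (\<lambda>p x. p \<otimes>\<^bsub>H,tensor M H\<^esub> (x \<otimes>\<^bsub>M,H\<^esub> m1)))) (\<lambda>v u. ts M H u (\<lambda>w x. f v w x))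
      = ts H (tensor M H) (ls H M m (\<lambda>p m0. p \<otimes>\<^bsub>H,tensor M H\<^esub> rco M m0)) (\<lambda>v u. ts M H u (\<lambda>w x. f v w x)))
      \<longleftrightarrow> (rs H M m (\<lambda>m0 m1. ls H M m0 (\<lambda>p x. f p x m1)) = ls H M m (\<lambda>p m0. rs H M m0 (\<lambda>x y. f p x y)))"
      by (simp add: sw_sm_base lin sm_closed)
  qed (auto intro!: sm_closed)
  show ?B
  proof (simp add: sw_eq_sm[where U = M] lin, intro iffI allI impI)
    fix g assume eq: "rs H M m (\<lambda>m0 m1. scl M (counit H m1) m0) = m" and g: "lin_map M base g"
    from arg_cong[OF eq, of g] show "rs H M m (\<lambda>m0 m1. counit H m1 * g m0) = g m"
      by (simp add: sm_hom[OF g] lin_mapD[OF g] scale_closed)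
  next
    assume eq: "\<forall>g. lin_map M base g \<longrightarrow> rs H M m (\<lambda>m0 m1. counit H m1 * g m0) = g m"
    show "rs H M m (\<lambda>m0 m1. scl M (counit H m1) m0) = m"
      by (rule vec_eqI[OF loc(1)])
        (use eq in \<open>auto intro!: sm_closed simp: scale_closed sm_hom[OF _ loc(1)] lin_mapD\<close>)
  qed
  show ?D
  proof (simp add: sw_eq_sm[where U = M] lin, intro iffI allI impI)
    fix g assume eq: "ls H M m (\<lambda>p m0. scl M (counit H p) m0) = m" and g: "lin_map M base g"
    from arg_cong[OF eq, of g] show "ls H M m (\<lambda>p m0. counit H p * g m0) = g m"
      by (simp add: sm_hom[OF g] lin_mapD[OF g] scale_closed)
  next
    assume eq: "\<forall>g. lin_map M base g \<longrightarrow> ls H M m (\<lambda>p m0. counit H p * g m0) = g m"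
    show "ls H M m (\<lambda>p m0. scl M (counit H p) m0) = m"
      by (rule vec_eqI[OF loc(1)])
        (use eq in \<open>auto intro!: sm_closed simp: scale_closed sm_hom[OF _ loc(1)] lin_mapD\<close>)
  qed
qed

private lemma rco_act:
  assumes m: "m \<in> carr M"
  shows
   "rco M (ract M (lact M a m) b) = cop H a (\<lambda>a1 a2. rcs H M m (\<lambda>m0 m1. cop H b (\<lambda>b1 b2.
            ract M (lact M a1 m0) b1 \<otimes>\<^bsub>M,H\<^esub> (a2 * m1 * b2)))) \<longleftrightarrow>
    (\<forall>f. bilin M H f \<longrightarrow> rs H M (ract M (lact M a m) b) f = cs H a (\<lambda>a1 a2. rs H M m (\<lambda>m0 m1. cs H b (\<lambda>b1 b2.
            f (ract M (lact M a1 m0) b1) (a2 * m1 * b2)))))" (is ?A)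
   "lco M (ract M (lact M a m) b) = cop H a (\<lambda>a1 a2. lcs H M m (\<lambda>p m0. cop H b (\<lambda>b1 b2.
            (a1 * p * b1) \<otimes>\<^bsub>H,M\<^esub> ract M (lact M a2 m0) b2))) \<longleftrightarrow>
    (\<forall>f. bilin H M f \<longrightarrow> ls H M (ract M (lact M a m) b) f = cs H a (\<lambda>a1 a2. ls H M m (\<lambda>p m0. cs H b (\<lambda>b1 b2.
            f (a1 * p * b1) (ract M (lact M a2 m0) b2)))))" (is ?B)
proof -
  note [simp] = loc m lics(5-6)
  note [lin] = locl
  have "ts M H (cs H a (\<lambda>a1 a2. rs H M m (\<lambda>m0 m1. cs H b (\<lambda>b1 b2.
            ract M (lact M a1 m0) b1 \<otimes>\<^bsub>M,H\<^esub> (a2 * m1 * b2))))) f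
     = cs H a (\<lambda>a1 a2. rs H M m (\<lambda>m0 m1. cs H b (\<lambda>b1 b2. f (ract M (lact M a1 m0) b1) (a2 * m1 * b2))))"
    if "bilin M H f" for f
    by (simp add: sw_sm_base bilinD[OF that] lin sm_closed)
  then show ?A
    by (simp add: sw_eq_sm[where U = "tensor M H"] lin) (subst tensor_iff, auto intro!: sm_closed)
  have "ts H M (cs H a (\<lambda>a1 a2. ls H M m (\<lambda>p m0. cs H b (\<lambda>b1 b2.
            (a1 * p * b1) \<otimes>\<^bsub>H,M\<^esub> ract M (lact M a2 m0) b2)))) f
     = cs H a (\<lambda>a1 a2. ls H M m (\<lambda>p m0. cs H b (\<lambda>b1 b2. f (a1 * p * b1) (ract M (lact M a2 m0) b2))))"
    if "bilin H M f" for f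
    by (simp add: sw_sm_base bilinD[OF that] lin sm_closed)
  then show ?B
    by (simp add: sw_eq_sm[where U = "tensor H M"] lin) (subst tensor_iff, auto intro!: sm_closed)
qed

text \<open>Setting \<open>b = 1\<close> or \<open>a = 1\<close> isolates one action, because the
  coproduct of 1 is \<open>1 \<otimes> 1\<close>. Conversely the rule for the right action produces
  a new bilinear form, to which the rule for the left action applies.\<close>

private lemma rco_act_split:
  "(\<forall>a b. \<forall>m\<in>carr M. \<forall>f. bilin M H f \<longrightarrow> rs H M (ract M (lact M a m) b) f
      = cs H a (\<lambda>a1 a2. rs H M m (\<lambda>m0 m1. cs H b (\<lambda>b1 b2. f (ract M (lact M a1 m0) b1) (a2 * m1 * b2)))))
   \<longleftrightarrow> (\<forall>a. \<forall>m\<in>carr M. \<forall>f. bilin M H f \<longrightarrow>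
        rs H M (lact M a m) f = cs H a (\<lambda>a1 a2. rs H M m (\<lambda>m0 m1. f (lact M a1 m0) (a2 * m1)))) \<and>
     (\<forall>b. \<forall>m\<in>carr M. \<forall>f. bilin M H f \<longrightarrow>
        rs H M (ract M m b) f = rs H M m (\<lambda>m0 m1. cs H b (\<lambda>b1 b2. f (ract M m0 b1) (m1 * b2))))"
  (is "?A \<longleftrightarrow> ?B \<and> ?C")
proof (intro iffI conjI allI impI ballI)
  note [simp] = lics
  note [lin] = locl
  fix a b m f assume m [simp]: "m \<in> carr M" and f: "bilin M H f"
  note [lin] = bilinD[OF f]
  {
    assume A: ?A
    show "rs H M (lact M a m) f = cs H a (\<lambda>a1 a2. rs H M m (\<lambda>m0 m1. f (lact M a1 m0) (a2 * m1)))"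
      using A[rule_format, OF m f, of a 1] by (simp add: cs_one lin)
    show "rs H M (ract M m b) f = rs H M m (\<lambda>m0 m1. cs H b (\<lambda>b1 b2. f (ract M m0 b1) (m1 * b2)))"
      using A[rule_format, OF m f, of 1 b] by (simp add: cs_one lin)
  next
    assume BC: "?B \<and> ?C"
    have "rs H M (ract M (lact M a m) b) f =
      rs H M (lact M a m) (\<lambda>m0 m1. cs H b (\<lambda>b1 b2. f (ract M m0 b1) (m1 * b2)))"
      by (intro BC[THEN conjunct2, rule_format, OF lics(5)[OF m] f])
    also have "\<dots> = cs H a (\<lambda>a1 a2. rs H M m (\<lambda>m0 m1. cs H b (\<lambda>b1 b2.
      f (ract M (lact M a1 m0) b1) (a2 * m1 * b2))))"
    proof -
      have "bilin M H (\<lambda>m0 m1. cs H b (\<lambda>b1 b2. f (ract M m0 b1) (m1 * b2)))"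
        by (simp add: bilin_def lin)
      with BC m show ?thesis by blast
    qed
    finally show "rs H M (ract M (lact M a m) b) f = cs H a (\<lambda>a1 a2. rs H M m (\<lambda>m0 m1. cs H b (\<lambda>b1 b2.
      f (ract M (lact M a1 m0) b1) (a2 * m1 * b2))))" .
  }
qed

private lemma lco_act_split:
  "(\<forall>a b. \<forall>m\<in>carr M. \<forall>f. bilin H M f \<longrightarrow> ls H M (ract M (lact M a m) b) f
      = cs H a (\<lambda>a1 a2. ls H M m (\<lambda>p m0. cs H b (\<lambda>b1 b2. f (a1 * p * b1) (ract M (lact M a2 m0) b2)))))
   \<longleftrightarrow> (\<forall>a. \<forall>m\<in>carr M. \<forall>f. bilin H M f \<longrightarrow>
        ls H M (lact M a m) f = cs H a (\<lambda>a1 a2. ls H M m (\<lambda>p m0. f (a1 * p) (lact M a2 m0)))) \<and>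
     (\<forall>b. \<forall>m\<in>carr M. \<forall>f. bilin H M f \<longrightarrow>
        ls H M (ract M m b) f = ls H M m (\<lambda>p m0. cs H b (\<lambda>b1 b2. f (p * b1) (ract M m0 b2))))"
  (is "?A \<longleftrightarrow> ?B \<and> ?C")
proof (intro iffI conjI allI impI ballI)
  note [simp] = lics
  note [lin] = locl
  fix a b m f assume m [simp]: "m \<in> carr M" and f: "bilin H M f"
  note [lin] = bilinD[OF f]
  {
    assume A: ?A
    show "ls H M (lact M a m) f = cs H a (\<lambda>a1 a2. ls H M m (\<lambda>p m0. f (a1 * p) (lact M a2 m0)))"
      using A[rule_format, OF m f, of a 1] by (simp add: cs_one lin)
    show "ls H M (ract M m b) f = ls H M m (\<lambda>p m0. cs H b (\<lambda>b1 b2. f (p * b1) (ract M m0 b2)))"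
      using A[rule_format, OF m f, of 1 b] by (simp add: cs_one lin)
  next
    assume BC: "?B \<and> ?C"
    have "ls H M (ract M (lact M a m) b) f =
      ls H M (lact M a m) (\<lambda>p m0. cs H b (\<lambda>b1 b2. f (p * b1) (ract M m0 b2)))"
      by (intro BC[THEN conjunct2, rule_format, OF lics(5)[OF m] f])
    also have "\<dots> = cs H a (\<lambda>a1 a2. ls H M m (\<lambda>p m0. cs H b (\<lambda>b1 b2.
      f (a1 * p * b1) (ract M (lact M a2 m0) b2))))"
    proof -
      have "bilin H M (\<lambda>p m0. cs H b (\<lambda>b1 b2. f (p * b1) (ract M m0 b2)))"
        by (simp add: bilin_def lin)
      with BC m show ?thesis by blast
    qed
    finally show "ls H M (ract M (lact M a m) b) f = cs H a (\<lambda>a1 a2. ls H M m (\<lambda>p m0. cs H b (\<lambda>b1 b2.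
      f (a1 * p * b1) (ract M (lact M a2 m0) b2))))" .
  }
qed

lemma bicov_iff_aux:
  "bicov_bimodule H M \<longleftrightarrow> rside H M \<and> lside H M \<and> bico H M"
proof -
  have "bicov_bimodule H M \<longleftrightarrow> bicomodule H M \<and>
     (\<forall>a b. \<forall>m\<in>carr M. \<forall>f. bilin M H f \<longrightarrow> rs H M (ract M (lact M a m) b) f
      = cs H a (\<lambda>a1 a2. rs H M m (\<lambda>m0 m1. cs H b (\<lambda>b1 b2. f (ract M (lact M a1 m0) b1) (a2 * m1 * b2))))) \<and>
     (\<forall>a b. \<forall>m\<in>carr M. \<forall>f. bilin H M f \<longrightarrow> ls H M (ract M (lact M a m) b) f
      = cs H a (\<lambda>a1 a2. ls H M m (\<lambda>p m0. cs H b (\<lambda>b1 b2. f (a1 * p * b1) (ract M (lact M a2 m0) b2)))))"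
    unfolding bicov_bimodule_def
    by (simp only: rco_act cong: ball_cong) (use M(1)[unfolded bimod_def] in blast)
  also have "\<dots> \<longleftrightarrow> rside H M \<and> lside H M \<and> bico H M"
    unfolding rco_act_split lco_act_split bicomodule_def rside_def lside_def bico_def
    using M(2,3) loc(1)
    by (simp only: bicomodule_eqs cong: ball_cong)
      (intro iffI; elim conjE; intro conjI; (assumption | rule TrueI))
  finally show ?thesis .
qed

end

text \<open>Bicovariance is used and established in this form in all that follows; the tensor
  equations of the definition do not return.\<close>

lemma bicov_iff:
  "bicov_bimodule H M \<longleftrightarrow> bimod H M \<and> lin_map M (tensor M H) (rco M) \<and> lin_map M (tensor H M) (lco M) \<and>
     rside H M \<and> lside H M \<and> bico H M"
  using bicov_iff_aux[of M] by (auto simp: bicov_bimodule_def bimod_def bicomodule_def)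

lemma bicov_bimod: "bicov_bimodule H M \<Longrightarrow> bimod H M"
  by (simp add: bicov_iff)

lemmas bicov_simps [simp] = bimodD(1-7)[OF bicov_bimod]
lemmas bicov_commute = bimodD(8)[OF bicov_bimod]
lemmas bicov_lin [lin] = bimodD(9-)[OF bicov_bimod]

lemma bicov_coaction:
  assumes "bicov_bimodule H M"
  shows "lin_map M (tensor M H) (rco M)" "lin_map M (tensor H M) (lco M)"
  using assms by (auto simp: bicov_iff)

lemmas bicov_coaction_lin [lin] =
  lin_compose[OF bicov_coaction(1)] lin_compose[OF bicov_coaction(2)]

lemma bicov_coaction_in [simp]:
  assumes "bicov_bimodule H M" "m \<in> carr M"
  shows "rco M m \<in> carr (tensor M H)" "lco M m \<in> carr (tensor H M)"
  using lin_mapD(1)[OF bicov_coaction(1)] lin_mapD(1)[OF bicov_coaction(2)] assms by auto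

lemma rs_rules:
  assumes "bicov_bimodule H M" "m \<in> carr M"
  shows
   rs_coassoc: "trilin M H H f \<Longrightarrow>
     rs H M m (\<lambda>m0 m1. rs H M m0 (\<lambda>x y. f x y m1)) = rs H M m (\<lambda>m0 m1. cs H m1 (\<lambda>y z. f m0 y z))"
   and rs_counit: "lin_map M base g \<Longrightarrow> rs H M m (\<lambda>m0 m1. counit H m1 * g m0) = g m"
   and rs_lact: "bilin M H b \<Longrightarrow>
     rs H M (lact M a m) b = cs H a (\<lambda>a1 a2. rs H M m (\<lambda>m0 m1. b (lact M a1 m0) (a2 * m1)))"
   and rs_ract: "bilin M H b \<Longrightarrow>
     rs H M (ract M m a) b = rs H M m (\<lambda>m0 m1. cs H a (\<lambda>b1 b2. b (ract M m0 b1) (m1 * b2)))"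
  using assms by (auto simp: bicov_iff rside_def)

lemma ls_rules:
  assumes "bicov_bimodule H M" "m \<in> carr M"
  shows
   ls_coassoc: "trilin H H M f \<Longrightarrow>
     ls H M m (\<lambda>p m0. ls H M m0 (\<lambda>y z. f p y z)) = ls H M m (\<lambda>p m0. cs H p (\<lambda>x y. f x y m0))"
   and ls_counit: "lin_map M base g \<Longrightarrow> ls H M m (\<lambda>p m0. counit H p * g m0) = g m"
   and ls_lact: "bilin H M b \<Longrightarrow>
     ls H M (lact M a m) b = cs H a (\<lambda>a1 a2. ls H M m (\<lambda>p m0. b (a1 * p) (lact M a2 m0)))"
   and ls_ract: "bilin H M b \<Longrightarrow>
     ls H M (ract M m a) b = ls H M m (\<lambda>p m0. cs H a (\<lambda>b1 b2. b (p * b1) (ract M m0 b2)))"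
  using assms by (auto simp: bicov_iff lside_def)

lemma ls_rs_commute:
  assumes "bicov_bimodule H M" "m \<in> carr M" "trilin H M H f"
  shows "rs H M m (\<lambda>m0 m1. ls H M m0 (\<lambda>p x. f p x m1)) = ls H M m (\<lambda>p m0. rs H M m0 (\<lambda>x y. f p x y))"
  using assms by (auto simp: bicov_iff bico_def)

text \<open>The one-sided compatibilities are the two-sided ones at \<open>b = 1\<close>.\<close>

lemma left_bicov_module:
  assumes M: "bicov_bimodule H M"
  shows "left_bicov_module H M"
proof -
  have r: "ract M (lact M a m) 1 = lact M a m" if "m \<in> carr M" for a m
    using M that by simp
  have "rco M (lact M a m) = cop H a (\<lambda>a1 a2. rcs H M m (\<lambda>m0 m1. lact M a1 m0 \<otimes>\<^bsub>M,H\<^esub> (a2 * m1)))"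
    if [simp]: "m \<in> carr M" for a m
  proof -
    have "rco M (ract M (lact M a m) 1) = cop H a (\<lambda>a1 a2. rcs H M m (\<lambda>m0 m1. cop H 1 (\<lambda>b1 b2.
            ract M (lact M a1 m0) b1 \<otimes>\<^bsub>M,H\<^esub> (a2 * m1 * b2))))"
      using M that unfolding bicov_bimodule_def by blast
    also have "\<dots> = cop H a (\<lambda>a1 a2. rcs H M m (\<lambda>m0 m1. lact M a1 m0 \<otimes>\<^bsub>M,H\<^esub> (a2 * m1)))"
      using M by (simp add: sw_eq_sm[where U = "tensor M H"] lin comult_one sm_tens[where U = "tensor M H"])
    finally show ?thesis unfolding r[OF that] .
  qed
  moreover have "lco M (lact M a m) = cop H a (\<lambda>a1 a2. lcs H M m (\<lambda>p m0. (a1 * p) \<otimes>\<^bsub>H,M\<^esub> lact M a2 m0))"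
    if [simp]: "m \<in> carr M" for a m
  proof -
    have "lco M (ract M (lact M a m) 1) = cop H a (\<lambda>a1 a2. lcs H M m (\<lambda>p m0. cop H 1 (\<lambda>b1 b2.
            (a1 * p * b1) \<otimes>\<^bsub>H,M\<^esub> ract M (lact M a2 m0) b2)))"
      using M that unfolding bicov_bimodule_def by blast
    also have "\<dots> = cop H a (\<lambda>a1 a2. lcs H M m (\<lambda>p m0. (a1 * p) \<otimes>\<^bsub>H,M\<^esub> lact M a2 m0))"
      using M by (simp add: sw_eq_sm[where U = "tensor H M"] lin comult_one sm_tens[where U = "tensor H M"])
    finally show ?thesis unfolding r[OF that] .
  qed
  ultimately show ?thesis using M by (auto simp: left_bicov_module_def bicov_bimodule_def)
qed

end

subsection \<open>The mirror image\<close>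

text \<open>
  Passing to the opposite coproduct, with the inverse antipode, and exchanging the two coactions
  turns statements on right coactions into statements on left coactions.
\<close>

definition copH :: "('k::field, 'h::ring_1) hopf \<Rightarrow> ('k, 'h) hopf" where
  "copH H = H\<lparr>comult := \<lambda>h. flip (comult H h), antipode := inv (antipode H)\<rparr>"

definition mir :: "('k::field, 'h, 'm) bicov \<Rightarrow> ('k, 'h, 'm) bicov" where
  "mir M = M\<lparr>rco := \<lambda>m. flip (lco M m), lco := \<lambda>m. flip (rco M m)\<rparr>"

text \<open>The linear algebra depends on a record only through \<open>carr\<close> and
  \<open>scl\<close>. Changing the coproduct, the antipode or the coactions therefore leaves spaces
  of linear maps and tensor products literally the same.\<close>

lemma vspace_cong:
  assumes "carr V = carr V'" "scl V = scl V'"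
  shows "is_vspace V = is_vspace V'"
    "lin_map V W = lin_map V' W" "lin_map W V = lin_map W V'"
    "bilinear_maps V W U = bilinear_maps V' W U" "bilinear_maps W V U = bilinear_maps W V' U"
    "bilinear_maps W U V = bilinear_maps W U V'"
    "tensor_space B V W = tensor_space B V' W" "tensor_space B' W V = tensor_space B' W V'"
    "sm B V W = sm B V' W" "sm B' W V = sm B' W V'"
    "lift B V W = lift B V' W" "lift B' W V = lift B' W V'"
    "hom_space V W = hom_space V' W" "hom_space W V = hom_space W V'"
  unfolding is_vspace_def lin_map_def bilinear_maps_def tensor_space_def sm_def dec_def lift_def hom_space_def
    assms
  by (rule refl)+

lemma copH_simps [simp]:
  "carr (copH H) = carr H" "scl (copH H) = scl H" "counit (copH H) = counit H"
  "comult (copH H) h = flip (comult H h)" "antipode (copH H) = inv (antipode H)"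
  by (simp_all add: copH_def)

lemma mir_simps [simp]:
  "carr (mir M) = carr M" "scl (mir M) = scl M" "lact (mir M) = lact M" "ract (mir M) = ract M"
  "rco (mir M) m = flip (lco M m)" "lco (mir M) m = flip (rco M m)"
  by (simp_all add: mir_def)

lemma mir_coactions: "rco (mir M) = (\<lambda>m. flip (lco M m))" "lco (mir M) = (\<lambda>m. flip (rco M m))"
  by (simp_all add: mir_def)

lemmas copH_vspace [simp] = vspace_cong[OF copH_simps(1,2)]
lemmas mir_vspace [simp] = vspace_cong[OF mir_simps(1,2)]

lemma mir_mir [simp]: "mir (mir M) = M"
  by (simp add: mir_def)

lemma copH_copH: "bij (antipode H) \<Longrightarrow> copH (copH H) = H"
  by (simp add: copH_def inv_inv_eq)

lemma mir_predicates [simp]: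
  "left_module (copH H) (mir M) = left_module H M" "right_module (copH H) (mir M) = right_module H M"
  "bimod (copH H) (mir M) = bimod H M"
  "balanced_maps (mir M) N U = balanced_maps M N U" "balanced_maps M (mir N) U = balanced_maps M N U"
  by (simp_all add: left_module_def right_module_def bimod_def balanced_maps_def)

lemma bilin_cong:
  "bilin (copH H) W f = bilin H W f" "bilin W (copH H) f' = bilin W H f'"
  "bilin (mir M) W f1 = bilin M W f1" "bilin W (mir M) f2 = bilin W M f2"
  "trilin (copH H) W X g = trilin H W X g" "trilin W (copH H) X g1 = trilin W H X g1"
  "trilin W X (copH H) g2 = trilin W X H g2"
  "trilin (mir M) W X g3 = trilin M W X g3" "trilin W (mir M) X g4 = trilin W M X g4"
  "trilin W X (mir M) g5 = trilin W X M g5"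
  by (simp_all add: bilin_def trilin_def)

context hopf
begin

text \<open>The antipode axioms for the opposite coproduct are \<open>cs_inv_antipode\<close>, and
  this is where bijectivity of the antipode enters; multiplication stays as it is.\<close>

lemma copH: "hopf (copH H)"
proof
  show "bij (antipode (copH H))" using bij_antipode by (simp add: bij_imp_bij_inv)
  show "hopf_algebra (copH H)"
  proof (rule hopf_algebraI; simp?)
    show "scl H c a * b = scl H c (a * b)" "a * scl H c b = scl H c (a * b)" for c a b
      by (rule scl_mult)+
    show "lin_map H (tensor H H) (comult (copH H))"
      using flip_lin[OF is_vspace_H lin_comult] by (simp add: copH_def)
    show "lin_map H base (counit H)" "lin_map H H (inv (antipode H))"
      by (rule lin_counit lin_inv_antipode)+
    show "flip (comult H 1) = 1 \<otimes>\<^bsub>H,H\<^esub> 1" by (simp add: comult_one flip_pure)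
    show "counit H (a * b) = counit H a * counit H b" for a b by (rule counit_mult)
  next
    fix h and f :: "'h \<Rightarrow> 'h \<Rightarrow> 'h \<Rightarrow> 'k"
    assume f: "\<And>a b. lin_map H base (\<lambda>x. f a b x)" "\<And>a b. lin_map H base (\<lambda>x. f a x b)"
      "\<And>a b. lin_map H base (\<lambda>x. f x a b)"
    note [lin] = f f[THEN lin_compose]
    show "ts H H (flip (comult H h)) (\<lambda>a b.
        ts H H (flip (comult H a)) (\<lambda>x y. f x y b))
      = ts H H (flip (comult H h)) (\<lambda>a b.
        ts H H (flip (comult H b)) (f a))"
      by (simp add: sm_flip[where U = base] lin cs_coassoc)
  next
    fix h and g assume g: "lin_map H base g"
    note [lin] = lin_compose[OF g]
    show "ts H H (flip (comult H h)) (\<lambda>a b. counit H a * g b) = g h"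
      "ts H H (flip (comult H h)) (\<lambda>a b. counit H b * g a) = g h"
      "ts H H (flip (comult H h)) (\<lambda>a b. g (inv (antipode H) a * b)) = counit H h * g 1"
      "ts H H (flip (comult H h)) (\<lambda>a b. g (a * inv (antipode H) b)) = counit H h * g 1"
      using g by (simp_all add: sm_flip[where U = base] lin cs_counit cs_inv_antipode)
  next
    fix a b and f :: "'h \<Rightarrow> 'h \<Rightarrow> 'k"
    assume f: "\<And>a. lin_map H base (\<lambda>x. f a x)" "\<And>a. lin_map H base (\<lambda>x. f x a)"
    note [lin] = f f[THEN lin_compose]
    show "ts H H (flip (comult H (a * b))) f
      = ts H H (flip (comult H a)) (\<lambda>a1 a2.
        ts H H (flip (comult H b)) (\<lambda>b1 b2. f (a1 * b1) (a2 * b2)))"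
      by (simp add: sm_flip[where U = base] lin cs_mult)
  qed
qed

lemma rs_mir:
  assumes "is_vspace M" "lco M m \<in> carr (tensor H M)" "bilin M H f"
  shows "rs (copH H) (mir M) m f = ls H M m (\<lambda>p m0. f m0 p)"
proof -
  note [lin] = bilinD[OF assms(3)]
  show ?thesis using assms(1,2) by (simp add: sm_flip[where U = base] lin)
qed

text \<open>Each axiom of \<open>lside\<close> is the corresponding one of \<open>rside\<close> for
  the form with its arguments reversed. For tensor products and for \<open>HOM\<close> the left half
  thus costs only one more application of the right half.\<close>

lemma rside_mir_imp:
  assumes M: "bimod H M" "lin_map M (tensor H M) (lco M)" and l: "rside (copH H) (mir M)"
  shows "lside H M"
proof -
  note [simp] = bimodD(1-7)[OF M(1)]
  note [lin] = bimodD(9-)[OF M(1)] lin_compose[OF M(2)]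
  have [simp]: "m \<in> carr M \<Longrightarrow> lco M m \<in> carr (tensor H M)" for m using lin_mapD(1)[OF M(2)] by simp
  note l' = l[unfolded rside_def bilin_cong mir_simps copH_simps copH_vspace mir_vspace]
  show ?thesis unfolding lside_def
  proof (intro conjI ballI allI impI)
    fix m assume m [simp]: "m \<in> carr M"
    {
      fix f assume f: "trilin H H M f"
      note [lin] = trilinD[OF f]
      have "trilin M H H (\<lambda>x y z. f z y x)" by (simp add: trilin_def lin)
      from l'[THEN conjunct1, rule_format, OF m this]
      show "ls H M m (\<lambda>p m0. ls H M m0 (\<lambda>y z. f p y z)) = ls H M m (\<lambda>p m0. cs H p (\<lambda>x y. f x y m0))"
        by (simp add: sm_flip[where U = base] lin)
    next
      fix g assume g: "lin_map M base g"
      note [lin] = g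
      from l'[THEN conjunct2, THEN conjunct1, rule_format, OF m g]
      show "ls H M m (\<lambda>p m0. counit H p * g m0) = g m"
        by (simp add: sm_flip[where U = base] lin)
    next
      fix a f assume f: "bilin H M f"
      note [lin] = bilinD[OF f]
      have f': "bilin M H (\<lambda>x y. f y x)" by (simp add: bilin_def lin)
      from l'[THEN conjunct2, THEN conjunct2, THEN conjunct1, rule_format, OF m f', of a]
      show "ls H M (lact M a m) f = cs H a (\<lambda>a1 a2. ls H M m (\<lambda>p m0. f (a1 * p) (lact M a2 m0)))"
        by (simp add: sm_flip[where U = base] lin)
      from l'[THEN conjunct2, THEN conjunct2, THEN conjunct2, rule_format, OF m f', of a]
      show "ls H M (ract M m a) f = ls H M m (\<lambda>p m0. cs H a (\<lambda>b1 b2. f (p * b1) (ract M m0 b2)))"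
        by (simp add: sm_flip[where U = base] lin)
    }
  qed
qed

lemma mir_bicov:
  assumes M: "bicov_bimodule H M"
  shows "bicov_bimodule (copH H) (mir M)"
proof -
  note [simp] = M
  have 1: "lin_map M (tensor M H) (\<lambda>m. flip (lco M m))" "lin_map M (tensor H M) (\<lambda>m. flip (rco M m))"
    by (simp_all add: lin)
  have "rside (copH H) (mir M)" unfolding rside_def bilin_cong mir_simps copH_simps copH_vspace mir_vspace
  proof (intro conjI ballI allI impI)
    fix m assume m [simp]: "m \<in> carr M"
    {
      fix f assume f: "trilin M H H f"
      note [lin] = trilinD[OF f]
      have t: "trilin H H M (\<lambda>x y z. f z y x)" by (simp add: trilin_def lin)
      show "ts M H (flip (lco M m)) (\<lambda>m0 m1.
          ts M H (flip (lco M m0)) (\<lambda>x y. f x y m1))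
        = ts M H (flip (lco M m)) (\<lambda>m0 m1.
            ts H H (flip (comult H m1)) (f m0))"
        using ls_coassoc[OF M m t] by (simp add: sm_flip[where U = base] lin)
    next
      fix g assume g: "lin_map M base g"
      note [lin] = g
      show "ts M H (flip (lco M m)) 
         (\<lambda>m0 m1. counit H m1 * g m0) = g m"
        using ls_counit[OF M m g] by (simp add: sm_flip[where U = base] lin)
    next
      fix a f assume f: "bilin M H f"
      note [lin] = bilinD[OF f]
      have f': "bilin H M (\<lambda>x y. f y x)" by (simp add: bilin_def lin)
      show "ts M H (flip (lco M (lact M a m))) f
        = ts H H (flip (comult H a)) (\<lambda>a1 a2. ts M H (flip (lco M m))
          (\<lambda>m0 m1. f (lact M a1 m0) (a2 * m1)))"
        using ls_lact[OF M m f', of a] by (simp add: sm_flip[where U = base] lin)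
      show "ts M H (flip (lco M (ract M m a))) f
        = ts M H (flip (lco M m))
          (\<lambda>m0 m1. ts H H (flip (comult H a)) (\<lambda>b1 b2. f (ract M m0 b1) (m1 * b2)))"
        using ls_ract[OF M m f', of a] by (simp add: sm_flip[where U = base] lin)
    }
  qed
  \<comment> \<open>The mirror image of the mirror image is \<open>M\<close>, whose right half is
    known.\<close>
  moreover have "lside (copH H) (mir M)"
  proof (rule hopf.rside_mir_imp[OF copH])
    show "bimod (copH H) (mir M)" using bicov_bimod[OF M] by simp
    show "lin_map (mir M) (tensor (copH H) (mir M)) (lco (mir M))"
      using 1(2) by (simp add: mir_coactions)
    show "rside (copH (copH H)) (mir (mir M))"
      using M by (simp add: copH_copH[OF bij_antipode] bicov_iff)
  qed
  moreover have "bico (copH H) (mir M)" unfolding bico_def bilin_cong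
  proof (intro ballI allI impI)
    fix m f assume m: "m \<in> carr (mir M)" and f: "trilin H M H f"
    then have m' [simp]: "m \<in> carr M" by simp
    note [lin] = trilinD[OF f]
    have "trilin H M H (\<lambda>x y z. f z y x)" by (simp add: trilin_def lin)
    from ls_rs_commute[OF M m' this]
    show "rs (copH H) (mir M) m (\<lambda>m0 m1. ls (copH H) (mir M) m0 (\<lambda>p x. f p x m1))
      = ls (copH H) (mir M) m (\<lambda>p m0. rs (copH H) (mir M) m0 (\<lambda>x y. f p x y))"
      by (simp add: sm_flip[where U = base] lin)
  qed
  ultimately show ?thesis
    using 1 bicov_bimod[OF M] by (simp add: hopf.bicov_iff[OF copH] mir_coactions)
qed

end

section \<open>Tensor products are bicovariant bimodules\<close>

text \<open>Allows one treatment of the tensor product over the base field and of the one over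
  \<open>H\<close>.\<close>

definition tkind ::
  "('m \<Rightarrow> 'n \<Rightarrow> 'k::field) set \<Rightarrow> ('k, 'h::ring_1, 'm::ab_group_add) bicov \<Rightarrow> ('k, 'h, 'n::ab_group_add) bicov \<Rightarrow> bool" where
  "tkind B M N \<longleftrightarrow> B = bilinear_forms M N \<or> B = balanced_forms M N"

lemma tkind_simps [simp]:
  "tkind (bilinear_forms M N) M N" "tkind (balanced_forms M N) M N"
  "tkind B (mir M) (mir N) = tkind B M N"
  by (auto simp: tkind_def)

lemma tkind_sub: "tkind B M N \<Longrightarrow> B \<subseteq> bilinear_forms M N"
  by (auto simp: tkind_def balanced_maps_def)

text \<open>Balancedness of \<open>f\<close> is asked for under the assumption that pure tensors are
  balanced, which for the balanced kind is \<open>tens_H_balanced\<close>. A map built from pure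
  tensors can so be checked once for both kinds.\<close>

lemma tkind_adm:
  assumes "tkind B M N" "is_vspace M" "is_vspace U"
    "\<And>m. m \<in> carr M \<Longrightarrow> lin_map N U (\<lambda>n. f m n)" "\<And>n. n \<in> carr N \<Longrightarrow> lin_map M U (\<lambda>m. f m n)"
    "\<And>m h n. (\<And>m h n. m \<in> carr M \<Longrightarrow> n \<in> carr N \<Longrightarrow> pure B (ract M m h) n = pure B m (lact N h n)) \<Longrightarrow>
       m \<in> carr M \<Longrightarrow> n \<in> carr N \<Longrightarrow> f (ract M m h) n = f m (lact N h n)"
  shows "adm B M N U f"
proof -
  have b: "f \<in> bilinear_maps M N U" using assms(4,5) by (auto simp: bilinear_maps_iff)
  from assms(1) consider "B = bilinear_forms M N" | "B = balanced_forms M N" by (auto simp: tkind_def)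
  then show ?thesis
  proof cases
    case 1
    then show ?thesis using adm_bilinear[OF assms(2,3) b] by simp
  next
    case 2
    have "f \<in> balanced_maps M N U"
      using b assms(6) tens_H_balanced[of _ M _ N] by (auto simp: balanced_maps_def 2)
    then show ?thesis using adm_balanced[OF assms(2,3)] 2 by blast
  qed
qed

lemma bicov_tensor_simps:
  "carr (bicov_tensor B H M N) = carr (tensor_space B M N)"
  "scl (bicov_tensor B H M N) = (\<lambda>c t \<beta>. c * t \<beta>)"
  by (simp_all add: bicov_tensor_def Let_def)

lemma pure_in_bicov_tensor [simp]:
  "m \<in> carr M \<Longrightarrow> n \<in> carr N \<Longrightarrow> pure B m n \<in> carr (bicov_tensor B H M N)"
  by (simp add: bicov_tensor_simps)

lemma bicov_tensor_vspace:
  fixes M :: "('k::field, 'h::ring_1, 'm::ab_group_add) bicov" and N :: "('k, 'h, 'n::ab_group_add) bicov"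
  shows
    "is_vspace (bicov_tensor B H M N) = is_vspace (tensor_space B M N)"
    "lin_map (bicov_tensor B H M N) W = lin_map (tensor_space B M N) W"
    "lin_map W (bicov_tensor B H M N) = lin_map W (tensor_space B M N)"
    "bilinear_maps (bicov_tensor B H M N) W U = bilinear_maps (tensor_space B M N) W U"
    "bilinear_maps W (bicov_tensor B H M N) U = bilinear_maps W (tensor_space B M N) U"
    "bilinear_maps W U (bicov_tensor B H M N) = bilinear_maps W U (tensor_space B M N)"
    "tensor_space B1 (bicov_tensor B H M N) W = tensor_space B1 (tensor_space B M N) W"
    "tensor_space B2 W (bicov_tensor B H M N) = tensor_space B2 W (tensor_space B M N)"
    "sm B1 (bicov_tensor B H M N) W = sm B1 (tensor_space B M N) W"
    "sm B2 W (bicov_tensor B H M N) = sm B2 W (tensor_space B M N)"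
    "lift B1 (bicov_tensor B H M N) W = lift B1 (tensor_space B M N) W"
    "lift B2 W (bicov_tensor B H M N) = lift B2 W (tensor_space B M N)"
  by (rule vspace_cong; simp add: bicov_tensor_simps)+

context hopf
begin

lemma is_vspace_bicov_tensor [simp]: "is_vspace (bicov_tensor B H M N)"
  by (simp add: bicov_tensor_vspace)

lemma lin_tens [lin]:
  assumes "tkind B M N"
  shows "lin_map X M f \<Longrightarrow> n \<in> carr N \<Longrightarrow> lin_map X (bicov_tensor B H M N) (\<lambda>x. pure B (f x) n)"
    "m \<in> carr M \<Longrightarrow> lin_map X N g \<Longrightarrow> lin_map X (bicov_tensor B H M N) (\<lambda>x. pure B m (g x))"
  using tkind_sub[OF assms] by (simp_all add: bicov_tensor_vspace lin_pure)

lemma bicov_tensor_ext: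
  assumes "tkind B M N" "is_vspace M" "lin_map (bicov_tensor B H M N) U F" "lin_map (bicov_tensor B H M N) U G"
    "\<And>m n. m \<in> carr M \<Longrightarrow> n \<in> carr N \<Longrightarrow> F (pure B m n) = G (pure B m n)"
    "t \<in> carr (bicov_tensor B H M N)"
  shows "F t = G t"
  by (rule tensor_lin_ext[where F = F and G = G and U = U, OF assms(2) tkind_sub[OF assms(1)]])
    (use assms in \<open>simp_all add: bicov_tensor_vspace bicov_tensor_simps\<close>)

text \<open>Stated for an unspecified \<open>X\<close>, so as to apply to the mirror image of a tensor product, too.\<close>

lemma rside_tensor:
  assumes B: "tkind B M N" and M: "bicov_bimodule H M" and N: "bicov_bimodule H N"
    and X: "carr X = carr (tensor_space B M N)" "scl X = (\<lambda>c t \<beta>. c * t \<beta>)"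
    and bim: "bimod H X" and lin_rco: "lin_map X (tensor X H) (rco X)"
    and act: "\<And>a m n. m \<in> carr M \<Longrightarrow> n \<in> carr N \<Longrightarrow> lact X a (pure B m n) = pure B (lact M a m) n"
      "\<And>a m n. m \<in> carr M \<Longrightarrow> n \<in> carr N \<Longrightarrow> ract X (pure B m n) a = pure B m (ract N n a)"
    and rs: "\<And>m n f. m \<in> carr M \<Longrightarrow> n \<in> carr N \<Longrightarrow> bilin X H f \<Longrightarrow> rs H X (pure B m n) f
      = rs H M m (\<lambda>m0 m1. rs H N n (\<lambda>n0 n1. f (pure B m0 n0) (m1 * n1)))"
  shows "rside H X"
proof -
  note [simp] = M N act bimodD(1-7)[OF bim]
  note v = vspace_cong[of X "tensor_space B M N", unfolded scl_tensor_space, OF X]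
  have pl: "lin_map Y M f \<Longrightarrow> n \<in> carr N \<Longrightarrow> lin_map Y X (\<lambda>x. pure B (f x) n)"
    "m \<in> carr M \<Longrightarrow> lin_map Y' N g \<Longrightarrow> lin_map Y' X (\<lambda>x. pure B m (g x))"
    for Y :: "('k, 'c::ab_group_add, 'e) vspace_scheme" and Y' :: "('k, 'd::ab_group_add, 'f) vspace_scheme" and f g m n
    using tkind_sub[OF B] by (simp_all add: v lin_pure)
  note [lin] = pl bimodD(9-)[OF bim] lin_compose[OF lin_rco]
  have [simp]: "m \<in> carr M \<Longrightarrow> n \<in> carr N \<Longrightarrow> pure B m n \<in> carr X" for m n using X by simp
  have [simp]: "t \<in> carr X \<Longrightarrow> rco X t \<in> carr (tensor X H)" for t using lin_mapD(1)[OF lin_rco] .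
  \<comment> \<open>Every axiom is an equation between functionals that are linear in the element of
    \<open>X\<close>, so pure tensors suffice.\<close>
  have ext: "F t = G t" if "lin_map X base F" "lin_map X base G"
    "\<And>m n. m \<in> carr M \<Longrightarrow> n \<in> carr N \<Longrightarrow> F (pure B m n) = G (pure B m n)" "t \<in> carr X" for F G t
    by (rule tensor_lin_ext[OF _ tkind_sub[OF B], where F = F and G = G and U = base])
      (use that X in \<open>auto simp: v\<close>)
  show ?thesis unfolding rside_def
  proof (intro conjI ballI allI impI)
    fix t assume t: "t \<in> carr X"
    {
      fix f assume f: "trilin X H H f"
      note [lin] = trilinD[OF f]
      show "rs H X t (\<lambda>m0 m1. rs H X m0 (\<lambda>x y. f x y m1)) = rs H X t (\<lambda>m0 m1. cs H m1 (\<lambda>y z. f m0 y z))"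
      proof (rule ext[OF _ _ _ t])
        fix m n assume mn [simp]: "m \<in> carr M" "n \<in> carr N"
        show "rs H X (pure B m n) (\<lambda>m0 m1. rs H X m0 (\<lambda>x y. f x y m1))
          = rs H X (pure B m n) (\<lambda>m0 m1. cs H m1 (\<lambda>y z. f m0 y z))"
          by (simp add: rs bilin_def trilin_def lin sm_swap[where t = "rco N n"] rs_coassoc cs_mult)
      qed (simp_all add: lin)
    next
      fix g assume g: "lin_map X base g"
      note [lin] = g lin_compose[OF g]
      show "rs H X t (\<lambda>m0 m1. counit H m1 * g m0) = g t"
        by (rule ext[OF _ _ _ t])
          (simp_all add: rs bilin_def lin counit_mult mult.assoc sm_mult_left rs_counit)
    next
      fix a f assume f: "bilin X H f"
      note [lin] = bilinD[OF f]
      show "rs H X (lact X a t) f = cs H a (\<lambda>a1 a2. rs H X t (\<lambda>m0 m1. f (lact X a1 m0) (a2 * m1)))"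
        by (rule ext[OF _ _ _ t]) (simp_all add: rs bilin_def lin rs_lact mult.assoc)
      show "rs H X (ract X t a) f = rs H X t (\<lambda>m0 m1. cs H a (\<lambda>b1 b2. f (ract X m0 b1) (m1 * b2)))"
        by (rule ext[OF _ _ _ t]) (simp_all add: rs bilin_def lin rs_ract mult.assoc)
    }
  qed
qed

context
  fixes M :: "('k, 'h, 'm::ab_group_add) bicov" and N :: "('k, 'h, 'n::ab_group_add) bicov"
    and B :: "('m \<Rightarrow> 'n \<Rightarrow> 'k) set"
  assumes B [simp]: "tkind B M N" and M [simp]: "bicov_bimodule H M" and N [simp]: "bicov_bimodule H N"
begin

private abbreviation "T \<equiv> bicov_tensor B H M N"
private abbreviation "T' \<equiv> tensor_space B M N"

private lemma sub [simp]: "B \<subseteq> bilinear_forms M N"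
  by (rule tkind_sub[OF B])

text \<open>The left action on the first factor respects balancing because it commutes with the
  right action on \<open>M\<close>; dually for the right action on \<open>N\<close>.\<close>

private lemma adm_act:
  "adm B M N T' (\<lambda>m n. pure B (lact M a m) n)" "adm B M N T' (\<lambda>m n. pure B m (ract N n a))"
proof -
  show "adm B M N T' (\<lambda>m n. pure B (lact M a m) n)"
    by (rule tkind_adm[OF B]) (simp_all add: lin bicov_commute[symmetric])
  show "adm B M N T' (\<lambda>m n. pure B m (ract N n a))"
    by (rule tkind_adm[OF B]) (simp_all add: lin bicov_commute)
qed

private lemma T_act_sm:
  assumes "t \<in> carr T"
  shows "lact T a t = sm B M N t (\<lambda>m n. pure B (lact M a m) n)"
    "ract T t a = sm B M N t (\<lambda>m n. pure B m (ract N n a))"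
  using assms unfolding bicov_tensor_simps
  by (simp_all add: bicov_tensor_def Let_def)
    (rule lift_eq_sm[OF adm_act(1)] lift_eq_sm[OF adm_act(2)]; simp)+

lemma tensor_act_pure:
  assumes [simp]: "m \<in> carr M" "n \<in> carr N"
  shows "lact T a (pure B m n) = pure B (lact M a m) n" "ract T (pure B m n) a = pure B m (ract N n a)"
  by (simp_all add: T_act_sm sm_pure[OF adm_act(1)] sm_pure[OF adm_act(2)])

lemma bimod_tensor: "bimod H T"
proof -
  note [simp] = tensor_act_pure
  have l: "lin_map T T (lact T a)" for a
    using lin_sm_arg[OF adm_act(1), of a] unfolding bicov_tensor_vspace
    by (subst lin_map_cong) (auto simp: T_act_sm bicov_tensor_simps)
  have r: "lin_map T T (\<lambda>t. ract T t a)" for a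
    using lin_sm_arg[OF adm_act(2), of a] unfolding bicov_tensor_vspace
    by (subst lin_map_cong) (auto simp: T_act_sm bicov_tensor_simps)
  have l': "t \<in> carr T \<Longrightarrow> lin_map H T (\<lambda>a. lact T a t)" for t
    by (simp add: T_act_sm lin)
  have r': "t \<in> carr T \<Longrightarrow> lin_map H T (\<lambda>a. ract T t a)" for t
    by (simp add: T_act_sm lin)
  note [lin] = l r lin_compose[OF l] lin_compose[OF r]
  note ext = bicov_tensor_ext[OF B bicov_simps(1)[OF M], where U = T]
  have "lact T 1 t = t" if "t \<in> carr T" for t
    by (rule ext[OF _ _ _ that]) (simp_all add: lin)
  moreover have "lact T (a * b) t = lact T a (lact T b t)" if "t \<in> carr T" for a b t
    by (rule ext[OF _ _ _ that]) (simp_all add: lin)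
  moreover have "ract T t 1 = t" if "t \<in> carr T" for t
    by (rule ext[OF _ _ _ that]) (simp_all add: lin)
  moreover have "ract T t (a * b) = ract T (ract T t a) b" if "t \<in> carr T" for a b t
    by (rule ext[OF _ _ _ that]) (simp_all add: lin)
  moreover have "ract T (lact T a t) b = lact T a (ract T t b)" if "t \<in> carr T" for a b t
    by (rule ext[OF _ _ _ that]) (simp_all add: lin)
  ultimately show ?thesis using l r l' r'
    by (auto simp: bimod_def left_module_def right_module_def bilinear_maps_iff)
qed

private abbreviation "RR m n \<equiv> rs H M m (\<lambda>m0 m1. rs H N n (\<lambda>n0 n1. pure B m0 n0 \<otimes>\<^bsub>T,H\<^esub> (m1 * n1)))"
private abbreviation "LL m n \<equiv> ls H M m (\<lambda>p m0. ls H N n (\<lambda>q n0. (p * q) \<otimes>\<^bsub>H,T\<^esub> pure B m0 n0))"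

text \<open>Both \<open>m h \<otimes> n\<close> and \<open>m \<otimes> h n\<close> lead to
  \<open>m0 h1 \<otimes> n0 \<otimes> m1 h2 n1\<close>, up to moving \<open>h1\<close> across the
  balanced tensor sign; likewise on the left.\<close>

private lemma adm_co:
  "adm B M N (tensor T H) (\<lambda>m n. RR m n)" "adm B M N (tensor H T) (\<lambda>m n. LL m n)"
proof -
  show "adm B M N (tensor T H) (\<lambda>m n. RR m n)"
  proof (rule tkind_adm[OF B])
    fix m h n assume bal: "\<And>m h n. m \<in> carr M \<Longrightarrow> n \<in> carr N \<Longrightarrow> pure B (ract M m h) n = pure B m (lact N h n)"
      and [simp]: "m \<in> carr M" "n \<in> carr N"
    show "RR (ract M m h) n = RR m (lact N h n)"
    proof (rule tensor_eqI)
      fix f assume f: "\<And>v. v \<in> carr T \<Longrightarrow> lin_map H base (\<lambda>w. f v w)" "\<And>w. w \<in> carr H \<Longrightarrow> lin_map T base (\<lambda>v. f v w)"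
      note [lin] = f[THEN lin_compose] f
      have "rs H M (ract M m h) (\<lambda>m0 m1. rs H N n (\<lambda>n0 n1. f (pure B m0 n0) (m1 * n1)))
         = rs H M m (\<lambda>m0 m1. rs H N (lact N h n) (\<lambda>n0 n1. f (pure B m0 n0) (m1 * n1)))"
        by (simp add: rs_ract rs_lact bilin_def lin bal mult.assoc)
      then show "ts T H (RR (ract M m h) n) f = ts T H (RR m (lact N h n)) f"
        by (simp add: sw_sm_base sm_closed lin)
    qed (auto intro!: sm_closed)
  qed (simp_all add: lin)
  show "adm B M N (tensor H T) (\<lambda>m n. LL m n)"
  proof (rule tkind_adm[OF B])
    fix m h n assume bal: "\<And>m h n. m \<in> carr M \<Longrightarrow> n \<in> carr N \<Longrightarrow> pure B (ract M m h) n = pure B m (lact N h n)"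
      and [simp]: "m \<in> carr M" "n \<in> carr N"
    show "LL (ract M m h) n = LL m (lact N h n)"
    proof (rule tensor_eqI)
      fix f assume f: "\<And>v. v \<in> carr H \<Longrightarrow> lin_map T base (\<lambda>w. f v w)" "\<And>w. w \<in> carr T \<Longrightarrow> lin_map H base (\<lambda>v. f v w)"
      note [lin] = f[THEN lin_compose] f
      have "ls H M (ract M m h) (\<lambda>p m0. ls H N n (\<lambda>q n0. f (p * q) (pure B m0 n0)))
         = ls H M m (\<lambda>p m0. ls H N (lact N h n) (\<lambda>q n0. f (p * q) (pure B m0 n0)))"
        by (simp add: ls_ract ls_lact bilin_def lin bal mult.assoc)
      then show "ts H T (LL (ract M m h) n) f = ts H T (LL m (lact N h n)) f"
        by (simp add: sw_sm_base sm_closed lin)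
    qed (auto intro!: sm_closed)
  qed (simp_all add: lin)
qed

private lemma T_co_sm:
  assumes "t \<in> carr T"
  shows "rco T t = sm B M N t (\<lambda>m n. RR m n)" "lco T t = sm B M N t (\<lambda>m n. LL m n)"
proof -
  have "rco T t = lift B M N (\<lambda>m n. rcs H M m (\<lambda>m0 m1. rcs H N n (\<lambda>n0 n1. pure B m0 n0 \<otimes>\<^bsub>T,H\<^esub> (m1 * n1)))) t"
    by (simp only: bicov_tensor_vspace) (simp add: bicov_tensor_def Let_def)
  also have "\<dots> = lift B M N (\<lambda>m n. RR m n) t"
    by (simp add: sw_eq_sm[where U = "tensor T H"] lin)
  also have "\<dots> = sm B M N t (\<lambda>m n. RR m n)"
    by (rule lift_eq_sm[OF adm_co(1)]) (use assms in \<open>simp add: bicov_tensor_simps\<close>)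
  finally show "rco T t = sm B M N t (\<lambda>m n. RR m n)" .
  have "lco T t = lift B M N (\<lambda>m n. lcs H M m (\<lambda>p m0. lcs H N n (\<lambda>q n0. (p * q) \<otimes>\<^bsub>H,T\<^esub> pure B m0 n0))) t"
    by (simp only: bicov_tensor_vspace) (simp add: bicov_tensor_def Let_def)
  also have "\<dots> = lift B M N (\<lambda>m n. LL m n) t"
    by (simp add: sw_eq_sm[where U = "tensor H T"] lin)
  also have "\<dots> = sm B M N t (\<lambda>m n. LL m n)"
    by (rule lift_eq_sm[OF adm_co(2)]) (use assms in \<open>simp add: bicov_tensor_simps\<close>)
  finally show "lco T t = sm B M N t (\<lambda>m n. LL m n)" .
qed

private lemma lin_co: "lin_map T (tensor T H) (rco T)" "lin_map T (tensor H T) (lco T)"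
proof -
  have "lin_map T (tensor T H) (\<lambda>t. sm B M N t (\<lambda>m n. RR m n))"
    using lin_sm_arg[OF adm_co(1)] by (simp only: bicov_tensor_vspace)
  then show "lin_map T (tensor T H) (rco T)"
    by (subst lin_map_cong) (auto simp: T_co_sm bicov_tensor_simps)
  have "lin_map T (tensor H T) (\<lambda>t. sm B M N t (\<lambda>m n. LL m n))"
    using lin_sm_arg[OF adm_co(2)] by (simp only: bicov_tensor_vspace)
  then show "lin_map T (tensor H T) (lco T)"
    by (subst lin_map_cong) (auto simp: T_co_sm bicov_tensor_simps)
qed

lemma rs_tensor_pure:
  assumes [simp]: "m \<in> carr M" "n \<in> carr N" and f: "bilin T H f"
  shows "rs H T (pure B m n) f = rs H M m (\<lambda>m0 m1. rs H N n (\<lambda>n0 n1. f (pure B m0 n0) (m1 * n1)))"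
proof -
  note [lin] = bilinD[OF f]
  have "rco T (pure B m n) = RR m n" by (simp add: T_co_sm sm_pure[OF adm_co(1)])
  then show ?thesis by (simp add: sw_sm_base sm_closed lin)
qed

lemma ls_tensor_pure:
  assumes [simp]: "m \<in> carr M" "n \<in> carr N" and f: "bilin H T f"
  shows "ls H T (pure B m n) f = ls H M m (\<lambda>p m0. ls H N n (\<lambda>q n0. f (p * q) (pure B m0 n0)))"
proof -
  note [lin] = bilinD[OF f]
  have "lco T (pure B m n) = LL m n" by (simp add: T_co_sm sm_pure[OF adm_co(2)])
  then show ?thesis by (simp add: sw_sm_base sm_closed lin)
qed

lemma bicov_bimodule_tensor: "bicov_bimodule H T"
proof -
  note [lin] = bimodD(9-)[OF bimod_tensor] lin_compose[OF lin_co(1)] lin_compose[OF lin_co(2)]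
  have coin: "t \<in> carr T \<Longrightarrow> rco T t \<in> carr (tensor T H)" "t \<in> carr T \<Longrightarrow> lco T t \<in> carr (tensor H T)" for t
    using lin_mapD(1)[OF lin_co(1)] lin_mapD(1)[OF lin_co(2)] by auto
  have 1: "rside H T"
    by (rule rside_tensor[OF B M N]) (simp_all add: bimod_tensor lin_co tensor_act_pure rs_tensor_pure bicov_tensor_simps)
  \<comment> \<open>The flipped left coaction of \<open>T\<close> is the diagonal right coaction of
    the mirrored factors. The products in \<open>H\<close> keep their order, since only the
    coproduct is reversed.\<close>
  have "rside (copH H) (mir T)"
  proof (rule hopf.rside_tensor[OF copH _ mir_bicov[OF M] mir_bicov[OF N]])
    show "tkind B (mir M) (mir N)" by simp
    show "bimod (copH H) (mir T)" using bimod_tensor by simp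
    show "lin_map (mir T) (tensor (mir T) (copH H)) (rco (mir T))"
      using flip_lin[OF is_vspace_H lin_co(2)] by (simp add: mir_coactions)
    fix m n f assume mn: "m \<in> carr (mir M)" "n \<in> carr (mir N)" and f: "bilin (mir T) (copH H) f"
    from mn have [simp]: "m \<in> carr M" "n \<in> carr N" by auto
    from f have f': "bilin T H f" by (simp only: bilin_cong)
    note [lin] = bilinD[OF f']
    have "rs (copH H) (mir T) (pure B m n) f = ls H T (pure B m n) (\<lambda>p t. f t p)"
      by (rule rs_mir[OF _ _ f']) (rule is_vspace_bicov_tensor coin; simp)+
    also have "\<dots> = ls H M m (\<lambda>p m0. ls H N n (\<lambda>q n0. f (pure B m0 n0) (p * q)))"
      by (rule ls_tensor_pure) (simp_all add: bilin_def lin)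
    also have "\<dots> = rs (copH H) (mir M) m (\<lambda>m0 m1. rs (copH H) (mir N) n (\<lambda>n0 n1. f (pure B m0 n0) (m1 * n1)))"
      by (simp add: sm_flip[where U = base] lin)
    finally show "rs (copH H) (mir T) (pure B m n) f
      = rs (copH H) (mir M) m (\<lambda>m0 m1. rs (copH H) (mir N) n (\<lambda>n0 n1. f (pure B m0 n0) (m1 * n1)))" .
  qed (simp_all add: tensor_act_pure bicov_tensor_simps)
  then have 2: "lside H T" by (rule rside_mir_imp[OF bimod_tensor lin_co(2)])
  have 3: "bico H T" unfolding bico_def
  proof (intro ballI allI impI)
    fix t f assume t: "t \<in> carr T" and f: "trilin H T H f"
    note [lin] = trilinD[OF f]
    show "rs H T t (\<lambda>m0 m1. ls H T m0 (\<lambda>p x. f p x m1)) = ls H T t (\<lambda>p m0. rs H T m0 (\<lambda>x y. f p x y))"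
    proof (rule bicov_tensor_ext[OF B _ _ _ _ t, where U = base])
      fix m n assume mn [simp]: "m \<in> carr M" "n \<in> carr N"
      show "rs H T (pure B m n) (\<lambda>m0 m1. ls H T m0 (\<lambda>p x. f p x m1))
        = ls H T (pure B m n) (\<lambda>p m0. rs H T m0 (\<lambda>x y. f p x y))"
        by (simp add: rs_tensor_pure ls_tensor_pure bilin_def trilin_def lin sm_swap[where t = "rco N n"]
            sm_swap[where t = "lco N n"] ls_rs_commute)
    qed (simp_all add: lin)
  qed
  show ?thesis using bimod_tensor lin_co 1 2 3 by (simp add: bicov_iff)
qed

end

end

section \<open>Rational morphisms\<close>

text \<open>
  \<open>Kr H V M N \<phi> t\<close> says \<open>\<phi>(m)\<^sub>0 \<otimes> \<phi>(m)\<^sub>1 = \<chi>(m\<^sub>0) \<otimes> h m\<^sub>1\<close> for \<open>t = \<chi> \<otimes> h\<close>; by \<open>represents_right_iff\<close> below this is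
  \<open>t = \<delta>\<^sup>A\<^sup>d(\<phi>)\<close> with the antipode moved to the other side.
\<close>

definition Kr ::
  "('k::field, 'h::ring_1) hopf \<Rightarrow> ('k, 'm \<Rightarrow> 'n, 'z) vspace_scheme \<Rightarrow> ('k, 'h, 'm::ab_group_add) bicov
    \<Rightarrow> ('k, 'h, 'n::ab_group_add) bicov \<Rightarrow> ('m \<Rightarrow> 'n) \<Rightarrow> ('m \<Rightarrow> 'n, 'h, 'k) tensor \<Rightarrow> bool" where
  "Kr H V M N \<phi> t \<longleftrightarrow> t \<in> carr (tensor V H) \<and>
     (\<forall>m\<in>carr M. \<forall>\<beta>. bilin N H \<beta> \<longrightarrow> rs H N (\<phi> m) \<beta>
       = ts V H t (\<lambda>\<chi> h. rs H M m (\<lambda>m0 m1. \<beta> (\<chi> m0) (h * m1))))"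

definition Kl ::
  "('k::field, 'h::ring_1) hopf \<Rightarrow> ('k, 'm \<Rightarrow> 'n, 'z) vspace_scheme \<Rightarrow> ('k, 'h, 'm::ab_group_add) bicov
    \<Rightarrow> ('k, 'h, 'n::ab_group_add) bicov \<Rightarrow> ('m \<Rightarrow> 'n) \<Rightarrow> ('h, 'm \<Rightarrow> 'n, 'k) tensor \<Rightarrow> bool" where
  "Kl H V M N \<phi> s \<longleftrightarrow> s \<in> carr (tensor H V) \<and>
     (\<forall>m\<in>carr M. \<forall>\<beta>. bilin H N \<beta> \<longrightarrow> ls H N (\<phi> m) \<beta>
       = ts H V s (\<lambda>h \<chi>. ls H M m (\<lambda>p m0. \<beta> (h * p) (\<chi> m0))))"

lemma KrD:
  assumes "Kr H V M N \<phi> t"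
  shows "t \<in> carr (tensor V H)"
    "m \<in> carr M \<Longrightarrow> bilin N H \<beta> \<Longrightarrow> rs H N (\<phi> m) \<beta>
       = ts V H t (\<lambda>\<chi> h. rs H M m (\<lambda>m0 m1. \<beta> (\<chi> m0) (h * m1)))"
  using assms by (auto simp: Kr_def)

lemma KlD:
  assumes "Kl H V M N \<phi> t"
  shows "t \<in> carr (tensor H V)"
    "m \<in> carr M \<Longrightarrow> bilin H N \<beta> \<Longrightarrow> ls H N (\<phi> m) \<beta>
       = ts H V t (\<lambda>h \<chi>. ls H M m (\<lambda>p m0. \<beta> (h * p) (\<chi> m0)))"
  using assms by (auto simp: Kl_def)

lemma hom_space_simps:
  "\<phi> \<in> carr (hom_space M N) \<longleftrightarrow> lin_map M N \<phi> \<and> (\<forall>x. x \<notin> carr M \<longrightarrow> \<phi> x = 0)"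
  "scl (hom_space M N) = (\<lambda>c \<phi> m. scl N c (\<phi> m))"
  by (simp_all add: hom_space_def)

lemma is_vspace_hom_space [simp]:
  assumes "is_vspace M" "is_vspace N"
  shows "is_vspace (hom_space M N)"
proof -
  note v [simp] = vspace_scale_simps[OF assms(2)]
  interpret vector_space "scl (hom_space M N)"
    by unfold_locales (auto simp: hom_space_simps fun_eq_iff)
  have "0 \<in> carr N" by (rule zero_closed[OF assms(2)])
  then have "subspace (carr (hom_space M N))"
    using assms
    by (intro subspaceI)
      (auto simp: hom_space_simps lin_map_def add_closed scale_closed algebra_simps)
  then show ?thesis using vector_space_axioms by (simp add: is_vspace_def)
qed

text \<open>The contraction \<open>\<phi>\<^sub>0 g(\<phi>\<^sub>1)\<close>, which makes sense without rationality.\<close>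

definition cg ::
  "('k::field, 'h::ring_1) hopf \<Rightarrow> ('k, 'h, 'm::ab_group_add) bicov
    \<Rightarrow> ('k, 'h, 'n::ab_group_add) bicov \<Rightarrow> ('h \<Rightarrow> 'k) \<Rightarrow> ('m \<Rightarrow> 'n) \<Rightarrow> 'm \<Rightarrow> 'n" where
  "cg H M N g \<phi> = (\<lambda>m. if m \<in> carr M then rs H M m (\<lambda>m0 m1. rs H N (\<phi> m0) (\<lambda>n0 n1.
     scl N (g (n1 * antipode H m1)) n0)) else 0)"

section \<open>The adjoint coaction on spaces of linear maps\<close>

context hopf
begin

context
  fixes M :: "('k, 'h, 'm::ab_group_add) bicov" and N :: "('k, 'h, 'n::ab_group_add) bicov"
  assumes M [simp]: "bicov_bimodule H M" and N [simp]: "bicov_bimodule H N"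
begin

private abbreviation "hs \<equiv> hom_space M N"

lemma hom_space_lin:
  assumes "is_vspace V" "carr V \<subseteq> carr hs" "scl V = scl hs"
  shows "\<chi> \<in> carr V \<Longrightarrow> lin_map X M f \<Longrightarrow> lin_map X N (\<lambda>x. \<chi> (f x))"
    "m \<in> carr M \<Longrightarrow> lin_map V N (\<lambda>\<chi>. \<chi> m)"
    "\<chi> \<in> carr V \<Longrightarrow> lin_map M N \<chi>"
proof -
  have l: "lin_map M N \<chi>" if "\<chi> \<in> carr V" for \<chi>
    using subsetD[OF assms(2) that] by (simp add: hom_space_simps)
  show "lin_map M N \<chi>" if "\<chi> \<in> carr V" using l[OF that] .
  show "lin_map X N (\<lambda>x. \<chi> (f x))" if "\<chi> \<in> carr V" "lin_map X M f"
    using lin_compose[OF l[OF that(1)] that(2)] .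
  show "m \<in> carr M \<Longrightarrow> lin_map V N (\<lambda>\<chi>. \<chi> m)"
    using assms(3) lin_mapD(1)[OF l] by (intro lin_mapI) (simp_all add: hom_space_simps)
qed

lemma hom_space_closed:
  assumes "carr V \<subseteq> carr hs" "\<chi> \<in> carr V" "m \<in> carr M"
  shows "\<chi> m \<in> carr N"
proof -
  have "lin_map M N \<chi>" using subsetD[OF assms(1,2)] by (simp add: hom_space_simps)
  then show ?thesis by (rule lin_mapD(1)[OF _ assms(3)])
qed

lemma hs_lin:
  "\<chi> \<in> carr hs \<Longrightarrow> lin_map X M f \<Longrightarrow> lin_map X N (\<lambda>x. \<chi> (f x))"
  "m \<in> carr M \<Longrightarrow> lin_map hs N (\<lambda>\<chi>. \<chi> m)"
  "\<chi> \<in> carr hs \<Longrightarrow> m \<in> carr M \<Longrightarrow> \<chi> m \<in> carr N"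
  "\<chi> \<in> carr hs \<Longrightarrow> lin_map M N \<chi>"
  using hom_space_lin[of hs, OF _ subset_refl refl] hom_space_closed[of hs, OF subset_refl] by simp_all

lemma cg_in:
  assumes \<phi>: "\<phi> \<in> carr hs" and g: "lin_map H base g"
  shows "cg H M N g \<phi> \<in> carr hs"
proof -
  note [lin] = hs_lin(1)[OF \<phi>] lin_compose[OF g]
  note [simp] = hs_lin(3)[OF \<phi>]
  have "lin_map M N (cg H M N g \<phi>)" unfolding cg_def
    by (subst lin_map_cong) (auto, simp add: lin)
  then show ?thesis by (simp add: hom_space_simps cg_def)
qed

context
  fixes V :: "('k, 'm \<Rightarrow> 'n, 'z) vspace_scheme"
  assumes V [simp]: "is_vspace V" and Vhs: "carr V \<subseteq> carr hs" and sclV: "scl V = scl hs"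
begin

private lemmas Vlin = hom_space_lin[OF V Vhs sclV]
private lemmas Vcl [simp] = hom_space_closed[OF Vhs]

private lemma delta_Ad_sm:
  assumes "\<phi> \<in> carr hs" "m \<in> carr M"
  shows "delta_Ad H M N \<phi> m = rs H M m (\<lambda>m0 m1. rs H N (\<phi> m0) (\<lambda>n0 n1. n0 \<otimes>\<^bsub>N,H\<^esub> (n1 * antipode H m1)))"
proof -
  note [lin] = hs_lin(1)[OF assms(1)]
  note [simp] = hs_lin(3)[OF assms(1)]
  show ?thesis unfolding delta_Ad_def using assms(2)
    by (simp add: sw_eq_sm[where U = "tensor N H"] lin)
qed

private lemma delta_Ad_form:
  assumes "\<phi> \<in> carr hs" "m \<in> carr M" "bilin N H \<beta>"
  shows "ts N H (delta_Ad H M N \<phi> m) \<beta>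
    = rs H M m (\<lambda>m0 m1. rs H N (\<phi> m0) (\<lambda>n0 n1. \<beta> n0 (n1 * antipode H m1)))"
proof -
  note [lin] = hs_lin(1)[OF assms(1)] bilinD[OF assms(3)]
  note [simp] = hs_lin(3)[OF assms(1)]
  show ?thesis using assms(2) by (simp add: delta_Ad_sm[OF assms(1)] sw_sm_base sm_closed lin)
qed

private lemma antipode_step:
  assumes "bilin N H \<beta>" "u \<in> carr N"
  shows "cs H q (\<lambda>y m1. rs H N u (\<lambda>n0 n1. \<beta> n0 (n1 * (antipode H y * m1)))) = counit H q * rs H N u \<beta>"
proof -
  note [lin] = bilinD[OF assms(1)]
  show ?thesis using assms(2) cs_antipode(1)[of "\<lambda>z. rs H N u (\<lambda>n0 n1. \<beta> n0 (n1 * z))" q]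
    by (simp add: lin)
qed

text \<open>The two descriptions are exchanged by multiplying the \<open>H\<close>-component with
  \<open>S(m1)\<close> or \<open>m1\<close> from the right after one further coaction: one direction
  cancels \<open>m1 S(m2)\<close>, the other \<open>S(m1) m2\<close>.\<close>

lemma Kr_iff:
  assumes \<phi>: "\<phi> \<in> carr hs" and t: "t \<in> carr (tensor V H)"
  shows "Kr H V M N \<phi> t \<longleftrightarrow> (\<forall>m\<in>carr M. delta_Ad H M N \<phi> m = sw V H t (\<lambda>\<chi> h. \<chi> m \<otimes>\<^bsub>N,H\<^esub> h))"
    (is "_ \<longleftrightarrow> (\<forall>m\<in>_. ?d m = ?s m)")
proof -
  note [lin] = Vlin hs_lin(1)[OF \<phi>]
  note [simp] = hs_lin(3)[OF \<phi>] t
  let ?sm = "\<lambda>f. ts V H t f"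
  have s: "?s m = ?sm (\<lambda>\<chi> h. \<chi> m \<otimes>\<^bsub>N,H\<^esub> h)" if "m \<in> carr M" for m
    using that by (simp add: sw_eq_sm[where U = "tensor N H"] lin)
  have dform: "ts N H (?d m) \<beta> = rs H M m (\<lambda>m0 m1. rs H N (\<phi> m0) (\<lambda>n0 n1. \<beta> n0 (n1 * antipode H m1)))"
    if "m \<in> carr M" "bilin N H \<beta>" for m \<beta>
    by (rule delta_Ad_form[OF \<phi> that])
  have sform: "ts N H (?s m) \<beta> = ?sm (\<lambda>\<chi> h. \<beta> (\<chi> m) h)"
    if m: "m \<in> carr M" and b: "bilin N H \<beta>" for m \<beta>
  proof -
    note [lin] = bilinD[OF b]
    show ?thesis using m by (simp add: s sw_sm_base lin)
  qed
  show ?thesis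
  proof (intro iffI ballI)
    fix m assume K: "Kr H V M N \<phi> t" and m [simp]: "m \<in> carr M"
    show "?d m = ?s m"
    proof (rule tensor_eqI)
      fix \<beta> assume "\<And>v. v \<in> carr N \<Longrightarrow> lin_map H base (\<lambda>w. \<beta> v w)" "\<And>w. w \<in> carr H \<Longrightarrow> lin_map N base (\<lambda>v. \<beta> v w)"
      then have b: "bilin N H \<beta>" by (simp add: bilin_def)
      note [lin] = bilinD[OF b]
      have "ts N H (?d m) \<beta>
          = rs H M m (\<lambda>m0 m1. ?sm (\<lambda>\<chi> h. rs H M m0 (\<lambda>x y. \<beta> (\<chi> x) (h * y * antipode H m1))))"
        using K by (simp add: dform b KrD(2)[OF K] bilin_def lin)
      also have "\<dots> = ?sm (\<lambda>\<chi> h. rs H M m (\<lambda>m0 m1. rs H M m0 (\<lambda>x y. \<beta> (\<chi> x) (h * y * antipode H m1))))"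
        by (rule sm_swap)
      also have "\<dots> = ?sm (\<lambda>\<chi> h. rs H M m (\<lambda>m0 q. cs H q (\<lambda>y m1. \<beta> (\<chi> m0) (h * (y * antipode H m1)))))"
        by (simp add: rs_coassoc trilin_def lin mult.assoc)
      also have "\<dots> = ?sm (\<lambda>\<chi> h. \<beta> (\<chi> m) h)"
      proof -
        have "cs H q (\<lambda>y m1. \<beta> u (h * (y * antipode H m1))) = counit H q * \<beta> u h" if "u \<in> carr N" for q u h
          using cs_antipode(2)[of "\<lambda>z. \<beta> u (h * z)" q] that by (simp add: lin)
        then show ?thesis by (simp add: rs_counit lin)
      qed
      finally show "ts N H (?d m) \<beta> = ts N H (?s m) \<beta>"
        by (simp add: sform b)
    qed (auto simp: s delta_Ad_sm[OF \<phi>] intro!: sm_closed)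
  next
    assume eq: "\<forall>m\<in>carr M. ?d m = ?s m"
    show "Kr H V M N \<phi> t" unfolding Kr_def
    proof (intro conjI t ballI allI impI)
      fix m \<beta> assume m [simp]: "m \<in> carr M" and b: "bilin N H \<beta>"
      note [lin] = bilinD[OF b]
      have "?sm (\<lambda>\<chi> h. rs H M m (\<lambda>m0 m1. \<beta> (\<chi> m0) (h * m1)))
          = rs H M m (\<lambda>m0 m1. ?sm (\<lambda>\<chi> h. \<beta> (\<chi> m0) (h * m1)))"
        by (rule sm_swap)
      also have "\<dots> = rs H M m (\<lambda>m0 m1. ts N H (?d m0) (\<lambda>n h. \<beta> n (h * m1)))"
        using eq by (simp add: sform bilin_def lin)
      also have "\<dots> = rs H M m (\<lambda>m0 m1. rs H M m0 (\<lambda>x y. rs H N (\<phi> x) (\<lambda>n0 n1. \<beta> n0 (n1 * (antipode H y * m1)))))"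
        by (simp add: dform bilin_def lin mult.assoc)
      also have "\<dots> = rs H M m (\<lambda>m0 q. cs H q (\<lambda>y m1. rs H N (\<phi> m0) (\<lambda>n0 n1. \<beta> n0 (n1 * (antipode H y * m1)))))"
        by (simp add: rs_coassoc trilin_def lin)
      also have "\<dots> = rs H N (\<phi> m) \<beta>"
        by (simp add: antipode_step b rs_counit lin)
      finally show "rs H N (\<phi> m) \<beta> = ?sm (\<lambda>\<chi> h. rs H M m (\<lambda>m0 m1. \<beta> (\<chi> m0) (h * m1)))" by simp
    qed
  qed
qed

text \<open>The right side does not mention \<open>t\<close>. Two tensors that belong to the same
  \<open>\<phi>\<close> have therefore the same contractions, which makes the coaction
  unique.\<close>

lemma Kr_contract:
  assumes \<phi>: "\<phi> \<in> carr hs" and K: "Kr H V M N \<phi> t" and g: "lin_map H base g"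
  shows "ts V H t (\<lambda>\<chi> h. scl V (g h) \<chi>) = cg H M N g \<phi>"
proof
  note [lin] = Vlin hs_lin(1)[OF \<phi>] lin_compose[OF g]
  note [simp] = hs_lin(3)[OF \<phi>] KrD(1)[OF K]
  let ?sm = "\<lambda>f. ts V H t f"
  fix m
  have a: "?sm (\<lambda>\<chi> h. scl V (g h) \<chi>) m = ?sm (\<lambda>\<chi> h. scl N (g h) (\<chi> m))"
    unfolding sm_apply sclV hom_space_simps ..
  show "?sm (\<lambda>\<chi> h. scl V (g h) \<chi>) m = cg H M N g \<phi> m"
  proof (cases "m \<in> carr M")
    case m [simp]: True
    show ?thesis unfolding a
    proof (rule vec_eqI[of N])
      fix l assume l: "lin_map N base l"
      note [lin] = lin_compose[OF l]
      have b: "bilin N H (\<lambda>n h. g h * l n)" by (simp add: bilin_def lin)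
      have eq: "delta_Ad H M N \<phi> m = ?sm (\<lambda>\<chi> h. \<chi> m \<otimes>\<^bsub>N,H\<^esub> h)"
        using K \<phi> by (simp add: Kr_iff sw_eq_sm[where U = "tensor N H"] lin)
      have "l (?sm (\<lambda>\<chi> h. scl N (g h) (\<chi> m))) = ?sm (\<lambda>\<chi> h. g h * l (\<chi> m))"
        by (simp add: sm_hom[OF l] scale_closed lin_mapD(3)[OF l])
      also have "\<dots> = ts N H (delta_Ad H M N \<phi> m) (\<lambda>n h. g h * l n)"
        by (simp add: eq sw_sm_base lin)
      also have "\<dots> = l (cg H M N g \<phi> m)"
        by (simp add: delta_Ad_form[OF \<phi> _ b] cg_def sm_hom[OF l] scale_closed sm_closed lin_mapD(3)[OF l])
      finally show "l (?sm (\<lambda>\<chi> h. scl N (g h) (\<chi> m))) = l (cg H M N g \<phi> m)" .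
    qed (auto simp: cg_def scale_closed intro!: sm_closed)
  next
    case False
    have z: "scl N (g h) (\<chi> m) = 0" if "\<chi> \<in> carr V" for \<chi> h
      using subsetD[OF Vhs that] False by (simp add: hom_space_simps vspace_scale_simps[of N])
    have "?sm (\<lambda>\<chi> h. scl N (g h) (\<chi> m)) = ?sm (\<lambda>\<chi> h. 0)"
      by (rule sm_cong[OF refl refl refl refl z])
    then show ?thesis unfolding a by (simp add: cg_def False) (simp add: sm_def split_def)
  qed
qed

lemma Kr_unique:
  assumes "\<phi> \<in> carr hs" "Kr H V M N \<phi> t" "Kr H V M N \<phi> t'"
  shows "t = t'"
  by (rule tensor_eq_contract[OF V is_vspace_H])
    (use assms Kr_contract[OF assms(1)] in \<open>simp_all add: KrD(1)\<close>)

text \<open>Coassociativity in disguise: the coaction of \<open>\<phi>0 g(\<phi>1)\<close> is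
  \<open>\<phi>0 \<otimes> \<phi>1 g(\<phi>2)\<close>. It is derived from the comodules
  \<open>M\<close> and \<open>N\<close> before any coaction on maps exists; it gives closure under
  contraction and later the coassociativity of \<open>HOM\<close>.\<close>

lemma Kr_cg:
  assumes \<phi>: "\<phi> \<in> carr hs" and K: "Kr H V M N \<phi> t" and g: "lin_map H base g"
  shows "Kr H V M N (cg H M N g \<phi>) (ts V H t (\<lambda>\<chi> h. cs H h (\<lambda>a b.
     \<chi> \<otimes>\<^bsub>V,H\<^esub> scl H (g b) a)))"
  unfolding Kr_def
proof (intro conjI ballI allI impI)
  let ?sm = "\<lambda>f. ts V H t f"
  note [lin] = Vlin hs_lin(1)[OF \<phi>] lin_compose[OF g]
  note [simp] = hs_lin(3)[OF \<phi>]
  fix m \<beta> assume m [simp]: "m \<in> carr M" and b: "bilin N H \<beta>"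
  note [lin] = bilinD[OF b]
  have bs [simp]: "n \<in> carr N \<Longrightarrow> \<beta> n (scl H c h) = c * \<beta> n h" for n c h
    using b lin_mapD(3)[of H base "\<beta> n" h c] by (simp add: bilin_def)
  have l: "lin_map N base (\<lambda>u. rs H N u \<beta>)" by (simp add: lin)
  let ?G = "\<lambda>\<chi> h m0 z c. cs H h (\<lambda>a b. g (b * z) * \<beta> (\<chi> m0) (a * c))"
  have "rs H N (cg H M N g \<phi> m) \<beta>
      = rs H M m (\<lambda>m0 m1. rs H N (\<phi> m0) (\<lambda>n0 n1. g (n1 * antipode H m1) * rs H N n0 \<beta>))"
    by (simp add: cg_def sm_hom[OF l] scale_closed sm_closed lin_mapD(3)[OF l])
  also have "\<dots> = rs H M m (\<lambda>m0 m1. rs H N (\<phi> m0) (\<lambda>n0 n1. cs H n1 (\<lambda>y z. g (z * antipode H m1) * \<beta> n0 y)))"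
    by (simp add: sm_mult_left[symmetric] rs_coassoc trilin_def lin)
  also have "\<dots> = rs H M m (\<lambda>m0 m1. ?sm (\<lambda>\<chi> h. rs H M m0 (\<lambda>x y. cs H (h * y) (\<lambda>p q. g (q * antipode H m1) * \<beta> (\<chi> x) p))))"
    by (simp add: KrD(2)[OF K] bilin_def lin)
  also have "\<dots> = rs H M m (\<lambda>m0 m1. ?sm (\<lambda>\<chi> h. rs H M m0 (\<lambda>x y. cs H y (\<lambda>c d. ?G \<chi> h x (d * antipode H m1) c))))"
  proof -
    have "cs H (h * y) (\<lambda>p q. g (q * z) * \<beta> (\<chi> x) p) = cs H y (\<lambda>c d. ?G \<chi> h x (d * z) c)"
      if "\<chi> \<in> carr V" "x \<in> carr M" for \<chi> h x y z
      using that by (subst sm_swap, subst cs_mult) (simp_all add: lin mult.assoc)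
    then show ?thesis by simp
  qed
  also have "\<dots> = ?sm (\<lambda>\<chi> h. rs H M m (\<lambda>m0 m1. rs H M m0 (\<lambda>x y. cs H y (\<lambda>c d. ?G \<chi> h x (d * antipode H m1) c))))"
    by (rule sm_swap)
  also have "\<dots> = ?sm (\<lambda>\<chi> h. rs H M m (\<lambda>m0 q. cs H q (\<lambda>y m1. cs H y (\<lambda>c d. ?G \<chi> h m0 (d * antipode H m1) c))))"
    by (simp add: rs_coassoc trilin_def lin)
  \<comment> \<open>Regrouping makes \<open>d\<close> and \<open>m1\<close> the two halves of one
    coproduct, so that \<open>d * antipode H m1\<close> collapses.\<close>
  also have "\<dots> = ?sm (\<lambda>\<chi> h. rs H M m (\<lambda>m0 q. cs H q (\<lambda>c w. cs H w (\<lambda>d m1. ?G \<chi> h m0 (d * antipode H m1) c))))"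
    by (simp add: cs_coassoc lin)
  also have "\<dots> = ?sm (\<lambda>\<chi> h. rs H M m (\<lambda>m0 q. ?G \<chi> h m0 1 q))"
  proof -
    have "cs H w (\<lambda>d m1. ?G \<chi> h m0 (d * antipode H m1) c) = counit H w * ?G \<chi> h m0 1 c"
      if "\<chi> \<in> carr V" "m0 \<in> carr M" for \<chi> h m0 w c
      using cs_antipode(2)[of "\<lambda>z. ?G \<chi> h m0 z c" w] that by (simp add: lin)
    then show ?thesis by (simp add: cs_counit lin)
  qed
  finally show "rs H N (cg H M N g \<phi> m) \<beta> = ts V H
      (?sm (\<lambda>\<chi> h. cs H h (\<lambda>a b. \<chi> \<otimes>\<^bsub>V,H\<^esub> scl H (g b) a))) (\<lambda>\<chi> h. rs H M m (\<lambda>m0 m1. \<beta> (\<chi> m0) (h * m1)))"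
    by (simp add: sw_sm_base sm_closed lin scl_mult sm_swap[where t = "rco M m"])
qed (auto intro!: sm_closed)

text \<open>A contraction uses the right coactions of \<open>M\<close> and \<open>N\<close> only. As
  they commute with the left ones, it acts on the map component of the left coaction alone, which
  will yield the bicomodule condition for \<open>HOM\<close>.\<close>

lemma Kl_cg:
  assumes \<phi>: "\<phi> \<in> carr hs" and K: "Kl H V M N \<phi> s" and g: "lin_map H base g"
    and W: "is_vspace W" "carr W \<subseteq> carr hs" "scl W = scl hs"
    and VW: "\<And>\<chi>. \<chi> \<in> carr V \<Longrightarrow> cg H M N g \<chi> \<in> carr W"
  shows "Kl H W M N (cg H M N g \<phi>) (ts H V s (\<lambda>h \<chi>. h \<otimes>\<^bsub>H,W\<^esub> cg H M N g \<chi>))"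
  unfolding Kl_def
proof (intro conjI ballI allI impI)
  let ?sm = "\<lambda>f. ts H V s f"
  note [lin] = Vlin hom_space_lin[OF W] hs_lin(1)[OF \<phi>] lin_compose[OF g]
  note [simp] = hs_lin(3)[OF \<phi>] W(1) VW hom_space_closed[OF W(2)]
  fix m \<beta> assume m [simp]: "m \<in> carr M" and b: "bilin H N \<beta>"
  note [lin] = bilinD[OF b]
  have l: "lin_map N base (\<lambda>u. ls H N u \<beta>)" by (simp add: lin)
  have l': "lin_map N base (\<beta> h)" for h using b by (simp add: bilin_def)
  have "ls H N (cg H M N g \<phi> m) \<beta>
      = rs H M m (\<lambda>m0 m1. rs H N (\<phi> m0) (\<lambda>n0 n1. ls H N n0 (\<lambda>p x. g (n1 * antipode H m1) * \<beta> p x)))"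
    by (simp add: cg_def sm_hom[OF l] scale_closed sm_closed lin_mapD(3)[OF l] sm_mult_left)
  also have "\<dots> = rs H M m (\<lambda>m0 m1. ls H N (\<phi> m0) (\<lambda>p n0. rs H N n0 (\<lambda>x y. g (y * antipode H m1) * \<beta> p x)))"
    by (simp add: ls_rs_commute trilin_def lin)
  also have "\<dots> = rs H M m (\<lambda>m0 m1. ?sm (\<lambda>h \<chi>. ls H M m0 (\<lambda>p m00. rs H N (\<chi> m00) (\<lambda>x y. g (y * antipode H m1) * \<beta> (h * p) x))))"
    by (simp add: KlD(2)[OF K] bilin_def lin)
  also have "\<dots> = ?sm (\<lambda>h \<chi>. rs H M m (\<lambda>m0 m1. ls H M m0 (\<lambda>p m00. rs H N (\<chi> m00) (\<lambda>x y. g (y * antipode H m1) * \<beta> (h * p) x))))"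
    by (rule sm_swap)
  also have "\<dots> = ?sm (\<lambda>h \<chi>. ls H M m (\<lambda>p m0. rs H M m0 (\<lambda>z m1. rs H N (\<chi> z) (\<lambda>x y. g (y * antipode H m1) * \<beta> (h * p) x))))"
    by (simp add: ls_rs_commute trilin_def lin)
  also have "\<dots> = ?sm (\<lambda>h \<chi>. ls H M m (\<lambda>p m0. \<beta> (h * p) (cg H M N g \<chi> m0)))"
    by (simp add: cg_def sm_hom[OF l'] scale_closed sm_closed lin_mapD(3)[OF l'])
  finally show "ls H N (cg H M N g \<phi> m) \<beta> = ts H W
      (?sm (\<lambda>h \<chi>. h \<otimes>\<^bsub>H,W\<^esub> cg H M N g \<chi>)) (\<lambda>h \<chi>. ls H M m (\<lambda>p m0. \<beta> (h * p) (\<chi> m0)))"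
    by (simp add: sw_sm_base sm_closed lin)
qed (use VW W(1) in \<open>auto intro!: sm_closed\<close>)

end

end

end

subsection \<open>The bicovariant bimodule of rational morphisms\<close>

text \<open>Cut off outside the carrier of \<open>M\<close>, since members of
  \<open>hom_space\<close> have to vanish there.\<close>

definition rb :: "('k::field, 'h, 'm) bicov \<Rightarrow> 'h \<Rightarrow> ('m \<Rightarrow> 'n::ab_group_add) \<Rightarrow> 'm \<Rightarrow> 'n" where
  "rb M b \<phi> = (\<lambda>m. if m \<in> carr M then \<phi> (lact M b m) else 0)"

lemma HOM_simps:
  "carr (HOM H M N) = carr (HOM_space H M N)" "scl (HOM H M N) = (\<lambda>c \<phi> m. scl N c (\<phi> m))"
  "lact (HOM H M N) a \<phi> = (\<lambda>m. lact N a (\<phi> m))" "ract (HOM H M N) \<phi> a = rb M a \<phi>"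
  by (simp_all add: HOM_def HOM_space_def Let_def rb_def)

context hopf
begin

context
  fixes M :: "('k, 'h, 'm::ab_group_add) bicov" and N :: "('k, 'h, 'n::ab_group_add) bicov"
  assumes M [simp]: "bicov_bimodule H M" and N [simp]: "bicov_bimodule H N"
begin

private abbreviation "hMN \<equiv> hom_space M N"
private lemmas hl = hs_lin[OF M N]

lemma represents_right_iff:
  assumes "\<phi> \<in> carr hMN" "is_vspace V" "carr V \<subseteq> carr hMN" "scl V = scl hMN"
  shows "represents_right H V M N t (delta_Ad H M N \<phi>) \<longleftrightarrow> Kr H V M N \<phi> t"
  using Kr_iff[OF M N assms(2-4,1)] by (auto simp: represents_right_def Kr_def)

text \<open>No antipode occurs in \<open>Kr\<close>, so passing to the mirror image merely flips the
  tensor and transposes the test form. All statements on left coactions of maps are drawn from the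
  right ones through this equivalence.\<close>

lemma Kr_mir:
  assumes \<phi>: "\<phi> \<in> carr hMN" and V [simp]: "is_vspace V" and V': "carr V \<subseteq> carr hMN" "scl V = scl hMN"
  shows "Kr (copH H) V (mir M) (mir N) \<phi> t \<longleftrightarrow> Kl H V M N \<phi> (flip t)"
proof -
  note [lin] = hom_space_lin[OF M N V V'] hl(1)[OF \<phi>]
  note [simp] = hom_space_closed[OF M N V'(1)] hl(3)[OF \<phi>]
  have t: "flip t \<in> carr (tensor H V) \<longleftrightarrow> t \<in> carr (tensor V H)"
    using flip_in[OF V, of t H] flip_in[OF is_vspace_H, of "flip t" V] by auto
  have 1: "rs (copH H) (mir N) (\<phi> m) \<beta>
      = ts V (copH H) t (\<lambda>\<chi> h. rs (copH H) (mir M) m (\<lambda>m0 m1. \<beta> (\<chi> m0) (h * m1)))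
    \<longleftrightarrow> ls H N (\<phi> m) (\<lambda>h n. \<beta> n h)
      = ts H V (flip t) (\<lambda>h \<chi>. ls H M m (\<lambda>p m0. \<beta> (\<chi> m0) (h * p)))"
    if [simp]: "t \<in> carr (tensor V H)" "m \<in> carr M" and b: "bilin N H \<beta>" for m \<beta>
  proof -
    note [lin] = bilinD[OF b]
    show ?thesis by (simp add: sm_flip[where U = base] lin)
  qed
  have "Kr (copH H) V (mir M) (mir N) \<phi> t \<longleftrightarrow> flip t \<in> carr (tensor H V) \<and>
     (\<forall>m\<in>carr M. \<forall>\<beta>. bilin N H \<beta> \<longrightarrow> ls H N (\<phi> m) (\<lambda>h n. \<beta> n h)
      = ts H V (flip t) (\<lambda>h \<chi>. ls H M m (\<lambda>p m0. \<beta> (\<chi> m0) (h * p))))"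
    unfolding Kr_def using 1 t by (auto simp: bilin_cong)
  also have "\<dots> \<longleftrightarrow> Kl H V M N \<phi> (flip t)"
  proof -
    have "(\<forall>\<beta>. bilin N H \<beta> \<longrightarrow> P (\<lambda>h n. \<beta> n h)) \<longleftrightarrow> (\<forall>\<beta>. bilin H N \<beta> \<longrightarrow> P \<beta>)" for P
    proof (intro iffI allI impI)
      fix \<beta> assume *: "\<forall>\<beta>. bilin N H \<beta> \<longrightarrow> P (\<lambda>h n. \<beta> n h)" and b: "bilin H N \<beta>"
      then have "bilin N H (\<lambda>n h. \<beta> h n)" by (auto simp: bilin_def)
      with * show "P \<beta>" by auto
    qed (auto simp: bilin_def)
    from this[of "\<lambda>\<beta>. ls H N (\<phi> m) \<beta> = ts H V (flip t) (\<lambda>h \<chi>. ls H M m (\<lambda>p m0. \<beta> (h * p) (\<chi> m0)))" for m]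
    show ?thesis unfolding Kl_def by simp
  qed
  finally show ?thesis .
qed

text \<open>The flip of \<open>lambda_Ad\<close> over \<open>H\<close> is \<open>delta_Ad\<close>
  over \<open>copH H\<close>, whose antipode is the inverse antipode of \<open>H\<close>; thus
  \<open>Kr_iff\<close> for the mirror image decides the question.\<close>

lemma represents_left_iff:
  assumes \<phi>: "\<phi> \<in> carr hMN" and V [simp]: "is_vspace V" and V': "carr V \<subseteq> carr hMN" "scl V = scl hMN"
  shows "represents_left H V M N s (lambda_Ad H M N \<phi>) \<longleftrightarrow> Kl H V M N \<phi> s"
proof (cases "s \<in> carr (tensor H V)")
  case s [simp]: True
  note [lin] = hom_space_lin[OF M N V V'] hl(1)[OF \<phi>]
  note [simp] = hom_space_closed[OF M N V'(1)] hl(3)[OF \<phi>]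
  have fl: "lin_map (tensor H N) (tensor N H) flip" using flip_lin[OF is_vspace_H lin_id] .
  have 1: "delta_Ad (copH H) (mir M) (mir N) \<phi> m = flip (lambda_Ad H M N \<phi> m)" if [simp]: "m \<in> carr M" for m
    unfolding delta_Ad_def lambda_Ad_def mir_vspace copH_vspace mir_simps copH_simps
    by (simp add: sw_eq_sm[where U = "tensor N H"] sw_eq_sm[where U = "tensor H N"]
      sm_flip[where U = "tensor N H"] lin sm_hom[OF fl] sm_closed flip_in flip_pure)
  have 2: "sw V H (flip s) (\<lambda>\<chi> h. \<chi> m \<otimes>\<^bsub>N,H\<^esub> h) = flip (sw H V s (\<lambda>h \<chi>. h \<otimes>\<^bsub>H,N\<^esub> \<chi> m))"
    if [simp]: "m \<in> carr M" for m
    by (simp add: sw_eq_sm[where U = "tensor N H"] sw_eq_sm[where U = "tensor H N"]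
      sm_flip[where U = "tensor N H"] lin sm_hom[OF fl] sm_closed flip_in flip_pure)
  have "Kl H V M N \<phi> s \<longleftrightarrow> Kr (copH H) V (mir M) (mir N) \<phi> (flip s)"
    by (simp add: Kr_mir[OF \<phi> V V'])
  also have "\<dots> \<longleftrightarrow> (\<forall>m\<in>carr M. flip (lambda_Ad H M N \<phi> m) = flip (sw H V s (\<lambda>h \<chi>. h \<otimes>\<^bsub>H,N\<^esub> \<chi> m)))"
  proof -
    have "flip s \<in> carr (tensor V (copH H))" using flip_in[OF is_vspace_H s] by simp
    from hopf.Kr_iff[OF copH mir_bicov[OF M] mir_bicov[OF N] V _ _ _ this, of \<phi>]
    show ?thesis using V' \<phi> by (simp add: 1 2)
  qed
  also have "\<dots> \<longleftrightarrow> represents_left H V M N s (lambda_Ad H M N \<phi>)"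
    unfolding represents_left_def using s by (metis flip_flip)
  finally show ?thesis by simp
qed (simp add: represents_left_def Kl_def)

lemma Kr_add:
  assumes "is_vspace V" "carr V \<subseteq> carr hMN" "scl V = scl hMN"
    "\<phi> \<in> carr hMN" "\<psi> \<in> carr hMN" "Kr H V M N \<phi> t" "Kr H V M N \<psi> u"
  shows "Kr H V M N (\<phi> + \<psi>) (t + u)" "Kr H V M N (scl hMN c \<phi>) (scl (tensor V H) c t)"
proof -
  note [simp] = assms(1) KrD(1)[OF assms(6)] KrD(1)[OF assms(7)] hl(3)[OF assms(4)] hl(3)[OF assms(5)]
  note [lin] = hom_space_lin[OF M N assms(1-3)]
  have a: "adm (bilinear_forms V H) V H base (\<lambda>\<chi> h. rs H M m (\<lambda>m0 m1. \<beta> (\<chi> m0) (h * m1)))"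
    if [simp]: "m \<in> carr M" and b: "bilin N H \<beta>" for m \<beta>
  proof -
    note [lin] = bilinD[OF b]
    note [simp] = hom_space_closed[OF M N assms(2)]
    show ?thesis by (rule adm_bilinear) (auto simp: lin intro!: bilinear_mapsI)
  qed
  have b: "lin_map N base (\<lambda>n. rs H N n \<beta>)" if "bilin N H \<beta>" for \<beta>
    using bilinD[OF that] by (intro lin_sm_tensor bicov_coaction_lin) (auto intro: lin_id simp: bilin_def that[unfolded bilin_def])
  show "Kr H V M N (\<phi> + \<psi>) (t + u)" unfolding Kr_def
    by (auto intro!: add_closed simp: lin_mapD(2)[OF lin_sm_arg[OF a]] lin_mapD(2)[OF b] KrD(2)[OF assms(6)] KrD(2)[OF assms(7)])
  show "Kr H V M N (scl hMN c \<phi>) (scl (tensor V H) c t)" unfolding Kr_def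
    by (auto intro!: scale_closed simp: lin_mapD(3)[OF lin_sm_arg[OF a]] lin_mapD(3)[OF b] KrD(2)[OF assms(6)] hom_space_simps(2)
      simp del: scl_tensor_space)
qed

lemma Kr_lact:
  assumes V [simp]: "is_vspace V" and V': "carr V \<subseteq> carr hMN" "scl V = scl hMN"
    and \<phi>: "\<phi> \<in> carr hMN" and K: "Kr H V M N \<phi> t"
    and cl [simp]: "\<And>a \<chi>. \<chi> \<in> carr V \<Longrightarrow> (\<lambda>m. lact N a (\<chi> m)) \<in> carr V"
  shows "Kr H V M N (\<lambda>m. lact N a (\<phi> m)) (cs H a (\<lambda>a1 a2. ts V H t (\<lambda>\<chi> h.
     (\<lambda>m. lact N a1 (\<chi> m)) \<otimes>\<^bsub>V,H\<^esub> (a2 * h))))"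
  unfolding Kr_def
proof (intro conjI ballI allI impI)
  note [lin] = hom_space_lin[OF M N V V'] hl(1)[OF \<phi>]
  note [simp] = hom_space_closed[OF M N V'(1)] hl(3)[OF \<phi>]
  fix m \<beta> assume m [simp]: "m \<in> carr M" and b: "bilin N H \<beta>"
  note [lin] = bilinD[OF b]
  have "rs H N (lact N a (\<phi> m)) \<beta> = cs H a (\<lambda>a1 a2. ts V H t (\<lambda>\<chi> h.
     rs H M m (\<lambda>m0 m1. \<beta> (lact N a1 (\<chi> m0)) (a2 * h * m1))))"
    using b by (simp add: rs_lact KrD(2)[OF K] bilin_def lin mult.assoc)
  then show "rs H N (lact N a (\<phi> m)) \<beta> = ts V H (cs H a (\<lambda>a1 a2. 
     ts V H t (\<lambda>\<chi> h. (\<lambda>m. lact N a1 (\<chi> m)) \<otimes>\<^bsub>V,H\<^esub> (a2 * h))))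
       (\<lambda>\<chi> h. rs H M m (\<lambda>m0 m1. \<beta> (\<chi> m0) (h * m1)))"
    by (simp add: sw_sm_base sm_closed lin)
qed (auto intro!: sm_closed)

lemma Kr_ract:
  assumes V [simp]: "is_vspace V" and V': "carr V \<subseteq> carr hMN" "scl V = scl hMN"
    and \<phi>: "\<phi> \<in> carr hMN" and K: "Kr H V M N \<phi> t"
    and cl [simp]: "\<And>b \<chi>. \<chi> \<in> carr V \<Longrightarrow> rb M b \<chi> \<in> carr V"
  shows "Kr H V M N (rb M b \<phi>) (ts V H t (\<lambda>\<chi> h. cs H b (\<lambda>b1 b2. 
     rb M b1 \<chi> \<otimes>\<^bsub>V,H\<^esub> (h * b2))))"
  unfolding Kr_def
proof (intro conjI ballI allI impI)
  note [lin] = hom_space_lin[OF M N V V'] hl(1)[OF \<phi>]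
  note [simp] = hom_space_closed[OF M N V'(1)] hl(3)[OF \<phi>]
  fix m \<beta> assume m [simp]: "m \<in> carr M" and b: "bilin N H \<beta>"
  note [lin] = bilinD[OF b]
  have r [simp]: "m \<in> carr M \<Longrightarrow> rb M b \<chi> m = \<chi> (lact M b m)" for m b \<chi> by (simp add: rb_def)
  have "rs H N (\<phi> (lact M b m)) \<beta> = ts V H t (\<lambda>\<chi> h. cs H b (\<lambda>b1 b2.
     rs H M m (\<lambda>m0 m1. \<beta> (\<chi> (lact M b1 m0)) (h * b2 * m1))))"
    using b by (simp add: rs_lact KrD(2)[OF K] bilin_def lin mult.assoc)
  then show "rs H N (rb M b \<phi> m) \<beta> = ts V H (ts V H t (\<lambda>\<chi> h. cs H b (\<lambda>b1 b2. 
     rb M b1 \<chi> \<otimes>\<^bsub>V,H\<^esub> (h * b2)))) (\<lambda>\<chi> h. rs H M m (\<lambda>m0 m1. \<beta> (\<chi> m0) (h * m1)))"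
    by (simp add: sw_sm_base sm_closed lin)
qed (auto intro!: sm_closed)

lemma hs_act:
  assumes "\<phi> \<in> carr hMN"
  shows "(\<lambda>m. lact N a (\<phi> m)) \<in> carr hMN" "rb M a \<phi> \<in> carr hMN"
proof -
  note [lin] = hl(1)[OF assms] hl(4)[OF assms] and [simp] = hl(3)[OF assms]
  have z: "lact N a 0 = 0" by (rule lin_map_zero[of N N "lact N a"]) (simp_all add: lin)
  have "lin_map M N (\<lambda>m. lact N a (\<phi> m))" by (simp add: lin)
  then show "(\<lambda>m. lact N a (\<phi> m)) \<in> carr hMN" using assms by (simp add: hom_space_simps z)
  have "lin_map M N (\<lambda>m. rb M a \<phi> m)" by (subst lin_map_cong[where g = "\<lambda>m. \<phi> (lact M a m)"]) (simp_all add: rb_def lin)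
  then show "rb M a \<phi> \<in> carr hMN" by (simp add: hom_space_simps rb_def)
qed

definition rational :: "('m \<Rightarrow> 'n) \<Rightarrow> bool" where
  "rational \<phi> \<longleftrightarrow> \<phi> \<in> carr hMN \<and> (\<exists>t. Kr H hMN M N \<phi> t) \<and> (\<exists>s. Kl H hMN M N \<phi> s)"

lemma HOM_space_rational:
  "carr (HOM_space H M N) = {\<phi>. rational \<phi>}" "scl (HOM_space H M N) = scl hMN"
  using represents_right_iff[of _ hMN] represents_left_iff[of _ hMN]
  by (auto simp: HOM_space_def rational_def hom_space_simps(2))

lemma HOM_space_vspace [simp]: "is_vspace (HOM_space H M N)"
  and HOM_space_sub: "carr (HOM_space H M N) \<subseteq> carr hMN"
proof -
  show "carr (HOM_space H M N) \<subseteq> carr hMN" by (auto simp: HOM_space_rational rational_def)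
  \<comment> \<open>Rationality is expressed by \<open>Kr\<close> over \<open>H\<close> and
    \<open>Kr\<close> over the mirror image, so that \<open>Kr_add\<close> serves for both
    coactions.\<close>
  have mk: "rational \<phi>" if "\<phi> \<in> carr hMN" "Kr H hMN M N \<phi> t" "Kr (copH H) hMN (mir M) (mir N) \<phi> u" for \<phi> t u
    using that Kr_mir[of \<phi> hMN] by (auto simp: rational_def)
  have dk: "\<exists>t u. Kr H hMN M N \<phi> t \<and> Kr (copH H) hMN (mir M) (mir N) \<phi> u" if r: "rational \<phi>" for \<phi>
  proof -
    obtain t s where ts: "Kr H hMN M N \<phi> t" "Kl H hMN M N \<phi> s" "\<phi> \<in> carr hMN"
      using r by (auto simp: rational_def)
    then have "Kr (copH H) hMN (mir M) (mir N) \<phi> (flip s)" by (simp add: Kr_mir)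
    with ts show ?thesis by blast
  qed
  note mirr = hopf.Kr_add[OF copH mir_bicov[OF M] mir_bicov[OF N], of hMN, unfolded mir_vspace]
  have add: "rational (\<phi> + \<psi>)" if "rational \<phi>" "rational \<psi>" for \<phi> \<psi>
  proof -
    have h: "\<phi> \<in> carr hMN" "\<psi> \<in> carr hMN" using that by (auto simp: rational_def)
    from dk[OF that(1)] dk[OF that(2)] obtain t u t' u' where
      k: "Kr H hMN M N \<phi> t" "Kr (copH H) hMN (mir M) (mir N) \<phi> u"
      "Kr H hMN M N \<psi> t'" "Kr (copH H) hMN (mir M) (mir N) \<psi> u'" by blast
    show ?thesis
      by (rule mk[OF add_closed[OF _ h] Kr_add(1)[OF _ _ _ h k(1,3)] mirr(1)[OF _ _ _ h k(2,4)]]) simp_all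
  qed
  have scale: "rational (scl hMN c \<phi>)" if "rational \<phi>" for c \<phi>
  proof -
    have h: "\<phi> \<in> carr hMN" using that by (auto simp: rational_def)
    from dk[OF that] obtain t u where
      k: "Kr H hMN M N \<phi> t" "Kr (copH H) hMN (mir M) (mir N) \<phi> u" by blast
    show ?thesis
      by (rule mk[OF scale_closed[OF _ h] Kr_add(2)[OF _ _ _ h h k(1,1)] mirr(2)[OF _ _ _ h h k(2,2)]]) simp_all
  qed
  interpret h: vector_space "scl hMN" using is_vspace_hom_space[OF bicov_simps(1)[OF M] bicov_simps(1)[OF N]] unfolding is_vspace_def by blast
  have "rational 0"
  proof -
    have h: "0 \<in> carr hMN" by (simp add: zero_closed)
    note [lin] = hl
    note [simp] = hl(3)
    have "Kr H hMN M N 0 0" unfolding Kr_def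
    proof (intro conjI ballI allI impI)
      fix m \<beta> assume [simp]: "m \<in> carr M" and b: "bilin N H \<beta>"
      note [lin] = bilinD[OF b]
      have l: "lin_map N base (\<lambda>n. rs H N n \<beta>)" by (simp add: lin)
      have r: "lin_map (tensor hMN H) base (\<lambda>t. ts hMN H t
        (\<lambda>\<chi> h. rs H M m (\<lambda>m0 m1. \<beta> (\<chi> m0) (h * m1))))" by (simp add: lin)
      show "rs H N (0 m) \<beta> = ts hMN H 0
        (\<lambda>\<chi> h. rs H M m (\<lambda>m0 m1. \<beta> (\<chi> m0) (h * m1)))"
        using lin_map_zero[OF bicov_simps(1)[OF N] l] lin_map_zero[OF is_vspace_tensor_space r] by simp
    qed (simp add: zero_closed)
    moreover have "Kl H hMN M N 0 0" unfolding Kl_def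
    proof (intro conjI ballI allI impI)
      fix m \<beta> assume [simp]: "m \<in> carr M" and b: "bilin H N \<beta>"
      note [lin] = bilinD[OF b]
      have l: "lin_map N base (\<lambda>n. ls H N n \<beta>)" by (simp add: lin)
      have r: "lin_map (tensor H hMN) base (\<lambda>t. ts H hMN t
        (\<lambda>h \<chi>. ls H M m (\<lambda>p m0. \<beta> (h * p) (\<chi> m0))))" by (simp add: lin)
      show "ls H N (0 m) \<beta> = ts H hMN 0
        (\<lambda>h \<chi>. ls H M m (\<lambda>p m0. \<beta> (h * p) (\<chi> m0)))"
        using lin_map_zero[OF bicov_simps(1)[OF N] l] lin_map_zero[OF is_vspace_tensor_space r] by simp
    qed (simp add: zero_closed)
    ultimately show ?thesis using h by (auto simp: rational_def)
  qed
  then have "h.subspace {\<phi>. rational \<phi>}"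
    using add scale by (intro h.subspaceI) auto
  then show "is_vspace (HOM_space H M N)"
    using h.vector_space_axioms by (simp add: is_vspace_def HOM_space_rational)
qed

lemma rational_cg:
  assumes "rational \<phi>" "lin_map H base g"
  shows "rational (cg H M N g \<phi>)"
proof -
  from assms(1) obtain t s where h: "\<phi> \<in> carr hMN" and k: "Kr H hMN M N \<phi> t" "Kl H hMN M N \<phi> s"
    by (auto simp: rational_def)
  show ?thesis unfolding rational_def
    using cg_in[OF M N h assms(2)] Kr_cg[OF M N _ _ _ h k(1) assms(2)]
      Kl_cg[OF M N _ _ _ h k(2) assms(2), of hMN] cg_in[OF M N _ assms(2)] by auto
qed

text \<open>Expanding the coaction in a basis of \<open>H\<close> gives contractions of
  \<open>\<phi>\<close> as coefficients, and these are rational by \<open>rational_cg\<close>. The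
  sum has to be formed again with the forms on \<open>HOM_space\<close>.\<close>

lemma Kr_HOM_space:
  assumes "rational \<phi>"
  shows "\<exists>t. Kr H (HOM_space H M N) M N \<phi> t"
proof -
  let ?V = "HOM_space H M N"
  from assms obtain t where \<phi>: "\<phi> \<in> carr hMN" and k: "Kr H hMN M N \<phi> t" by (auto simp: rational_def)
  obtain es g where es: "set es \<subseteq> carr H" "\<And>e. lin_map H base (g e)"
    and t: "t = (\<Sum>e\<leftarrow>es. pure (bilinear_forms hMN H)
      (ts hMN H t (\<lambda>v w. scl hMN (g e w) v)) e)"
    using tensor_expand[OF _ is_vspace_H KrD(1)[OF k]] by auto
  have cg: "cg H M N (g e) \<phi> \<in> carr ?V" "cg H M N (g e) \<phi> \<in> carr hMN" for e
    using rational_cg[OF assms es(2)] HOM_space_sub by (auto simp: HOM_space_rational)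
  have t: "t = (\<Sum>e\<leftarrow>es. pure (bilinear_forms hMN H) (cg H M N (g e) \<phi>) e)"
    by (subst t) (simp only: Kr_contract[OF M N is_vspace_hom_space[OF bicov_simps(1)[OF M] bicov_simps(1)[OF N]] subset_refl refl \<phi> k es(2)])
  let ?t = "\<Sum>e\<leftarrow>es. pure (bilinear_forms ?V H) (cg H M N (g e) \<phi>) e"
  have "Kr H ?V M N \<phi> ?t" unfolding Kr_def
  proof (intro conjI ballI allI impI)
    show "?t \<in> carr (tensor ?V H)" by (rule sum_list_closed) (simp_all add: cg)
    fix m \<beta> assume m [simp]: "m \<in> carr M" and b: "bilin N H \<beta>"
    note [lin] = bilinD[OF b]
    let ?f = "\<lambda>\<chi> h. rs H M m (\<lambda>m0 m1. \<beta> (\<chi> m0) (h * m1))"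
    \<comment> \<open>Stated for a variable \<open>V\<close> in order to evaluate the given tensor
      over \<open>hom_space\<close> and the new one over \<open>HOM_space\<close> by the same finite
      sum.\<close>
    have 1: "ts V H (\<Sum>e\<leftarrow>es. pure (bilinear_forms V H) (cg H M N (g e) \<phi>) e) ?f
       = (\<Sum>e\<leftarrow>es. ?f (cg H M N (g e) \<phi>) e)"
      if V [simp]: "is_vspace V" and V': "carr V \<subseteq> carr hMN" "scl V = scl hMN" and c: "\<And>e. cg H M N (g e) \<phi> \<in> carr V"
      for V :: "('k, 'm \<Rightarrow> 'n) vspace"
    proof -
      note [lin] = hom_space_lin[OF M N V V']
      note [simp] = hom_space_closed[OF M N V'(1)]
      have ad: "adm (bilinear_forms V H) V H base ?f"
        by (rule adm_bilinear) (auto simp: lin intro!: bilinear_mapsI)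
      show ?thesis
        by (subst lin_map_sum_list[OF _ lin_sm_arg[OF ad]]) (simp_all add: c sm_pure[OF ad])
    qed
    show "rs H N (\<phi> m) \<beta> = ts ?V H ?t ?f"
      using KrD(2)[OF k m b] t 1[of hMN] 1[of ?V] cg HOM_space_sub HOM_space_rational(2) by simp
  qed
  then show ?thesis by blast
qed

end

lemma rational_mir:
  assumes M: "bicov_bimodule H M" and N: "bicov_bimodule H N"
  shows "hopf.rational (copH H) (mir M) (mir N) \<phi> \<longleftrightarrow> rational M N \<phi>"
proof -
  let ?hs = "hom_space M N"
  note [simp] = bicov_simps(1)[OF M] bicov_simps(1)[OF N]
  have 1: "Kr (copH H) ?hs (mir M) (mir N) \<phi> t \<longleftrightarrow> Kl H ?hs M N \<phi> (flip t)" if "\<phi> \<in> carr ?hs" for t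
    using Kr_mir[OF M N that _ subset_refl refl] by simp
  have 2: "Kr H ?hs M N \<phi> t \<longleftrightarrow> Kl (copH H) ?hs (mir M) (mir N) \<phi> (flip t)" if "\<phi> \<in> carr ?hs" for t
    using hopf.Kr_mir[OF copH mir_bicov[OF M] mir_bicov[OF N], of \<phi> ?hs t] that
    by (simp add: copH_copH[OF bij_antipode])
  show ?thesis unfolding rational_def[OF M N] hopf.rational_def[OF copH mir_bicov[OF M] mir_bicov[OF N]]
    using 1 2 by simp (metis flip_flip)
qed

context
  fixes M :: "('k, 'h, 'm::ab_group_add) bicov" and N :: "('k, 'h, 'n::ab_group_add) bicov"
  assumes M [simp]: "bicov_bimodule H M" and N [simp]: "bicov_bimodule H N"
begin

private abbreviation "hom' \<equiv> hom_space M N"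
private abbreviation "HS \<equiv> HOM_space H M N"
private lemmas HSv = HOM_space_vspace[OF M N] HOM_space_sub[OF M N] HOM_space_rational(2)[OF M N]

lemma HOM_space_mir: "HOM_space (copH H) (mir M) (mir N) = HS"
  using HOM_space_rational(1)[OF M N] hopf.HOM_space_rational(1)[OF copH mir_bicov[OF M] mir_bicov[OF N]]
  by (auto simp: rational_mir HOM_space_def)

text \<open>Existence from \<open>Kr_HOM_space\<close> and uniqueness from \<open>Kr_unique\<close>
  justify the definite description in \<open>HOM\<close>.\<close>

lemma HOM_rco:
  assumes "\<phi> \<in> carr HS"
  shows "Kr H HS M N \<phi> (rco (HOM H M N) \<phi>)"
proof -
  have \<phi>: "\<phi> \<in> carr hom'" and r: "rational M N \<phi>"
    using assms HSv(2) by (auto simp: HOM_space_rational)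
  obtain t where t: "Kr H HS M N \<phi> t" using Kr_HOM_space[OF M N r] by blast
  have "rco (HOM H M N) \<phi> = (THE t. Kr H HS M N \<phi> t)"
    by (simp add: HOM_def Let_def represents_right_iff[OF M N \<phi> HSv])
  also have "\<dots> = t"
    using Kr_unique[OF M N HSv \<phi> _ t] t by blast
  finally show ?thesis using t by simp
qed

lemma HOM_lco:
  assumes "\<phi> \<in> carr HS"
  shows "Kl H HS M N \<phi> (lco (HOM H M N) \<phi>)"
proof -
  note mir = copH mir_bicov[OF M] mir_bicov[OF N]
  have \<phi>: "\<phi> \<in> carr hom'" and r: "rational M N \<phi>"
    using assms HSv(2) by (auto simp: HOM_space_rational)
  have K: "Kl H HS M N \<phi> s \<longleftrightarrow> Kr (copH H) HS (mir M) (mir N) \<phi> (flip s)" for s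
    using Kr_mir[OF M N \<phi> HSv, of "flip s"] by simp
  have "hopf.rational (copH H) (mir M) (mir N) \<phi>" using r by (simp add: rational_mir)
  from hopf.Kr_HOM_space[OF mir this]
  obtain t where t: "Kr (copH H) HS (mir M) (mir N) \<phi> t" unfolding HOM_space_mir by blast
  then have s: "Kl H HS M N \<phi> (flip t)" by (simp add: K)
  have "lco (HOM H M N) \<phi> = (THE s. Kl H HS M N \<phi> s)"
    by (simp add: HOM_def Let_def represents_left_iff[OF M N \<phi> HSv])
  also have "\<dots> = flip t"
  proof (rule the_equality)
    show "Kl H HS M N \<phi> (flip t)" by (rule s)
    fix s assume "Kl H HS M N \<phi> s"
    then have "flip s = t"
      using hopf.Kr_unique[OF mir, of HS \<phi>] t HSv \<phi> by (simp add: K)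
    then show "s = flip t" by auto
  qed
  finally show ?thesis using s by simp
qed

lemma HOM_space_act:
  assumes "\<phi> \<in> carr HS"
  shows "(\<lambda>m. lact N a (\<phi> m)) \<in> carr HS" "rb M a \<phi> \<in> carr HS"
proof -
  note mir = copH mir_bicov[OF M] mir_bicov[OF N]
  have \<phi>: "\<phi> \<in> carr hom'" and r: "rational M N \<phi>"
    using assms HSv(2) by (auto simp: HOM_space_rational)
  obtain t s where k: "Kr H hom' M N \<phi> t" "Kl H hom' M N \<phi> s" using r by (auto simp: rational_def)
  then have k': "Kr (copH H) hom' (mir M) (mir N) \<phi> (flip s)" using Kr_mir[OF M N \<phi>, of hom'] by simp
  have hv: "is_vspace hom'" "carr hom' \<subseteq> carr hom'" "scl hom' = scl hom'" by simp_all
  have hv': "is_vspace hom'" "carr hom' \<subseteq> carr (hom_space (mir M) (mir N))" "scl hom' = scl (hom_space (mir M) (mir N))" by simp_all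
  have \<phi>': "\<phi> \<in> carr (hom_space (mir M) (mir N))" using \<phi> by simp
  have rbm: "rb (mir M) a \<chi> = rb M a \<chi>" for a and \<chi> :: "'m \<Rightarrow> 'n" by (simp add: rb_def fun_eq_iff)
  have "Kr (copH H) hom' (mir M) (mir N) (\<lambda>m. lact (mir N) a (\<phi> m)) u
      \<Longrightarrow> Kl H hom' M N (\<lambda>m. lact N a (\<phi> m)) (flip u)" for u
    using Kr_mir[OF M N hs_act(1)[OF M N \<phi>] hv, of a u] by simp
  from this[OF hopf.Kr_lact[OF mir hv' \<phi>' k']] Kr_lact[OF M N hv \<phi> k(1)] hs_act[OF M N]
  have "rational M N (\<lambda>m. lact N a (\<phi> m))" unfolding rational_def[OF M N] using \<phi> by auto
  then show "(\<lambda>m. lact N a (\<phi> m)) \<in> carr HS" by (simp add: HOM_space_rational)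
  have "Kr (copH H) hom' (mir M) (mir N) (rb M a \<phi>) u \<Longrightarrow> Kl H hom' M N (rb M a \<phi>) (flip u)" for u
    using Kr_mir[OF M N hs_act(2)[OF M N \<phi>] hv, of a u] by simp
  from this[OF hopf.Kr_ract[OF mir hv' \<phi>' k', unfolded rbm]] Kr_ract[OF M N hv \<phi> k(1)] hs_act[OF M N]
  have "rational M N (rb M a \<phi>)" unfolding rational_def[OF M N] using \<phi> by auto
  then show "rb M a \<phi> \<in> carr HS" by (simp add: HOM_space_rational)
qed

text \<open>\<open>X\<close> is kept abstract so that the mirror image of \<open>HOM\<close> is
  covered as well. The axioms are read off from candidates for the coaction: whatever satisfies
  \<open>Kr\<close> for a map must be its coaction.\<close>

lemma rside_HOM:
  fixes X :: "('k, 'h, 'm \<Rightarrow> 'n) bicov"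
  assumes X: "carr X = carr HS" "scl X = scl HS"
    and act: "\<And>a \<phi>. lact X a \<phi> = (\<lambda>m. lact N a (\<phi> m))" "\<And>a \<phi>. ract X \<phi> a = rb M a \<phi>"
    and bim: "bimod H X" and co: "\<And>\<phi>. \<phi> \<in> carr X \<Longrightarrow> Kr H X M N \<phi> (rco X \<phi>)"
  shows "lin_map X (tensor X H) (rco X)" "rside H X"
proof -
  note X' = bimodD(1)[OF bim] X(1)[THEN equalityD1, THEN subset_trans, OF HSv(2)] X(2)[unfolded HSv(3)]
  note [simp] = bimodD(1-7)[OF bim] KrD(1)[OF co]
  have hom: "\<phi> \<in> carr hom'" if "\<phi> \<in> carr X" for \<phi> using X'(2) that by auto
  note U = Kr_unique[OF M N X' hom]
  have sX: "scl X = scl hom'" using X'(3) .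
  show lin_rco: "lin_map X (tensor X H) (rco X)"
  proof (rule lin_mapI)
    fix \<phi> \<psi> c assume p: "\<phi> \<in> carr X"
    show "rco X (scl X c \<phi>) = scl (tensor X H) c (rco X \<phi>)"
    proof (rule U)
      show s: "scl X c \<phi> \<in> carr X" using p by (simp add: scale_closed)
      show "Kr H X M N (scl X c \<phi>) (rco X (scl X c \<phi>))" by (rule co[OF s])
      show "Kr H X M N (scl X c \<phi>) (scl (tensor X H) c (rco X \<phi>))"
        unfolding sX by (rule Kr_add(2)[OF M N X' hom[OF p] hom[OF p] co[OF p] co[OF p]])
    qed
    assume q: "\<psi> \<in> carr X"
    show "rco X (\<phi> + \<psi>) = rco X \<phi> + rco X \<psi>"
    proof (rule U)
      show s: "\<phi> + \<psi> \<in> carr X" using p q by (simp add: add_closed)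
      show "Kr H X M N (\<phi> + \<psi>) (rco X (\<phi> + \<psi>))" by (rule co[OF s])
      show "Kr H X M N (\<phi> + \<psi>) (rco X \<phi> + rco X \<psi>)"
        by (rule Kr_add(1)[OF M N X' hom[OF p] hom[OF q] co[OF p] co[OF q]])
    qed
  qed simp
  note [lin] = hom_space_lin[OF M N X'] lin_compose[OF lin_rco] bimodD(9-)[OF bim]
  note [simp] = hom_space_closed[OF M N X'(2)]
  have cl: "\<chi> \<in> carr X \<Longrightarrow> (\<lambda>m. lact N a (\<chi> m)) \<in> carr X" "\<chi> \<in> carr X \<Longrightarrow> rb M a \<chi> \<in> carr X" for a \<chi>
    using HOM_space_act X(1) by auto
  show "rside H X" unfolding rside_def
  proof (intro conjI ballI allI impI)
    fix \<phi> assume p [simp]: "\<phi> \<in> carr X"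
    {
      fix f assume f: "trilin X H H f"
      note [lin] = trilinD[OF f]
      let ?T = "tensor X H"
      \<comment> \<open>The two sides of coassociativity. Contracted with \<open>g\<close> in the
        last factor, both are the coaction of \<open>cg H M N g \<phi>\<close>: \<open>?T1\<close>
        because the coaction is linear, \<open>?T2\<close> by \<open>Kr_cg\<close>.\<close>
      let ?T1 = "rs H X \<phi> (\<lambda>\<phi>0 \<phi>1. rco X \<phi>0 \<otimes>\<^bsub>?T,H\<^esub> \<phi>1)"
      let ?T2 = "rs H X \<phi> (\<lambda>\<phi>0 \<phi>1. cs H \<phi>1 (\<lambda>a b. (\<phi>0 \<otimes>\<^bsub>X,H\<^esub> a) \<otimes>\<^bsub>?T,H\<^esub> b))"
      have "?T1 = ?T2"
      proof (rule tensor_eq_contract)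
        fix g assume g: "lin_map H base g"
        note [lin] = lin_compose[OF g] g
        have cgX: "cg H M N g \<phi> \<in> carr X"
          using rational_cg[OF M N _ g] p X(1) by (simp add: HOM_space_rational)
        have sc: "\<chi> \<in> carr X \<Longrightarrow> \<chi> \<otimes>\<^bsub>X,H\<^esub> scl H c a = scl ?T c (\<chi> \<otimes>\<^bsub>X,H\<^esub> a)" for \<chi> c a
          using lin_mapD(3)[of H ?T "\<lambda>a. \<chi> \<otimes>\<^bsub>X,H\<^esub> a" a c] by (simp add: lin)
        have "ts ?T H ?T1 (\<lambda>v w. scl ?T (g w) v) = rs H X \<phi> (\<lambda>\<phi>0 \<phi>1. scl ?T (g \<phi>1) (rco X \<phi>0))"
          by (simp add: sm_sm_tensor[where U = ?T] sm_tens[where U = ?T] lin del: scl_tensor_space)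
        also have "\<dots> = rs H X \<phi> (\<lambda>\<phi>0 \<phi>1. rco X (scl X (g \<phi>1) \<phi>0))"
          by (simp add: lin_mapD(3)[OF lin_rco] del: scl_tensor_space)
        also have "\<dots> = rco X (rs H X \<phi> (\<lambda>\<phi>0 \<phi>1. scl X (g \<phi>1) \<phi>0))"
          by (subst sm_hom[OF lin_rco]) (simp_all add: scale_closed)
        also have "\<dots> = rco X (cg H M N g \<phi>)"
          by (simp only: Kr_contract[OF M N X' hom[OF p] co[OF p] g])
        also have "\<dots> = rs H X \<phi> (\<lambda>\<phi>0 \<phi>1. cs H \<phi>1 (\<lambda>a b. \<phi>0 \<otimes>\<^bsub>X,H\<^esub> scl H (g b) a))"
          by (rule U[OF cgX co[OF cgX] Kr_cg[OF M N X' hom[OF p] co[OF p] g]])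
        also have "\<dots> = ts ?T H ?T2 (\<lambda>v w. scl ?T (g w) v)"
          by (simp add: sm_sm_tensor[where U = ?T] sm_tens[where U = ?T] lin sm_closed sc del: scl_tensor_space)
        finally show "ts ?T H ?T1 (\<lambda>v w. scl ?T (g w) v)
          = ts ?T H ?T2 (\<lambda>v w. scl ?T (g w) v)" .
      qed (auto intro!: sm_closed)
      from arg_cong[OF this, of "\<lambda>t. ts ?T H t (\<lambda>u h. ts X H u (\<lambda>\<chi> a. f \<chi> a h))"]
      show "rs H X \<phi> (\<lambda>m0 m1. rs H X m0 (\<lambda>x y. f x y m1)) = rs H X \<phi> (\<lambda>m0 m1. cs H m1 (\<lambda>y z. f m0 y z))"
        by (simp add: sw_sm_base lin sm_closed)
    next
      fix l assume l: "lin_map X base l"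
      have "rs H X \<phi> (\<lambda>m0 m1. scl X (counit H m1) m0) = \<phi>"
      proof
        fix m
        have a: "rs H X \<phi> (\<lambda>m0 m1. scl X (counit H m1) m0) m = rs H X \<phi> (\<lambda>m0 m1. scl N (counit H m1) (m0 m))"
          unfolding sm_apply X'(3) hom_space_simps ..
        show "rs H X \<phi> (\<lambda>m0 m1. scl X (counit H m1) m0) m = \<phi> m"
        proof (cases "m \<in> carr M")
          case m [simp]: True
          show ?thesis unfolding a
          proof (rule vec_eqI[of N])
            fix k assume k: "lin_map N base k"
            note [lin] = lin_compose[OF k] k
            \<comment> \<open>The relation \<open>Kr\<close> is evaluated at this form: the counit
              is multiplicative, and the counit laws of \<open>M\<close> and \<open>N\<close> remove
              the remaining components.\<close>
            have "bilin N H (\<lambda>n h. counit H h * k n)" by (simp add: bilin_def lin)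
            from KrD(2)[OF co[OF p] m this]
            have "rs H N (\<phi> m) (\<lambda>n h. counit H h * k n) = rs H X \<phi> (\<lambda>m0 m1. counit H m1 * k (m0 m))"
              by (simp add: counit_mult mult.assoc sm_mult_left rs_counit lin)
            then show "k (rs H X \<phi> (\<lambda>m0 m1. scl N (counit H m1) (m0 m))) = k (\<phi> m)"
              by (simp add: rs_counit lin sm_hom[OF k] scale_closed lin_mapD(3)[OF k])
          qed (auto simp: scale_closed intro!: sm_closed)
        next
          case False
          have z: "scl N (g h) (\<chi> m) = 0" if "\<chi> \<in> carr X" for \<chi> and g :: "'h \<Rightarrow> 'k" and h
            using hom[OF that] False by (simp add: hom_space_simps vspace_scale_simps[of N])
          have "rs H X \<phi> (\<lambda>m0 m1. scl N (counit H m1) (m0 m)) = rs H X \<phi> (\<lambda>m0 m1. 0)"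
            by (rule sm_cong[OF refl refl refl refl z])
          also have "\<dots> = \<phi> m" using hom[OF p] False by (simp add: hom_space_simps sm_def split_def)
          finally show ?thesis unfolding a .
        qed
      qed
      from arg_cong[OF this, of l]
      show "rs H X \<phi> (\<lambda>m0 m1. counit H m1 * l m0) = l \<phi>"
        by (simp add: sm_hom[OF l] scale_closed lin_mapD(3)[OF l])
    next
      fix a f assume f: "bilin X H f"
      note [lin] = bilinD[OF f]
      have "rco X (lact X a \<phi>) = cs H a (\<lambda>a1 a2. rs H X \<phi> (\<lambda>\<chi> h. (\<lambda>m. lact N a1 (\<chi> m)) \<otimes>\<^bsub>X,H\<^esub> (a2 * h)))"
        unfolding act
        by (rule U[OF cl(1)[OF p] co[OF cl(1)[OF p]] Kr_lact[OF M N X' hom[OF p] co[OF p] cl(1)]])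
      then show "rs H X (lact X a \<phi>) f = cs H a (\<lambda>a1 a2. rs H X \<phi> (\<lambda>m0 m1. f (lact X a1 m0) (a2 * m1)))"
        by (simp add: sw_sm_base sm_closed lin cl act)
      have "rco X (ract X \<phi> a) = rs H X \<phi> (\<lambda>\<chi> h. cs H a (\<lambda>b1 b2. rb M b1 \<chi> \<otimes>\<^bsub>X,H\<^esub> (h * b2)))"
        unfolding act
        by (rule U[OF cl(2)[OF p] co[OF cl(2)[OF p]] Kr_ract[OF M N X' hom[OF p] co[OF p] cl(2)]])
      then show "rs H X (ract X \<phi> a) f = rs H X \<phi> (\<lambda>m0 m1. cs H a (\<lambda>b1 b2. f (ract X m0 b1) (m1 * b2)))"
        by (simp add: sw_sm_base sm_closed lin cl act)
    }
  qed
qed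

lemma bimod_HOM: "bimod H (HOM H M N)"
proof -
  let ?X = "HOM H M N"
  have sX: "scl ?X = scl hom'" by (simp add: HOM_simps hom_space_simps)
  have cX: "carr ?X = carr HS" by (simp add: HOM_simps)
  have vX [simp]: "is_vspace ?X"
    using HSv(1) vspace_cong(1)[OF cX] sX HSv(3) by simp
  have hom: "\<phi> \<in> carr hom'" if "\<phi> \<in> carr ?X" for \<phi> using HSv(2) that cX by auto
  have cl: "(\<lambda>m. lact N a (\<chi> m)) \<in> carr ?X" "rb M a \<chi> \<in> carr ?X" if "\<chi> \<in> carr ?X" for a \<chi>
    using HOM_space_act[of \<chi>] that cX by auto
  note [lin] = hom_space_lin[OF M N vX HSv(2)[folded cX] sX]
  note [simp] = hom_space_closed[OF M N HSv(2)[folded cX]]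
  have z: "\<phi> m = 0" if "\<phi> \<in> carr ?X" "m \<notin> carr M" for \<phi> m
    using hom[OF that(1)] that(2) by (simp add: hom_space_simps)
  have lz [simp]: "lact N a 0 = 0" for a by (rule lin_map_zero[of N N "lact N a"]) (simp_all add: lin)
  have la: "lin_map N N (lact N a)" for a by (simp add: lin)
  have all: "\<phi> m \<in> carr N" if "\<phi> \<in> carr ?X" for \<phi> m
    using that z[OF that] by (cases "m \<in> carr M") (simp_all add: zero_closed)
  have 1: "lin_map ?X ?X (lact ?X a)" for a
    by (rule lin_mapI) (simp_all add: HOM_simps cl[unfolded HOM_simps] fun_eq_iff
        lin_mapD(2,3)[OF la] all[unfolded HOM_simps])
  have la': "n \<in> carr N \<Longrightarrow> lin_map H N (\<lambda>a. lact N a n)" for n by (simp add: lin)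
  have 2: "lin_map H ?X (\<lambda>a. lact ?X a \<phi>)" if p: "\<phi> \<in> carr ?X" for \<phi>
    by (rule lin_mapI) (use p in \<open>simp_all add: HOM_simps cl[unfolded HOM_simps] fun_eq_iff
        lin_mapD(2,3)[OF la'] all[unfolded HOM_simps]\<close>)
  have 3: "lin_map ?X ?X (\<lambda>\<phi>. ract ?X \<phi> a)" for a
    by (rule lin_mapI) (simp_all add: HOM_simps cl[unfolded HOM_simps rb_def] fun_eq_iff rb_def vspace_scale_simps[of N])
  have 4: "lin_map H ?X (\<lambda>a. ract ?X \<phi> a)" if p: "\<phi> \<in> carr ?X" for \<phi>
  proof -
    have r: "m \<in> carr M \<Longrightarrow> lin_map H N (\<lambda>a. \<phi> (lact M a m))" for m
      using lin_compose[of M N \<phi> H "\<lambda>a. lact M a m"] hom[OF p] by (simp add: hom_space_simps lin)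
    show ?thesis
      by (rule lin_mapI) (use p in \<open>simp_all add: HOM_simps cl[unfolded HOM_simps rb_def] fun_eq_iff rb_def
        lin_mapD(2,3)[OF r] vspace_scale_simps[of N]\<close>)
  qed
  have "lact ?X 1 \<phi> = \<phi>" "ract ?X \<phi> 1 = \<phi>" "lact ?X (a * b) \<phi> = lact ?X a (lact ?X b \<phi>)"
    "ract ?X \<phi> (a * b) = ract ?X (ract ?X \<phi> a) b" "ract ?X (lact ?X a \<phi>) b = lact ?X a (ract ?X \<phi> b)"
    if p: "\<phi> \<in> carr ?X" for \<phi> a b
    using all[OF p] z[OF p] by (auto simp: HOM_simps fun_eq_iff rb_def)
  then show ?thesis using 1 2 3 4
    by (simp add: bimod_def left_module_def right_module_def bilinear_maps_iff)
qed

lemma HOM_eqs: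
  "is_vspace (HOM H M N)" "carr (HOM H M N) \<subseteq> carr hom'" "scl (HOM H M N) = scl hom'"
  using bimodD(1)[OF bimod_HOM] HSv(2) by (simp_all add: HOM_simps hom_space_simps)

lemma HOM_coactions:
  assumes "\<phi> \<in> carr (HOM H M N)"
  shows "Kr H (HOM H M N) M N \<phi> (rco (HOM H M N) \<phi>)" "Kl H (HOM H M N) M N \<phi> (lco (HOM H M N) \<phi>)"
proof -
  have v: "carr (HOM H M N) = carr HS" "scl (HOM H M N) = scl HS"
    by (simp_all add: HOM_simps HOM_space_def)
  show "Kr H (HOM H M N) M N \<phi> (rco (HOM H M N) \<phi>)" "Kl H (HOM H M N) M N \<phi> (lco (HOM H M N) \<phi>)"
    using HOM_rco[of \<phi>] HOM_lco[of \<phi>] assms unfolding Kr_def Kl_def vspace_cong[OF v] by (simp_all add: v)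
qed

lemma HOM_cg:
  assumes "\<phi> \<in> carr (HOM H M N)" "lin_map H base g"
  shows "cg H M N g \<phi> \<in> carr (HOM H M N)"
  using rational_cg[OF M N _ assms(2)] assms(1) by (simp add: HOM_simps HOM_space_rational)

lemma bicov_bimodule_HOM: "bicov_bimodule H (HOM H M N)"
proof -
  let ?X = "HOM H M N"
  note mir = copH mir_bicov[OF M] mir_bicov[OF N]
  have v: "carr ?X = carr HS" "scl ?X = scl HS" by (simp_all add: HOM_simps HOM_space_def)
  have v': "carr (mir ?X) = carr (HOM_space (copH H) (mir M) (mir N))"
    "scl (mir ?X) = scl (HOM_space (copH H) (mir M) (mir N))" using v by (simp_all add: HOM_space_mir)
  have 1: "lin_map ?X (tensor ?X H) (rco ?X)" "rside H ?X"
    by (rule rside_HOM[OF v]; simp add: HOM_simps(3,4) bimod_HOM HOM_coactions)+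
  have hom: "\<phi> \<in> carr hom'" if "\<phi> \<in> carr ?X" for \<phi> using HOM_eqs(2) that by auto
  have K: "Kr (copH H) (mir ?X) (mir M) (mir N) \<phi> (rco (mir ?X) \<phi>)" if "\<phi> \<in> carr (mir ?X)" for \<phi>
  proof -
    have p: "\<phi> \<in> carr ?X" using that by simp
    have "Kr (copH H) ?X (mir M) (mir N) \<phi> (flip (lco ?X \<phi>))"
      using Kr_mir[OF M N hom[OF p] HOM_eqs, of "flip (lco ?X \<phi>)"] HOM_coactions(2)[OF p] by simp
    then show ?thesis by (simp add: Kr_def)
  qed
  have rbm: "rb (mir M) a \<chi> = rb M a \<chi>" for a and \<chi> :: "'m \<Rightarrow> 'n" by (simp add: rb_def fun_eq_iff)
  have "lact (mir ?X) a \<phi> = (\<lambda>m. lact (mir N) a (\<phi> m))" "ract (mir ?X) \<phi> a = rb (mir M) a \<phi>"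
    "bimod (copH H) (mir ?X)" for a \<phi>
    by (simp_all add: HOM_simps rbm bimod_HOM)
  note m = hopf.rside_HOM[OF mir v' this K]
  from m(1) have "lin_map ?X (tensor ?X H) (\<lambda>\<phi>. flip (lco ?X \<phi>))" by (simp add: mir_coactions)
  from flip_lin[OF HOM_eqs(1) this] have 2: "lin_map ?X (tensor H ?X) (lco ?X)" by simp
  have 3: "lside H ?X" by (rule rside_mir_imp[OF bimod_HOM 2 m(2)])
  note [simp] = bimodD(1-7)[OF bimod_HOM] KlD(1)[OF HOM_coactions(2)] KrD(1)[OF HOM_coactions(1)]
  note [lin] = hom_space_lin[OF M N HOM_eqs] lin_compose[OF 1(1)] lin_compose[OF 2]
  have 4: "bico H ?X" unfolding bico_def
  proof (intro ballI allI impI)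
    fix \<phi> f assume p [simp]: "\<phi> \<in> carr ?X" and f: "trilin H ?X H f"
    note [lin] = trilinD[OF f]
    let ?T = "tensor H ?X"
    \<comment> \<open>The two sides of the bicomodule condition. Contraction of the last factor
      turns both into the left coaction of the contracted map, \<open>?T1\<close> by linearity and
      \<open>?T2\<close> by \<open>Kl_cg\<close>.\<close>
    let ?T1 = "rs H ?X \<phi> (\<lambda>\<phi>0 \<phi>1. lco ?X \<phi>0 \<otimes>\<^bsub>?T,H\<^esub> \<phi>1)"
    let ?T2 = "ls H ?X \<phi> (\<lambda>p \<phi>0. rs H ?X \<phi>0 (\<lambda>x y. (p \<otimes>\<^bsub>H,?X\<^esub> x) \<otimes>\<^bsub>?T,H\<^esub> y))"
    have "?T1 = ?T2"
    proof (rule tensor_eq_contract)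
      fix g assume g: "lin_map H base g"
      note [lin] = lin_compose[OF g] g
      have sc: "\<chi> \<in> carr ?X \<Longrightarrow> h \<otimes>\<^bsub>H,?X\<^esub> scl ?X c \<chi> = scl ?T c (h \<otimes>\<^bsub>H,?X\<^esub> \<chi>)" for \<chi> c h
        using lin_mapD(3)[of ?X ?T "\<lambda>\<chi>. h \<otimes>\<^bsub>H,?X\<^esub> \<chi>" \<chi> c] by (simp add: lin)
      have lp: "lin_map ?X ?T (\<lambda>\<chi>. h \<otimes>\<^bsub>H,?X\<^esub> \<chi>)" for h by (simp add: lin)
      note c = Kr_contract[OF M N HOM_eqs hom HOM_coactions(1) g]
      have "ts ?T H ?T1 (\<lambda>v w. scl ?T (g w) v) = rs H ?X \<phi> (\<lambda>\<phi>0 \<phi>1. scl ?T (g \<phi>1) (lco ?X \<phi>0))"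
        by (simp add: sm_sm_tensor[where U = ?T] sm_tens[where U = ?T] lin del: scl_tensor_space)
      also have "\<dots> = rs H ?X \<phi> (\<lambda>\<phi>0 \<phi>1. lco ?X (scl ?X (g \<phi>1) \<phi>0))"
        by (simp add: lin_mapD(3)[OF 2] del: scl_tensor_space)
      also have "\<dots> = lco ?X (rs H ?X \<phi> (\<lambda>\<phi>0 \<phi>1. scl ?X (g \<phi>1) \<phi>0))"
        by (subst sm_hom[OF 2]) (simp_all add: scale_closed)
      also have "\<dots> = lco ?X (cg H M N g \<phi>)" by (simp only: c[OF p p])
      also have "\<dots> = ls H ?X \<phi> (\<lambda>p \<phi>0. p \<otimes>\<^bsub>H,?X\<^esub> cg H M N g \<phi>0)"
      proof -
        have cgX: "cg H M N g \<phi> \<in> carr ?X" by (rule HOM_cg[OF p g])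
        have "Kl H ?X M N (cg H M N g \<phi>) (ls H ?X \<phi> (\<lambda>p \<phi>0. p \<otimes>\<^bsub>H,?X\<^esub> cg H M N g \<phi>0))"
          by (rule Kl_cg[OF M N HOM_eqs hom[OF p] HOM_coactions(2)[OF p] g HOM_eqs]) (rule HOM_cg[OF _ g])
        \<comment> \<open>Left coactions are unique because right coactions over the mirror image
          are.\<close>
        then have "Kr (copH H) ?X (mir M) (mir N) (cg H M N g \<phi>) (flip (ls H ?X \<phi> (\<lambda>p \<phi>0. p \<otimes>\<^bsub>H,?X\<^esub> cg H M N g \<phi>0)))"
          using Kr_mir[OF M N hom[OF cgX] HOM_eqs] by simp
        moreover have "Kr (copH H) ?X (mir M) (mir N) (cg H M N g \<phi>) (flip (lco ?X (cg H M N g \<phi>)))"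
          using Kr_mir[OF M N hom[OF cgX] HOM_eqs] HOM_coactions(2)[OF cgX] by simp
        ultimately have "flip (lco ?X (cg H M N g \<phi>)) = flip (ls H ?X \<phi> (\<lambda>p \<phi>0. p \<otimes>\<^bsub>H,?X\<^esub> cg H M N g \<phi>0))"
          using hopf.Kr_unique[OF mir, of ?X "cg H M N g \<phi>"] HOM_eqs hom[OF cgX] by simp
        then show ?thesis by (metis flip_flip)
      qed
      also have "\<dots> = ls H ?X \<phi> (\<lambda>p \<phi>0. rs H ?X \<phi>0 (\<lambda>x y. scl ?T (g y) (p \<otimes>\<^bsub>H,?X\<^esub> x)))"
      proof (rule sm_cong[OF refl refl refl refl])
        fix h \<chi> assume x [simp]: "\<chi> \<in> carr ?X"
        have "h \<otimes>\<^bsub>H,?X\<^esub> cg H M N g \<chi> = rs H ?X \<chi> (\<lambda>x y. h \<otimes>\<^bsub>H,?X\<^esub> scl ?X (g y) x)"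
          unfolding c[OF x x, symmetric] by (subst sm_hom[OF lp]) (simp_all add: scale_closed)
        then show "h \<otimes>\<^bsub>H,?X\<^esub> cg H M N g \<chi> = rs H ?X \<chi> (\<lambda>x y. scl ?T (g y) (h \<otimes>\<^bsub>H,?X\<^esub> x))"
          by (simp add: sc del: scl_tensor_space)
      qed
      also have "\<dots> = ts ?T H ?T2 (\<lambda>v w. scl ?T (g w) v)"
        by (simp add: sm_sm_tensor[where U = ?T] sm_tens[where U = ?T] lin sm_closed del: scl_tensor_space)
      finally show "ts ?T H ?T1 (\<lambda>v w. scl ?T (g w) v)
        = ts ?T H ?T2 (\<lambda>v w. scl ?T (g w) v)" .
    qed (auto intro!: sm_closed)
    from arg_cong[OF this, of "\<lambda>t. ts ?T H t (\<lambda>u h. ts H ?X u (\<lambda>a \<chi>. f a \<chi> h))"]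
    show "rs H ?X \<phi> (\<lambda>m0 m1. ls H ?X m0 (\<lambda>p x. f p x m1)) = ls H ?X \<phi> (\<lambda>p m0. rs H ?X m0 (\<lambda>x y. f p x y))"
      by (simp add: sw_sm_base lin sm_closed)
  qed
  show ?thesis using bimod_HOM 1 2 3 4 by (simp add: bicov_iff)
qed

end

lemma HOM_lin:
  assumes "bicov_bimodule H M" "bicov_bimodule H N"
  shows "\<chi> \<in> carr (HOM H M N) \<Longrightarrow> lin_map X M f \<Longrightarrow> lin_map X N (\<lambda>x. \<chi> (f x))"
    "m \<in> carr M \<Longrightarrow> lin_map (HOM H M N) N (\<lambda>\<chi>. \<chi> m)"
    "\<chi> \<in> carr (HOM H M N) \<Longrightarrow> lin_map M N \<chi>"
  using hom_space_lin[OF assms HOM_eqs[OF assms]] by auto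

lemma HOM_closed:
  assumes "bicov_bimodule H M" "bicov_bimodule H N" "\<chi> \<in> carr (HOM H M N)"
  shows "m \<in> carr M \<Longrightarrow> \<chi> m \<in> carr N" "m \<notin> carr M \<Longrightarrow> \<chi> m = 0" "\<chi> m \<in> carr N"
proof -
  show 1: "m \<in> carr M \<Longrightarrow> \<chi> m \<in> carr N"
    by (rule hom_space_closed[OF assms(1,2) HOM_eqs(2)[OF assms(1,2)] assms(3)])
  show 2: "m \<notin> carr M \<Longrightarrow> \<chi> m = 0"
    using HOM_eqs(2)[OF assms(1,2)] assms(3) by (auto simp: hom_space_simps)
  show "\<chi> m \<in> carr N" using 1 2 bicov_simps(1)[OF assms(2)] by (cases "m \<in> carr M") (auto simp: zero_closed)
qed

lemma HOM_K:
  assumes "bicov_bimodule H M" "bicov_bimodule H N" "\<phi> \<in> carr (HOM H M N)" "m \<in> carr M"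
  shows "bilin N H \<beta> \<Longrightarrow> rs H N (\<phi> m) \<beta>
      = rs H (HOM H M N) \<phi> (\<lambda>\<phi>0 \<phi>1. rs H M m (\<lambda>m0 m1. \<beta> (\<phi>0 m0) (\<phi>1 * m1)))"
    "bilin H N \<gamma> \<Longrightarrow> ls H N (\<phi> m) \<gamma>
      = ls H (HOM H M N) \<phi> (\<lambda>p \<phi>0. ls H M m (\<lambda>q m0. \<gamma> (p * q) (\<phi>0 m0)))"
  using KrD(2)[OF HOM_coactions(1)[OF assms(1-3)] assms(4)] KlD(2)[OF HOM_coactions(2)[OF assms(1-3)] assms(4)] by auto

lemma Kl_unique:
  assumes M: "bicov_bimodule H M" and N: "bicov_bimodule H N"
    and V: "is_vspace V" "carr V \<subseteq> carr (hom_space M N)" "scl V = scl (hom_space M N)"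
    and \<phi>: "\<phi> \<in> carr (hom_space M N)" "Kl H V M N \<phi> s" "Kl H V M N \<phi> s'"
  shows "s = s'"
proof -
  have "Kr (copH H) V (mir M) (mir N) \<phi> (flip s)" "Kr (copH H) V (mir M) (mir N) \<phi> (flip s')"
    using Kr_mir[OF M N \<phi>(1) V] \<phi> by simp_all
  then have "flip s = flip s'"
    using hopf.Kr_unique[OF copH mir_bicov[OF M] mir_bicov[OF N], of V \<phi>] V \<phi>(1) by simp
  then show ?thesis by (metis flip_flip)
qed

lemma HOM_memI:
  assumes M: "bicov_bimodule H M" and N: "bicov_bimodule H N" and "\<phi> \<in> carr (hom_space M N)"
    "Kr H (hom_space M N) M N \<phi> t" "Kl H (hom_space M N) M N \<phi> s"
  shows "\<phi> \<in> carr (HOM H M N)"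
  using assms by (auto simp: HOM_simps HOM_space_rational rational_def)

lemma HOM_coactionI:
  assumes M: "bicov_bimodule H M" and N: "bicov_bimodule H N" and "\<phi> \<in> carr (HOM H M N)"
  shows "Kr H (HOM H M N) M N \<phi> t \<Longrightarrow> rco (HOM H M N) \<phi> = t"
    "Kl H (HOM H M N) M N \<phi> s \<Longrightarrow> lco (HOM H M N) \<phi> = s"
  using Kr_unique[OF M N HOM_eqs[OF M N] _ HOM_coactions(1)[OF M N assms(3)]]
    Kl_unique[OF M N HOM_eqs[OF M N] _ HOM_coactions(2)[OF M N assms(3)]] HOM_eqs(2)[OF M N] assms(3) by auto

text \<open>Both sides of a colinearity condition are linear in the tensor, and forms separate the
  values, so it is enough to test pure tensors on forms.\<close>

lemma colinear_tensorI:
  assumes B: "tkind B A C" and A [simp]: "bicov_bimodule H A" and C [simp]: "bicov_bimodule H C"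
    and N [simp]: "bicov_bimodule H N"
    and F: "lin_map (bicov_tensor B H A C) N F"
  shows "(\<And>a c \<beta>. a \<in> carr A \<Longrightarrow> c \<in> carr C \<Longrightarrow> bilin N H \<beta> \<Longrightarrow> rs H N (F (pure B a c)) \<beta>
      = rs H A a (\<lambda>a0 a1. rs H C c (\<lambda>c0 c1. \<beta> (F (pure B a0 c0)) (a1 * c1)))) \<Longrightarrow>
      right_colinear H (bicov_tensor B H A C) N F"
    "(\<And>a c \<beta>. a \<in> carr A \<Longrightarrow> c \<in> carr C \<Longrightarrow> bilin H N \<beta> \<Longrightarrow> ls H N (F (pure B a c)) \<beta>
      = ls H A a (\<lambda>p a0. ls H C c (\<lambda>q c0. \<beta> (p * q) (F (pure B a0 c0))))) \<Longrightarrow>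
      left_colinear H (bicov_tensor B H A C) N F"
proof -
  let ?T = "bicov_tensor B H A C"
  have T [simp]: "bicov_bimodule H ?T" by (rule bicov_bimodule_tensor[OF B A C])
  have [simp]: "t \<in> carr ?T \<Longrightarrow> F t \<in> carr N" for t using lin_mapD(1)[OF F] .
  note [lin] = F lin_compose[OF F]
  {
    assume eq: "\<And>a c \<beta>. a \<in> carr A \<Longrightarrow> c \<in> carr C \<Longrightarrow> bilin N H \<beta> \<Longrightarrow> rs H N (F (pure B a c)) \<beta>
      = rs H A a (\<lambda>a0 a1. rs H C c (\<lambda>c0 c1. \<beta> (F (pure B a0 c0)) (a1 * c1)))"
    show "right_colinear H ?T N F" unfolding right_colinear_def
    proof
      fix t assume t: "t \<in> carr ?T"
      have "rco N (F t) = rs H ?T t (\<lambda>m0 m1. F m0 \<otimes>\<^bsub>N,H\<^esub> m1)"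
      proof (rule bicov_tensor_ext[OF B _ _ _ _ t, where U = "tensor N H"])
        fix a c assume ac [simp]: "a \<in> carr A" "c \<in> carr C"
        show "rco N (F (pure B a c)) = rs H ?T (pure B a c) (\<lambda>m0 m1. F m0 \<otimes>\<^bsub>N,H\<^esub> m1)"
        proof (rule tensor_eqI)
          fix \<beta> assume "\<And>v. v \<in> carr N \<Longrightarrow> lin_map H base (\<lambda>w. \<beta> v w)" "\<And>w. w \<in> carr H \<Longrightarrow> lin_map N base (\<lambda>v. \<beta> v w)"
          then have b: "bilin N H \<beta>" by (simp add: bilin_def)
          note [lin] = bilinD[OF b]
          show "rs H N (F (pure B a c)) \<beta> = ts N H (rs H ?T (pure B a c) (\<lambda>m0 m1. F m0 \<otimes>\<^bsub>N,H\<^esub> m1)) \<beta>"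
            by (simp add: eq b sw_sm_base lin rs_tensor_pure[OF B] bilin_def)
        qed (auto intro!: sm_closed)
      qed (simp_all add: lin)
      then show "rco N (F t) = rcs H ?T t (\<lambda>m0 m1. F m0 \<otimes>\<^bsub>N,H\<^esub> m1)"
        using t by (simp add: sw_eq_sm[where U = "tensor N H"] lin)
    qed
  next
    assume eq: "\<And>a c \<beta>. a \<in> carr A \<Longrightarrow> c \<in> carr C \<Longrightarrow> bilin H N \<beta> \<Longrightarrow> ls H N (F (pure B a c)) \<beta>
      = ls H A a (\<lambda>p a0. ls H C c (\<lambda>q c0. \<beta> (p * q) (F (pure B a0 c0))))"
    show "left_colinear H ?T N F" unfolding left_colinear_def
    proof
      fix t assume t: "t \<in> carr ?T"
      have "lco N (F t) = ls H ?T t (\<lambda>p m0. p \<otimes>\<^bsub>H,N\<^esub> F m0)"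
      proof (rule bicov_tensor_ext[OF B _ _ _ _ t, where U = "tensor H N"])
        fix a c assume ac [simp]: "a \<in> carr A" "c \<in> carr C"
        show "lco N (F (pure B a c)) = ls H ?T (pure B a c) (\<lambda>p m0. p \<otimes>\<^bsub>H,N\<^esub> F m0)"
        proof (rule tensor_eqI)
          fix \<beta> assume "\<And>v. v \<in> carr H \<Longrightarrow> lin_map N base (\<lambda>w. \<beta> v w)" "\<And>w. w \<in> carr N \<Longrightarrow> lin_map H base (\<lambda>v. \<beta> v w)"
          then have b: "bilin H N \<beta>" by (simp add: bilin_def)
          note [lin] = bilinD[OF b]
          show "ls H N (F (pure B a c)) \<beta> = ts H N (ls H ?T (pure B a c) (\<lambda>p m0. p \<otimes>\<^bsub>H,N\<^esub> F m0)) \<beta>"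
            by (simp add: eq b sw_sm_base lin ls_tensor_pure[OF B] bilin_def)
        qed (auto intro!: sm_closed)
      qed (simp_all add: lin)
      then show "lco N (F t) = lcs H ?T t (\<lambda>p m0. p \<otimes>\<^bsub>H,N\<^esub> F m0)"
        using t by (simp add: sw_eq_sm[where U = "tensor H N"] lin)
    qed
  }
qed

section \<open>Evaluation and composition\<close>

lemma lift_tensor:
  assumes "tkind B A C" "adm B A C U f"
  shows "lin_map (bicov_tensor B H A C) U (lift B A C f)"
    "a \<in> carr A \<Longrightarrow> c \<in> carr C \<Longrightarrow> lift B A C f (pure B a c) = f a c"
proof -
  have "lin_map (bicov_tensor B H A C) U (\<lambda>t. sm B A C t f)"
    using lin_sm_arg[OF assms(2)] by (simp only: bicov_tensor_vspace)
  then show "lin_map (bicov_tensor B H A C) U (lift B A C f)"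
    by (subst lin_map_cong) (auto simp: lift_eq_sm[OF assms(2)] bicov_tensor_simps)
  show "a \<in> carr A \<Longrightarrow> c \<in> carr C \<Longrightarrow> lift B A C f (pure B a c) = f a c"
    by (simp add: lift_eq_sm[OF assms(2)] sm_pure[OF assms(2)])
qed

context
  fixes M :: "('k, 'h, 'm::ab_group_add) bicov" and N :: "('k, 'h, 'n::ab_group_add) bicov"
  assumes M [simp]: "bicov_bimodule H M" and N [simp]: "bicov_bimodule H N"
begin

private lemma ev_HOM [simp]: "bicov_bimodule H (HOM H M N)" by (rule bicov_bimodule_HOM[OF M N])
private lemmas ev_closed [simp] = HOM_closed[OF M N]
private lemmas ev_hlin = HOM_lin[OF M N]

text \<open>Balancedness over \<open>H\<close> is the definition of the right action on maps:
  \<open>\<phi> h\<close> sends \<open>m\<close> to \<open>\<phi>(h m)\<close>.\<close>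

lemma ev_adm: "adm (balanced_forms (HOM H M N) M) (HOM H M N) M N (\<lambda>\<phi> m. \<phi> m)"
proof -
  note [lin] = ev_hlin
  show ?thesis by (rule tkind_adm) (simp_all add: lin HOM_simps(4) rb_def)
qed

lemma ev_pure: "\<phi> \<in> carr (HOM H M N) \<Longrightarrow> m \<in> carr M \<Longrightarrow> ev H M N (\<phi> \<odot>\<^bsub>HOM H M N,M\<^esub> m) = \<phi> m"
  unfolding ev_def by (rule lift_tensor(2)[OF _ ev_adm]) simp

lemma ev_morphism: "left_bicov_morphism H (tensor_H H (HOM H M N) M) N (ev H M N)"
proof -
  let ?T = "tensor_H H (HOM H M N) M"
  note [lin] = ev_hlin
  have T [simp]: "bicov_bimodule H ?T" by (rule bicov_bimodule_tensor) simp_all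
  have F: "lin_map ?T N (ev H M N)" unfolding ev_def by (rule lift_tensor(1)[OF _ ev_adm]) simp
  note [lin] = F lin_compose[OF F]
  have "right_colinear H ?T N (ev H M N)"
    by (rule colinear_tensorI(1)[OF _ ev_HOM M N F]) (simp_all add: ev_pure HOM_K[OF M N])
  moreover have "left_colinear H ?T N (ev H M N)"
    by (rule colinear_tensorI(2)[OF _ ev_HOM M N F]) (simp_all add: ev_pure HOM_K[OF M N])
  moreover have "left_linear ?T N (ev H M N)" unfolding left_linear_def
  proof (intro allI ballI)
    fix a t assume t: "t \<in> carr ?T"
    show "ev H M N (lact ?T a t) = lact N a (ev H M N t)"
    proof (rule bicov_tensor_ext[OF _ _ _ _ _ t, where U = N])
      fix \<phi> m assume [simp]: "\<phi> \<in> carr (HOM H M N)" "m \<in> carr M"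
      show "ev H M N (lact ?T a (\<phi> \<odot>\<^bsub>HOM H M N,M\<^esub> m)) = lact N a (ev H M N (\<phi> \<odot>\<^bsub>HOM H M N,M\<^esub> m))"
        by (simp add: tensor_act_pure ev_pure) (simp add: HOM_simps)
    qed (simp_all add: lin)
  qed
  ultimately show ?thesis unfolding left_bicov_morphism_def
    using left_bicov_module[OF T] left_bicov_module[OF N] F by simp
qed

end

context
  fixes M :: "('k, 'h, 'm::ab_group_add) bicov" and N :: "('k, 'h, 'n::ab_group_add) bicov"
    and P :: "('k, 'h, 'p::ab_group_add) bicov"
  assumes M [simp]: "bicov_bimodule H M" and N [simp]: "bicov_bimodule H N" and P [simp]: "bicov_bimodule H P"
begin

private abbreviation "X \<equiv> HOM H M N"
private abbreviation "Y \<equiv> HOM H N P"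
private abbreviation "Z \<equiv> HOM H M P"

private lemma XYZ [simp]: "bicov_bimodule H X" "bicov_bimodule H Y" "bicov_bimodule H Z"
  by (rule bicov_bimodule_HOM; simp)+

private lemmas comp_closed [simp] = HOM_closed(1)[OF M N] HOM_closed(1)[OF N P] HOM_closed(1)[OF M P]
private lemmas comp_hlin = HOM_lin[OF M N] HOM_lin[OF N P] HOM_lin[OF M P]

private lemma comp_hom:
  assumes "\<phi> \<in> carr Y" "\<psi> \<in> carr X"
  shows "\<phi> \<circ> \<psi> \<in> carr (hom_space M P)"
proof -
  have "lin_map M P (\<lambda>m. \<phi> (\<psi> m))"
    by (rule lin_compose[OF HOM_lin(3)[OF N P assms(1)] HOM_lin(3)[OF M N assms(2)]])
  moreover have "\<phi> 0 = 0" by (rule lin_map_zero[OF _ HOM_lin(3)[OF N P assms(1)]]) simp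
  ultimately show ?thesis using HOM_closed(2)[OF M N assms(2)] by (simp add: hom_space_simps comp_def)
qed

text \<open>Apply the relation \<open>HOM_K\<close> for \<open>\<phi>\<close> at the vector
  \<open>\<psi>(m)\<close>, then the one for \<open>\<psi>\<close> at \<open>m\<close>. With all
  linear maps for \<open>V\<close> this shows that the composite is rational, with the rational ones
  it identifies its coactions.\<close>

private lemma comp_K:
  assumes V [simp]: "is_vspace V" and V': "carr V \<subseteq> carr (hom_space M P)" "scl V = scl (hom_space M P)"
    and VV [simp]: "\<And>\<phi> \<psi>. \<phi> \<in> carr Y \<Longrightarrow> \<psi> \<in> carr X \<Longrightarrow> \<phi> \<circ> \<psi> \<in> carr V"
    and p [simp]: "\<phi> \<in> carr Y" "\<psi> \<in> carr X"
  shows "Kr H V M P (\<phi> \<circ> \<psi>) (rs H Y \<phi> (\<lambda>\<phi>0 \<phi>1. rs H X \<psi> (\<lambda>\<psi>0 \<psi>1. (\<phi>0 \<circ> \<psi>0) \<otimes>\<^bsub>V,H\<^esub> (\<phi>1 * \<psi>1))))" (is ?A)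
    "Kl H V M P (\<phi> \<circ> \<psi>) (ls H Y \<phi> (\<lambda>p \<phi>0. ls H X \<psi> (\<lambda>q \<psi>0. (p * q) \<otimes>\<^bsub>H,V\<^esub> (\<phi>0 \<circ> \<psi>0))))" (is ?B)
proof -
  note [simp] = hom_space_closed[OF M P V'(1)]
  note [lin] = comp_hlin hom_space_lin[OF M P V V']
  show ?A unfolding Kr_def
  proof (intro conjI ballI allI impI)
    fix m \<beta> assume m [simp]: "m \<in> carr M" and b: "bilin P H \<beta>"
    note [lin] = bilinD[OF b]
    show "rs H P ((\<phi> \<circ> \<psi>) m) \<beta> = ts V H
       (rs H Y \<phi> (\<lambda>\<phi>0 \<phi>1. rs H X \<psi> (\<lambda>\<psi>0 \<psi>1. (\<phi>0 \<circ> \<psi>0) \<otimes>\<^bsub>V,H\<^esub> (\<phi>1 * \<psi>1))))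
       (\<lambda>\<chi> h. rs H M m (\<lambda>m0 m1. \<beta> (\<chi> m0) (h * m1)))"
      by (simp add: HOM_K[OF N P] HOM_K[OF M N] b bilin_def lin sw_sm_base sm_closed mult.assoc)
  qed (auto intro!: sm_closed)
  show ?B unfolding Kl_def
  proof (intro conjI ballI allI impI)
    fix m \<beta> assume m [simp]: "m \<in> carr M" and b: "bilin H P \<beta>"
    note [lin] = bilinD[OF b]
    show "ls H P ((\<phi> \<circ> \<psi>) m) \<beta> = ts H V
       (ls H Y \<phi> (\<lambda>p \<phi>0. ls H X \<psi> (\<lambda>q \<psi>0. (p * q) \<otimes>\<^bsub>H,V\<^esub> (\<phi>0 \<circ> \<psi>0))))
       (\<lambda>h \<chi>. ls H M m (\<lambda>p m0. \<beta> (h * p) (\<chi> m0)))"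
      by (simp add: HOM_K[OF N P] HOM_K[OF M N] b bilin_def lin sw_sm_base sm_closed mult.assoc)
  qed (auto intro!: sm_closed)
qed

private lemma comp_in [simp]:
  assumes "\<phi> \<in> carr Y" "\<psi> \<in> carr X"
  shows "\<phi> \<circ> \<psi> \<in> carr Z"
  using comp_K[of "hom_space M P", OF _ subset_refl refl comp_hom assms]
  by (intro HOM_memI[OF M P comp_hom[OF assms]]) simp_all

private lemma comp_lin:
  "\<psi> \<in> carr X \<Longrightarrow> lin_map Y Z (\<lambda>\<phi>. \<phi> \<circ> \<psi>)" "\<phi> \<in> carr Y \<Longrightarrow> lin_map X Z (\<lambda>\<psi>. \<phi> \<circ> \<psi>)"
proof -
  show "\<psi> \<in> carr X \<Longrightarrow> lin_map Y Z (\<lambda>\<phi>. \<phi> \<circ> \<psi>)"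
    by (rule lin_mapI) (simp_all add: HOM_simps(2) fun_eq_iff)
  assume p: "\<phi> \<in> carr Y"
  show "lin_map X Z (\<lambda>\<psi>. \<phi> \<circ> \<psi>)"
    using p by (intro lin_mapI)
      (simp_all add: HOM_simps(2) fun_eq_iff lin_mapD(2,3)[OF HOM_lin(3)[OF N P p]] HOM_closed(3)[OF M N])
qed

lemma comp_adm: "adm (balanced_forms Y X) Y X Z (\<lambda>\<phi> \<psi>. \<phi> \<circ> \<psi>)"
proof (rule tkind_adm)
  fix \<phi> h \<psi> assume pq: "\<phi> \<in> carr Y" "\<psi> \<in> carr X"
  have "\<psi> m \<in> carr N" for m by (rule HOM_closed(3)[OF M N pq(2)])
  then show "ract Y \<phi> h \<circ> \<psi> = \<phi> \<circ> lact X h \<psi>"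
    by (simp add: HOM_simps rb_def fun_eq_iff)
qed (simp_all add: comp_lin)

lemma comp_HOM_pure:
  "\<phi> \<in> carr Y \<Longrightarrow> \<psi> \<in> carr X \<Longrightarrow> comp_HOM H M N P (\<phi> \<odot>\<^bsub>Y,X\<^esub> \<psi>) = \<phi> \<circ> \<psi>"
  unfolding comp_HOM_def by (rule lift_tensor(2)[OF _ comp_adm]) simp

lemma comp_morphism: "bicov_morphism H (tensor_H H Y X) Z (comp_HOM H M N P)"
proof -
  let ?T = "tensor_H H Y X" and ?F = "comp_HOM H M N P"
  note [lin] = comp_lin
  have T [simp]: "bicov_bimodule H ?T" by (rule bicov_bimodule_tensor) simp_all
  have F: "lin_map ?T Z ?F" unfolding comp_HOM_def by (rule lift_tensor(1)[OF _ comp_adm]) simp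
  note [lin] = F lin_compose[OF F]
  note KZ = comp_K[OF HOM_eqs[OF M P] comp_in]
  have "right_colinear H ?T Z ?F"
  proof (rule colinear_tensorI(1)[OF _ XYZ(2,1,3) F])
    fix \<phi> \<psi> \<beta> assume p [simp]: "\<phi> \<in> carr Y" "\<psi> \<in> carr X" and b: "bilin Z H \<beta>"
    note [lin] = bilinD[OF b]
    have "rco Z (\<phi> \<circ> \<psi>) = rs H Y \<phi> (\<lambda>\<phi>0 \<phi>1. rs H X \<psi> (\<lambda>\<psi>0 \<psi>1. (\<phi>0 \<circ> \<psi>0) \<otimes>\<^bsub>Z,H\<^esub> (\<phi>1 * \<psi>1)))"
      by (rule HOM_coactionI(1)[OF M P _ KZ(1)]) simp_all
    then show "rs H Z (?F (\<phi> \<odot>\<^bsub>Y,X\<^esub> \<psi>)) \<beta>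
      = rs H Y \<phi> (\<lambda>a0 a1. rs H X \<psi> (\<lambda>c0 c1. \<beta> (?F (a0 \<odot>\<^bsub>Y,X\<^esub> c0)) (a1 * c1)))"
      by (simp add: comp_HOM_pure sw_sm_base sm_closed lin)
  qed simp
  moreover have "left_colinear H ?T Z ?F"
  proof (rule colinear_tensorI(2)[OF _ XYZ(2,1,3) F])
    fix \<phi> \<psi> \<beta> assume p [simp]: "\<phi> \<in> carr Y" "\<psi> \<in> carr X" and b: "bilin H Z \<beta>"
    note [lin] = bilinD[OF b]
    have "lco Z (\<phi> \<circ> \<psi>) = ls H Y \<phi> (\<lambda>p \<phi>0. ls H X \<psi> (\<lambda>q \<psi>0. (p * q) \<otimes>\<^bsub>H,Z\<^esub> (\<phi>0 \<circ> \<psi>0)))"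
      by (rule HOM_coactionI(2)[OF M P _ KZ(2)]) simp_all
    then show "ls H Z (?F (\<phi> \<odot>\<^bsub>Y,X\<^esub> \<psi>)) \<beta>
      = ls H Y \<phi> (\<lambda>p a0. ls H X \<psi> (\<lambda>q c0. \<beta> (p * q) (?F (a0 \<odot>\<^bsub>Y,X\<^esub> c0))))"
      by (simp add: comp_HOM_pure sw_sm_base sm_closed lin)
  qed simp
  moreover have "left_linear ?T Z ?F" unfolding left_linear_def
  proof (intro allI ballI)
    fix a t assume t: "t \<in> carr ?T"
    show "?F (lact ?T a t) = lact Z a (?F t)"
    proof (rule bicov_tensor_ext[OF _ _ _ _ _ t, where U = Z])
      fix \<phi> \<psi> assume [simp]: "\<phi> \<in> carr Y" "\<psi> \<in> carr X"
      show "?F (lact ?T a (\<phi> \<odot>\<^bsub>Y,X\<^esub> \<psi>)) = lact Z a (?F (\<phi> \<odot>\<^bsub>Y,X\<^esub> \<psi>))"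
        by (simp add: tensor_act_pure comp_HOM_pure) (simp add: HOM_simps fun_eq_iff)
    qed (simp_all add: lin)
  qed
  moreover have "right_linear ?T Z ?F" unfolding right_linear_def
  proof (intro allI ballI)
    fix a t assume t: "t \<in> carr ?T"
    show "?F (ract ?T t a) = ract Z (?F t) a"
    proof (rule bicov_tensor_ext[OF _ _ _ _ _ t, where U = Z])
      fix \<phi> \<psi> assume p [simp]: "\<phi> \<in> carr Y" "\<psi> \<in> carr X"
      \<comment> \<open>Outside the carrier of \<open>M\<close> the left side has the value
        \<open>\<phi> 0\<close>, whereas the right side is cut off to 0.\<close>
      have "\<phi> 0 = 0" by (rule lin_map_zero[OF _ HOM_lin(3)[OF N P p(1)]]) simp
      then show "?F (ract ?T (\<phi> \<odot>\<^bsub>Y,X\<^esub> \<psi>) a) = ract Z (?F (\<phi> \<odot>\<^bsub>Y,X\<^esub> \<psi>)) a"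
        by (simp add: tensor_act_pure comp_HOM_pure) (simp add: HOM_simps fun_eq_iff rb_def)
    qed (simp_all add: lin)
  qed
  ultimately show ?thesis unfolding bicov_morphism_def using F by simp
qed

end

section \<open>Right coinvariants\<close>

end

text \<open>\<open>pm H M m\<close> is the right coinvariant \<open>m\<^sub>0 S(m\<^sub>1)\<close>, and \<open>adj\<close> is the adjoint action \<open>x\<^sub>1 u S(x\<^sub>2)\<close>.\<close>

definition pm :: "('k::field, 'h::ring_1) hopf \<Rightarrow> ('k, 'h, 'm::ab_group_add) bicov \<Rightarrow> 'm \<Rightarrow> 'm" where
  "pm H M m = rs H M m (\<lambda>m0 m1. ract M m0 (antipode H m1))"

definition adj :: "('k::field, 'h::ring_1) hopf \<Rightarrow> ('k, 'h, 'm::ab_group_add) bicov \<Rightarrow> 'h \<Rightarrow> 'm \<Rightarrow> 'm" where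
  "adj H M x u = cs H x (\<lambda>x1 x2. ract M (lact M x1 u) (antipode H x2))"

context hopf
begin

context
  fixes M :: "('k, 'h, 'm::ab_group_add) bicov"
  assumes M [simp]: "bicov_bimodule H M"
begin

lemma pm_adj_in [simp]: "m \<in> carr M \<Longrightarrow> pm H M m \<in> carr M" "m \<in> carr M \<Longrightarrow> adj H M x m \<in> carr M"
  by (auto simp: pm_def adj_def intro!: sm_closed)

lemma pm_adj_lin:
  "lin_map V M f \<Longrightarrow> lin_map V M (\<lambda>v. pm H M (f v))" "lin_map V M f \<Longrightarrow> lin_map V M (\<lambda>v. adj H M x (f v))"
  "m \<in> carr M \<Longrightarrow> lin_map V H g \<Longrightarrow> lin_map V M (\<lambda>v. adj H M (g v) m)"
  by (simp_all add: pm_def adj_def lin)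

lemma pm_form:
  assumes "lin_map M base g" "m \<in> carr M"
  shows "g (pm H M m) = rs H M m (\<lambda>m0 m1. g (ract M m0 (antipode H m1)))"
  unfolding pm_def by (rule sm_hom[OF assms(1)]) (use assms(2) in simp_all)

lemma adj_form:
  assumes "lin_map M base g" "m \<in> carr M"
  shows "g (adj H M x m) = cs H x (\<lambda>x1 x2. g (ract M (lact M x1 m) (antipode H x2)))"
  unfolding adj_def by (rule sm_hom[OF assms(1)]) (use assms(2) in simp_all)

text \<open>Since the antipode reverses the coproduct, the coaction of \<open>m0 S(m1)\<close> is
  \<open>m0 S(m3) \<otimes> m1 S(m2)\<close>, and the second component collapses to 1.\<close>

lemma rs_pm:
  assumes [simp]: "m \<in> carr M" and F: "bilin M H F"
  shows "rs H M (pm H M m) F = F (pm H M m) 1"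
proof -
  note [lin] = bilinD[OF F]
  let ?S = "antipode H"
  have a: "cs H w (\<lambda>z1 c. F u (z1 * ?S c)) = counit H w * F u 1" if "u \<in> carr M" for w u
    using cs_antipode(2)[of "\<lambda>z. F u z" w] that by (simp add: lin)
  have "rs H M (pm H M m) F = rs H M m (\<lambda>m0 m1. rs H M (ract M m0 (?S m1)) F)"
    by (rule pm_form) (simp_all add: lin)
  also have "\<dots> = rs H M m (\<lambda>m0 m1. rs H M m0 (\<lambda>z0 z1. cs H m1 (\<lambda>c d. F (ract M z0 (?S d)) (z1 * ?S c))))"
    using F by (simp add: rs_ract cs_antipode_comult lin)
  also have "\<dots> = rs H M m (\<lambda>z0 q. cs H q (\<lambda>z1 w. cs H w (\<lambda>c d. F (ract M z0 (?S d)) (z1 * ?S c))))"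
    by (simp add: rs_coassoc trilin_def lin)
  also have "\<dots> = rs H M m (\<lambda>z0 q. cs H q (\<lambda>w d. cs H w (\<lambda>z1 c. F (ract M z0 (?S d)) (z1 * ?S c))))"
    by (simp add: cs_coassoc lin)
  also have "\<dots> = rs H M m (\<lambda>z0 q. F (ract M z0 (?S q)) 1)"
    by (simp add: a cs_counit lin)
  also have "\<dots> = F (pm H M m) 1"
    by (rule pm_form[symmetric]) (simp_all add: lin)
  finally show ?thesis .
qed

text \<open>In \<open>m0 h1 S(m1 h2) = m0 h1 S(h2) S(m1)\<close> the two parts of \<open>h\<close>
  are adjacent.\<close>

lemma pm_ract:
  assumes [simp]: "m \<in> carr M"
  shows "pm H M (ract M m h) = scl M (counit H h) (pm H M m)"
proof (rule vec_eqI[of M])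
  fix g assume g: "lin_map M base g"
  note [lin] = g lin_compose[OF g]
  let ?S = "antipode H"
  have a: "cs H h (\<lambda>b1 b2. g (ract M (ract M u b1) (?S (m1 * b2)))) = counit H h * g (ract M u (?S m1))"
    if "u \<in> carr M" for u m1
    using cs_antipode(2)[of "\<lambda>z. g (ract M u (z * ?S m1))" h] that by (simp add: lin antipode_mult)
  have "g (pm H M (ract M m h)) = rs H M (ract M m h) (\<lambda>m0 m1. g (ract M m0 (?S m1)))"
    by (rule pm_form[OF g]) simp
  also have "\<dots> = counit H h * g (pm H M m)"
    by (simp add: rs_ract bilin_def lin a sm_mult_left pm_form[OF g])
  finally show "g (pm H M (ract M m h)) = g (scl M (counit H h) (pm H M m))"
    by (simp add: lin_mapD(3)[OF g])
qed (simp_all add: scale_closed)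

text \<open>In \<open>h1 m0 S(h2 m1) = h1 m0 S(m1) S(h2)\<close> the parts of \<open>h\<close>
  enclose the coinvariant of \<open>m\<close>.\<close>

lemma pm_lact:
  assumes [simp]: "m \<in> carr M"
  shows "pm H M (lact M h m) = adj H M h (pm H M m)"
proof (rule vec_eqI[of M])
  fix g assume g: "lin_map M base g"
  note [lin] = g lin_compose[OF g]
  let ?S = "antipode H"
  have "g (pm H M (lact M h m)) = rs H M (lact M h m) (\<lambda>m0 m1. g (ract M m0 (?S m1)))"
    by (rule pm_form[OF g]) simp
  also have "\<dots> = cs H h (\<lambda>h1 h2. rs H M m (\<lambda>m0 m1. g (ract M (lact M h1 (ract M m0 (?S m1))) (?S h2))))"
    by (simp add: rs_lact bilin_def lin antipode_mult bicov_commute)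
  also have "\<dots> = cs H h (\<lambda>h1 h2. g (ract M (lact M h1 (pm H M m)) (?S h2)))"
  proof (rule sm_cong[OF refl refl refl refl])
    fix h1 h2
    have "lin_map M base (\<lambda>u. g (ract M (lact M h1 u) (?S h2)))" by (simp add: lin)
    from pm_form[OF this, of m]
    show "rs H M m (\<lambda>m0 m1. g (ract M (lact M h1 (ract M m0 (?S m1))) (?S h2))) = g (ract M (lact M h1 (pm H M m)) (?S h2))"
      by simp
  qed
  also have "\<dots> = g (adj H M h (pm H M m))" by (rule adj_form[OF g, symmetric]) simp
  finally show "g (pm H M (lact M h m)) = g (adj H M h (pm H M m))" .
qed simp_all

text \<open>Reversal of the coproduct by the antipode sends the last component of \<open>m\<close>
  to the left leg, and the inner two recombine to the coinvariant: \<open>m0 S(m1)\<close> has left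
  coaction \<open>r S(m2) \<otimes> m0 S(m1)\<close> with \<open>r\<close> the left component of
  \<open>m\<close>.\<close>

lemma ls_pm:
  assumes [simp]: "m \<in> carr M" and F: "bilin H M F"
  shows "ls H M (pm H M m) F = ls H M m (\<lambda>r m0. rs H M m0 (\<lambda>w0 w1. F (r * antipode H w1) (pm H M w0)))"
proof -
  note [lin] = bilinD[OF F] pm_adj_lin
  let ?S = "antipode H"
  have f: "F h (pm H M w) = rs H M w (\<lambda>z c. F h (ract M z (?S c)))" if "w \<in> carr M" for h w
    by (rule pm_form) (use that F in \<open>simp_all add: bilin_def\<close>)
  have "ls H M (pm H M m) F = rs H M m (\<lambda>m0 m1. ls H M (ract M m0 (?S m1)) F)"
    by (rule pm_form) (simp_all add: lin)
  also have "\<dots> = rs H M m (\<lambda>m0 m1. ls H M m0 (\<lambda>p z. cs H m1 (\<lambda>c d. F (p * ?S d) (ract M z (?S c)))))"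
    using F by (simp add: ls_ract cs_antipode_comult lin)
  also have "\<dots> = ls H M m (\<lambda>p m0. rs H M m0 (\<lambda>z m1. cs H m1 (\<lambda>c d. F (p * ?S d) (ract M z (?S c)))))"
    by (simp add: ls_rs_commute trilin_def lin)
  also have "\<dots> = ls H M m (\<lambda>r m0. rs H M m0 (\<lambda>w0 w1. F (r * ?S w1) (pm H M w0)))"
    by (simp add: f rs_coassoc trilin_def lin)
  finally show ?thesis .
qed

text \<open>For coinvariant \<open>u\<close> the coaction of \<open>x1 u S(x2)\<close> is
  \<open>x1 u S(x4) \<otimes> x2 S(x3)\<close>, where again the second component is trivial.
  Coinvariance of \<open>u\<close> is expressed on all forms.\<close>

lemma rs_adj:
  assumes [simp]: "u \<in> carr M" and u: "\<And>G. bilin M H G \<Longrightarrow> rs H M u G = G u 1" and F: "bilin M H F"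
  shows "rs H M (adj H M x u) F = F (adj H M x u) 1"
proof -
  note [lin] = bilinD[OF F]
  let ?S = "antipode H"
  have a: "cs H w (\<lambda>z1 c. F v (z1 * ?S c)) = counit H w * F v 1" if "v \<in> carr M" for w v
    using cs_antipode(2)[of "\<lambda>z. F v z" w] that by (simp add: lin)
  have "rs H M (adj H M x u) F = cs H x (\<lambda>x1 x2. rs H M (ract M (lact M x1 u) (?S x2)) F)"
    by (rule adj_form) (simp_all add: lin)
  also have "\<dots> = cs H x (\<lambda>x1 x2. cs H x1 (\<lambda>y1 y2. cs H x2 (\<lambda>c d. F (ract M (lact M y1 u) (?S d)) (y2 * ?S c))))"
    using F by (simp add: rs_ract rs_lact cs_antipode_comult bilin_def u lin)
  also have "\<dots> = cs H x (\<lambda>y1 q. cs H q (\<lambda>y2 w. cs H w (\<lambda>c d. F (ract M (lact M y1 u) (?S d)) (y2 * ?S c))))"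
    by (simp add: cs_coassoc lin)
  also have "\<dots> = cs H x (\<lambda>y1 q. cs H q (\<lambda>w d. cs H w (\<lambda>y2 c. F (ract M (lact M y1 u) (?S d)) (y2 * ?S c))))"
    by (simp add: cs_coassoc lin)
  also have "\<dots> = cs H x (\<lambda>y1 d. F (ract M (lact M y1 u) (?S d)) 1)"
    by (simp add: a cs_counit lin)
  also have "\<dots> = F (adj H M x u) 1"
    by (rule adj_form[symmetric]) (simp_all add: lin)
  finally show ?thesis .
qed

text \<open>The outer parts of \<open>x\<close> go to the left leg, and the inner two form an
  adjoint action again. Nothing cancels here; this is the source of the antipodes that
  \<open>ls_hf\<close> has to remove.\<close>

lemma ls_adj:
  assumes [simp]: "u \<in> carr M" and F: "bilin H M F"
  shows "ls H M (adj H M x u) F = cs H x (\<lambda>x1 y. cs H y (\<lambda>x2 x3.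
     ls H M u (\<lambda>r w. F (x1 * r * antipode H x3) (adj H M x2 w))))"
proof -
  note [lin] = bilinD[OF F] pm_adj_lin
  let ?S = "antipode H"
  have f: "F h (adj H M x w) = cs H x (\<lambda>c d. F h (ract M (lact M c w) (?S d)))" if "w \<in> carr M" for h w x
    by (rule adj_form) (use that F in \<open>simp_all add: bilin_def\<close>)
  have "ls H M (adj H M x u) F = cs H x (\<lambda>x1 x2. ls H M (ract M (lact M x1 u) (?S x2)) F)"
    by (rule adj_form) (simp_all add: lin)
  also have "\<dots> = cs H x (\<lambda>x1 x2. cs H x1 (\<lambda>y1 y2. ls H M u (\<lambda>r w. cs H x2 (\<lambda>c d.
      F (y1 * r * ?S d) (ract M (lact M y2 w) (?S c))))))"
    using F by (simp add: ls_ract ls_lact cs_antipode_comult bilin_def lin)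
  also have "\<dots> = cs H x (\<lambda>y1 q. cs H q (\<lambda>y2 x2. cs H x2 (\<lambda>c d. ls H M u (\<lambda>r w.
      F (y1 * r * ?S d) (ract M (lact M y2 w) (?S c))))))"
    by (simp add: cs_coassoc lin sm_swap[where t = "lco M u"])
  also have "\<dots> = cs H x (\<lambda>x1 y. cs H y (\<lambda>x2 x3. ls H M u (\<lambda>r w. F (x1 * r * ?S x3) (adj H M x2 w))))"
    by (simp add: f cs_coassoc lin sm_swap[where t = "lco M u"])
  finally show ?thesis .
qed

text \<open>Because the antipode reverses products, \<open>adj\<close> is a left action of
  \<open>H\<close>.\<close>

lemma adj_mult:
  assumes [simp]: "u \<in> carr M"
  shows "adj H M (x * y) u = adj H M x (adj H M y u)"
proof (rule vec_eqI[of M])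
  fix g assume g: "lin_map M base g"
  note [lin] = g lin_compose[OF g]
  let ?S = "antipode H"
  have "g (adj H M x (adj H M y u)) = cs H x (\<lambda>x1 x2. g (ract M (lact M x1 (adj H M y u)) (?S x2)))"
    by (rule adj_form[OF g]) simp
  also have "\<dots> = cs H x (\<lambda>x1 x2. cs H y (\<lambda>y1 y2. g (ract M (lact M x1 (ract M (lact M y1 u) (?S y2))) (?S x2))))"
    by (rule sm_cong[OF refl refl refl refl], rule adj_form) (simp_all add: lin)
  also have "\<dots> = cs H (x * y) (\<lambda>z1 z2. g (ract M (lact M z1 u) (?S z2)))"
    by (simp add: cs_mult lin antipode_mult bicov_commute)
  also have "\<dots> = g (adj H M (x * y) u)" by (rule adj_form[OF g, symmetric]) simp
  finally show "g (adj H M (x * y) u) = g (adj H M x (adj H M y u))" by simp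
qed simp_all

end

end

section \<open>The tensor product of rational morphisms\<close>

text \<open>The form of \<open>(\<phi> \<hat>\<otimes> \<psi>)(m \<otimes> n)\<close> used in computations: \<open>\<phi>(x \<triangleright> m\<^sub>0 S(m\<^sub>1)) \<otimes> \<psi>\<^sub>0(m\<^sub>2 n)\<close>, \<open>x = \<psi>\<^sub>-\<^sub>1\<close>,
  where \<open>\<triangleright>\<close> is the adjoint action.\<close>

definition hf ::
  "('k::field, 'h::ring_1) hopf \<Rightarrow> ('k, 'h, 'm::ab_group_add) bicov
    \<Rightarrow> ('k, 'h, 'm'::ab_group_add) bicov \<Rightarrow> ('k, 'h, 'n::ab_group_add) bicov
    \<Rightarrow> ('k, 'h, 'n'::ab_group_add) bicov \<Rightarrow> ('m \<Rightarrow> 'm') \<Rightarrow> ('n \<Rightarrow> 'n')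
    \<Rightarrow> 'm \<Rightarrow> 'n \<Rightarrow> ('m', 'n', 'k) tensor" where
  "hf H M M' N N' \<phi> \<psi> m n = ls H (HOM H N N') \<psi> (\<lambda>x \<psi>0. rs H M m (\<lambda>m0 m1.
     \<phi> (adj H M x (pm H M m0)) \<odot>\<^bsub>M',N'\<^esub> \<psi>0 (lact N m1 n)))"

context hopf
begin

lemma cs_antipode_pair:
  assumes g: "lin_map H base g"
  shows "cs H a (\<lambda>a1 a2. cs H b (\<lambda>b1 b2. g (antipode H (a1 * b1) * (a2 * b2)))) = counit H a * (counit H b * g 1)"
proof -
  note [lin] = lin_compose[OF g]
  have "cs H a (\<lambda>a1 a2. cs H b (\<lambda>b1 b2. g (antipode H (a1 * b1) * (a2 * b2)))) = cs H (a * b) (\<lambda>x y. g (antipode H x * y))"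
    by (simp add: cs_mult lin)
  then show ?thesis by (simp add: cs_antipode(1)[OF g] counit_mult mult.assoc)
qed

context
  fixes M :: "('k, 'h, 'm::ab_group_add) bicov" and M' :: "('k, 'h, 'm'::ab_group_add) bicov"
    and N :: "('k, 'h, 'n::ab_group_add) bicov" and N' :: "('k, 'h, 'n'::ab_group_add) bicov"
  assumes M [simp]: "bicov_bimodule H M" and M' [simp]: "bicov_bimodule H M'"
    and N [simp]: "bicov_bimodule H N" and N' [simp]: "bicov_bimodule H N'"
begin

private abbreviation "HM \<equiv> HOM H M M'"
private abbreviation "HN \<equiv> HOM H N N'"
private abbreviation "TT \<equiv> tensor_H H M N"
private abbreviation "TT' \<equiv> tensor_H H M' N'"
private abbreviation "BB' \<equiv> balanced_forms M' N'"

private lemma hat_bicov [simp]: "bicov_bimodule H HM" "bicov_bimodule H HN" "bicov_bimodule H TT" "bicov_bimodule H TT'"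
  by (rule bicov_bimodule_HOM bicov_bimodule_tensor; simp)+

private lemmas hat_closed [simp] = HOM_closed(1)[OF M M'] HOM_closed(1)[OF N N'] pm_adj_in[OF M]
text \<open>Rules whose head is a bound morphism are only matched first-order by the simplifier, so that the
  arguments have to be spelled out.\<close>

private lemma hat_lin_special:
  "\<chi> \<in> carr HN \<Longrightarrow> n \<in> carr N \<Longrightarrow> lin_map H N' (\<lambda>a. \<chi> (lact N a n))"
  "\<chi> \<in> carr HN \<Longrightarrow> lin_map N N' (\<lambda>n. \<chi> (lact N a n))"
  "\<theta> \<in> carr HM \<Longrightarrow> lin_map M M' (\<lambda>m. \<theta> (adj H M x (pm H M m)))"
  "\<theta> \<in> carr HM \<Longrightarrow> m \<in> carr M \<Longrightarrow> lin_map H M' (\<lambda>x. \<theta> (adj H M x (pm H M m)))"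
  "\<chi> \<in> carr HN \<Longrightarrow> n \<in> carr N \<Longrightarrow> lin_map H N' (\<lambda>b. \<chi> (lact N a (lact N b n)))"
  using lin_compose[OF HOM_lin(3)[OF N N', of \<chi>], of H "\<lambda>a. lact N a n"]
    lin_compose[OF HOM_lin(3)[OF N N', of \<chi>], of N "\<lambda>n. lact N a n"]
    lin_compose[OF HOM_lin(3)[OF M M', of \<theta>], of M "\<lambda>m. adj H M x (pm H M m)"]
    lin_compose[OF HOM_lin(3)[OF M M', of \<theta>], of H "\<lambda>x. adj H M x (pm H M m)"]
    lin_compose[OF HOM_lin(3)[OF N N', of \<chi>], of H "\<lambda>b. lact N a (lact N b n)"]
  by (simp_all add: lin pm_adj_lin[OF M] pm_adj_in[OF M])

private lemmas hat_lin = HOM_lin[OF M M'] HOM_lin[OF N N'] pm_adj_lin[OF M] hat_lin_special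

private lemma bal: "m \<in> carr M' \<Longrightarrow> n \<in> carr N' \<Longrightarrow> pure BB' (ract M' m h) n = pure BB' m (lact N' h n)"
  by (rule tens_H_balanced)

private lemma hf_in [simp]:
  "\<phi> \<in> carr HM \<Longrightarrow> \<psi> \<in> carr HN \<Longrightarrow> m \<in> carr M \<Longrightarrow> n \<in> carr N \<Longrightarrow> hf H M M' N N' \<phi> \<psi> m n \<in> carr TT'"
  unfolding hf_def by (intro sm_closed) simp_all

private lemma hf_lin:
  "\<phi> \<in> carr HM \<Longrightarrow> \<psi> \<in> carr HN \<Longrightarrow> n \<in> carr N \<Longrightarrow> lin_map X M f \<Longrightarrow> lin_map X TT' (\<lambda>x. hf H M M' N N' \<phi> \<psi> (f x) n)"
  "\<phi> \<in> carr HM \<Longrightarrow> \<psi> \<in> carr HN \<Longrightarrow> m \<in> carr M \<Longrightarrow> lin_map X N g \<Longrightarrow> lin_map X TT' (\<lambda>x. hf H M M' N N' \<phi> \<psi> m (g x))"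
  "\<psi> \<in> carr HN \<Longrightarrow> m \<in> carr M \<Longrightarrow> n \<in> carr N \<Longrightarrow> lin_map HM TT' (\<lambda>\<phi>. hf H M M' N N' \<phi> \<psi> m n)"
  "\<phi> \<in> carr HM \<Longrightarrow> m \<in> carr M \<Longrightarrow> n \<in> carr N \<Longrightarrow> lin_map HN TT' (\<lambda>\<psi>. hf H M M' N N' \<phi> \<psi> m n)"
proof -
  show "lin_map X TT' (\<lambda>x. hf H M M' N N' \<phi> \<psi> (f x) n)" if "\<phi> \<in> carr HM" "\<psi> \<in> carr HN" "n \<in> carr N" "lin_map X M f"
    by (rule lin_compose[OF _ that(4)]) (use that(1-3) in \<open>simp add: hf_def lin hat_lin\<close>)
  show "lin_map X TT' (\<lambda>x. hf H M M' N N' \<phi> \<psi> m (g x))" if "\<phi> \<in> carr HM" "\<psi> \<in> carr HN" "m \<in> carr M" "lin_map X N g"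
    by (rule lin_compose[OF _ that(4)]) (use that(1-3) in \<open>simp add: hf_def lin hat_lin\<close>)
qed (simp_all add: hf_def lin hat_lin)

private lemma hf_form:
  assumes "lin_map TT' base g" and [simp]: "\<phi> \<in> carr HM" "\<psi> \<in> carr HN" "m \<in> carr M" "n \<in> carr N"
  shows "g (hf H M M' N N' \<phi> \<psi> m n) = ls H HN \<psi> (\<lambda>x \<psi>0. rs H M m (\<lambda>m0 m1.
     g (\<phi> (adj H M x (pm H M m0)) \<odot>\<^bsub>M',N'\<^esub> \<psi>0 (lact N m1 n))))"
  unfolding hf_def
  by (subst sm_hom[OF assms(1)], simp, (intro sm_closed; simp), rule sm_cong[OF refl refl refl refl],
    rule sm_hom[OF assms(1)]) simp_all

text \<open>With \<open>p2\<close> and \<open>p1\<close> the two parts of \<open>\<psi>\<close>'s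
  left component, \<open>S(p1 m1) = S(m1) S(p1)\<close> separates the part of \<open>m\<close> from
  that of \<open>\<psi>\<close>: what remains around \<open>m0 S(m1)\<close> is the adjoint action
  of the whole left component.\<close>

lemma hat_formula_eq:
  assumes p [simp]: "\<phi> \<in> carr HM" "\<psi> \<in> carr HN" and mn [simp]: "m \<in> carr M" "n \<in> carr N"
  shows "hat_formula H M M' N N' \<phi> \<psi> m n = hf H M M' N N' \<phi> \<psi> m n"
proof -
  note [lin] = hat_lin HOM_lin(1)[OF M M' p(1)]
  let ?f = "\<lambda>p \<psi>0. cs H p (\<lambda>p2 p1. rs H M m (\<lambda>m0 q. cs H q (\<lambda>m1 m2.
       \<phi> (ract M (lact M p2 m0) (antipode H (p1 * m1))) \<odot>\<^bsub>M',N'\<^esub> \<psi>0 (lact N m2 n))))"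
  have "hat_formula H M M' N N' \<phi> \<psi> m n = ls H HN \<psi> ?f"
    unfolding hat_formula_def by (simp add: sw_eq_sm[where U = TT'] lin)
  also have "\<dots> = hf H M M' N N' \<phi> \<psi> m n"
    unfolding hf_def
  proof (rule sm_cong[OF refl refl refl refl])
    fix p \<psi>0 assume [simp]: "\<psi>0 \<in> carr HN"
    show "?f p \<psi>0 = rs H M m (\<lambda>m0 m1. \<phi> (adj H M p (pm H M m0)) \<odot>\<^bsub>M',N'\<^esub> \<psi>0 (lact N m1 n))"
    proof (rule vec_eqI[of TT'])
      fix g assume g: "lin_map TT' base g"
      note [lin] = lin_compose[OF g]
      have g2: "lin_map M base (\<lambda>u. g (\<phi> u \<odot>\<^bsub>M',N'\<^esub> v))" if "v \<in> carr N'" for v using that by (simp add: lin)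
      have e: "g (\<phi> (adj H M p (pm H M m0)) \<odot>\<^bsub>M',N'\<^esub> v)
        = cs H p (\<lambda>p2 p1. rs H M m0 (\<lambda>z0 z1. g (\<phi> (ract M (lact M p2 z0) (antipode H (p1 * z1))) \<odot>\<^bsub>M',N'\<^esub> v)))"
        if [simp]: "m0 \<in> carr M" "v \<in> carr N'" for m0 v
      proof -
        have "g (\<phi> (adj H M p (pm H M m0)) \<odot>\<^bsub>M',N'\<^esub> v)
          = cs H p (\<lambda>p2 p1. g (\<phi> (ract M (lact M p2 (pm H M m0)) (antipode H p1)) \<odot>\<^bsub>M',N'\<^esub> v))"
          by (rule adj_form[OF M g2]) simp_all
        also have "\<dots> = cs H p (\<lambda>p2 p1. rs H M m0 (\<lambda>z0 z1.
            g (\<phi> (ract M (lact M p2 (ract M z0 (antipode H z1))) (antipode H p1)) \<odot>\<^bsub>M',N'\<^esub> v)))"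
          by (rule sm_cong[OF refl refl refl refl], rule pm_form[OF M]) (simp_all add: lin)
        finally show ?thesis by (simp add: antipode_mult bicov_commute)
      qed
      have "g (?f p \<psi>0) = cs H p (\<lambda>p2 p1. rs H M m (\<lambda>m0 q. cs H q (\<lambda>m1 m2.
          g (\<phi> (ract M (lact M p2 m0) (antipode H (p1 * m1))) \<odot>\<^bsub>M',N'\<^esub> \<psi>0 (lact N m2 n)))))"
        by (simp add: sm_hom[OF g] sm_closed)
      also have "\<dots> = rs H M m (\<lambda>m0 m1. g (\<phi> (adj H M p (pm H M m0)) \<odot>\<^bsub>M',N'\<^esub> \<psi>0 (lact N m1 n)))"
        by (simp add: e rs_coassoc trilin_def lin sm_swap[where t = "comult H p"])
      also have "\<dots> = g (rs H M m (\<lambda>m0 m1. \<phi> (adj H M p (pm H M m0)) \<odot>\<^bsub>M',N'\<^esub> \<psi>0 (lact N m1 n)))"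
        by (simp add: sm_hom[OF g])
      finally show "g (?f p \<psi>0) = g (rs H M m (\<lambda>m0 m1. \<phi> (adj H M p (pm H M m0)) \<odot>\<^bsub>M',N'\<^esub> \<psi>0 (lact N m1 n)))" .
    qed (auto intro!: sm_closed)
  qed
  finally show ?thesis .
qed

text \<open>For \<open>m h\<close> the first factor contains the coinvariant of
  \<open>m0 h1\<close>, that is \<open>counit h1\<close> times the one of \<open>m0\<close>, so all
  of \<open>h\<close> ends up in the second factor as \<open>m1 h n\<close>.\<close>

private lemma hf_adm:
  assumes p [simp]: "\<phi> \<in> carr HM" "\<psi> \<in> carr HN"
  shows "adm (balanced_forms M N) M N TT' (\<lambda>m n. hf H M M' N N' \<phi> \<psi> m n)"
proof (rule tkind_adm)
  note [lin] = hat_lin HOM_lin(1)[OF M M' p(1)]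
  fix m h n assume [simp]: "m \<in> carr M" "n \<in> carr N"
  show "hf H M M' N N' \<phi> \<psi> (ract M m h) n = hf H M M' N N' \<phi> \<psi> m (lact N h n)"
  proof (rule vec_eqI[of TT'])
    fix g assume g: "lin_map TT' base g"
    note [lin] = lin_compose[OF g]
    have s: "g (\<phi> (adj H M x (pm H M (ract M u b))) \<odot>\<^bsub>M',N'\<^esub> v) = counit H b * g (\<phi> (adj H M x (pm H M u)) \<odot>\<^bsub>M',N'\<^esub> v)"
      if [simp]: "u \<in> carr M" "v \<in> carr N'" for u v x b
    proof -
      have "lin_map M base (\<lambda>u. g (\<phi> (adj H M x u) \<odot>\<^bsub>M',N'\<^esub> v))" by (simp add: lin)
      from lin_mapD(3)[OF this, of "pm H M u" "counit H b"] show ?thesis by (simp add: pm_ract)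
    qed
    show "g (hf H M M' N N' \<phi> \<psi> (ract M m h) n) = g (hf H M M' N N' \<phi> \<psi> m (lact N h n))"
      by (simp add: hf_form[OF g] rs_ract bilin_def lin s cs_counit)
  qed simp_all
qed (simp_all add: hf_lin lin)

section \<open>The induced map on the tensor product over \<open>H\<close>\<close>

private abbreviation "hat \<equiv> hat_map H M M' N N'"

private lemma hat_sm:
  assumes "\<phi> \<in> carr HM" "\<psi> \<in> carr HN" "t \<in> carr TT"
  shows "hat \<phi> \<psi> t = sm (balanced_forms M N) M N t (\<lambda>m n. hf H M M' N N' \<phi> \<psi> m n)"
proof -
  have "hat \<phi> \<psi> t = lift_H M N (hat_formula H M M' N N' \<phi> \<psi>) t" using assms(3) by (simp add: hat_map_def)
  also have "\<dots> = lift_H M N (\<lambda>m n. hf H M M' N N' \<phi> \<psi> m n) t"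
    by (rule lift_cong[OF refl refl refl refl]) (simp add: hat_formula_eq assms)
  also have "\<dots> = sm (balanced_forms M N) M N t (\<lambda>m n. hf H M M' N N' \<phi> \<psi> m n)"
    by (rule lift_eq_sm[OF hf_adm]) (use assms in \<open>simp_all add: bicov_tensor_simps\<close>)
  finally show ?thesis .
qed

private lemma hat_pure [simp]:
  assumes "\<phi> \<in> carr HM" "\<psi> \<in> carr HN" "m \<in> carr M" "n \<in> carr N"
  shows "hat \<phi> \<psi> (m \<odot>\<^bsub>M,N\<^esub> n) = hf H M M' N N' \<phi> \<psi> m n"
  using assms by (simp add: hat_sm sm_pure[OF hf_adm])

private lemma hat_T_lin:
  assumes "\<phi> \<in> carr HM" "\<psi> \<in> carr HN"
  shows "lin_map TT TT' (hat \<phi> \<psi>)"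
proof -
  have "lin_map TT TT' (\<lambda>t. sm (balanced_forms M N) M N t (\<lambda>m n. hf H M M' N N' \<phi> \<psi> m n))"
    using lin_sm_arg[OF hf_adm[OF assms]] by (simp only: bicov_tensor_vspace)
  then show ?thesis by (subst lin_map_cong) (auto simp: hat_sm assms)
qed

private lemma hat_hom: "\<phi> \<in> carr HM \<Longrightarrow> \<psi> \<in> carr HN \<Longrightarrow> hat \<phi> \<psi> \<in> carr (hom_space TT TT')"
  using hat_T_lin by (simp add: hom_space_simps hat_map_def)

private lemma hat_lin_args:
  "\<psi> \<in> carr HN \<Longrightarrow> t \<in> carr TT \<Longrightarrow> lin_map HM TT' (\<lambda>\<phi>. hat \<phi> \<psi> t)"
  "\<phi> \<in> carr HM \<Longrightarrow> t \<in> carr TT \<Longrightarrow> lin_map HN TT' (\<lambda>\<psi>. hat \<phi> \<psi> t)"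
proof -
  assume t [simp]: "t \<in> carr TT"
  show "lin_map HM TT' (\<lambda>\<phi>. hat \<phi> \<psi> t)" if [simp]: "\<psi> \<in> carr HN"
    by (subst lin_map_cong[where g = "\<lambda>\<phi>. sm (balanced_forms M N) M N t (\<lambda>m n. hf H M M' N N' \<phi> \<psi> m n)"])
      (simp_all add: hat_sm lin hf_lin)
  show "lin_map HN TT' (\<lambda>\<psi>. hat \<phi> \<psi> t)" if [simp]: "\<phi> \<in> carr HM"
    by (subst lin_map_cong[where g = "\<lambda>\<psi>. sm (balanced_forms M N) M N t (\<lambda>m n. hf H M M' N N' \<phi> \<psi> m n)"])
      (simp_all add: hat_sm lin hf_lin)
qed

text \<open>The argument of \<open>\<phi>\<close> is right coinvariant and contributes 1 to the
  \<open>H\<close>-component. Only \<open>\<phi>1\<close> and the components of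
  \<open>\<psi>0(m1 n)\<close> remain, in the order required by a diagonal coaction.\<close>

private lemma rs_hf:
  assumes p [simp]: "\<phi> \<in> carr HM" "\<psi> \<in> carr HN" and mn [simp]: "m \<in> carr M" "n \<in> carr N" and b: "bilin TT' H \<beta>"
  shows "rs H TT' (hf H M M' N N' \<phi> \<psi> m n) \<beta> = rs H HM \<phi> (\<lambda>\<phi>0 \<phi>1. rs H HN \<psi> (\<lambda>\<psi>0 \<psi>1.
     rs H M m (\<lambda>m0 m1. rs H N n (\<lambda>n0 n1. \<beta> (hf H M M' N N' \<phi>0 \<psi>0 m0 n0) (\<phi>1 * \<psi>1 * (m1 * n1))))))"
proof -
  note [lin] = hat_lin bilinD[OF b] hf_lin
  let ?q = "\<lambda>x m. adj H M x (pm H M m)"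
  have co: "rs H M (?q x u) F = F (?q x u) 1" if [simp]: "u \<in> carr M" and F: "bilin M H F" for x u F
    by (rule rs_adj[OF M _ _ F]) (simp_all add: rs_pm[OF M])
  have "rs H TT' (hf H M M' N N' \<phi> \<psi> m n) \<beta> = ls H HN \<psi> (\<lambda>x \<psi>0. rs H M m (\<lambda>m0 m1.
     rs H TT' (\<phi> (?q x m0) \<odot>\<^bsub>M',N'\<^esub> \<psi>0 (lact N m1 n)) \<beta>))"
    by (rule hf_form) (simp_all add: lin)
  also have "\<dots> = ls H HN \<psi> (\<lambda>x \<psi>0. rs H M m (\<lambda>m0 m1. rs H HM \<phi> (\<lambda>\<phi>0 \<phi>1. rs H HN \<psi>0 (\<lambda>\<chi> \<psi>1.
     rs H N (lact N m1 n) (\<lambda>n0 n1. \<beta> (\<phi>0 (?q x m0) \<odot>\<^bsub>M',N'\<^esub> \<chi> n0) (\<phi>1 * (\<psi>1 * n1)))))))"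
    using b by (simp add: rs_tensor_pure HOM_K[OF M M'] HOM_K[OF N N'] bilin_def lin co)
  also have "\<dots> = ls H HN \<psi> (\<lambda>x \<psi>0. rs H M m (\<lambda>m0 m1. rs H HM \<phi> (\<lambda>\<phi>0 \<phi>1. rs H HN \<psi>0 (\<lambda>\<chi> \<psi>1.
     cs H m1 (\<lambda>a b. rs H N n (\<lambda>n0 n1. \<beta> (\<phi>0 (?q x m0) \<odot>\<^bsub>M',N'\<^esub> \<chi> (lact N a n0)) (\<phi>1 * (\<psi>1 * (b * n1)))))))))"
    by (simp add: rs_lact bilin_def lin)
  \<comment> \<open>A mere interchange of sums: the coactions of \<open>\<psi>\<close> become
    adjacent, so that they can be commuted next.\<close>
  also have "\<dots> = rs H HM \<phi> (\<lambda>\<phi>0 \<phi>1. ls H HN \<psi> (\<lambda>x \<psi>0. rs H HN \<psi>0 (\<lambda>\<chi> \<psi>1. rs H M m (\<lambda>m0 m1.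
     cs H m1 (\<lambda>a b. rs H N n (\<lambda>n0 n1. \<beta> (\<phi>0 (?q x m0) \<odot>\<^bsub>M',N'\<^esub> \<chi> (lact N a n0)) (\<phi>1 * (\<psi>1 * (b * n1)))))))))"
    by (subst (2) sm_swap, subst (3) sm_swap, subst sm_swap) (rule refl)
  \<comment> \<open>Commuting the coactions of \<open>\<psi>\<close> and coassociativity in
    \<open>M\<close> restore the shape of \<open>hf\<close>, now for \<open>\<psi>0\<close> and
    \<open>m0\<close>.\<close>
  also have "\<dots> = rs H HM \<phi> (\<lambda>\<phi>0 \<phi>1. rs H HN \<psi> (\<lambda>\<psi>0 \<psi>1. ls H HN \<psi>0 (\<lambda>x \<chi>. rs H M m (\<lambda>m0 m1.
     rs H M m0 (\<lambda>y z. rs H N n (\<lambda>n0 n1. \<beta> (\<phi>0 (?q x y) \<odot>\<^bsub>M',N'\<^esub> \<chi> (lact N z n0)) (\<phi>1 * (\<psi>1 * (m1 * n1)))))))))"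
    by (simp add: ls_rs_commute rs_coassoc trilin_def lin)
  also have "\<dots> = rs H HM \<phi> (\<lambda>\<phi>0 \<phi>1. rs H HN \<psi> (\<lambda>\<psi>0 \<psi>1.
     rs H M m (\<lambda>m0 m1. rs H N n (\<lambda>n0 n1. \<beta> (hf H M M' N N' \<phi>0 \<psi>0 m0 n0) (\<phi>1 * \<psi>1 * (m1 * n1))))))"
  proof -
    have l: "lin_map TT' base (\<lambda>t. \<beta> t h)" for h using b by (simp add: bilin_def)
    have "rs H M m (\<lambda>m0 m1. rs H N n (\<lambda>n0 n1. \<beta> (hf H M M' N N' \<phi>0 \<psi>0 m0 n0) (\<phi>1 * \<psi>1 * (m1 * n1))))
      = ls H HN \<psi>0 (\<lambda>x \<chi>. rs H M m (\<lambda>m0 m1.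
        rs H M m0 (\<lambda>y z. rs H N n (\<lambda>n0 n1. \<beta> (\<phi>0 (?q x y) \<odot>\<^bsub>M',N'\<^esub> \<chi> (lact N z n0)) (\<phi>1 * (\<psi>1 * (m1 * n1)))))))"
      if [simp]: "\<phi>0 \<in> carr HM" "\<psi>0 \<in> carr HN" for \<phi>0 \<psi>0 \<phi>1 \<psi>1
    proof -
      have "rs H M m (\<lambda>m0 m1. rs H N n (\<lambda>n0 n1. \<beta> (hf H M M' N N' \<phi>0 \<psi>0 m0 n0) (\<phi>1 * \<psi>1 * (m1 * n1))))
        = rs H M m (\<lambda>m0 m1. rs H N n (\<lambda>n0 n1. ls H HN \<psi>0 (\<lambda>x \<chi>. rs H M m0 (\<lambda>y z.
          \<beta> (\<phi>0 (?q x y) \<odot>\<^bsub>M',N'\<^esub> \<chi> (lact N z n0)) (\<phi>1 * (\<psi>1 * (m1 * n1)))))))"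
        by (simp add: hf_form[OF l] mult.assoc)
      also have "\<dots> = rs H M m (\<lambda>m0 m1. ls H HN \<psi>0 (\<lambda>x \<chi>. rs H M m0 (\<lambda>y z. rs H N n (\<lambda>n0 n1. 
          \<beta> (\<phi>0 (?q x y) \<odot>\<^bsub>M',N'\<^esub> \<chi> (lact N z n0)) (\<phi>1 * (\<psi>1 * (m1 * n1)))))))"
        by (simp only: sm_swap[where t = "rco N n"])
      also have "\<dots> = ls H HN \<psi>0 (\<lambda>x \<chi>. rs H M m (\<lambda>m0 m1. rs H M m0 (\<lambda>y z. rs H N n (\<lambda>n0 n1. 
          \<beta> (\<phi>0 (?q x y) \<odot>\<^bsub>M',N'\<^esub> \<chi> (lact N z n0)) (\<phi>1 * (\<psi>1 * (m1 * n1)))))))"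
        by (rule sm_swap)
      finally show ?thesis .
    qed
    then show ?thesis by simp
  qed
  finally show ?thesis .
qed

private lemma ls_q:
  assumes [simp]: "u \<in> carr M" and F: "bilin H M F"
  shows "ls H M (adj H M x (pm H M u)) F = cs H x (\<lambda>x1 y. cs H y (\<lambda>x2 x3. ls H M u (\<lambda>r u0. rs H M u0 (\<lambda>w0 w1.
     F (x1 * (r * antipode H w1) * antipode H x3) (adj H M x2 (pm H M w0))))))"
proof -
  note [lin] = bilinD[OF F] pm_adj_lin[OF M]
  show ?thesis by (simp add: ls_adj[OF M _ F] ls_pm[OF M] bilin_def lin)
qed

text \<open>The left coaction of the first factor ends in \<open>S(w1) S(x3)\<close>, with
  \<open>w1\<close> from \<open>m\<close> and \<open>x3\<close> from \<open>\<psi>\<close>, and that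
  of the second begins with \<open>s a\<close>, again from \<open>\<psi>\<close> and
  \<open>m\<close>. After regrouping these are consecutive components, and
  \<open>S(x3 w1) s a\<close> cancels by \<open>cs_antipode_pair\<close>.\<close>

private lemma ls_hf:
  assumes p [simp]: "\<phi> \<in> carr HM" "\<psi> \<in> carr HN" and mn [simp]: "m \<in> carr M" "n \<in> carr N" and b: "bilin H TT' \<beta>"
  shows "ls H TT' (hf H M M' N N' \<phi> \<psi> m n) \<beta> = ls H HM \<phi> (\<lambda>k \<phi>0. ls H HN \<psi> (\<lambda>q \<psi>0.
     ls H M m (\<lambda>r m0. ls H N n (\<lambda>t n0. \<beta> (k * q * (r * t)) (hf H M M' N N' \<phi>0 \<psi>0 m0 n0)))))"
proof -
  note [lin] = hat_lin bilinD[OF b] hf_lin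
  let ?S = "antipode H" and ?e = "counit H"
  let ?q = "\<lambda>x m. adj H M x (pm H M m)"
  let ?v = "\<lambda>\<phi>0 x2 w0 \<chi> b n0. \<phi>0 (?q x2 w0) \<odot>\<^bsub>M',N'\<^esub> \<chi> (lact N b n0)"
  let ?L = "\<lambda>k x1 x2 x3 s r w0 w1 a b \<phi>0 \<chi>. ls H N n (\<lambda>t n0.
      \<beta> (k * (x1 * (r * ?S w1) * ?S x3) * (s * (a * t))) (?v \<phi>0 x2 w0 \<chi> b n0))"
  let ?L1 = "\<lambda>k x1 x2 r w0 b \<phi>0 \<chi>. ls H N n (\<lambda>t n0. \<beta> (k * (x1 * (r * t))) (?v \<phi>0 x2 w0 \<chi> b n0))"
  have l: "lin_map TT' base (\<lambda>t. \<beta> h t)" for h using b by (simp add: bilin_def)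
  have "ls H TT' (hf H M M' N N' \<phi> \<psi> m n) \<beta> = ls H HN \<psi> (\<lambda>x \<psi>0. rs H M m (\<lambda>m0 m1.
     ls H TT' (\<phi> (?q x m0) \<odot>\<^bsub>M',N'\<^esub> \<psi>0 (lact N m1 n)) \<beta>))"
    by (rule hf_form) (simp_all add: lin)
  also have "\<dots> = ls H HN \<psi> (\<lambda>x \<psi>0. rs H M m (\<lambda>m0 m1. ls H HM \<phi> (\<lambda>k \<phi>0. ls H M (?q x m0) (\<lambda>z z0.
     ls H HN \<psi>0 (\<lambda>s \<chi>. ls H N (lact N m1 n) (\<lambda>t n0. \<beta> (k * z * (s * t)) (\<phi>0 z0 \<odot>\<^bsub>M',N'\<^esub> \<chi> n0)))))))"
    using b by (simp add: ls_tensor_pure HOM_K[OF M M'] HOM_K[OF N N'] bilin_def lin)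
  also have "\<dots> = ls H HN \<psi> (\<lambda>x \<psi>0. rs H M m (\<lambda>m0 m1. ls H HM \<phi> (\<lambda>k \<phi>0. ls H M (?q x m0) (\<lambda>z z0.
     ls H HN \<psi>0 (\<lambda>s \<chi>. cs H m1 (\<lambda>a b. ls H N n (\<lambda>t n0. \<beta> (k * z * (s * (a * t))) (\<phi>0 z0 \<odot>\<^bsub>M',N'\<^esub> \<chi> (lact N b n0)))))))))"
    by (simp add: ls_lact bilin_def lin)
  also have "\<dots> = ls H HN \<psi> (\<lambda>x \<psi>0. rs H M m (\<lambda>m0 m1. ls H HM \<phi> (\<lambda>k \<phi>0. 
     cs H x (\<lambda>x1 y. cs H y (\<lambda>x2 x3. ls H M m0 (\<lambda>r u0. rs H M u0 (\<lambda>w0 w1.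
     ls H HN \<psi>0 (\<lambda>s \<chi>. cs H m1 (\<lambda>a b. ?L k x1 x2 x3 s r w0 w1 a b \<phi>0 \<chi>)))))))))"
    by (simp add: ls_q bilin_def lin)
  \<comment> \<open>Only the order of summation changes; both coactions of \<open>\<psi>\<close> and
    all those of \<open>m\<close> are brought together.\<close>
  also have "\<dots> = ls H HM \<phi> (\<lambda>k \<phi>0. ls H HN \<psi> (\<lambda>x \<psi>0. ls H HN \<psi>0 (\<lambda>s \<chi>. cs H x (\<lambda>x1 y. cs H y (\<lambda>x2 x3.
     rs H M m (\<lambda>m0 m1. ls H M m0 (\<lambda>r u0. rs H M u0 (\<lambda>w0 w1. cs H m1 (\<lambda>a b. ?L k x1 x2 x3 s r w0 w1 a b \<phi>0 \<chi>)))))))))"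
  proof -
    have "rs H M m (\<lambda>m0 m1. ls H HM \<phi> (\<lambda>k \<phi>0. 
       cs H x (\<lambda>x1 y. cs H y (\<lambda>x2 x3. ls H M m0 (\<lambda>r u0. rs H M u0 (\<lambda>w0 w1.
       ls H HN \<psi>0 (\<lambda>s \<chi>. cs H m1 (\<lambda>a b. ?L k x1 x2 x3 s r w0 w1 a b \<phi>0 \<chi>))))))))
     = ls H HM \<phi> (\<lambda>k \<phi>0. ls H HN \<psi>0 (\<lambda>s \<chi>. cs H x (\<lambda>x1 y. cs H y (\<lambda>x2 x3.
       rs H M m (\<lambda>m0 m1. ls H M m0 (\<lambda>r u0. rs H M u0 (\<lambda>w0 w1. cs H m1 (\<lambda>a b. ?L k x1 x2 x3 s r w0 w1 a b \<phi>0 \<chi>))))))))"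
      for x \<psi>0
      by (simp only: sm_swap[where s = "lco HM \<phi>"] sm_swap[where s = "lco HN \<psi>0" and t = "rco M _"]
        sm_swap[where s = "lco HN \<psi>0" and t = "comult H _"] sm_swap[where s = "lco HN \<psi>0" and t = "lco M _"]
        sm_swap[where t = "rco M m"])
    then show ?thesis by (simp only: sm_swap[where s = "lco HM \<phi>"])
  qed
  \<comment> \<open>Coassociativity for \<open>\<psi>\<close> turns \<open>x3\<close> and
    \<open>s\<close> into the two parts of one element \<open>v\<close>.\<close>
  also have "\<dots> = ls H HM \<phi> (\<lambda>k \<phi>0. ls H HN \<psi> (\<lambda>p \<chi>. cs H p (\<lambda>x1 u. cs H u (\<lambda>x2 v. cs H v (\<lambda>x3 s.
     rs H M m (\<lambda>m0 m1. ls H M m0 (\<lambda>r u0. rs H M u0 (\<lambda>w0 w1. cs H m1 (\<lambda>a b. ?L k x1 x2 x3 s r w0 w1 a b \<phi>0 \<chi>)))))))))"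
    by (simp add: ls_coassoc cs_coassoc trilin_def lin)
  also have "\<dots> = ls H HM \<phi> (\<lambda>k \<phi>0. ls H HN \<psi> (\<lambda>p \<chi>. cs H p (\<lambda>x1 x2.
     ls H M m (\<lambda>r m0. rs H M m0 (\<lambda>w0 b. ?L1 k x1 x2 r w0 b \<phi>0 \<chi>)))))"
  proof -
    \<comment> \<open>In the same way \<open>w1\<close> and \<open>a\<close> become the two parts of
      one element \<open>q'\<close>.\<close>
    have R: "rs H M m (\<lambda>m0 m1. ls H M m0 (\<lambda>r u0. rs H M u0 (\<lambda>w0 w1. cs H m1 (\<lambda>a b. ?L k x1 x2 x3 s r w0 w1 a b \<phi>0 \<chi>))))
      = ls H M m (\<lambda>r m0. rs H M m0 (\<lambda>w0 q. cs H q (\<lambda>q' b. cs H q' (\<lambda>w1 a. ?L k x1 x2 x3 s r w0 w1 a b \<phi>0 \<chi>))))"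
      if [simp]: "\<phi>0 \<in> carr HM" "\<chi> \<in> carr HN" for k x1 x2 x3 s \<phi>0 \<chi>
      by (simp add: ls_rs_commute rs_coassoc cs_coassoc trilin_def lin)
    \<comment> \<open>The cancellation itself: \<open>S(w1) S(x3)\<close> is \<open>S(x3 w1)\<close>
      and meets the product \<open>s a\<close>.\<close>
    have A: "cs H v (\<lambda>x3 s. cs H q' (\<lambda>w1 a. ?L k x1 x2 x3 s r w0 w1 a b \<phi>0 \<chi>)) = ?e v * (?e q' * ?L1 k x1 x2 r w0 b \<phi>0 \<chi>)"
      if [simp]: "\<phi>0 \<in> carr HM" "\<chi> \<in> carr HN" "w0 \<in> carr M" for k x1 x2 r w0 b \<phi>0 \<chi> v q'
      using cs_antipode_pair[of "\<lambda>z. ls H N n (\<lambda>t n0. \<beta> (k * (x1 * (r * (z * t)))) (?v \<phi>0 x2 w0 \<chi> b n0))" v q']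
      by (simp add: lin antipode_mult mult.assoc)
    have "cs H v (\<lambda>x3 s. rs H M m (\<lambda>m0 m1. ls H M m0 (\<lambda>r u0. rs H M u0 (\<lambda>w0 w1. cs H m1 (\<lambda>a b. ?L k x1 x2 x3 s r w0 w1 a b \<phi>0 \<chi>)))))
      = ?e v * ls H M m (\<lambda>r m0. rs H M m0 (\<lambda>w0 b. ?L1 k x1 x2 r w0 b \<phi>0 \<chi>))"
      if [simp]: "\<phi>0 \<in> carr HM" "\<chi> \<in> carr HN" for k x1 x2 v \<phi>0 \<chi>
    proof -
      have "cs H v (\<lambda>x3 s. ls H M m (\<lambda>r m0. rs H M m0 (\<lambda>w0 q. cs H q (\<lambda>q' b. cs H q' (\<lambda>w1 a. ?L k x1 x2 x3 s r w0 w1 a b \<phi>0 \<chi>)))))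
        = ls H M m (\<lambda>r m0. cs H v (\<lambda>x3 s. rs H M m0 (\<lambda>w0 q. cs H q (\<lambda>q' b. cs H q' (\<lambda>w1 a. ?L k x1 x2 x3 s r w0 w1 a b \<phi>0 \<chi>)))))"
        by (rule sm_swap)
      also have "\<dots> = ls H M m (\<lambda>r m0. rs H M m0 (\<lambda>w0 q. cs H v (\<lambda>x3 s. cs H q (\<lambda>q' b. cs H q' (\<lambda>w1 a. ?L k x1 x2 x3 s r w0 w1 a b \<phi>0 \<chi>)))))"
        by (rule sm_cong[OF refl refl refl refl], rule sm_swap)
      also have "\<dots> = ls H M m (\<lambda>r m0. rs H M m0 (\<lambda>w0 q. cs H q (\<lambda>q' b. cs H v (\<lambda>x3 s. cs H q' (\<lambda>w1 a. ?L k x1 x2 x3 s r w0 w1 a b \<phi>0 \<chi>)))))"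
        by (rule sm_cong[OF refl refl refl refl], rule sm_cong[OF refl refl refl refl], rule sm_swap)
      also have "\<dots> = ls H M m (\<lambda>r m0. rs H M m0 (\<lambda>w0 q. cs H q (\<lambda>q' b. ?e v * (?e q' * ?L1 k x1 x2 r w0 b \<phi>0 \<chi>))))"
        by (simp add: A)
      also have "\<dots> = ?e v * ls H M m (\<lambda>r m0. rs H M m0 (\<lambda>w0 b. ?L1 k x1 x2 r w0 b \<phi>0 \<chi>))"
        by (simp add: sm_mult_left cs_counit lin)
      finally show ?thesis by (simp add: R)
    qed
    then show ?thesis by (simp add: cs_counit lin)
  qed
  also have "\<dots> = ls H HM \<phi> (\<lambda>k \<phi>0. ls H HN \<psi> (\<lambda>q \<psi>0.
     ls H M m (\<lambda>r m0. ls H N n (\<lambda>t n0. \<beta> (k * q * (r * t)) (hf H M M' N N' \<phi>0 \<psi>0 m0 n0)))))"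
  proof (rule sm_cong[OF refl refl refl refl])
    fix k \<phi>0 assume [simp]: "\<phi>0 \<in> carr HM"
    have "ls H M m (\<lambda>r m0. ls H N n (\<lambda>t n0. \<beta> (k * q * (r * t)) (hf H M M' N N' \<phi>0 \<psi>0 m0 n0)))
      = ls H HN \<psi>0 (\<lambda>x \<chi>. ls H M m (\<lambda>r m0. rs H M m0 (\<lambda>w0 b. ?L1 k q x r w0 b \<phi>0 \<chi>)))"
      if [simp]: "\<psi>0 \<in> carr HN" for q \<psi>0
    proof -
      have "ls H M m (\<lambda>r m0. ls H N n (\<lambda>t n0. \<beta> (k * q * (r * t)) (hf H M M' N N' \<phi>0 \<psi>0 m0 n0)))
       = ls H M m (\<lambda>r m0. ls H N n (\<lambda>t n0. ls H HN \<psi>0 (\<lambda>x \<chi>. rs H M m0 (\<lambda>w0 b. 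
          \<beta> (k * (q * (r * t))) (?v \<phi>0 x w0 \<chi> b n0)))))"
        by (simp add: hf_form[OF l] mult.assoc)
      also have "\<dots> = ls H M m (\<lambda>r m0. ls H HN \<psi>0 (\<lambda>x \<chi>. rs H M m0 (\<lambda>w0 b. ?L1 k q x r w0 b \<phi>0 \<chi>)))"
        by (simp only: sm_swap[where t = "lco N n"])
      also have "\<dots> = ls H HN \<psi>0 (\<lambda>x \<chi>. ls H M m (\<lambda>r m0. rs H M m0 (\<lambda>w0 b. ?L1 k q x r w0 b \<phi>0 \<chi>)))"
        by (rule sm_swap)
      finally show ?thesis .
    qed
    then show "ls H HN \<psi> (\<lambda>p \<chi>. cs H p (\<lambda>x1 x2.
       ls H M m (\<lambda>r m0. rs H M m0 (\<lambda>w0 b. ?L1 k x1 x2 r w0 b \<phi>0 \<chi>)))) = ls H HN \<psi> (\<lambda>q \<psi>0.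
       ls H M m (\<lambda>r m0. ls H N n (\<lambda>t n0. \<beta> (k * q * (r * t)) (hf H M M' N N' \<phi>0 \<psi>0 m0 n0))))"
      by (simp add: ls_coassoc trilin_def lin)
  qed
  finally show ?thesis .
qed

section \<open>Rationality of the tensor product of two rational maps, and its bilinearity\<close>

private lemma hat_in_T' [simp]: "\<phi> \<in> carr HM \<Longrightarrow> \<psi> \<in> carr HN \<Longrightarrow> t \<in> carr TT \<Longrightarrow> hat \<phi> \<psi> t \<in> carr TT'"
  using lin_mapD(1)[OF hat_T_lin] by blast

text \<open>Extends \<open>rs_hf\<close> and \<open>ls_hf\<close> from pure tensors to all of
  \<open>TT\<close>. As for composition, \<open>V\<close> is first the space of all linear maps,
  which gives rationality, and then \<open>HOM\<close>, which gives colinearity.\<close>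

private lemma hat_K:
  assumes V [simp]: "is_vspace V" and V': "carr V \<subseteq> carr (hom_space TT TT')" "scl V = scl (hom_space TT TT')"
    and VV [simp]: "\<And>\<phi> \<psi>. \<phi> \<in> carr HM \<Longrightarrow> \<psi> \<in> carr HN \<Longrightarrow> hat \<phi> \<psi> \<in> carr V"
    and p [simp]: "\<phi> \<in> carr HM" "\<psi> \<in> carr HN"
  shows "Kr H V TT TT' (hat \<phi> \<psi>) (rs H HM \<phi> (\<lambda>\<phi>0 \<phi>1. rs H HN \<psi> (\<lambda>\<psi>0 \<psi>1. hat \<phi>0 \<psi>0 \<otimes>\<^bsub>V,H\<^esub> (\<phi>1 * \<psi>1))))" (is ?A)
    "Kl H V TT TT' (hat \<phi> \<psi>) (ls H HM \<phi> (\<lambda>p \<phi>0. ls H HN \<psi> (\<lambda>q \<psi>0. (p * q) \<otimes>\<^bsub>H,V\<^esub> hat \<phi>0 \<psi>0)))" (is ?B)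
proof -
  note [simp] = hom_space_closed[OF hat_bicov(3,4) V'(1)]
  note [lin] = hat_lin_args hat_T_lin lin_compose[OF hat_T_lin] hom_space_lin[OF hat_bicov(3,4) V V']
  show ?A unfolding Kr_def
  proof (intro conjI ballI allI impI)
    fix t \<beta> assume t [simp]: "t \<in> carr TT" and b: "bilin TT' H \<beta>"
    note [lin] = bilinD[OF b]
    have "rs H TT' (hat \<phi> \<psi> t) \<beta> = rs H HM \<phi> (\<lambda>\<phi>0 \<phi>1. rs H HN \<psi> (\<lambda>\<psi>0 \<psi>1.
       rs H TT t (\<lambda>t0 t1. \<beta> (hat \<phi>0 \<psi>0 t0) (\<phi>1 * \<psi>1 * t1))))"
      by (rule bicov_tensor_ext[OF _ _ _ _ _ t, where U = base])
        (simp_all add: lin rs_hf b rs_tensor_pure bilin_def)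
    then show "rs H TT' (hat \<phi> \<psi> t) \<beta> = ts V H
       (rs H HM \<phi> (\<lambda>\<phi>0 \<phi>1. rs H HN \<psi> (\<lambda>\<psi>0 \<psi>1. hat \<phi>0 \<psi>0 \<otimes>\<^bsub>V,H\<^esub> (\<phi>1 * \<psi>1))))
       (\<lambda>\<chi> h. rs H TT t (\<lambda>m0 m1. \<beta> (\<chi> m0) (h * m1)))"
      by (simp add: sw_sm_base sm_closed lin)
  qed (auto intro!: sm_closed)
  show ?B unfolding Kl_def
  proof (intro conjI ballI allI impI)
    fix t \<beta> assume t [simp]: "t \<in> carr TT" and b: "bilin H TT' \<beta>"
    note [lin] = bilinD[OF b]
    have "ls H TT' (hat \<phi> \<psi> t) \<beta> = ls H HM \<phi> (\<lambda>p \<phi>0. ls H HN \<psi> (\<lambda>q \<psi>0.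
       ls H TT t (\<lambda>r t0. \<beta> (p * q * r) (hat \<phi>0 \<psi>0 t0))))"
      by (rule bicov_tensor_ext[OF _ _ _ _ _ t, where U = base])
        (simp_all add: lin ls_hf b ls_tensor_pure bilin_def)
    then show "ls H TT' (hat \<phi> \<psi> t) \<beta> = ts H V
       (ls H HM \<phi> (\<lambda>p \<phi>0. ls H HN \<psi> (\<lambda>q \<psi>0. (p * q) \<otimes>\<^bsub>H,V\<^esub> hat \<phi>0 \<psi>0)))
       (\<lambda>h \<chi>. ls H TT t (\<lambda>p m0. \<beta> (h * p) (\<chi> m0)))"
      by (simp add: sw_sm_base sm_closed lin)
  qed (auto intro!: sm_closed)
qed

private abbreviation "HT \<equiv> HOM H TT TT'"

private lemma hat_in [simp]:
  assumes "\<phi> \<in> carr HM" "\<psi> \<in> carr HN"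
  shows "hat \<phi> \<psi> \<in> carr HT"
  using hat_K[of "hom_space TT TT'", OF _ subset_refl refl hat_hom assms]
  by (intro HOM_memI[OF hat_bicov(3,4) hat_hom[OF assms]]) simp_all

private lemma hat_HT_lin:
  "\<psi> \<in> carr HN \<Longrightarrow> lin_map HM HT (\<lambda>\<phi>. hat \<phi> \<psi>)" "\<phi> \<in> carr HM \<Longrightarrow> lin_map HN HT (\<lambda>\<psi>. hat \<phi> \<psi>)"
proof -
  have o: "t \<notin> carr TT \<Longrightarrow> hat \<phi> \<psi> t = 0" for \<phi> \<psi> t by (simp add: hat_map_def)
  have z: "scl TT' c 0 = 0" for c by (rule vspace_scale_simps(6)) simp
  have eqI: "F = G" if "\<And>t. t \<in> carr TT \<Longrightarrow> F t = G t" "\<And>t. t \<notin> carr TT \<Longrightarrow> F t = G t"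
    for F G :: "('m, 'n, 'k) tensor \<Rightarrow> ('m', 'n', 'k) tensor" using that by blast
  show "lin_map HM HT (\<lambda>\<phi>. hat \<phi> \<psi>)" if p [simp]: "\<psi> \<in> carr HN"
  proof (rule lin_mapI)
    fix \<phi> \<phi>' c assume [simp]: "\<phi> \<in> carr HM"
    show "hat (scl HM c \<phi>) \<psi> = scl HT c (hat \<phi> \<psi>)"
      by (rule eqI) (simp_all only: HOM_simps(2)[of H TT TT'] lin_mapD(3)[OF hat_lin_args(1)] that \<open>\<phi> \<in> carr HM\<close> o z simp_thms)
    assume [simp]: "\<phi>' \<in> carr HM"
    show "hat (\<phi> + \<phi>') \<psi> = hat \<phi> \<psi> + hat \<phi>' \<psi>"
      by (rule eqI) (simp_all add: lin_mapD(2)[OF hat_lin_args(1)] o)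
  qed simp
  show "lin_map HN HT (\<lambda>\<psi>. hat \<phi> \<psi>)" if p [simp]: "\<phi> \<in> carr HM"
  proof (rule lin_mapI)
    fix \<psi> \<psi>' c assume [simp]: "\<psi> \<in> carr HN"
    show "hat \<phi> (scl HN c \<psi>) = scl HT c (hat \<phi> \<psi>)"
      by (rule eqI) (simp_all only: HOM_simps(2)[of H TT TT'] lin_mapD(3)[OF hat_lin_args(2)] that \<open>\<psi> \<in> carr HN\<close> o z simp_thms)
    assume [simp]: "\<psi>' \<in> carr HN"
    show "hat \<phi> (\<psi> + \<psi>') = hat \<phi> \<psi> + hat \<phi> \<psi>'"
      by (rule eqI) (simp_all add: lin_mapD(2)[OF hat_lin_args(2)] o)
  qed simp
qed

private lemma hat_adm: "adm (bilinear_forms HM HN) HM HN HT hat"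
  by (rule adm_bilinear) (auto intro!: bilinear_mapsI hat_HT_lin)

lemma hat_tensor_tens:
  "\<phi> \<in> carr HM \<Longrightarrow> \<psi> \<in> carr HN \<Longrightarrow> hat_tensor H M M' N N' (\<phi> \<otimes>\<^bsub>HM,HN\<^esub> \<psi>) = hat \<phi> \<psi>"
  unfolding hat_tensor_def by (rule lift_tensor(2)[OF _ hat_adm]) simp

lemma hat_tensor_pure:
  assumes "\<phi> \<in> carr HM" "\<psi> \<in> carr HN" "m \<in> carr M" "n \<in> carr N"
  shows "hat_tensor H M M' N N' (\<phi> \<otimes>\<^bsub>HM,HN\<^esub> \<psi>) (m \<odot>\<^bsub>M,N\<^esub> n) = hat_formula H M M' N N' \<phi> \<psi> m n"
  using assms by (simp add: hat_tensor_tens hat_formula_eq)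

private lemma hat_lact:
  assumes p [simp]: "\<phi> \<in> carr HM" "\<psi> \<in> carr HN"
  shows "hat (lact HM a \<phi>) \<psi> = lact HT a (hat \<phi> \<psi>)"
proof
  fix t
  have la: "lin_map TT' TT' (lact TT' a)" by (simp add: lin)
  show "hat (lact HM a \<phi>) \<psi> t = lact HT a (hat \<phi> \<psi>) t"
  proof (cases "t \<in> carr TT")
    case t: True
    note [lin] = lin_compose[OF hat_T_lin] hat_T_lin la
    have "hat (lact HM a \<phi>) \<psi> t = lact TT' a (hat \<phi> \<psi> t)"
    proof (rule bicov_tensor_ext[OF _ _ _ _ _ t, where U = TT'])
      fix m n assume [simp]: "m \<in> carr M" "n \<in> carr N"
      have "lact TT' a (hf H M M' N N' \<phi> \<psi> m n) = ls H HN \<psi> (\<lambda>x \<psi>0. rs H M m (\<lambda>m0 m1.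
          lact TT' a (\<phi> (adj H M x (pm H M m0)) \<odot>\<^bsub>M',N'\<^esub> \<psi>0 (lact N m1 n))))"
        unfolding hf_def by (simp add: sm_hom[OF la] sm_closed)
      also have "\<dots> = hf H M M' N N' (lact HM a \<phi>) \<psi> m n"
        unfolding hf_def by (simp add: tensor_act_pure) (simp add: HOM_simps)
      finally show "hat (lact HM a \<phi>) \<psi> (m \<odot>\<^bsub>M,N\<^esub> n) = lact TT' a (hat \<phi> \<psi> (m \<odot>\<^bsub>M,N\<^esub> n))" by simp
    qed (simp_all add: lin)
    then show ?thesis by (simp add: HOM_simps)
  next
    case False
    then show ?thesis using lin_map_zero[OF _ la] by (simp add: HOM_simps hat_map_def)
  qed
qed

text \<open>With \<open>x\<close> the left component of \<open>\<psi>\<close> and \<open>u\<close>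
  the coinvariant of \<open>m0\<close>, the left side contains the adjoint action of
  \<open>x b1\<close> on \<open>u\<close> and the right side that of \<open>x\<close> on the
  coinvariant of \<open>b1 m0\<close>, which \<open>pm_lact\<close> and \<open>adj_mult\<close>
  identify. The second factors both are \<open>\<psi>0(b2 m1 n)\<close>.\<close>

private lemma hat_ract:
  assumes p [simp]: "\<phi> \<in> carr HM" "\<psi> \<in> carr HN"
  shows "hat \<phi> (ract HN \<psi> b) = ract HT (hat \<phi> \<psi>) b"
proof
  fix t
  show "hat \<phi> (ract HN \<psi> b) t = ract HT (hat \<phi> \<psi>) b t"
  proof (cases "t \<in> carr TT")
    case t: True
    note [lin] = lin_compose[OF hat_T_lin] hat_T_lin
    have "hat \<phi> (ract HN \<psi> b) t = hat \<phi> \<psi> (lact TT b t)"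
    proof (rule bicov_tensor_ext[OF _ _ _ _ _ t, where U = TT'])
      fix m n assume [simp]: "m \<in> carr M" "n \<in> carr N"
      have r: "ract HN \<chi> h v = \<chi> (lact N h v)" if "v \<in> carr N" for \<chi> h v
        using that by (simp add: HOM_simps rb_def)
      have "hf H M M' N N' \<phi> (ract HN \<psi> b) m n = hf H M M' N N' \<phi> \<psi> (lact M b m) n"
      proof (rule vec_eqI[of TT'])
        fix g assume g: "lin_map TT' base g"
        note [lin] = lin_compose[OF g] hat_lin HOM_lin(1)[OF M M' p(1)]
        show "g (hf H M M' N N' \<phi> (ract HN \<psi> b) m n) = g (hf H M M' N N' \<phi> \<psi> (lact M b m) n)"
          by (simp add: hf_form[OF g] ls_ract rs_lact bilin_def lin r pm_lact adj_mult)
      qed simp_all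
      then show "hat \<phi> (ract HN \<psi> b) (m \<odot>\<^bsub>M,N\<^esub> n) = hat \<phi> \<psi> (lact TT b (m \<odot>\<^bsub>M,N\<^esub> n))"
        by (simp add: tensor_act_pure)
    qed (simp_all add: lin)
    then show ?thesis using t by (simp add: HOM_simps rb_def)
  next
    case False
    then show ?thesis by (simp add: HOM_simps rb_def hat_map_def)
  qed
qed

lemma hat_morphism: "bicov_morphism H (tensor_k H HM HN) HT (hat_tensor H M M' N N')"
proof -
  let ?T = "tensor_k H HM HN" and ?F = "hat_tensor H M M' N N'"
  note [simp] = hat_tensor_tens
  have T [simp]: "bicov_bimodule H ?T" by (rule bicov_bimodule_tensor) simp_all
  have HT [simp]: "bicov_bimodule H HT" by (rule bicov_bimodule_HOM) simp_all
  have F: "lin_map ?T HT ?F" unfolding hat_tensor_def by (rule lift_tensor(1)[OF _ hat_adm]) simp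
  note [lin] = F lin_compose[OF F] hat_HT_lin
  note K = hat_K[OF HOM_eqs[OF hat_bicov(3,4)] hat_in]
  have "right_colinear H ?T HT ?F"
  proof (rule colinear_tensorI(1)[OF _ hat_bicov(1,2) HT F])
    fix \<phi> \<psi> \<beta> assume p [simp]: "\<phi> \<in> carr HM" "\<psi> \<in> carr HN" and b: "bilin HT H \<beta>"
    note [lin] = bilinD[OF b]
    have "rco HT (hat \<phi> \<psi>) = rs H HM \<phi> (\<lambda>\<phi>0 \<phi>1. rs H HN \<psi> (\<lambda>\<psi>0 \<psi>1. hat \<phi>0 \<psi>0 \<otimes>\<^bsub>HT,H\<^esub> (\<phi>1 * \<psi>1)))"
      by (rule HOM_coactionI(1)[OF hat_bicov(3,4) _ K(1)]) simp_all
    then show "rs H HT (?F (\<phi> \<otimes>\<^bsub>HM,HN\<^esub> \<psi>)) \<beta>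
      = rs H HM \<phi> (\<lambda>a0 a1. rs H HN \<psi> (\<lambda>c0 c1. \<beta> (?F (a0 \<otimes>\<^bsub>HM,HN\<^esub> c0)) (a1 * c1)))"
      by (simp add: sw_sm_base sm_closed lin)
  qed simp
  moreover have "left_colinear H ?T HT ?F"
  proof (rule colinear_tensorI(2)[OF _ hat_bicov(1,2) HT F])
    fix \<phi> \<psi> \<beta> assume p [simp]: "\<phi> \<in> carr HM" "\<psi> \<in> carr HN" and b: "bilin H HT \<beta>"
    note [lin] = bilinD[OF b]
    have "lco HT (hat \<phi> \<psi>) = ls H HM \<phi> (\<lambda>p \<phi>0. ls H HN \<psi> (\<lambda>q \<psi>0. (p * q) \<otimes>\<^bsub>H,HT\<^esub> hat \<phi>0 \<psi>0))"
      by (rule HOM_coactionI(2)[OF hat_bicov(3,4) _ K(2)]) simp_all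
    then show "ls H HT (?F (\<phi> \<otimes>\<^bsub>HM,HN\<^esub> \<psi>)) \<beta>
      = ls H HM \<phi> (\<lambda>p a0. ls H HN \<psi> (\<lambda>q c0. \<beta> (p * q) (?F (a0 \<otimes>\<^bsub>HM,HN\<^esub> c0))))"
      by (simp add: sw_sm_base sm_closed lin)
  qed simp
  moreover have "left_linear ?T HT ?F" unfolding left_linear_def
  proof (intro allI ballI)
    fix a t assume t: "t \<in> carr ?T"
    show "?F (lact ?T a t) = lact HT a (?F t)"
      by (rule bicov_tensor_ext[OF _ _ _ _ _ t, where U = HT]) (simp_all add: lin tensor_act_pure hat_lact)
  qed
  moreover have "right_linear ?T HT ?F" unfolding right_linear_def
  proof (intro allI ballI)
    fix a t assume t: "t \<in> carr ?T"
    show "?F (ract ?T t a) = ract HT (?F t) a"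
      by (rule bicov_tensor_ext[OF _ _ _ _ _ t, where U = HT]) (simp_all add: lin tensor_act_pure hat_ract)
  qed
  ultimately show ?thesis unfolding bicov_morphism_def using F by simp
qed

text \<open>The factor \<open>S(p1)\<close> of \<open>S(p1 m1) = S(m1) S(p1)\<close> stands at the
  far right, so a right linear \<open>\<phi>\<close> lets it out, and it crosses the tensor sign
  over \<open>H\<close>.\<close>

lemma hat_formula_right_linear:
  assumes "\<phi> \<in> HOM_right_linear H M M'" "\<psi> \<in> carr HN" "m \<in> carr M" "n \<in> carr N"
  shows "hat_formula H M M' N N' \<phi> \<psi> m n = sigma_W_formula H M M' N N' \<phi> \<psi> m n"
  unfolding hat_formula_def sigma_W_formula_def
proof (intro lift_cong refl)
  fix p2 p1 m0 m1 m2 \<psi>0 assume [simp]: "m0 \<in> carr M" "\<psi>0 \<in> carr HN"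
  have p [simp]: "\<phi> \<in> carr HM" and r: "\<And>u b. u \<in> carr M \<Longrightarrow> \<phi> (ract M u b) = ract M' (\<phi> u) b"
    using assms(1) by (auto simp: HOM_right_linear_def right_linear_def)
  show "\<phi> (ract M (lact M p2 m0) (antipode H (p1 * m1))) \<odot>\<^bsub>M',N'\<^esub> \<psi>0 (lact N m2 n)
    = \<phi> (ract M (lact M p2 m0) (antipode H m1)) \<odot>\<^bsub>M',N'\<^esub> lact N' (antipode H p1) (\<psi>0 (lact N m2 n))"
    using assms(4) by (simp add: antipode_mult r bal)
qed

end

end

theorem theorem2p14:
  fixes H :: "('k::field, 'h::ring_1) hopf"
    and M :: "('k, 'h, 'm::ab_group_add) bicov"
    and M' :: "('k, 'h, 'm'::ab_group_add) bicov"
    and N :: "('k, 'h, 'n::ab_group_add) bicov"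
    and N' :: "('k, 'h, 'n'::ab_group_add) bicov"
    and P :: "('k, 'h, 'p::ab_group_add) bicov"
  assumes H: "hopf_algebra H" "bij (antipode H)"
    and bicov: "bicov_bimodule H M" "bicov_bimodule H M'" "bicov_bimodule H N"
      "bicov_bimodule H N'" "bicov_bimodule H P"
  shows
    "((\<forall>\<phi>\<in>carr (HOM H M N). \<forall>m\<in>carr M. ev H M N (\<phi> \<odot>\<^bsub>HOM H M N,M\<^esub> m) = \<phi> m) \<and>
      left_bicov_morphism H (tensor_H H (HOM H M N) M) N (ev H M N)) \<and>
     ((\<forall>\<phi>\<in>carr (HOM H N P). \<forall>\<psi>\<in>carr (HOM H M N). \<forall>m\<in>carr M.
         comp_HOM H M N P (\<phi> \<odot>\<^bsub>HOM H N P,HOM H M N\<^esub> \<psi>) m = \<phi> (\<psi> m)) \<and>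
      bicov_morphism H (tensor_H H (HOM H N P) (HOM H M N)) (HOM H M P) (comp_HOM H M N P)) \<and>
     ((\<forall>\<phi>\<in>carr (HOM H M M'). \<forall>\<psi>\<in>carr (HOM H N N'). \<forall>m\<in>carr M. \<forall>n\<in>carr N.
         hat_tensor H M M' N N' (\<phi> \<otimes>\<^bsub>HOM H M M',HOM H N N'\<^esub> \<psi>) (m \<odot>\<^bsub>M,N\<^esub> n)
           = hat_formula H M M' N N' \<phi> \<psi> m n) \<and>
      bicov_morphism H (tensor_k H (HOM H M M') (HOM H N N'))
        (HOM H (tensor_H H M N) (tensor_H H M' N')) (hat_tensor H M M' N N')) \<and>
     (\<forall>\<phi>\<in>HOM_right_linear H M M'. \<forall>\<psi>\<in>HOM_right_linear H N N'. \<forall>m\<in>carr M. \<forall>n\<in>carr N.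
        hat_tensor H M M' N N' (\<phi> \<otimes>\<^bsub>HOM H M M',HOM H N N'\<^esub> \<psi>) (m \<odot>\<^bsub>M,N\<^esub> n)
          = sigma_W_formula H M M' N N' \<phi> \<psi> m n)"
proof -
  interpret hopf H using H by unfold_locales
  note b = bicov_bimodule_HOM
  show ?thesis
  proof (intro conjI ballI)
    fix \<phi> \<psi> m assume p: "\<phi> \<in> carr (HOM H N P)" "\<psi> \<in> carr (HOM H M N)"
    show "comp_HOM H M N P (\<phi> \<odot>\<^bsub>HOM H N P,HOM H M N\<^esub> \<psi>) m = \<phi> (\<psi> m)"
      by (simp add: comp_HOM_pure[OF bicov(1,3,5) p])
  next
    fix \<phi> \<psi> m n
    assume p: "\<phi> \<in> HOM_right_linear H M M'" "\<psi> \<in> HOM_right_linear H N N'" "m \<in> carr M" "n \<in> carr N"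
    then have q: "\<phi> \<in> carr (HOM H M M')" "\<psi> \<in> carr (HOM H N N')" by (auto simp: HOM_right_linear_def)
    show "hat_tensor H M M' N N' (\<phi> \<otimes>\<^bsub>HOM H M M',HOM H N N'\<^esub> \<psi>) (m \<odot>\<^bsub>M,N\<^esub> n)
      = sigma_W_formula H M M' N N' \<phi> \<psi> m n"
      using hat_tensor_pure[OF bicov(1-4) q p(3,4)] hat_formula_right_linear[OF bicov(1-4) p(1) q(2) p(3,4)] by simp
  qed (use bicov in \<open>simp_all add: ev_pure ev_morphism comp_morphism hat_tensor_pure hat_morphism\<close>)
qed

end
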